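(* Let $P=\mathbb{N}^k\times\mathbb{Z}_2^a$ and let $\Lambda$ be a row-finite $P$-graph with no sources. Let $Z_2$ denote the group $\mathbb{Z}_2$ regarded as a $\mathbb{Z}_2$-graph with one vertex. Then $$C^*(\Lambda\times Z_2,c_{\Lambda\times Z_2})\cong C^*(\Lambda,c_\Lambda)\widehat\otimes C^*(Z_2)\cong C^*(\Lambda,c_\Lambda)\widehat\otimes\mathbb{C}\mathrm{liff}_1$$ as graded $C^*$-algebras, with respect to the gradings $\alpha_{\delta_{\Lambda\times Z_2}}$ and $\alpha_{\delta_\Lambda}\widehat\otimes\alpha_{\delta_{Z_2}}$ (and, for the last algebra, $\alpha_{\delta_\Lambda}$ tensored with the standard grading of $\mathbb{C}\mathrm{liff}_1$).
   Context: For a monoid $P$ of the form $\mathbb{N}^k\times\mathbb{Z}_2^a$, a $P$-graph is a countable small category $\Lambda$ with a functor $d:\Lambda\to P$ satisfying the factorisation property: if $d(\lambda)=p+q$ then there are unique $\mu,\nu$ with $d(\mu)=p$, $d(\nu)=q$, $\lambda=\mu\nu$. $r,s$ are the codomain and domain maps, $\Lambda^p=d^{-1}(p)$, $\Lambda^0$ is identified with the objects, $v\Lambda^p=\{\lambda\in\Lambda^p:r(\lambda)=v\}$. $\Lambda$ is row-finite (has no sources) if every $v\Lambda^p$ is finite (nonempty). $Z_2$ is the group $\mathbb{Z}_2$ as a one-object category with degree map the identity. The product category $\Lambda\times Z_2$ with degree map $(\lambda,i)\mapsto(d(\lambda),i)$ is a $(P\times\mathbb{Z}_2)$-graph. A $2$-cocycle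 $c\in Z^2(\Lambda,\mathbb{T})$ is a function from composable pairs to $\mathbb{T}$ with $c(\lambda,\mu)c(\lambda\mu,\nu)=c(\mu,\nu)c(\lambda,\mu\nu)$ and $c(r(\lambda),\lambda)=1=c(\lambda,s(\lambda))$. $C^*(\Lambda,c)$ is the universal $C^*$-algebra generated by $s_\lambda$ ($\lambda\in\Lambda$) such that: $\{s_v:v\in\Lambda^0\}$ are mutually orthogonal projections; $s_\mu s_\nu=c(\mu,\nu)s_{\mu\nu}$ when $s(\mu)=r(\nu)$; $s_\lambda^*s_\lambda=s_{s(\lambda)}$; $s_v=\sum_{\lambda\in v\Lambda^p}s_\lambda s_\lambda^*$ for $v\in\Lambda^0$, $p\in P$. $C^*(\Lambda)$ is the case $c\equiv1$. For a $P$-graph $\Lambda$ with $P=\mathbb{N}^k\times\mathbb{Z}_2^a$, $c_\Lambda(\lambda,\mu):=(-1)^{\kappa(\rho(d(\lambda)),\rho(d(\mu)))}$, where $\rho:P\to\mathbb{Z}_2^{k+a}$ is coordinatewise reduction mod $2$ and $\kappa(m,n)=\sum_{j<i}m_i\cdot n_j$; $\delta_\Lambda(\lambda):=\pi(d(\lambda))$ where $\pi:P\to\mathbb{Z}_2$ is the homomorphism sending each standard generator to $1$; and $\alpha_{\delta_\Lambda}$ is the grading automorphism of $C^*(\Lambda,c_\Lambda)$ with $\alpha_{\delta_\Lambda}(s_\lambda)=(-1)^{\delta_\Lambda(\lambda)}s_\lambda$. The same formulas are used for $Z_2$ and $\Lambda\times Z_2$. A grading of a $C^*$-algebra is an automorphism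 $\alpha$ with $\alpha^2=1$, and $a$ has degree $\partial a=j$ if $\alpha(a)=(-1)^ja$. $A\widehat\otimes B$ is the completion in the minimal norm of the algebraic tensor product with, for homogeneous elements, $(a\widehat\otimes b)(a'\widehat\otimes b')=(-1)^{\partial b\cdot\partial a'}aa'\widehat\otimes bb'$ and $(a\widehat\otimes b)^*=(-1)^{\partial a\cdot\partial b}a^*\widehat\otimes b^*$. $\mathbb{C}\mathrm{liff}_1$ is $\mathbb{C}\oplus\mathbb{C}$ with grading $(z,w)\mapsto(w,z)$. *)

theory Defs
  imports
    Complex_Main
    "HOL-Algebra.Module"
    "HOL-Library.Countable_Set"
    "HOL-Library.Function_Algebras"
    "HOL-Library.Product_Plus"
    "HOL-Library.Poly_Mapping"
    "HOL-Library.Z2"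
begin

section \<open>The monoids \<open>\<nat>\<^sup>k \<times> \<int>\<^sub>2\<^sup>a\<close>\<close>

type_synonym deg = "(nat \<Rightarrow> nat) \<times> (nat \<Rightarrow> bit)"

text \<open>
  Coordinates are numbered from 0, first the \<open>k\<close> natural ones and then the \<open>a\<close> binary ones.
  Addition is the pointwise addition of the type, so \<open>(\<nat>\<^sup>k \<times> \<int>\<^sub>2\<^sup>a) \<times> \<int>\<^sub>2\<close> is
  \<open>Pmon k (Suc a)\<close>, the additional coordinate being the last one.
\<close>

definition Pmon :: "nat \<Rightarrow> nat \<Rightarrow> deg set" where
  "Pmon k a = {(m, n). (\<forall>i\<ge>k. m i = 0) \<and> (\<forall>i\<ge>a. n i = 0)}"

definition reduce2 :: "nat \<Rightarrow> deg \<Rightarrow> nat \<Rightarrow> bit" where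
  "reduce2 k p i = (if i < k then of_nat (fst p i) else snd p (i - k))"

definition kappa :: "nat \<Rightarrow> (nat \<Rightarrow> bit) \<Rightarrow> (nat \<Rightarrow> bit) \<Rightarrow> bit" where
  "kappa l m n = (\<Sum>i<l. \<Sum>j<i. m i * n j)"

text \<open>The homomorphism to \<open>\<int>\<^sub>2\<close> that maps each of the \<open>k + a\<close> standard generators to 1.\<close>

definition parity :: "nat \<Rightarrow> nat \<Rightarrow> deg \<Rightarrow> bit" where
  "parity k a p = (\<Sum>i<k + a. reduce2 k p i)"

text \<open>\<open>bit_sign b\<close> is \<open>(-1)\<^sup>b\<close>.\<close>

definition bit_sign :: "bit \<Rightarrow> complex" where
  "bit_sign b = (if b = 0 then 1 else -1)"


section \<open>\<open>P\<close>-graphs\<close>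

text \<open>Small categories are given by their morphisms; objects are identified with identities.\<close>

record 'l pgraph =
  mor :: "'l set"
  rng :: "'l \<Rightarrow> 'l"
  src :: "'l \<Rightarrow> 'l"
  cmp :: "'l \<Rightarrow> 'l \<Rightarrow> 'l"
  pdeg :: "'l \<Rightarrow> deg"

definition objs :: "'l pgraph \<Rightarrow> 'l set" where
  "objs L = {v \<in> mor L. rng L v = v \<and> src L v = v}"

locale small_category =
  fixes L :: "'l pgraph"
  assumes rng_obj: "x \<in> mor L \<Longrightarrow> rng L x \<in> objs L"
    and src_obj: "x \<in> mor L \<Longrightarrow> src L x \<in> objs L"
    and cmp_closed: "\<lbrakk>x \<in> mor L; y \<in> mor L; src L x = rng L y\<rbrakk> \<Longrightarrow> cmp L x y \<in> mor L"
    and rng_cmp: "\<lbrakk>x \<in> mor L; y \<in> mor L; src L x = rng L y\<rbrakk> \<Longrightarrow> rng L (cmp L x y) = rng L x"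
    and src_cmp: "\<lbrakk>x \<in> mor L; y \<in> mor L; src L x = rng L y\<rbrakk> \<Longrightarrow> src L (cmp L x y) = src L y"
    and cmp_assoc: "\<lbrakk>x \<in> mor L; y \<in> mor L; z \<in> mor L; src L x = rng L y; src L y = rng L z\<rbrakk>
      \<Longrightarrow> cmp L (cmp L x y) z = cmp L x (cmp L y z)"
    and cmp_rng: "x \<in> mor L \<Longrightarrow> cmp L (rng L x) x = x"
    and cmp_src: "x \<in> mor L \<Longrightarrow> cmp L x (src L x) = x"

locale P_graph = small_category L
  for k a :: nat and L :: "'l pgraph" +
  assumes countable_mor: "countable (mor L)"
    and pdeg_in: "x \<in> mor L \<Longrightarrow> pdeg L x \<in> Pmon k a"
    and pdeg_obj: "v \<in> objs L \<Longrightarrow> pdeg L v = 0"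
    and pdeg_cmp: "\<lbrakk>x \<in> mor L; y \<in> mor L; src L x = rng L y\<rbrakk>
      \<Longrightarrow> pdeg L (cmp L x y) = pdeg L x + pdeg L y"
    and factorisation: "\<lbrakk>x \<in> mor L; p \<in> Pmon k a; q \<in> Pmon k a; pdeg L x = p + q\<rbrakk>
      \<Longrightarrow> \<exists>!(y, z). y \<in> mor L \<and> z \<in> mor L \<and> src L y = rng L z \<and>
            pdeg L y = p \<and> pdeg L z = q \<and> x = cmp L y z"

text \<open>The set \<open>v\<Lambda>\<^sup>p\<close>.\<close>

definition paths_to :: "'l pgraph \<Rightarrow> 'l \<Rightarrow> deg \<Rightarrow> 'l set" where
  "paths_to L v p = {x \<in> mor L. rng L x = v \<and> pdeg L x = p}"

definition row_finite :: "nat \<Rightarrow> nat \<Rightarrow> 'l pgraph \<Rightarrow> bool" where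
  "row_finite k a L \<longleftrightarrow> (\<forall>v\<in>objs L. \<forall>p\<in>Pmon k a. finite (paths_to L v p))"

definition no_sources :: "nat \<Rightarrow> nat \<Rightarrow> 'l pgraph \<Rightarrow> bool" where
  "no_sources k a L \<longleftrightarrow> (\<forall>v\<in>objs L. \<forall>p\<in>Pmon k a. paths_to L v p \<noteq> {})"

text \<open>The group \<open>\<int>\<^sub>2\<close> as a graph over \<open>Pmon 0 1\<close>.\<close>

definition Z2_graph :: "bit pgraph" where
  "Z2_graph = \<lparr>mor = UNIV, rng = (\<lambda>_. 0), src = (\<lambda>_. 0), cmp = (+),
     pdeg = (\<lambda>i. (\<lambda>_. 0, (\<lambda>_. 0)(0 := i)))\<rparr>"

text \<open>
  The product of a graph over \<open>Pmon k a\<close> with \<open>Z2_graph\<close>, which is a graph over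
  \<open>Pmon k (Suc a)\<close>: the degree of the second component is put in the new last coordinate.
\<close>

definition times_Z2 :: "nat \<Rightarrow> 'l pgraph \<Rightarrow> ('l \<times> bit) pgraph" where
  "times_Z2 a L = \<lparr>mor = mor L \<times> mor Z2_graph,
     rng = map_prod (rng L) (rng Z2_graph),
     src = map_prod (src L) (src Z2_graph),
     cmp = (\<lambda>(x, i) (y, j). (cmp L x y, cmp Z2_graph i j)),
     pdeg = (\<lambda>(x, i). (fst (pdeg L x), (snd (pdeg L x))(a := snd (pdeg Z2_graph i) 0)))\<rparr>"

definition graph_cocycle :: "nat \<Rightarrow> nat \<Rightarrow> 'l pgraph \<Rightarrow> 'l \<Rightarrow> 'l \<Rightarrow> complex" where
  "graph_cocycle k a L x y =
     bit_sign (kappa (k + a) (reduce2 k (pdeg L x)) (reduce2 k (pdeg L y)))"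

definition graph_parity :: "nat \<Rightarrow> nat \<Rightarrow> 'l pgraph \<Rightarrow> 'l \<Rightarrow> bit" where
  "graph_parity k a L x = parity k a (pdeg L x)"


section \<open>Graded \<open>C\<^sup>*\<close>-algebras\<close>

text \<open>
  Algebras need not be unital: the field \<^const>\<open>one\<close>, which is inherited from the ring records,
  is never constrained or used.
\<close>

record 'a star_alg = "(complex, 'a) module" +
  star :: "'a \<Rightarrow> 'a"
  nrm :: "'a \<Rightarrow> real"

definition cauchy_seqs :: "'a star_alg \<Rightarrow> (nat \<Rightarrow> 'a) set" where
  "cauchy_seqs A = {x. (\<forall>n. x n \<in> carrier A) \<and>
     (\<forall>e>0. \<exists>N. \<forall>m\<ge>N. \<forall>n\<ge>N. nrm A (x m \<ominus>\<^bsub>A\<^esub> x n) < e)}"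

locale cstar_algebra = abelian_group A
  for A :: "'a star_alg" (structure) +
  assumes mult_closed: "\<lbrakk>x \<in> carrier A; y \<in> carrier A\<rbrakk> \<Longrightarrow> x \<otimes> y \<in> carrier A"
    and mult_assoc: "\<lbrakk>x \<in> carrier A; y \<in> carrier A; z \<in> carrier A\<rbrakk>
      \<Longrightarrow> (x \<otimes> y) \<otimes> z = x \<otimes> (y \<otimes> z)"
    and distrib_right: "\<lbrakk>x \<in> carrier A; y \<in> carrier A; z \<in> carrier A\<rbrakk>
      \<Longrightarrow> (x \<oplus> y) \<otimes> z = x \<otimes> z \<oplus> y \<otimes> z"
    and distrib_left: "\<lbrakk>x \<in> carrier A; y \<in> carrier A; z \<in> carrier A\<rbrakk>
      \<Longrightarrow> z \<otimes> (x \<oplus> y) = z \<otimes> x \<oplus> z \<otimes> y"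
    and scale_closed: "x \<in> carrier A \<Longrightarrow> c \<odot> x \<in> carrier A"
    and scale_add_left: "x \<in> carrier A \<Longrightarrow> (c + d) \<odot> x = c \<odot> x \<oplus> d \<odot> x"
    and scale_add_right: "\<lbrakk>x \<in> carrier A; y \<in> carrier A\<rbrakk> \<Longrightarrow> c \<odot> (x \<oplus> y) = c \<odot> x \<oplus> c \<odot> y"
    and scale_scale: "x \<in> carrier A \<Longrightarrow> (c * d) \<odot> x = c \<odot> (d \<odot> x)"
    and scale_one: "x \<in> carrier A \<Longrightarrow> 1 \<odot> x = x"
    and scale_mult_left: "\<lbrakk>x \<in> carrier A; y \<in> carrier A\<rbrakk> \<Longrightarrow> (c \<odot> x) \<otimes> y = c \<odot> (x \<otimes> y)"
    and scale_mult_right: "\<lbrakk>x \<in> carrier A; y \<in> carrier A\<rbrakk> \<Longrightarrow> x \<otimes> (c \<odot> y) = c \<odot> (x \<otimes> y)"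
    and star_closed: "x \<in> carrier A \<Longrightarrow> star A x \<in> carrier A"
    and star_star: "x \<in> carrier A \<Longrightarrow> star A (star A x) = x"
    and star_add: "\<lbrakk>x \<in> carrier A; y \<in> carrier A\<rbrakk> \<Longrightarrow> star A (x \<oplus> y) = star A x \<oplus> star A y"
    and star_scale: "x \<in> carrier A \<Longrightarrow> star A (c \<odot> x) = cnj c \<odot> star A x"
    and star_mult: "\<lbrakk>x \<in> carrier A; y \<in> carrier A\<rbrakk> \<Longrightarrow> star A (x \<otimes> y) = star A y \<otimes> star A x"
    and nrm_nonneg: "x \<in> carrier A \<Longrightarrow> 0 \<le> nrm A x"
    and nrm_eq_zero: "x \<in> carrier A \<Longrightarrow> nrm A x = 0 \<longleftrightarrow> x = \<zero>"
    and nrm_triangle: "\<lbrakk>x \<in> carrier A; y \<in> carrier A\<rbrakk> \<Longrightarrow> nrm A (x \<oplus> y) \<le> nrm A x + nrm A y"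
    and nrm_scale: "x \<in> carrier A \<Longrightarrow> nrm A (c \<odot> x) = cmod c * nrm A x"
    and nrm_mult: "\<lbrakk>x \<in> carrier A; y \<in> carrier A\<rbrakk> \<Longrightarrow> nrm A (x \<otimes> y) \<le> nrm A x * nrm A y"
    and nrm_star_mult: "x \<in> carrier A \<Longrightarrow> nrm A (star A x \<otimes> x) = (nrm A x)\<^sup>2"
    and complete: "f \<in> cauchy_seqs A
      \<Longrightarrow> \<exists>l\<in>carrier A. (\<lambda>n. nrm A (f n \<ominus> l)) \<longlonglongrightarrow> 0"

definition star_iso :: "'a star_alg \<Rightarrow> 'b star_alg \<Rightarrow> ('a \<Rightarrow> 'b) \<Rightarrow> bool" where
  "star_iso A B f \<longleftrightarrow> bij_betw f (carrier A) (carrier B) \<and>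
     (\<forall>x\<in>carrier A. \<forall>y\<in>carrier A. f (x \<oplus>\<^bsub>A\<^esub> y) = f x \<oplus>\<^bsub>B\<^esub> f y) \<and>
     (\<forall>x\<in>carrier A. \<forall>y\<in>carrier A. f (x \<otimes>\<^bsub>A\<^esub> y) = f x \<otimes>\<^bsub>B\<^esub> f y) \<and>
     (\<forall>c. \<forall>x\<in>carrier A. f (c \<odot>\<^bsub>A\<^esub> x) = c \<odot>\<^bsub>B\<^esub> f x) \<and>
     (\<forall>x\<in>carrier A. f (star A x) = star B (f x))"

definition graded_cstar :: "'a star_alg \<Rightarrow> ('a \<Rightarrow> 'a) \<Rightarrow> bool" where
  "graded_cstar A \<alpha> \<longleftrightarrow> cstar_algebra A \<and> star_iso A A \<alpha> \<and> (\<forall>x\<in>carrier A. \<alpha> (\<alpha> x) = x)"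

definition graded_isomorphic ::
  "'a star_alg \<Rightarrow> ('a \<Rightarrow> 'a) \<Rightarrow> 'b star_alg \<Rightarrow> ('b \<Rightarrow> 'b) \<Rightarrow> bool" where
  "graded_isomorphic A \<alpha> B \<beta> \<longleftrightarrow> graded_cstar A \<alpha> \<and> graded_cstar B \<beta> \<and>
     (\<exists>f. star_iso A B f \<and> (\<forall>x\<in>carrier A. f (\<alpha> x) = \<beta> (f x)))"

definition Cliff1 :: "(complex \<times> complex) star_alg" where
  "Cliff1 = \<lparr>carrier = UNIV, mult = (\<lambda>(z, w) (z', w'). (z * z', w * w')), one = (1, 1),
     zero = (0, 0), add = (+), smult = (\<lambda>c (z, w). (c * z, c * w)),
     star = (\<lambda>(z, w). (cnj z, cnj w)), nrm = (\<lambda>(z, w). max (cmod z) (cmod w))\<rparr>"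

definition Cliff1_grading :: "complex \<times> complex \<Rightarrow> complex \<times> complex" where
  "Cliff1_grading = prod.swap"


section \<open>Quotients and completions\<close>

text \<open>
  The quotient of \<open>S\<close> by an equivalence relation compatible with its operations and its norm.
\<close>

definition quotient_alg :: "'a star_alg \<Rightarrow> ('a \<times> 'a) set \<Rightarrow> 'a set star_alg" where
  "quotient_alg S R = \<lparr>carrier = carrier S // R,
     mult = (\<lambda>X Y. \<Union>x\<in>X. \<Union>y\<in>Y. R `` {x \<otimes>\<^bsub>S\<^esub> y}), one = undefined,
     zero = R `` {\<zero>\<^bsub>S\<^esub>}, add = (\<lambda>X Y. \<Union>x\<in>X. \<Union>y\<in>Y. R `` {x \<oplus>\<^bsub>S\<^esub> y}),
     smult = (\<lambda>c X. \<Union>x\<in>X. R `` {c \<odot>\<^bsub>S\<^esub> x}),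
     star = (\<lambda>X. \<Union>x\<in>X. R `` {star S x}),
     nrm = (\<lambda>X. THE r. \<forall>x\<in>X. nrm S x = r)\<rparr>"

definition quotient_map :: "('a \<times> 'a) set \<Rightarrow> ('a \<Rightarrow> 'a) \<Rightarrow> 'a set \<Rightarrow> 'a set" where
  "quotient_map R f X = (\<Union>x\<in>X. R `` {f x})"

definition cauchy_alg :: "'a star_alg \<Rightarrow> (nat \<Rightarrow> 'a) star_alg" where
  "cauchy_alg S = \<lparr>carrier = cauchy_seqs S,
     mult = (\<lambda>x y n. x n \<otimes>\<^bsub>S\<^esub> y n), one = undefined,
     zero = (\<lambda>_. \<zero>\<^bsub>S\<^esub>), add = (\<lambda>x y n. x n \<oplus>\<^bsub>S\<^esub> y n),
     smult = (\<lambda>c x n. c \<odot>\<^bsub>S\<^esub> x n), star = (\<lambda>x n. star S (x n)),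
     nrm = (\<lambda>x. lim (\<lambda>n. nrm S (x n)))\<rparr>"

definition null_rel :: "'a star_alg \<Rightarrow> ((nat \<Rightarrow> 'a) \<times> (nat \<Rightarrow> 'a)) set" where
  "null_rel S = {(x, y). x \<in> cauchy_seqs S \<and> y \<in> cauchy_seqs S \<and>
     (\<lambda>n. nrm S (x n \<ominus>\<^bsub>S\<^esub> y n)) \<longlonglongrightarrow> 0}"

text \<open>
  The Hausdorff completion: if \<open>nrm S\<close> is only a seminorm, its kernel is divided out as well.
\<close>

definition completion :: "'a star_alg \<Rightarrow> (nat \<Rightarrow> 'a) set star_alg" where
  "completion S = quotient_alg (cauchy_alg S) (null_rel S)"

definition completion_map ::
  "'a star_alg \<Rightarrow> ('a \<Rightarrow> 'a) \<Rightarrow> (nat \<Rightarrow> 'a) set \<Rightarrow> (nat \<Rightarrow> 'a) set" where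
  "completion_map S f = quotient_map (null_rel S) (\<lambda>x n. f (x n))"

definition scale_fun :: "complex \<Rightarrow> ('a \<Rightarrow>\<^sub>0 complex) \<Rightarrow> 'a \<Rightarrow>\<^sub>0 complex" where
  "scale_fun c x = Poly_Mapping.map ((*) c) x"


section \<open>The universal \<open>C\<^sup>*\<close>-algebra of a graph with a cocycle\<close>

definition graph_family ::
  "nat \<Rightarrow> nat \<Rightarrow> 'l pgraph \<Rightarrow> ('l \<Rightarrow> 'l \<Rightarrow> complex) \<Rightarrow> 'b star_alg \<Rightarrow> ('l \<Rightarrow> 'b) \<Rightarrow> bool" where
  "graph_family k a L c B t \<longleftrightarrow>
     (\<forall>x\<in>mor L. t x \<in> carrier B) \<and>
     (\<forall>v\<in>objs L. t v \<otimes>\<^bsub>B\<^esub> t v = t v \<and> star B (t v) = t v) \<and>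
     (\<forall>v\<in>objs L. \<forall>w\<in>objs L. v \<noteq> w \<longrightarrow> t v \<otimes>\<^bsub>B\<^esub> t w = \<zero>\<^bsub>B\<^esub>) \<and>
     (\<forall>x\<in>mor L. \<forall>y\<in>mor L. src L x = rng L y \<longrightarrow>
        t x \<otimes>\<^bsub>B\<^esub> t y = c x y \<odot>\<^bsub>B\<^esub> t (cmp L x y)) \<and>
     (\<forall>x\<in>mor L. star B (t x) \<otimes>\<^bsub>B\<^esub> t x = t (src L x)) \<and>
     (\<forall>v\<in>objs L. \<forall>p\<in>Pmon k a.
        t v = finsum B (\<lambda>x. t x \<otimes>\<^bsub>B\<^esub> star B (t x)) (paths_to L v p))"

text \<open>
  Elements of the free (non-unital) \<open>*\<close>-algebra on \<open>mor L\<close> are the finitely supported functions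
  on the nonempty words whose letters are \<open>(x, False)\<close>, standing for the generator \<open>s\<^sub>x\<close>,
  and \<open>(x, True)\<close>, standing for \<open>s\<^sub>x\<^sup>*\<close>.
\<close>

type_synonym 'l word = "('l \<times> bool) list"

definition letter :: "'b star_alg \<Rightarrow> ('l \<Rightarrow> 'b) \<Rightarrow> 'l \<times> bool \<Rightarrow> 'b" where
  "letter B t = (\<lambda>(x, starred). if starred then star B (t x) else t x)"

fun word_value :: "'b star_alg \<Rightarrow> ('l \<Rightarrow> 'b) \<Rightarrow> 'l word \<Rightarrow> 'b" where
  "word_value B t [] = \<zero>\<^bsub>B\<^esub>"  \<comment> \<open>irrelevant, only nonempty words occur\<close>
| "word_value B t [x] = letter B t x"
| "word_value B t (x # y # w) = letter B t x \<otimes>\<^bsub>B\<^esub> word_value B t (y # w)"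

definition free_value :: "'b star_alg \<Rightarrow> ('l \<Rightarrow> 'b) \<Rightarrow> ('l word \<Rightarrow>\<^sub>0 complex) \<Rightarrow> 'b" where
  "free_value B t x =
     finsum B (\<lambda>w. Poly_Mapping.lookup x w \<odot>\<^bsub>B\<^esub> word_value B t w) (Poly_Mapping.keys x)"

text \<open>
  The universal seminorm is the supremum over all families satisfying the relations in a
  \<open>C\<^sup>*\<close>-algebra. As \<open>mor L\<close> is countable, such a family generates a separable
  \<open>C\<^sup>*\<close>-algebra, which has at most continuum many elements and hence is isomorphic to one whose
  carrier is a set of real numbers; so it is enough to consider the algebras of this kind.
  (The real numbers only serve as a set of names, their arithmetic plays no role.)
\<close>

definition universal_norm ::
  "nat \<Rightarrow> nat \<Rightarrow> 'l pgraph \<Rightarrow> ('l \<Rightarrow> 'l \<Rightarrow> complex) \<Rightarrow> ('l word \<Rightarrow>\<^sub>0 complex) \<Rightarrow> real" where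
  "universal_norm k a L c x =
     Sup {nrm B (free_value B t x) | (B :: real star_alg) t.
       cstar_algebra B \<and> graph_family k a L c B t}"

definition free_star_alg ::
  "nat \<Rightarrow> nat \<Rightarrow> 'l pgraph \<Rightarrow> ('l \<Rightarrow> 'l \<Rightarrow> complex) \<Rightarrow> ('l word \<Rightarrow>\<^sub>0 complex) star_alg" where
  "free_star_alg k a L c =
    \<lparr>carrier = {x. \<forall>w\<in>Poly_Mapping.keys x. w \<noteq> [] \<and> fst ` set w \<subseteq> mor L},
     mult = (\<lambda>x y. \<Sum>u\<in>Poly_Mapping.keys x. \<Sum>v\<in>Poly_Mapping.keys y.
        Poly_Mapping.single (u @ v) (Poly_Mapping.lookup x u * Poly_Mapping.lookup y v)),
     one = undefined, zero = 0, add = (+), smult = scale_fun,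
     star = (\<lambda>x. \<Sum>w\<in>Poly_Mapping.keys x.
        Poly_Mapping.single (rev (map (apsnd Not) w)) (cnj (Poly_Mapping.lookup x w))),
     nrm = universal_norm k a L c\<rparr>"

definition graph_cstar ::
  "nat \<Rightarrow> nat \<Rightarrow> 'l pgraph \<Rightarrow> ('l \<Rightarrow> 'l \<Rightarrow> complex) \<Rightarrow> (nat \<Rightarrow> 'l word \<Rightarrow>\<^sub>0 complex) set star_alg" where
  "graph_cstar k a L c = completion (free_star_alg k a L c)"

text \<open>
  The grading of \<^term>\<open>graph_cstar k a L c\<close> which maps \<open>s\<^sub>x\<close> to \<open>(-1)\<^sup>\<delta>\<^sup>(\<^sup>x\<^sup>) s\<^sub>x\<close>, for \<open>\<delta>\<close> the
  parity of the degree; it is induced by the corresponding substitution in the free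
  \<open>*\<close>-algebra.
\<close>

definition free_grading ::
  "nat \<Rightarrow> nat \<Rightarrow> 'l pgraph \<Rightarrow> ('l word \<Rightarrow>\<^sub>0 complex) \<Rightarrow> 'l word \<Rightarrow>\<^sub>0 complex" where
  "free_grading k a L x = (\<Sum>w\<in>Poly_Mapping.keys x. Poly_Mapping.single w
     (prod_list (map (\<lambda>(y, _). bit_sign (graph_parity k a L y)) w) * Poly_Mapping.lookup x w))"

definition graph_grading ::
  "nat \<Rightarrow> nat \<Rightarrow> 'l pgraph \<Rightarrow> ('l \<Rightarrow> 'l \<Rightarrow> complex) \<Rightarrow>
    (nat \<Rightarrow> 'l word \<Rightarrow>\<^sub>0 complex) set \<Rightarrow> (nat \<Rightarrow> 'l word \<Rightarrow>\<^sub>0 complex) set" where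
  "graph_grading k a L c = completion_map (free_star_alg k a L c) (free_grading k a L)"


section \<open>The minimal graded tensor product\<close>

text \<open>The component of degree \<open>i\<close> of \<open>x\<close> with respect to the grading \<open>\<alpha>\<close>.\<close>

definition hcomp :: "'a star_alg \<Rightarrow> ('a \<Rightarrow> 'a) \<Rightarrow> bit \<Rightarrow> 'a \<Rightarrow> 'a" where
  "hcomp A \<alpha> i x = (1 / 2) \<odot>\<^bsub>A\<^esub> (x \<oplus>\<^bsub>A\<^esub> bit_sign i \<odot>\<^bsub>A\<^esub> \<alpha> x)"

text \<open>
  The algebraic tensor product is the free vector space on the pairs \<open>(x, y)\<close> (which become the
  elementary tensors), modulo the following subspace.
\<close>

inductive_set tensor_null :: "'a star_alg \<Rightarrow> 'b star_alg \<Rightarrow> ('a \<times> 'b \<Rightarrow>\<^sub>0 complex) set"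
  for A :: "'a star_alg" and B :: "'b star_alg" where
  add_left: "\<lbrakk>x \<in> carrier A; x' \<in> carrier A; y \<in> carrier B\<rbrakk> \<Longrightarrow>
    Poly_Mapping.single (x \<oplus>\<^bsub>A\<^esub> x', y) 1
      - (Poly_Mapping.single (x, y) 1 + Poly_Mapping.single (x', y) 1) \<in> tensor_null A B"
| add_right: "\<lbrakk>x \<in> carrier A; y \<in> carrier B; y' \<in> carrier B\<rbrakk> \<Longrightarrow>
    Poly_Mapping.single (x, y \<oplus>\<^bsub>B\<^esub> y') 1
      - (Poly_Mapping.single (x, y) 1 + Poly_Mapping.single (x, y') 1) \<in> tensor_null A B"
| scale_left: "\<lbrakk>x \<in> carrier A; y \<in> carrier B\<rbrakk> \<Longrightarrow>
    Poly_Mapping.single (c \<odot>\<^bsub>A\<^esub> x, y) 1 - Poly_Mapping.single (x, y) c \<in> tensor_null A B"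
| scale_right: "\<lbrakk>x \<in> carrier A; y \<in> carrier B\<rbrakk> \<Longrightarrow>
    Poly_Mapping.single (x, c \<odot>\<^bsub>B\<^esub> y) 1 - Poly_Mapping.single (x, y) c \<in> tensor_null A B"
| zero: "0 \<in> tensor_null A B"
| add: "\<lbrakk>u \<in> tensor_null A B; v \<in> tensor_null A B\<rbrakk> \<Longrightarrow> u + v \<in> tensor_null A B"
| scale: "u \<in> tensor_null A B \<Longrightarrow> scale_fun c u \<in> tensor_null A B"

definition pre_tensor_carrier :: "'a star_alg \<Rightarrow> 'b star_alg \<Rightarrow> ('a \<times> 'b \<Rightarrow>\<^sub>0 complex) set" where
  "pre_tensor_carrier A B = {u. Poly_Mapping.keys u \<subseteq> carrier A \<times> carrier B}"

definition tensor_rel :: "'a star_alg \<Rightarrow> 'b star_alg \<Rightarrow>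
    (('a \<times> 'b \<Rightarrow>\<^sub>0 complex) \<times> ('a \<times> 'b \<Rightarrow>\<^sub>0 complex)) set" where
  "tensor_rel A B = {(u, v). u \<in> pre_tensor_carrier A B \<and> v \<in> pre_tensor_carrier A B \<and>
     u - v \<in> tensor_null A B}"

text \<open>
  The graded product and involution. The formulas for homogeneous elements are extended
  bilinearly, by decomposing the elements concerned into their homogeneous components.
\<close>

definition pre_tensor_mult ::
  "'a star_alg \<Rightarrow> ('a \<Rightarrow> 'a) \<Rightarrow> 'b star_alg \<Rightarrow> ('b \<Rightarrow> 'b) \<Rightarrow>
    ('a \<times> 'b \<Rightarrow>\<^sub>0 complex) \<Rightarrow> ('a \<times> 'b \<Rightarrow>\<^sub>0 complex) \<Rightarrow> 'a \<times> 'b \<Rightarrow>\<^sub>0 complex" where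
  "pre_tensor_mult A \<alpha> B \<beta> u v =
     (\<Sum>(x, y)\<in>Poly_Mapping.keys u. \<Sum>(x', y')\<in>Poly_Mapping.keys v. \<Sum>i\<in>{0, 1}. \<Sum>j\<in>{0, 1}.
        Poly_Mapping.single (x \<otimes>\<^bsub>A\<^esub> hcomp A \<alpha> j x', hcomp B \<beta> i y \<otimes>\<^bsub>B\<^esub> y')
          (bit_sign (i * j) * (Poly_Mapping.lookup u (x, y) * Poly_Mapping.lookup v (x', y'))))"

definition pre_tensor_star ::
  "'a star_alg \<Rightarrow> ('a \<Rightarrow> 'a) \<Rightarrow> 'b star_alg \<Rightarrow> ('b \<Rightarrow> 'b) \<Rightarrow>
    ('a \<times> 'b \<Rightarrow>\<^sub>0 complex) \<Rightarrow> 'a \<times> 'b \<Rightarrow>\<^sub>0 complex" where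
  "pre_tensor_star A \<alpha> B \<beta> u =
     (\<Sum>(x, y)\<in>Poly_Mapping.keys u. \<Sum>i\<in>{0, 1}. \<Sum>j\<in>{0, 1}.
        Poly_Mapping.single (star A (hcomp A \<alpha> i x), star B (hcomp B \<beta> j y))
          (bit_sign (i * j) * cnj (Poly_Mapping.lookup u (x, y))))"

definition state :: "'a star_alg \<Rightarrow> ('a \<Rightarrow> complex) \<Rightarrow> bool" where
  "state A \<phi> \<longleftrightarrow>
     (\<forall>x\<in>carrier A. \<forall>y\<in>carrier A. \<phi> (x \<oplus>\<^bsub>A\<^esub> y) = \<phi> x + \<phi> y) \<and>
     (\<forall>c. \<forall>x\<in>carrier A. \<phi> (c \<odot>\<^bsub>A\<^esub> x) = c * \<phi> x) \<and>
     (\<forall>x\<in>carrier A. \<exists>r\<ge>0. \<phi> (star A x \<otimes>\<^bsub>A\<^esub> x) = complex_of_real r) \<and>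
     (\<forall>x\<in>carrier A. cmod (\<phi> x) \<le> nrm A x) \<and>
     (SUP x\<in>{x \<in> carrier A. nrm A x \<le> 1}. cmod (\<phi> x)) = 1"

text \<open>Equivalently, the state vanishes on the elements of degree 1.\<close>

definition graded_state :: "'a star_alg \<Rightarrow> ('a \<Rightarrow> 'a) \<Rightarrow> ('a \<Rightarrow> complex) \<Rightarrow> bool" where
  "graded_state A \<alpha> \<phi> \<longleftrightarrow> state A \<phi> \<and> (\<forall>x\<in>carrier A. \<phi> (\<alpha> x) = \<phi> x)"

definition tensor_functional ::
  "('a \<Rightarrow> complex) \<Rightarrow> ('b \<Rightarrow> complex) \<Rightarrow> ('a \<times> 'b \<Rightarrow>\<^sub>0 complex) \<Rightarrow> complex" where
  "tensor_functional \<phi> \<psi> u =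
     (\<Sum>(x, y)\<in>Poly_Mapping.keys u. Poly_Mapping.lookup u (x, y) * \<phi> x * \<psi> y)"

text \<open>
  The minimal (spatial) norm, as in Kasparov's definition of the graded tensor product: the
  supremum of the operator norms in the GNS representations of the product functionals
  \<open>\<phi> \<otimes> \<psi>\<close>, where \<open>\<phi>\<close> and \<open>\<psi>\<close> are grading-invariant states. That is,
  \<open>\<parallel>u\<parallel>\<^sup>2\<close> is the supremum of \<open>(\<phi> \<otimes> \<psi>)(v\<^sup>* u\<^sup>* u v) / (\<phi> \<otimes> \<psi>)(v\<^sup>* v)\<close>. The value 0 is
  inserted for the case that one of the algebras is zero, and so has no states.
\<close>

definition minimal_norm ::
  "'a star_alg \<Rightarrow> ('a \<Rightarrow> 'a) \<Rightarrow> 'b star_alg \<Rightarrow> ('b \<Rightarrow> 'b) \<Rightarrow> ('a \<times> 'b \<Rightarrow>\<^sub>0 complex) \<Rightarrow> real" where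
  "minimal_norm A \<alpha> B \<beta> u =
    (let sq = (\<lambda>w. pre_tensor_mult A \<alpha> B \<beta> (pre_tensor_star A \<alpha> B \<beta> w) w) in
     sqrt (Sup (insert 0
       {Re (tensor_functional \<phi> \<psi> (sq (pre_tensor_mult A \<alpha> B \<beta> u v)))
          / Re (tensor_functional \<phi> \<psi> (sq v)) | \<phi> \<psi> v.
        graded_state A \<alpha> \<phi> \<and> graded_state B \<beta> \<psi> \<and> v \<in> pre_tensor_carrier A B \<and>
        tensor_functional \<phi> \<psi> (sq v) \<noteq> 0})))"

definition algebraic_tensor ::
  "'a star_alg \<Rightarrow> ('a \<Rightarrow> 'a) \<Rightarrow> 'b star_alg \<Rightarrow> ('b \<Rightarrow> 'b) \<Rightarrow>
    ('a \<times> 'b \<Rightarrow>\<^sub>0 complex) set star_alg" where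
  "algebraic_tensor A \<alpha> B \<beta> = quotient_alg
    \<lparr>carrier = pre_tensor_carrier A B, mult = pre_tensor_mult A \<alpha> B \<beta>, one = undefined,
     zero = 0, add = (+), smult = scale_fun, star = pre_tensor_star A \<alpha> B \<beta>,
     nrm = minimal_norm A \<alpha> B \<beta>\<rparr> (tensor_rel A B)"

definition graded_tensor ::
  "'a star_alg \<Rightarrow> ('a \<Rightarrow> 'a) \<Rightarrow> 'b star_alg \<Rightarrow> ('b \<Rightarrow> 'b) \<Rightarrow>
    (nat \<Rightarrow> ('a \<times> 'b \<Rightarrow>\<^sub>0 complex) set) set star_alg" where
  "graded_tensor A \<alpha> B \<beta> = completion (algebraic_tensor A \<alpha> B \<beta>)"

text \<open>The grading induced by \<open>x \<otimes> y \<mapsto> \<alpha> x \<otimes> \<beta> y\<close>.\<close>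

definition pre_tensor_grading ::
  "('a \<Rightarrow> 'a) \<Rightarrow> ('b \<Rightarrow> 'b) \<Rightarrow> ('a \<times> 'b \<Rightarrow>\<^sub>0 complex) \<Rightarrow> 'a \<times> 'b \<Rightarrow>\<^sub>0 complex" where
  "pre_tensor_grading \<alpha> \<beta> u = (\<Sum>(x, y)\<in>Poly_Mapping.keys u.
     Poly_Mapping.single (\<alpha> x, \<beta> y) (Poly_Mapping.lookup u (x, y)))"

definition tensor_grading ::
  "'a star_alg \<Rightarrow> ('a \<Rightarrow> 'a) \<Rightarrow> 'b star_alg \<Rightarrow> ('b \<Rightarrow> 'b) \<Rightarrow>
    (nat \<Rightarrow> ('a \<times> 'b \<Rightarrow>\<^sub>0 complex) set) set \<Rightarrow> (nat \<Rightarrow> ('a \<times> 'b \<Rightarrow>\<^sub>0 complex) set) set" where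
  "tensor_grading A \<alpha> B \<beta> = completion_map (algebraic_tensor A \<alpha> B \<beta>)
     (quotient_map (tensor_rel A B) (pre_tensor_grading \<alpha> \<beta>))"

end

theory Submission
  imports "HOL-Analysis.Analysis" Defs
begin

text \<open>Let A be the graph algebra of the graph with its standard cocycle, and let \<gamma> be
  its grading. The crossed product of A by \<gamma> consists of the pairs (x, y), read as x + y e,
  where e is a self-adjoint unitary with e x = \<gamma>(x) e. Its grading sends (x, y) to (\<gamma>
  x, - \<gamma> y), so that e is odd. All three algebras of the theorem are identified with this one
  graded algebra, and \<open>realizes_graded_isomorphic\<close> turns the common model into
  isomorphisms.

  Tensor products. A graded algebra B that is a copy of \<open>Cliff1\<close> (locale
  \<open>clifford\<close>) is spanned by an even unit and an odd self-adjoint unitary e. Every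
  tensor is therefore x \<otimes> 1 + y \<otimes> e with unique x and y (\<open>null_iff\<close>),
  and the sign rule of the graded product says exactly that e x = \<gamma>(x) e
  (\<open>ev_mult\<close>, \<open>ev_star\<close>). The only grading-invariant state of B is the
  coefficient of the unit (\<open>graded_state_unique\<close>), so the minimal norm is the supremum
  \<open>cnorm\<close> of operator norms on the GNS spaces of the functionals x + y e -> \<phi> x,
  for invariant states \<phi> of A (\<open>minimal_norm_eq\<close>). This norm lies between the
  maximum and the sum of the norms of the two components (\<open>cnorm_lower\<close>,
  \<open>cnorm_upper\<close>), so the algebraic tensor product is already complete. The lower bound
  rests on \<open>norm_le_selfadj\<close>: the invariant states determine the norm of A. A state
  that attains the norm at the fourth power of h is averaged with its composition with \<gamma>;
  this costs a factor 2, which disappears on passing to high powers of h.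

  The group. The characters of the group with two elements identify its C*-algebra with
  \<open>Cliff1\<close>, the grading becoming the exchange of coordinates
  (\<open>clifford_Z2\<close>).

  The product graph. The new coordinate contributes to the cocycle the sign with which e passes a
  generator of A (\<open>cocycle_times_Z2\<close>). Hence the elements s_x e^i of the crossed
  product satisfy the relations of the product graph (\<open>tfam_twist\<close>) and generate
  everything (\<open>closure_twist\<close>). Conversely, a family s for the product graph restricts
  to one for the original graph (\<open>tfam_restrict\<close>), which gives a homomorphism \<phi> of
  A. The unitary e is recovered as a strict limit of the finite sums of the elements s (v, 1) over
  objects v: the limits \<psi> x of \<open>\<phi> x * W 1 n\<close> exist for all x in A, and x + y
  e -> \<phi> x + \<psi> y is a *-homomorphism that takes s_x e^i to s (x, i). As *-homomorphisms
  are contractive, no family has larger values than this one (\<open>norm_fv_le_twist\<close>), so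
  the universal norm is the norm of the crossed product (\<open>norm_fv_twist\<close>).

  Foundations. C*-algebras given by carriers are embedded into members of a type class, through the
  product of all algebras on a type. There, contractivity of *-homomorphisms, positivity of
  \<open>adj y * y\<close> and existence of states are derived from an iteration for square roots.
  The universal family \<open>gen\<close> has all families in algebras with real elements as its
  coordinates. It dominates every family whatsoever, because a countable family generates a
  separable algebra, whose elements can be named by real numbers (\<open>tfam_universal\<close>).
  Quotients and completions are treated once and for all by \<open>completion_realizes\<close>: the
  completion of an algebra mapped isometrically into the type class is the closure of its
  image.\<close>

section \<open>C*-algebras as types\<close>

class cstar_normed = real_normed_algebra +
  fixes scaleC :: "complex \<Rightarrow> 'a \<Rightarrow> 'a" (infixr "*\<^sub>C" 75)
    and adj :: "'a \<Rightarrow> 'a"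
  assumes scaleC_add_right: "scaleC c (x + y) = scaleC c x + scaleC c y"
    and scaleC_add_left: "scaleC (c + d) x = scaleC c x + scaleC d x"
    and scaleC_scaleC: "scaleC c (scaleC d x) = scaleC (c * d) x"
    and scaleC_of_real: "scaleC (complex_of_real r) x = r *\<^sub>R x"
    and scaleC_mult_left: "scaleC c x * y = scaleC c (x * y)"
    and scaleC_mult_right: "x * scaleC c y = scaleC c (x * y)"
    and norm_scaleC: "norm (scaleC c x) = cmod c * norm x"
    and adj_adj: "adj (adj x) = x"
    and adj_add: "adj (x + y) = adj x + adj y"
    and adj_scaleC: "adj (scaleC c x) = scaleC (cnj c) (adj x)"
    and adj_mult: "adj (x * y) = adj y * adj x"
    and norm_adj_mult: "norm (adj x * x) = (norm x)\<^sup>2"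


text \<open>Completeness is a separate step, because the instances below first establish the algebra
  and the norm and only then the convergence of Cauchy sequences. A unit is not part of the class:
  graphs with infinitely many objects lead to non-unital algebras.\<close>

class cstar_type = cstar_normed + banach

lemma scaleC_one: "scaleC 1 x = (x :: 'a::cstar_type)"
  using scaleC_of_real[of 1 x] by simp

lemma scaleC_zero_left: "scaleC 0 x = (0 :: 'a::cstar_type)"
  using scaleC_of_real[of 0 x] by simp

lemma scaleC_zero_right: "scaleC c 0 = (0 :: 'a::cstar_type)"
  using scaleC_add_right[of c "0 :: 'a" 0] by simp

lemma scaleC_minus1: "scaleC (-1) x = - (x :: 'a::cstar_type)"
  using scaleC_of_real[of "-1" x] by simp

lemma scaleC_minus_right: "scaleC c (- x) = - scaleC c (x :: 'a::cstar_type)"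
  using scaleC_scaleC[of c "-1" x] scaleC_scaleC[of "-1" c x] by (simp add: scaleC_minus1)

lemma scaleC_minus_left: "scaleC (- c) x = - scaleC c (x :: 'a::cstar_type)"
  using scaleC_scaleC[of "-1" c x] by (simp add: scaleC_minus1)

lemma scaleC_diff_right: "scaleC c (x - y) = scaleC c x - scaleC c (y :: 'a::cstar_type)"
  using scaleC_add_right[of c x "-y"] by (simp add: scaleC_minus_right)

lemma scaleC_sum: "scaleC c (sum f A) = (\<Sum>x\<in>A. scaleC c (f x :: 'a::cstar_type))"
  by (induction A rule: infinite_finite_induct) (auto simp: scaleC_add_right scaleC_zero_right)

lemma adj_zero: "adj 0 = (0 :: 'a::cstar_type)"
  using adj_add[of "0 :: 'a" 0] by simp

lemma adj_minus: "adj (- x) = - adj (x :: 'a::cstar_type)"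
  using adj_scaleC[of "-1" x] by (simp add: scaleC_minus1)

lemma adj_diff: "adj (x - y) = adj x - adj (y :: 'a::cstar_type)"
  using adj_add[of x "-y"] by (simp add: adj_minus)

lemma adj_scaleR: "adj (r *\<^sub>R x) = r *\<^sub>R adj (x :: 'a::cstar_type)"
  using adj_scaleC[of "of_real r" x] by (simp add: scaleC_of_real)

lemma adj_sum: "adj (sum f A) = (\<Sum>x\<in>A. adj (f x :: 'a::cstar_type))"
  by (induction A rule: infinite_finite_induct) (auto simp: adj_add adj_zero)

text \<open>By the C*-identity the square of \<open>norm x\<close> is at most
  \<open>norm (adj x) * norm x\<close>; cancelling and exchanging the roles of x and
  \<open>adj x\<close> gives equality.\<close>

lemma norm_adj: "norm (adj x) = norm (x :: 'a::cstar_type)"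
proof -
  have "norm x \<le> norm (adj x)" for x :: 'a
  proof (cases "norm x = 0")
    case False
    have "norm x * norm x \<le> norm (adj x) * norm x"
      using norm_mult_ineq[of "adj x" x] norm_adj_mult[of x] by (simp add: power2_eq_square)
    then show ?thesis using False by simp
  qed simp
  from this[of x] this[of "adj x"] show ?thesis by (simp add: adj_adj)
qed

lemma norm_mult_adj: "norm (x * adj x) = (norm (x :: 'a::cstar_type))\<^sup>2"
  using norm_adj_mult[of "adj x"] by (simp add: adj_adj norm_adj)

lemma adj_mult_eq_0: "adj x * x = 0 \<Longrightarrow> (x :: 'a::cstar_type) = 0"
  using norm_adj_mult[of x] by simp

lemma norm_proj_le_1:
  fixes x :: "'a::cstar_type"
  assumes "x * x = x" "adj x = x"
  shows "norm x \<le> 1"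
proof -
  have "norm x * norm x = norm x"
    using norm_adj_mult[of x] assms by (simp add: power2_eq_square)
  then show ?thesis by (cases "norm x = 0") auto
qed

lemma bounded_linear_scaleC: "bounded_linear (\<lambda>x::'a::cstar_type. scaleC c x)"
  by (rule bounded_linear_intro[where K="cmod c"])
    (auto simp: scaleC_add_right norm_scaleC scaleC_scaleC mult.commute simp flip: scaleC_of_real)

lemma bounded_linear_adj: "bounded_linear (adj :: 'a::cstar_type \<Rightarrow> 'a)"
  by (rule bounded_linear_intro[where K=1]) (auto simp: adj_add adj_scaleR norm_adj)

lemmas tendsto_scaleC [tendsto_intros] = bounded_linear.tendsto[OF bounded_linear_scaleC]
lemmas tendsto_adj [tendsto_intros] = bounded_linear.tendsto[OF bounded_linear_adj]
lemmas continuous_on_scaleC [continuous_intros] = bounded_linear.continuous_on[OF bounded_linear_scaleC]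
lemmas continuous_on_adj [continuous_intros] = bounded_linear.continuous_on[OF bounded_linear_adj]

subsection \<open>Products of \<open>C\<^sup>*\<close>-algebras\<close>

text \<open>
  Every algebra on the type \<open>'a\<close> is a factor of the product of all of them, indexed moreover by
  some type \<open>'j\<close>. In this way statements about carriers become statements about a type class.
\<close>

typedef ('a, 'j) cprod = "{f :: 'a star_alg \<times> 'j \<Rightarrow> 'a.
    (\<forall>p. if cstar_algebra (fst p) then f p \<in> carrier (fst p) else f p = undefined) \<and>
    (\<exists>K. \<forall>p. cstar_algebra (fst p) \<longrightarrow> nrm (fst p) (f p) \<le> K)}"
  morphisms proj Abs_cprod
proof -
  have "nrm A \<zero>\<^bsub>A\<^esub> = 0" if "cstar_algebra A" for A :: "'a star_alg"
  proof -
    interpret cstar_algebra A by fact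
    show ?thesis by (simp add: nrm_eq_zero)
  qed
  then show ?thesis
    by (intro exI[of _ "\<lambda>p. if cstar_algebra (fst p) then \<zero>\<^bsub>fst p\<^esub> else undefined"])
      (auto simp: cstar_algebra_def abelian_group_def abelian_monoid.zero_closed intro!: exI[of _ 0])
qed

lemma proj_closed: "cstar_algebra (fst p) \<Longrightarrow> proj f p \<in> carrier (fst p)"
  using proj[of f] by (cases p) (auto split: if_splits)

lemma proj_bounded: obtains K where "\<And>p. cstar_algebra (fst p) \<Longrightarrow> nrm (fst p) (proj f p) \<le> K"
  using proj[of f] by fastforce

text \<open>At an index whose first component is not a C*-algebra all elements have the value
  \<open>undefined\<close>, so only genuine factors have to be compared.\<close>

lemma cprod_eqI:
  assumes "\<And>p. cstar_algebra (fst p) \<Longrightarrow> proj f p = proj g p"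
  shows "f = g"
proof -
  have "proj f p = proj g p" for p
    using proj[of f] proj[of g] assms[of p]
    by (cases "cstar_algebra (fst p)") (auto simp del: split_paired_All)
  then show ?thesis by (simp add: proj_inject[symmetric] fun_eq_iff del: split_paired_All)
qed

definition mk_cprod :: "('a star_alg \<times> 'j \<Rightarrow> 'a) \<Rightarrow> ('a, 'j) cprod" where
  "mk_cprod f = Abs_cprod (\<lambda>p. if cstar_algebra (fst p) then f p else undefined)"

lemma proj_mk:
  assumes "\<And>p. cstar_algebra (fst p) \<Longrightarrow> f p \<in> carrier (fst p)"
    and "\<And>p. cstar_algebra (fst p) \<Longrightarrow> nrm (fst p) (f p) \<le> K"
    and "cstar_algebra (fst p)"
  shows "proj (mk_cprod f) p = f p"
  unfolding mk_cprod_def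
  by (subst Abs_cprod_inverse) (use assms in \<open>auto simp del: split_paired_All intro!: exI[of _ K]\<close>)

context cstar_algebra
begin

text \<open>New names inside the locale, so that the additive laws can be cited from outside as
  facts about \<open>cstar_algebra\<close>, for a different algebra in each factor of the
  product.\<close>

lemmas sum_assoc = a_assoc
  and sum_comm = a_comm
  and sum_zero_left = l_zero
  and sum_neg_left = l_neg
  and diff_eq = a_minus_def
  and zero_in = zero_closed
  and sum_in = a_closed
  and neg_in = a_inv_closed

lemma nrm_zero: "nrm A \<zero> = 0"
  by (simp add: nrm_eq_zero)

lemma scale_zero_left: "x \<in> carrier A \<Longrightarrow> 0 \<odot> x = \<zero>"
  using nrm_scale[of x 0] scale_closed[of x 0] by (simp add: nrm_eq_zero)

lemma a_inv_eq_scale: "x \<in> carrier A \<Longrightarrow> \<ominus> x = (-1) \<odot> x"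
  using scale_add_left[of x 1 "-1"] scale_closed[of x "-1"]
  by (intro minus_equality) (auto simp: scale_one scale_zero_left a_comm)

lemma nrm_minus: "x \<in> carrier A \<Longrightarrow> nrm A (\<ominus> x) = nrm A x"
  by (simp add: a_inv_eq_scale nrm_scale)

lemma nrm_star: assumes x: "x \<in> carrier A" shows "nrm A (star A x) = nrm A x"
proof -
  have "nrm A x \<le> nrm A (star A x)" if x: "x \<in> carrier A" for x
  proof (cases "nrm A x = 0")
    case True then show ?thesis using nrm_nonneg star_closed[OF x] by simp
  next
    case False
    have "nrm A x * nrm A x \<le> nrm A (star A x) * nrm A x"
      using nrm_mult[OF star_closed[OF x] x] nrm_star_mult[OF x] by (simp add: power2_eq_square)
    then show ?thesis using False nrm_nonneg[OF x] by simp
  qed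
  from this[OF x] this[OF star_closed[OF x]] x show ?thesis by (simp add: star_star)
qed

lemma nrm_star_mult_alt: "x \<in> carrier A \<Longrightarrow> nrm A (star A x \<otimes> x) = nrm A x * nrm A x"
  by (simp add: nrm_star_mult power2_eq_square)

end

instantiation cprod :: (type, type) cstar_normed
begin

definition "0 = mk_cprod (\<lambda>p. \<zero>\<^bsub>fst p\<^esub>)"
definition "f + g = mk_cprod (\<lambda>p. proj f p \<oplus>\<^bsub>fst p\<^esub> proj g p)"
definition "f * g = mk_cprod (\<lambda>p. proj f p \<otimes>\<^bsub>fst p\<^esub> proj g p)"
definition "scaleC c f = mk_cprod (\<lambda>p. c \<odot>\<^bsub>fst p\<^esub> proj f p)"
definition "adj f = mk_cprod (\<lambda>p. star (fst p) (proj f p))"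
definition "scaleR r f = scaleC (complex_of_real r) (f :: ('a, 'b) cprod)"
definition "- f = scaleC (-1) (f :: ('a, 'b) cprod)"
definition "f - g = f + - (g :: ('a, 'b) cprod)"
text \<open>The inserted 0 makes the set nonempty without exhibiting a C*-algebra on the
  type.\<close>

definition norm_cprod :: "('a, 'b) cprod \<Rightarrow> real" where
  "norm f = Sup (insert 0 {nrm (fst p) (proj f p) | p. cstar_algebra (fst p)})"
definition "dist f g = norm (f - g :: ('a, 'b) cprod)"
definition "sgn f = scaleR (inverse (norm f)) (f :: ('a, 'b) cprod)"
definition "uniformity = (INF e\<in>{0 <..}. principal {(x, y). dist x (y :: ('a, 'b) cprod) < e})"
definition "open U = (\<forall>x\<in>U. \<forall>\<^sub>F (x', y) in uniformity. x' = x \<longrightarrow> (y :: ('a, 'b) cprod) \<in> U)"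

context
  fixes p :: "'a star_alg \<times> 'b"
  assumes p: "cstar_algebra (fst p)"
begin

interpretation cstar_algebra "fst p" by (fact p)

lemma proj_zero: "proj 0 p = \<zero>\<^bsub>fst p\<^esub>"
  unfolding zero_cprod_def
proof (rule proj_mk[where K=0, OF _ _ p])
  fix q :: "'a star_alg \<times> 'b" assume "cstar_algebra (fst q)"
  then interpret cstar_algebra "fst q" .
  show "\<zero>\<^bsub>fst q\<^esub> \<in> carrier (fst q)" "nrm (fst q) \<zero>\<^bsub>fst q\<^esub> \<le> 0" by (auto simp: nrm_zero)
qed

lemma proj_add: "proj (f + g) p = proj f p \<oplus>\<^bsub>fst p\<^esub> proj g p"
proof -
  obtain K where K: "\<And>p. cstar_algebra (fst p) \<Longrightarrow> nrm (fst p) (proj f p) \<le> K"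
    using proj_bounded[of f] by blast
  obtain L where L: "\<And>p. cstar_algebra (fst p) \<Longrightarrow> nrm (fst p) (proj g p) \<le> L"
    using proj_bounded[of g] by blast
  show ?thesis unfolding plus_cprod_def
  proof (rule proj_mk[where K="K+L", OF _ _ p])
    fix q :: "'a star_alg \<times> 'b" assume q: "cstar_algebra (fst q)"
    then interpret cstar_algebra "fst q" .
    show "proj f q \<oplus>\<^bsub>fst q\<^esub> proj g q \<in> carrier (fst q)"
      "nrm (fst q) (proj f q \<oplus>\<^bsub>fst q\<^esub> proj g q) \<le> K + L"
      using K[OF q] L[OF q] nrm_triangle[OF proj_closed[OF q] proj_closed[OF q], of f g] proj_closed[OF q]
      by auto
  qed
qed

lemma proj_mult: "proj (f * g) p = proj f p \<otimes>\<^bsub>fst p\<^esub> proj g p"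
proof -
  obtain K where K: "\<And>p. cstar_algebra (fst p) \<Longrightarrow> nrm (fst p) (proj f p) \<le> K"
    using proj_bounded[of f] by blast
  obtain L where L: "\<And>p. cstar_algebra (fst p) \<Longrightarrow> nrm (fst p) (proj g p) \<le> L"
    using proj_bounded[of g] by blast
  show ?thesis unfolding times_cprod_def
  proof (rule proj_mk[where K="K*L", OF _ _ p])
    fix q :: "'a star_alg \<times> 'b" assume q: "cstar_algebra (fst q)"
    then interpret cstar_algebra "fst q" .
    have "nrm (fst q) (proj f q) * nrm (fst q) (proj g q) \<le> K * L"
      using K[OF q] L[OF q] proj_closed[OF q] nrm_nonneg by (intro mult_mono) (auto intro: order_trans)
    then show "proj f q \<otimes>\<^bsub>fst q\<^esub> proj g q \<in> carrier (fst q)"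
      "nrm (fst q) (proj f q \<otimes>\<^bsub>fst q\<^esub> proj g q) \<le> K * L"
      using nrm_mult[OF proj_closed[OF q] proj_closed[OF q], of f g] proj_closed[OF q] mult_closed
      by auto
  qed
qed

lemma proj_scaleC: "proj (scaleC c f) p = c \<odot>\<^bsub>fst p\<^esub> proj f p"
proof -
  obtain K where K: "\<And>p. cstar_algebra (fst p) \<Longrightarrow> nrm (fst p) (proj f p) \<le> K"
    using proj_bounded[of f] by blast
  show ?thesis unfolding scaleC_cprod_def
  proof (rule proj_mk[where K="cmod c * K", OF _ _ p])
    fix q :: "'a star_alg \<times> 'b" assume q: "cstar_algebra (fst q)"
    then interpret cstar_algebra "fst q" .
    show "c \<odot>\<^bsub>fst q\<^esub> proj f q \<in> carrier (fst q)" "nrm (fst q) (c \<odot>\<^bsub>fst q\<^esub> proj f q) \<le> cmod c * K"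
      using K[OF q] proj_closed[OF q] scale_closed by (auto simp: nrm_scale intro: mult_left_mono)
  qed
qed

lemma proj_adj: "proj (adj f) p = star (fst p) (proj f p)"
proof -
  obtain K where K: "\<And>p. cstar_algebra (fst p) \<Longrightarrow> nrm (fst p) (proj f p) \<le> K"
    using proj_bounded[of f] by blast
  show ?thesis unfolding adj_cprod_def
  proof (rule proj_mk[where K="K", OF _ _ p])
    fix q :: "'a star_alg \<times> 'b" assume q: "cstar_algebra (fst q)"
    then interpret cstar_algebra "fst q" .
    show "star (fst q) (proj f q) \<in> carrier (fst q)" "nrm (fst q) (star (fst q) (proj f q)) \<le> K"
      using K[OF q] proj_closed[OF q] star_closed by (auto simp: nrm_star)
  qed
qed

lemma proj_scaleR: "proj (r *\<^sub>R f) p = complex_of_real r \<odot>\<^bsub>fst p\<^esub> proj f p"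
  by (simp add: scaleR_cprod_def proj_scaleC)

lemma proj_minus: "proj (- f) p = \<ominus>\<^bsub>fst p\<^esub> proj f p"
  by (simp add: uminus_cprod_def proj_scaleC a_inv_eq_scale proj_closed p)

lemma proj_diff: "proj (f - g) p = proj f p \<ominus>\<^bsub>fst p\<^esub> proj g p"
  by (simp add: minus_cprod_def proj_add proj_minus a_minus_def)

lemma norm_proj: "nrm (fst p) (proj f p) \<le> norm f"
proof -
  obtain K where "\<And>p. cstar_algebra (fst p) \<Longrightarrow> nrm (fst p) (proj f p) \<le> K"
    using proj_bounded[of f] by blast
  then have "bdd_above (insert 0 {nrm (fst p) (proj f p) | p. cstar_algebra (fst p)})"
    by (auto intro!: bdd_aboveI[where M=K])
  then show ?thesis unfolding norm_cprod_def using p by (intro cSup_upper) blast+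
qed

end

lemma norm_cprod_le:
  fixes f :: "('a, 'b) cprod"
  assumes "0 \<le> K" "\<And>p. cstar_algebra (fst p) \<Longrightarrow> nrm (fst p) (proj f p) \<le> K"
  shows "norm f \<le> K"
  unfolding norm_cprod_def using assms by (intro cSup_least) auto

lemma norm_cprod_nonneg: "0 \<le> norm (f :: ('a, 'b) cprod)"
proof -
  obtain K where "\<And>p. cstar_algebra (fst p) \<Longrightarrow> nrm (fst p) (proj f p) \<le> K"
    using proj_bounded[of f] by blast
  then have "bdd_above (insert 0 {nrm (fst p) (proj f p) | p. cstar_algebra (fst p)})"
    by (auto intro!: bdd_aboveI[where M=K])
  then show ?thesis unfolding norm_cprod_def by (intro cSup_upper) auto
qed

lemmas proj_simps = proj_zero proj_add proj_mult proj_scaleC proj_adj proj_scaleR proj_minus proj_diff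

lemmas carrier_simps = cstar_algebra.mult_closed cstar_algebra.scale_closed cstar_algebra.star_closed
  cstar_algebra.zero_in cstar_algebra.sum_in cstar_algebra.neg_in

instance
proof
  fix f g h :: "('a, 'b) cprod" and c d :: complex and r s :: real
  note [simp] = proj_simps proj_closed carrier_simps
  show "f + g + h = f + (g + h)" by (rule cprod_eqI) (simp add: cstar_algebra.sum_assoc)
  show "f + g = g + f" by (rule cprod_eqI) (simp add: cstar_algebra.sum_comm)
  show "0 + f = f" by (rule cprod_eqI) (simp add: cstar_algebra.sum_zero_left)
  show "- f + f = 0" by (rule cprod_eqI) (simp add: cstar_algebra.sum_neg_left)
  show "f - g = f + - g" by (rule cprod_eqI) (simp add: cstar_algebra.diff_eq)
  show "f * g * h = f * (g * h)" by (rule cprod_eqI) (simp add: cstar_algebra.mult_assoc)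
  show "(f + g) * h = f * h + g * h" by (rule cprod_eqI) (simp add: cstar_algebra.distrib_right)
  show "f * (g + h) = f * g + f * h" by (rule cprod_eqI) (simp add: cstar_algebra.distrib_left)
  show "scaleC c (f + g) = scaleC c f + scaleC c g"
    "r *\<^sub>R (f + g) = r *\<^sub>R f + r *\<^sub>R g"
    by (rule cprod_eqI; simp add: cstar_algebra.scale_add_right)+
  show "scaleC (c + d) f = scaleC c f + scaleC d f" "(r + s) *\<^sub>R f = r *\<^sub>R f + s *\<^sub>R f"
    by (rule cprod_eqI; simp add: cstar_algebra.scale_add_left)+
  show "scaleC c (scaleC d f) = scaleC (c * d) f" "r *\<^sub>R s *\<^sub>R f = (r * s) *\<^sub>R f"
    by (rule cprod_eqI; simp add: cstar_algebra.scale_scale)+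
  show "scaleC (complex_of_real r) f = r *\<^sub>R f" by (rule cprod_eqI) simp
  show "1 *\<^sub>R f = f" by (rule cprod_eqI) (simp add: cstar_algebra.scale_one)
  show "scaleC c f * g = scaleC c (f * g)" "r *\<^sub>R f * g = r *\<^sub>R (f * g)"
    by (rule cprod_eqI; simp add: cstar_algebra.scale_mult_left)+
  show "f * scaleC c g = scaleC c (f * g)" "f * r *\<^sub>R g = r *\<^sub>R (f * g)"
    by (rule cprod_eqI; simp add: cstar_algebra.scale_mult_right)+
  show "adj (adj f) = f" by (rule cprod_eqI) (simp add: cstar_algebra.star_star)
  show "adj (f + g) = adj f + adj g" by (rule cprod_eqI) (simp add: cstar_algebra.star_add)
  show "adj (scaleC c f) = scaleC (cnj c) (adj f)" by (rule cprod_eqI) (simp add: cstar_algebra.star_scale)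
  show "adj (f * g) = adj g * adj f" by (rule cprod_eqI) (simp add: cstar_algebra.star_mult)
  show "norm (f * g) \<le> norm f * norm g"
  proof (rule norm_cprod_le)
    fix p :: "'a star_alg \<times> 'b" assume p: "cstar_algebra (fst p)"
    then have "nrm (fst p) (proj (f * g) p) \<le> nrm (fst p) (proj f p) * nrm (fst p) (proj g p)"
      by (simp add: cstar_algebra.nrm_mult)
    also have "\<dots> \<le> norm f * norm g"
      using p by (intro mult_mono norm_proj norm_cprod_nonneg cstar_algebra.nrm_nonneg) auto
    finally show "nrm (fst p) (proj (f * g) p) \<le> norm f * norm g" .
  qed (simp add: norm_cprod_nonneg)
  show "norm (f + g) \<le> norm f + norm g"
  proof (rule norm_cprod_le)
    fix p :: "'a star_alg \<times> 'b" assume p: "cstar_algebra (fst p)"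
    then have "nrm (fst p) (proj (f + g) p) \<le> nrm (fst p) (proj f p) + nrm (fst p) (proj g p)"
      by (simp add: cstar_algebra.nrm_triangle)
    also have "\<dots> \<le> norm f + norm g"
      using p by (intro add_mono norm_proj)
    finally show "nrm (fst p) (proj (f + g) p) \<le> norm f + norm g" .
  qed (simp add: norm_cprod_nonneg)
  \<comment> \<open>One inequality for all scalars suffices: equality follows by applying it to
    \<open>inverse c\<close>.\<close>
  have le: "norm (scaleC c f) \<le> cmod c * norm f" for c and f :: "('a, 'b) cprod"
    by (rule norm_cprod_le) (auto simp: norm_cprod_nonneg cstar_algebra.nrm_scale intro!: mult_left_mono norm_proj)
  have zero: "norm (0 :: ('a, 'b) cprod) = 0"
    by (rule antisym[OF norm_cprod_le norm_cprod_nonneg]) (auto simp: cstar_algebra.nrm_zero)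
  have norm_scaleC: "norm (scaleC c f) = cmod c * norm f" for c
  proof (cases "c = 0")
    case True
    have "scaleC 0 f = 0" by (rule cprod_eqI) (simp add: cstar_algebra.scale_zero_left)
    then show ?thesis using True zero by simp
  next
    case False
    have "scaleC (inverse c) (scaleC c f) = f"
      by (rule cprod_eqI) (simp add: False cstar_algebra.scale_one flip: cstar_algebra.scale_scale)
    then have "cmod c * norm f \<le> cmod c * (cmod (inverse c) * norm (scaleC c f))"
      using le[of "inverse c" "scaleC c f"] by (intro mult_left_mono) auto
    also have "\<dots> = norm (scaleC c f)" using False by (simp add: norm_inverse)
    finally show ?thesis using le[of c f] by simp
  qed
  then show "norm (scaleC c f) = cmod c * norm f" "norm (r *\<^sub>R f) = \<bar>r\<bar> * norm f"
    by (auto simp: scaleR_cprod_def)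
  show "norm f = 0 \<longleftrightarrow> f = 0"
  proof
    assume 0: "norm f = 0"
    show "f = 0"
    proof (rule cprod_eqI)
      fix p :: "'a star_alg \<times> 'b" assume p: "cstar_algebra (fst p)"
      have "nrm (fst p) (proj f p) = 0"
        using norm_proj[OF p, of f] 0 p by (auto simp: cstar_algebra.nrm_nonneg intro: antisym)
      then show "proj f p = proj 0 p" using p by (simp add: cstar_algebra.nrm_eq_zero)
    qed
  qed (simp add: zero)
  show "norm (adj f * f) = (norm f)\<^sup>2"
  proof (rule antisym)
    show "norm (adj f * f) \<le> (norm f)\<^sup>2"
    proof (rule norm_cprod_le)
      fix p :: "'a star_alg \<times> 'b" assume p: "cstar_algebra (fst p)"
      then show "nrm (fst p) (proj (adj f * f) p) \<le> (norm f)\<^sup>2"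
        by (simp add: cstar_algebra.nrm_star_mult cstar_algebra.nrm_nonneg power_mono norm_proj)
    qed simp
    have "norm f \<le> sqrt (norm (adj f * f))"
    proof (rule norm_cprod_le)
      fix p :: "'a star_alg \<times> 'b" assume p: "cstar_algebra (fst p)"
      have "(nrm (fst p) (proj f p))\<^sup>2 \<le> norm (adj f * f)"
        using norm_proj[OF p, of "adj f * f"] p by (simp add: cstar_algebra.nrm_star_mult)
      then show "nrm (fst p) (proj f p) \<le> sqrt (norm (adj f * f))"
        using real_le_rsqrt by blast
    qed (simp add: norm_cprod_nonneg)
    from power_mono[OF this norm_cprod_nonneg, of 2] show "(norm f)\<^sup>2 \<le> norm (adj f * f)"
      by (simp add: norm_cprod_nonneg)
  qed
qed (rule dist_cprod_def sgn_cprod_def uniformity_cprod_def open_cprod_def)+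

end

text \<open>Limits exist in each factor. The Cauchy estimate does not depend on the factor and
  passes to the limit, which shows both that the family of limits is bounded and that the
  convergence is uniform over the factors.\<close>

instance cprod :: (type, type) cstar_type
proof
  fix X :: "nat \<Rightarrow> ('a, 'b) cprod"
  note [simp] = proj_simps proj_closed carrier_simps
  assume "Cauchy X"
  then have C: "\<exists>N. \<forall>m\<ge>N. \<forall>n\<ge>N. norm (X m - X n) < e" if "e > 0" for e
    using that unfolding Cauchy_def dist_norm by blast
  have "\<exists>l\<in>carrier (fst p). (\<lambda>n. nrm (fst p) (proj (X n) p \<ominus>\<^bsub>fst p\<^esub> l)) \<longlonglongrightarrow> 0"
    if p: "cstar_algebra (fst p)" for p
  proof (rule cstar_algebra.complete[OF p], unfold cauchy_seqs_def, safe)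
    fix e :: real assume "e > 0"
    from C[OF this] obtain N where "\<forall>m\<ge>N. \<forall>n\<ge>N. norm (X m - X n) < e" ..
    moreover have "nrm (fst p) (proj (X m) p \<ominus>\<^bsub>fst p\<^esub> proj (X n) p) \<le> norm (X m - X n)" for m n
      using norm_proj[OF p, of "X m - X n"] p by simp
    ultimately show "\<exists>N. \<forall>m\<ge>N. \<forall>n\<ge>N. nrm (fst p) (proj (X m) p \<ominus>\<^bsub>fst p\<^esub> proj (X n) p) < e"
      by (meson le_less_trans)
  qed (use p in simp)
  then obtain l where l: "\<And>p. cstar_algebra (fst p) \<Longrightarrow> l p \<in> carrier (fst p)"
    and lim: "\<And>p. cstar_algebra (fst p) \<Longrightarrow> (\<lambda>n. nrm (fst p) (proj (X n) p \<ominus>\<^bsub>fst p\<^esub> l p)) \<longlonglongrightarrow> 0"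
    by metis
  have bound: "nrm (fst p) (proj (X m) p \<ominus>\<^bsub>fst p\<^esub> l p) \<le> e"
    if N: "\<forall>m\<ge>N. \<forall>n\<ge>N. norm (X m - X n) < e" and p: "cstar_algebra (fst p)" and m: "m \<ge> N" for e N m p
  proof (rule LIMSEQ_le_const2)
    interpret cstar_algebra "fst p" by (fact p)
    let ?d = "\<lambda>n. nrm (fst p) (proj (X n) p \<ominus>\<^bsub>fst p\<^esub> l p)"
    have "nrm (fst p) (proj (X m) p \<ominus>\<^bsub>fst p\<^esub> l p) - ?d n \<le> e" if "n \<ge> N" for n
    proof -
      have "proj (X m) p \<ominus>\<^bsub>fst p\<^esub> l p =
          (proj (X m) p \<ominus>\<^bsub>fst p\<^esub> proj (X n) p) \<oplus>\<^bsub>fst p\<^esub> (proj (X n) p \<ominus>\<^bsub>fst p\<^esub> l p)"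
        using l[OF p] p by (simp add: a_minus_def a_assoc r_neg1 r_neg2)
      then have "nrm (fst p) (proj (X m) p \<ominus>\<^bsub>fst p\<^esub> l p) \<le>
          nrm (fst p) (proj (X m) p \<ominus>\<^bsub>fst p\<^esub> proj (X n) p) + ?d n"
        using l[OF p] p by (simp add: nrm_triangle)
      moreover have "norm (X m - X n) < e" using N m that by blast
      then have "nrm (fst p) (proj (X m) p \<ominus>\<^bsub>fst p\<^esub> proj (X n) p) \<le> e"
        using norm_proj[OF p, of "X m - X n"] p by simp
      ultimately show ?thesis by simp
    qed
    then show "\<exists>N. \<forall>n\<ge>N. nrm (fst p) (proj (X m) p \<ominus>\<^bsub>fst p\<^esub> l p) - ?d n \<le> e" by blast
    show "(\<lambda>n. nrm (fst p) (proj (X m) p \<ominus>\<^bsub>fst p\<^esub> l p) - ?d n) \<longlonglongrightarrow>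
        nrm (fst p) (proj (X m) p \<ominus>\<^bsub>fst p\<^esub> l p)"
      using tendsto_diff[OF tendsto_const lim[OF p]] by simp
  qed
  obtain N0 where N0: "\<forall>m\<ge>N0. \<forall>n\<ge>N0. norm (X m - X n) < 1" using C[of 1] by auto
  have "nrm (fst p) (l p) \<le> norm (X N0) + 1" if p: "cstar_algebra (fst p)" for p
  proof -
    interpret cstar_algebra "fst p" by (fact p)
    have "l p = proj (X N0) p \<oplus>\<^bsub>fst p\<^esub> \<ominus>\<^bsub>fst p\<^esub> (proj (X N0) p \<ominus>\<^bsub>fst p\<^esub> l p)"
      using l[OF p] p by (simp add: a_minus_def minus_add r_neg1 r_neg2 a_assoc[symmetric] r_neg)
    then have "nrm (fst p) (l p) \<le> nrm (fst p) (proj (X N0) p) + nrm (fst p) (proj (X N0) p \<ominus>\<^bsub>fst p\<^esub> l p)"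
      using l[OF p] p nrm_triangle[of "proj (X N0) p" "\<ominus>\<^bsub>fst p\<^esub> (proj (X N0) p \<ominus>\<^bsub>fst p\<^esub> l p)"]
      by (simp add: nrm_minus)
    then show ?thesis using norm_proj[OF p, of "X N0"] bound[OF N0 p, of N0] by simp
  qed
  note mk = proj_mk[OF l this]
  have "X \<longlonglongrightarrow> mk_cprod l"
  proof (rule metric_LIMSEQ_I)
    fix e :: real assume "e > 0"
    then obtain N where N: "\<forall>m\<ge>N. \<forall>n\<ge>N. norm (X m - X n) < e / 2" using C[of "e/2"] by auto
    have "dist (X m) (mk_cprod l) < e" if "m \<ge> N" for m
    proof -
      have "norm (X m - mk_cprod l) \<le> e / 2"
        using \<open>e > 0\<close> bound[OF N _ that] by (intro norm_cprod_le) (auto simp: mk)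
      then show ?thesis using \<open>e > 0\<close> by (simp add: dist_norm)
    qed
    then show "\<exists>no. \<forall>n\<ge>no. dist (X n) (mk_cprod l) < e" by blast
  qed
  then show "convergent X" by (auto simp: convergent_def)
qed

section \<open>Subalgebras, *-homomorphisms and their contractivity\<close>

definition star_closed :: "'a::cstar_type set \<Rightarrow> bool" where
  "star_closed K \<longleftrightarrow> 0 \<in> K \<and> (\<forall>x\<in>K. \<forall>y\<in>K. x + y \<in> K \<and> x * y \<in> K) \<and>
     (\<forall>x\<in>K. adj x \<in> K \<and> (\<forall>c. scaleC c x \<in> K))"

lemma star_closedD:
  assumes "star_closed K"
  shows "0 \<in> K" "x \<in> K \<Longrightarrow> y \<in> K \<Longrightarrow> x + y \<in> K" "x \<in> K \<Longrightarrow> y \<in> K \<Longrightarrow> x * y \<in> K"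
    "x \<in> K \<Longrightarrow> adj x \<in> K" "x \<in> K \<Longrightarrow> scaleC c x \<in> K" "x \<in> K \<Longrightarrow> r *\<^sub>R x \<in> K"
    "x \<in> K \<Longrightarrow> - x \<in> K" "x \<in> K \<Longrightarrow> y \<in> K \<Longrightarrow> x - y \<in> K"
    "(\<And>i. i \<in> A \<Longrightarrow> f i \<in> K) \<Longrightarrow> sum f A \<in> K"
proof -
  show 1: "0 \<in> K" "x \<in> K \<Longrightarrow> y \<in> K \<Longrightarrow> x + y \<in> K" "x \<in> K \<Longrightarrow> y \<in> K \<Longrightarrow> x * y \<in> K"
    "x \<in> K \<Longrightarrow> adj x \<in> K" "x \<in> K \<Longrightarrow> scaleC c x \<in> K" for x y c
    using assms by (auto simp: star_closed_def)
  show "x \<in> K \<Longrightarrow> r *\<^sub>R x \<in> K"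
    using 1(5)[of x "of_real r"] by (simp add: scaleC_of_real)
  show 2: "x \<in> K \<Longrightarrow> - x \<in> K" for x
    using 1(5)[of x "-1"] by (simp add: scaleC_minus1)
  show "x \<in> K \<Longrightarrow> y \<in> K \<Longrightarrow> x - y \<in> K"
    using 1(2)[of x "-y"] 2[of y] by simp
  show "(\<And>i. i \<in> A \<Longrightarrow> f i \<in> K) \<Longrightarrow> sum f A \<in> K"
    by (induction A rule: infinite_finite_induct) (auto intro: 1)
qed

lemma star_closed_UNIV: "star_closed UNIV"
  by (simp add: star_closed_def)

lemma star_closed_closure:
  assumes "star_closed K"
  shows "star_closed (closure K)"
  unfolding star_closed_def
proof (intro conjI ballI allI)
  note K = star_closedD[OF assms]
  show "0 \<in> closure K" using K(1) closure_subset by blast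
  fix x assume x: "x \<in> closure K"
  then obtain f where f: "\<And>n. f n \<in> K" "f \<longlonglongrightarrow> x" by (auto simp: closure_sequential)
  show "adj x \<in> closure K" "scaleC c x \<in> closure K" for c
    unfolding closure_sequential
    using f K tendsto_adj[OF f(2)] tendsto_scaleC[OF f(2)]
    by (auto intro: exI[of _ "\<lambda>n. adj (f n)"] exI[of _ "\<lambda>n. scaleC c (f n)"])
  fix y assume y: "y \<in> closure K"
  then obtain g where g: "\<And>n. g n \<in> K" "g \<longlonglongrightarrow> y" by (auto simp: closure_sequential)
  show "x + y \<in> closure K" "x * y \<in> closure K"
    unfolding closure_sequential
    using f g K tendsto_add[OF f(2) g(2)] tendsto_mult[OF f(2) g(2)]
    by (auto intro: exI[of _ "\<lambda>n. f n + g n"] exI[of _ "\<lambda>n. f n * g n"])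
qed

definition star_hom_on :: "'a::cstar_type set \<Rightarrow> ('a \<Rightarrow> 'b::cstar_type) \<Rightarrow> bool" where
  "star_hom_on K \<psi> \<longleftrightarrow> (\<forall>x\<in>K. \<forall>y\<in>K. \<psi> (x + y) = \<psi> x + \<psi> y \<and> \<psi> (x * y) = \<psi> x * \<psi> y) \<and>
     (\<forall>x\<in>K. \<psi> (adj x) = adj (\<psi> x) \<and> (\<forall>c. \<psi> (scaleC c x) = scaleC c (\<psi> x)))"

lemma star_hom_onD:
  assumes "star_hom_on K \<psi>"
  shows "x \<in> K \<Longrightarrow> y \<in> K \<Longrightarrow> \<psi> (x + y) = \<psi> x + \<psi> y" "x \<in> K \<Longrightarrow> y \<in> K \<Longrightarrow> \<psi> (x * y) = \<psi> x * \<psi> y"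
    "x \<in> K \<Longrightarrow> \<psi> (adj x) = adj (\<psi> x)" "x \<in> K \<Longrightarrow> \<psi> (scaleC c x) = scaleC c (\<psi> x)"
    "x \<in> K \<Longrightarrow> \<psi> (r *\<^sub>R x) = r *\<^sub>R \<psi> x"
  using assms by (auto simp: star_hom_on_def simp flip: scaleC_of_real)

lemma star_hom_on_zero: "star_closed K \<Longrightarrow> star_hom_on K \<psi> \<Longrightarrow> \<psi> 0 = 0"
  using star_hom_onD(1)[of K \<psi> 0 0] star_closedD(1)[of K] by simp

lemma star_hom_on_diff:
  assumes "star_closed K" "star_hom_on K \<psi>" "x \<in> K" "y \<in> K"
  shows "\<psi> (x - y) = \<psi> x - \<psi> y"
  using star_hom_onD(1)[OF assms(2), of "x - y" y] assms(3,4) star_closedD(8)[OF assms(1)] by simp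

lemma star_hom_on_sum:
  assumes K: "star_closed K" "star_hom_on K \<psi>" and f: "\<And>i. i \<in> A \<Longrightarrow> f i \<in> K"
  shows "\<psi> (sum f A) = (\<Sum>i\<in>A. \<psi> (f i))"
  using f
  by (induction A rule: infinite_finite_induct)
    (auto simp: star_hom_on_zero[OF K] star_hom_onD[OF K(2)] star_closedD[OF K(1)])

text \<open>
  The iteration \<open>g \<mapsto> (h + g\<^sup>2) / 2\<close> computes \<open>1 - \<surd>(1 - h)\<close> without using a unit. It is dominated by
  the same iteration for the number \<open>h = 1\<close>.
\<close>

lemma quasi_sqrt:
  fixes h :: "'a::cstar_type"
  assumes h: "norm h \<le> 1"
  obtains g where "2 *\<^sub>R g - g * g = h"
    and "\<And>S. closed S \<Longrightarrow> 0 \<in> S \<Longrightarrow> (\<And>z. z \<in> S \<Longrightarrow> (1/2) *\<^sub>R (h + z * z) \<in> S) \<Longrightarrow> g \<in> S"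
proof -
  define G where "G = rec_nat 0 (\<lambda>_ z. (1/2) *\<^sub>R (h + z * z))"
  \<comment> \<open>This scalar sequence increases and stays below 1, so it is Cauchy; its
    increments will bound those of \<open>G\<close>.\<close>
  define c where "c = rec_nat 0 (\<lambda>_ z. (1 + z * z) / 2 :: real)"
  have [simp]: "G 0 = 0" "G (Suc n) = (1/2) *\<^sub>R (h + G n * G n)"
    "c 0 = 0" "c (Suc n) = (1 + c n * c n) / 2" for n by (simp_all add: G_def c_def)
  have comm1: "G n * b = b * G n" if "h * b = b * h" for n b
  proof (induction n)
    case (Suc n)
    have "G n * G n * b = b * (G n * G n)" by (metis Suc mult.assoc)
    then show ?case using that by (simp add: algebra_simps)
  qed simp
  have comm: "G m * G n = G n * G m" for m n
    by (rule comm1) (simp add: comm1)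
  have c01: "0 \<le> c n \<and> c n \<le> 1" for n
  proof (induction n)
    case (Suc n)
    then show ?case using mult_mono[of "c n" 1 "c n" 1] by auto
  qed simp
  have nG: "norm (G n) \<le> c n" for n
  proof (induction n)
    case (Suc n)
    have "norm (G n * G n) \<le> c n * c n"
      using norm_mult_ineq[of "G n" "G n"] mult_mono[OF Suc Suc] c01[of n] by simp
    then show ?case using norm_triangle_ineq[of h "G n * G n"] h by simp
  qed simp
  have step: "norm (G (Suc n) - G n) \<le> c (Suc n) - c n" for n
  proof (induction n)
    case (Suc n)
    \<comment> \<open>The iterates commute, so the difference of their squares factors as for
      numbers.\<close>
    have "G (Suc (Suc n)) - G (Suc n) = (1/2) *\<^sub>R ((G (Suc n) - G n) * (G (Suc n) + G n))"
      using comm[of n "Suc n"] by (simp add: algebra_simps del: scaleR_half_double)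
    moreover have "norm ((G (Suc n) - G n) * (G (Suc n) + G n)) \<le> (c (Suc n) - c n) * (c (Suc n) + c n)"
    proof (rule order_trans[OF norm_mult_ineq mult_mono[OF Suc]])
      show "norm (G (Suc n) + G n) \<le> c (Suc n) + c n"
        by (rule order_trans[OF norm_triangle_ineq add_mono[OF nG nG]])
      show "0 \<le> c (Suc n) - c n" using order_trans[OF norm_ge_zero Suc] .
    qed simp
    ultimately have "norm (G (Suc (Suc n)) - G (Suc n)) \<le> (c (Suc n) - c n) * (c (Suc n) + c n) / 2"
      by (simp only: norm_scaleR)
    also have "\<dots> = c (Suc (Suc n)) - c (Suc n)" by (simp add: field_simps)
    finally show ?case .
  qed (use h in simp)
  have dist: "norm (G (n + k) - G n) \<le> c (n + k) - c n" for n k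
  proof (induction k)
    case (Suc k)
    have "norm (G (n + Suc k) - G n) \<le> norm (G (Suc (n + k)) - G (n + k)) + norm (G (n + k) - G n)"
      using norm_triangle_ineq[of "G (Suc (n + k)) - G (n + k)" "G (n + k) - G n"] by simp
    then show ?case using step[of "n + k"] Suc by simp
  qed simp
  have "incseq c"
    using order_trans[OF norm_ge_zero step] by (intro incseq_SucI) (simp add: field_simps)
  then obtain l where "c \<longlonglongrightarrow> l"
    using incseq_convergent[of c 1] c01 by blast
  then have "Cauchy c" by (rule LIMSEQ_imp_Cauchy)
  have "Cauchy G"
  proof (rule metric_CauchyI)
    fix e :: real assume "e > 0"
    then obtain M where M: "\<And>m n. m \<ge> M \<Longrightarrow> n \<ge> M \<Longrightarrow> dist (c m) (c n) < e"
      using \<open>Cauchy c\<close> unfolding Cauchy_def by metis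
    have le: "dist (G n) (G m) \<le> dist (c n) (c m)" if "m \<le> n" for m n
    proof -
      obtain k where "n = m + k" using \<open>m \<le> n\<close> le_Suc_ex by blast
      then show ?thesis
        using dist[of m k] by (simp add: dist_norm)
    qed
    have "dist (G m) (G n) < e" if "m \<ge> M" "n \<ge> M" for m n
      using le[of m n] le[of n m] M[OF that] by (cases "m \<le> n") (auto simp: dist_commute)
    then show "\<exists>M. \<forall>m\<ge>M. \<forall>n\<ge>M. dist (G m) (G n) < e" by blast
  qed
  then obtain g where g: "G \<longlonglongrightarrow> g" using Cauchy_convergent convergent_def by blast
  have "(\<lambda>n. (1/2) *\<^sub>R (h + G n * G n)) \<longlonglongrightarrow> (1/2) *\<^sub>R (h + g * g)"
    by (intro tendsto_intros g)
  moreover have "(\<lambda>n. G (Suc n)) \<longlonglongrightarrow> g" using LIMSEQ_Suc[OF g] .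
  ultimately have eq: "g = (1/2) *\<^sub>R (h + g * g)" using LIMSEQ_unique by simp blast
  have "2 *\<^sub>R g - g * g = h" by (subst (1) eq) simp
  \<comment> \<open>A closed set containing 0 and stable under the iteration contains all iterates
    and hence the limit. This is the way in which all further properties of the root are
    obtained.\<close>
  moreover have "g \<in> S"
    if "closed S" "0 \<in> S" "\<And>z. z \<in> S \<Longrightarrow> (1/2) *\<^sub>R (h + z * z) \<in> S" for S
  proof (rule closed_sequentially[OF \<open>closed S\<close> _ g])
    show "G n \<in> S" for n using that by (induction n) auto
  qed
  ultimately show thesis using that by blast
qed

lemma closed_commutant: "closed {z :: 'a::cstar_type. z * b = b * z}"
  by (intro closed_Collect_eq continuous_intros)

lemma closed_selfadj: "closed {z :: 'a::cstar_type. adj z = z}"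
  by (intro closed_Collect_eq continuous_intros)

text \<open>In the notation of a unital algebra, g is 1 - sqrt (1 - h), an element that makes sense
  without a unit. The clauses after the equation replace the continuous functional calculus.\<close>

definition quasi_root :: "'a::cstar_type \<Rightarrow> 'a \<Rightarrow> bool" where
  "quasi_root h g \<longleftrightarrow> 2 *\<^sub>R g - g * g = h \<and> adj g = g \<and> norm g \<le> 1 \<and>
     (\<forall>b. h * b = b * h \<longrightarrow> g * b = b * g) \<and>
     (\<forall>K. closed K \<and> star_closed K \<and> h \<in> K \<longrightarrow> g \<in> K)"

lemma quasi_rootD:
  assumes "quasi_root h g"
  shows "2 *\<^sub>R g - g * g = h" "adj g = g" "norm g \<le> 1" "h * b = b * h \<Longrightarrow> g * b = b * g"
    "closed K \<Longrightarrow> star_closed K \<Longrightarrow> h \<in> K \<Longrightarrow> g \<in> K"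
proof -
  note * = assms[unfolded quasi_root_def]
  from * show "2 *\<^sub>R g - g * g = h" by (elim conjE)
  from * show "adj g = g" by (elim conjE)
  from * show "norm g \<le> 1" by (elim conjE)
  from * have "\<forall>b. h * b = b * h \<longrightarrow> g * b = b * g" by (elim conjE)
  then show "h * b = b * h \<Longrightarrow> g * b = b * g" by (elim allE impE)
  from * have "\<forall>K. closed K \<and> star_closed K \<and> h \<in> K \<longrightarrow> g \<in> K" by (elim conjE)
  then show "closed K \<Longrightarrow> star_closed K \<Longrightarrow> h \<in> K \<Longrightarrow> g \<in> K" by (elim allE impE) (intro conjI)
qed

text \<open>Each clause other than the equation places g in a closed set that contains 0 and is
  stable under the iteration of \<open>quasi_sqrt\<close>.\<close>

lemma quasi_root_exists:
  fixes h :: "'a::cstar_type"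
  assumes h: "norm h \<le> 1" "adj h = h"
  shows "\<exists>g. quasi_root h g"
proof -
  obtain g where 1: "2 *\<^sub>R g - g * g = h"
    and S: "\<And>S. closed S \<Longrightarrow> 0 \<in> S \<Longrightarrow> (\<And>z. z \<in> S \<Longrightarrow> (1/2) *\<^sub>R (h + z * z) \<in> S) \<Longrightarrow> g \<in> S"
    using quasi_sqrt[OF h(1)] by blast
  show ?thesis unfolding quasi_root_def
  proof (intro exI[of _ g] conjI allI impI 1)
    have "g \<in> {z. adj z = z}"
      by (rule S[OF closed_selfadj]) (auto simp: adj_zero adj_scaleR adj_add adj_mult h)
    then show "adj g = g" by simp
    have "g \<in> {z. z * b = b * z}" if b: "h * b = b * h" for b
    proof (rule S[OF closed_commutant])
      fix z assume "z \<in> {z. z * b = b * z}"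
      then have zb: "z * b = b * z" by simp
      have "z * z * b = b * (z * z)" by (metis zb mult.assoc)
      then have "(h + z * z) * b = b * (h + z * z)" by (simp only: distrib_left distrib_right b)
      then show "(1/2) *\<^sub>R (h + z * z) \<in> {z. z * b = b * z}" by simp
    qed simp
    then show "g * b = b * g" if "h * b = b * h" for b using that by blast
    have "g \<in> cball 0 1"
    proof (rule S[OF closed_cball])
      fix z :: 'a assume "z \<in> cball 0 1"
      then have z: "norm z \<le> 1" by simp
      then have "norm (h + z * z) \<le> 2"
        using norm_triangle_ineq[of h "z * z"] norm_mult_ineq[of z z] mult_mono[OF z z] h by simp
      then show "(1/2) *\<^sub>R (h + z * z) \<in> cball 0 1" by simp
    qed simp
    then show "norm g \<le> 1" by simp
    show "g \<in> K" if "closed K \<and> star_closed K \<and> h \<in> K" for K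
      using that by (intro S star_closedD(1,2,3,6)[of K]) auto
  qed
qed

text \<open>
  If \<open>h\<close> is self-adjoint of norm at most 1, then \<open>h + \<i> \<surd>(1 - h\<^sup>2)\<close> is unitary, and the same holds for the
  image of \<open>h\<close>, which therefore has norm at most 1.
\<close>

lemma star_hom_contractive:
  fixes \<psi> :: "'a::cstar_type \<Rightarrow> 'b::cstar_type"
  assumes K: "closed K" "star_closed K" and \<psi>: "star_hom_on K \<psi>" and x: "x \<in> K"
  shows "norm (\<psi> x) \<le> norm x"
proof -
  note cl = star_closedD[OF K(2)] and hom = star_hom_onD[OF \<psi>]
  have selfadj: "norm (\<psi> h) \<le> 1" if h: "h \<in> K" "adj h = h" "norm h \<le> 1" for h
  proof -
    have "norm (h * h) \<le> 1"
      using h(3) mult_mono[OF h(3) h(3)] norm_mult_ineq[of h h] by simp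
    moreover have "adj (h * h) = h * h" by (simp add: adj_mult h)
    ultimately obtain g where "quasi_root (h * h) g" using quasi_root_exists by blast
    note g = quasi_rootD[OF this]
    have gK: "g \<in> K" using g(5) K cl h by blast
    define k where "k = \<psi> h"
    define f where "f = \<psi> g"
    have fk: "f * k = k * f" unfolding f_def k_def using g(4)[of h] gK h hom(2) by (metis mult.assoc)
    have "2 *\<^sub>R f - f * f = k * k" unfolding f_def k_def
      using g(1) gK h(1) by (metis hom(2,5) star_hom_on_diff[OF K(2) \<psi>] cl(3,6))
    then have ff: "f * f = 2 *\<^sub>R f - k * k" by (simp add: algebra_simps)
    have adj[simp]: "adj f = f" "adj k = k"
      unfolding f_def k_def using hom(3) gK h g by metis+
    \<comment> \<open>With f = 1 - sqrt (1 - k k), this is multiplication of b by the unitary k + e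
      sqrt (1 - k k). Letting it act on b avoids the unit, which may be missing.\<close>
    have nrm: "norm (k * b + scaleC e (b - f * b)) = norm b" if e: "e = \<i> \<or> e = - \<i>" for b e
    proof -
      have "adj (k * b + scaleC e (b - f * b)) * (k * b + scaleC e (b - f * b)) =
         adj b * (k * k) * b + adj b * b - 2 *\<^sub>R (adj b * f * b) + adj b * (f * f) * b
         + scaleC e (adj b * (f * k - k * f) * b)"
        using e by (auto simp: adj_add adj_mult adj_scaleC adj_diff algebra_simps scaleC_add_right
           scaleC_diff_right scaleC_mult_left scaleC_mult_right scaleC_scaleC scaleC_minus1 scaleC_one
           scaleC_minus_left scaleR_2)
      also have "\<dots> = adj b * b"
        by (simp add: fk ff algebra_simps scaleC_zero_right)
      finally have "(norm (k * b + scaleC e (b - f * b)))\<^sup>2 = (norm b)\<^sup>2"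
        by (metis norm_adj_mult)
      then show ?thesis by (simp add: power2_eq_iff_nonneg)
    qed
    \<comment> \<open>The two conjugate unitaries add up to 2 k; both are applied to k
      itself.\<close>
    have "norm (2 *\<^sub>R (k * k)) = norm ((k * k + scaleC \<i> (k - f * k)) + (k * k + scaleC (-\<i>) (k - f * k)))"
      by (simp add: scaleC_minus_left scaleR_2)
    also have "\<dots> \<le> norm k + norm k" using norm_triangle_ineq nrm by metis
    finally have "norm (k * k) \<le> norm k" by simp
    then have "norm k * norm k \<le> norm k * 1" using norm_adj_mult[of k] by (simp add: power2_eq_square)
    then show ?thesis unfolding k_def[symmetric] using mult_le_cancel_left_pos[of "norm k" "norm k" 1]
      by (cases "norm k = 0") auto
  qed
  show ?thesis
  proof (cases "x = 0")
    case True then show ?thesis using star_hom_on_zero[OF K(2) \<psi>] by simp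
  next
    case False
    define r where "r = inverse ((norm x)\<^sup>2)"
    have r: "r > 0" using False by (simp add: r_def)
    \<comment> \<open>The C*-identity reduces a general x to the self-adjoint
      \<open>adj x * x\<close>, scaled to norm 1.\<close>
    have "norm (\<psi> (r *\<^sub>R (adj x * x))) \<le> 1"
      using x r False by (intro selfadj) (auto intro!: cl simp: adj_scaleR adj_mult adj_adj norm_adj_mult r_def)
    then have "r * (norm (\<psi> x))\<^sup>2 \<le> 1"
      using x r by (simp add: hom cl norm_adj_mult)
    then have "(norm (\<psi> x))\<^sup>2 \<le> (norm x)\<^sup>2" using False by (simp add: r_def field_simps)
    then show ?thesis by (simp add: power2_le_iff_abs_le)
  qed
qed

subsection \<open>Representing carrier-based algebras in the type class\<close>

text \<open>Closure of the carrier is included, because A is not assumed to be an algebra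
  beforehand: its laws are later reflected from the target along an injective h.\<close>

definition star_rep :: "'b star_alg \<Rightarrow> ('b \<Rightarrow> 'a::cstar_type) \<Rightarrow> bool" where
  "star_rep A h \<longleftrightarrow> \<zero>\<^bsub>A\<^esub> \<in> carrier A \<and> h \<zero>\<^bsub>A\<^esub> = 0 \<and>
     (\<forall>x\<in>carrier A. \<forall>y\<in>carrier A. x \<oplus>\<^bsub>A\<^esub> y \<in> carrier A \<and> h (x \<oplus>\<^bsub>A\<^esub> y) = h x + h y \<and>
        x \<otimes>\<^bsub>A\<^esub> y \<in> carrier A \<and> h (x \<otimes>\<^bsub>A\<^esub> y) = h x * h y) \<and>
     (\<forall>x\<in>carrier A. star A x \<in> carrier A \<and> h (star A x) = adj (h x) \<and>
        (\<forall>c. c \<odot>\<^bsub>A\<^esub> x \<in> carrier A \<and> h (c \<odot>\<^bsub>A\<^esub> x) = scaleC c (h x)))"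

definition isometric_rep :: "'b star_alg \<Rightarrow> ('b \<Rightarrow> 'a::cstar_type) \<Rightarrow> bool" where
  "isometric_rep A h \<longleftrightarrow> star_rep A h \<and> (\<forall>x\<in>carrier A. nrm A x = norm (h x))"

definition faithful_rep :: "'b star_alg \<Rightarrow> ('b \<Rightarrow> 'a::cstar_type) \<Rightarrow> bool" where
  "faithful_rep A h \<longleftrightarrow> isometric_rep A h \<and> inj_on h (carrier A)"

lemma star_repD:
  assumes "star_rep A h"
  shows "\<zero>\<^bsub>A\<^esub> \<in> carrier A" "h \<zero>\<^bsub>A\<^esub> = 0"
    "x \<in> carrier A \<Longrightarrow> y \<in> carrier A \<Longrightarrow> x \<oplus>\<^bsub>A\<^esub> y \<in> carrier A"
    "x \<in> carrier A \<Longrightarrow> y \<in> carrier A \<Longrightarrow> h (x \<oplus>\<^bsub>A\<^esub> y) = h x + h y"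
    "x \<in> carrier A \<Longrightarrow> y \<in> carrier A \<Longrightarrow> x \<otimes>\<^bsub>A\<^esub> y \<in> carrier A"
    "x \<in> carrier A \<Longrightarrow> y \<in> carrier A \<Longrightarrow> h (x \<otimes>\<^bsub>A\<^esub> y) = h x * h y"
    "x \<in> carrier A \<Longrightarrow> star A x \<in> carrier A" "x \<in> carrier A \<Longrightarrow> h (star A x) = adj (h x)"
    "x \<in> carrier A \<Longrightarrow> c \<odot>\<^bsub>A\<^esub> x \<in> carrier A" "x \<in> carrier A \<Longrightarrow> h (c \<odot>\<^bsub>A\<^esub> x) = scaleC c (h x)"
  using assms by (auto simp: star_rep_def)

lemma faithful_repD:
  assumes "faithful_rep A h"
  shows "star_rep A h" "inj_on h (carrier A)" "x \<in> carrier A \<Longrightarrow> nrm A x = norm (h x)"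
  using assms by (auto simp: faithful_rep_def isometric_rep_def)

lemma star_closed_image:
  assumes h: "star_rep A h"
  shows "star_closed (h ` carrier A)"
  unfolding star_closed_def
proof (intro conjI ballI allI)
  note D = star_repD[OF h]
  show "0 \<in> h ` carrier A" using D(1,2) by force
  fix u assume "u \<in> h ` carrier A"
  then obtain x where x: "x \<in> carrier A" "u = h x" by auto
  show "adj u \<in> h ` carrier A" using x D(7,8)[of x] by force
  show "scaleC c u \<in> h ` carrier A" for c using x D(9,10)[of x c] by force
  fix v assume "v \<in> h ` carrier A"
  then obtain y where y: "y \<in> carrier A" "v = h y" by auto
  show "u + v \<in> h ` carrier A" using x y D(3,4)[of x y] by force
  show "u * v \<in> h ` carrier A" using x y D(5,6)[of x y] by force
qed

lemma abelian_group_of_rep: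
  assumes h: "star_rep A h" and inj: "inj_on h (carrier A)"
  shows "abelian_group A"
proof (rule abelian_groupI)
  note D = star_repD[OF h]
  note eqI = inj_onD[OF inj]
  show "\<zero>\<^bsub>A\<^esub> \<in> carrier A" by (rule D)
  fix x assume x: "x \<in> carrier A"
  show "\<zero>\<^bsub>A\<^esub> \<oplus>\<^bsub>A\<^esub> x = x" by (rule eqI) (simp_all add: D x)
  show "\<exists>y\<in>carrier A. y \<oplus>\<^bsub>A\<^esub> x = \<zero>\<^bsub>A\<^esub>"
    by (intro bexI[of _ "(-1) \<odot>\<^bsub>A\<^esub> x"] eqI) (simp_all add: D x scaleC_minus1)
  fix y assume y: "y \<in> carrier A"
  show "x \<oplus>\<^bsub>A\<^esub> y \<in> carrier A" using x y by (rule D)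
  show "x \<oplus>\<^bsub>A\<^esub> y = y \<oplus>\<^bsub>A\<^esub> x" by (rule eqI) (simp_all add: D x y add.commute)
  fix z assume z: "z \<in> carrier A"
  show "x \<oplus>\<^bsub>A\<^esub> y \<oplus>\<^bsub>A\<^esub> z = x \<oplus>\<^bsub>A\<^esub> (y \<oplus>\<^bsub>A\<^esub> z)" by (rule eqI) (simp_all add: D x y z add.assoc)
qed

lemma rep_diff:
  assumes "abelian_group A" "star_rep A h" "x \<in> carrier A" "y \<in> carrier A"
  shows "x \<ominus>\<^bsub>A\<^esub> y \<in> carrier A" "h (x \<ominus>\<^bsub>A\<^esub> y) = h x - h y"
proof -
  interpret abelian_group A by fact
  show 1: "x \<ominus>\<^bsub>A\<^esub> y \<in> carrier A" using assms by simp
  have "(x \<ominus>\<^bsub>A\<^esub> y) \<oplus>\<^bsub>A\<^esub> y = x" using assms by (simp add: a_minus_def a_assoc l_neg)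
  then show "h (x \<ominus>\<^bsub>A\<^esub> y) = h x - h y"
    using star_repD(4)[OF assms(2) 1 assms(4)] by simp
qed

text \<open>The axioms are identities and inequalities valid in the target, and an injective
  isometry reflects them. Closedness of the image transfers the completeness of the target to
  A.\<close>

lemma cstar_algebra_of_rep:
  assumes faithful: "faithful_rep A h" and closed: "closed (h ` carrier A)"
  shows "cstar_algebra A"
proof -
  note D = star_repD[OF faithful_repD(1)[OF faithful]] and inj = faithful_repD(2)[OF faithful]
    and nrm = faithful_repD(3)[OF faithful]
  have grp: "abelian_group A" using faithful by (intro abelian_group_of_rep faithful_repD)
  note diff = rep_diff[OF grp faithful_repD(1)[OF faithful]]
  show ?thesis
  proof (intro cstar_algebra.intro cstar_algebra_axioms.intro grp)
    fix f assume f: "f \<in> cauchy_seqs A"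
    then have fc: "f n \<in> carrier A" for n by (auto simp: cauchy_seqs_def)
    have "Cauchy (\<lambda>n. h (f n))"
      using f fc by (auto simp: cauchy_seqs_def Cauchy_def dist_norm nrm diff)
    then obtain l where l: "(\<lambda>n. h (f n)) \<longlonglongrightarrow> l" using Cauchy_convergent convergent_def by blast
    then have "l \<in> h ` carrier A" using fc by (intro closed_sequentially[OF closed _ l]) auto
    then obtain y where y: "y \<in> carrier A" "l = h y" by auto
    have "(\<lambda>n. norm (h (f n) - l)) \<longlonglongrightarrow> 0" using l by (simp add: LIM_zero tendsto_norm_zero)
    then show "\<exists>l\<in>carrier A. (\<lambda>n. nrm A (f n \<ominus>\<^bsub>A\<^esub> l)) \<longlonglongrightarrow> 0"
      using y fc by (intro bexI[of _ y]) (auto simp: nrm diff)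
  next
    fix x assume x: "x \<in> carrier A"
    show "nrm A x = 0 \<longleftrightarrow> x = \<zero>\<^bsub>A\<^esub>" using x D(1,2) inj_onD[OF inj, of x "\<zero>\<^bsub>A\<^esub>"] by (auto simp: nrm)
  next
    note eqI = inj_onD[OF inj]
    fix x y z c d assume x: "x \<in> carrier A" and y: "y \<in> carrier A" and z: "z \<in> carrier A"
    note [simp] = D nrm x y z
    show "x \<otimes>\<^bsub>A\<^esub> y \<otimes>\<^bsub>A\<^esub> z = x \<otimes>\<^bsub>A\<^esub> (y \<otimes>\<^bsub>A\<^esub> z)" by (rule eqI) (simp_all add: mult.assoc)
    show "(x \<oplus>\<^bsub>A\<^esub> y) \<otimes>\<^bsub>A\<^esub> z = x \<otimes>\<^bsub>A\<^esub> z \<oplus>\<^bsub>A\<^esub> y \<otimes>\<^bsub>A\<^esub> z" by (rule eqI) (simp_all add: distrib_right)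
    show "z \<otimes>\<^bsub>A\<^esub> (x \<oplus>\<^bsub>A\<^esub> y) = z \<otimes>\<^bsub>A\<^esub> x \<oplus>\<^bsub>A\<^esub> z \<otimes>\<^bsub>A\<^esub> y" by (rule eqI) (simp_all add: distrib_left)
    show "(c + d) \<odot>\<^bsub>A\<^esub> x = c \<odot>\<^bsub>A\<^esub> x \<oplus>\<^bsub>A\<^esub> d \<odot>\<^bsub>A\<^esub> x" by (rule eqI) (simp_all add: scaleC_add_left)
    show "c \<odot>\<^bsub>A\<^esub> (x \<oplus>\<^bsub>A\<^esub> y) = c \<odot>\<^bsub>A\<^esub> x \<oplus>\<^bsub>A\<^esub> c \<odot>\<^bsub>A\<^esub> y" by (rule eqI) (simp_all add: scaleC_add_right)
    show "(c * d) \<odot>\<^bsub>A\<^esub> x = c \<odot>\<^bsub>A\<^esub> (d \<odot>\<^bsub>A\<^esub> x)" by (rule eqI) (simp_all add: scaleC_scaleC)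
    show "1 \<odot>\<^bsub>A\<^esub> x = x" by (rule eqI) (simp_all add: scaleC_one)
    show "(c \<odot>\<^bsub>A\<^esub> x) \<otimes>\<^bsub>A\<^esub> y = c \<odot>\<^bsub>A\<^esub> (x \<otimes>\<^bsub>A\<^esub> y)" by (rule eqI) (simp_all add: scaleC_mult_left)
    show "x \<otimes>\<^bsub>A\<^esub> (c \<odot>\<^bsub>A\<^esub> y) = c \<odot>\<^bsub>A\<^esub> (x \<otimes>\<^bsub>A\<^esub> y)" by (rule eqI) (simp_all add: scaleC_mult_right)
    show "star A (star A x) = x" by (rule eqI) (simp_all add: adj_adj)
    show "star A (x \<oplus>\<^bsub>A\<^esub> y) = star A x \<oplus>\<^bsub>A\<^esub> star A y" by (rule eqI) (simp_all add: adj_add)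
    show "star A (c \<odot>\<^bsub>A\<^esub> x) = cnj c \<odot>\<^bsub>A\<^esub> star A x" by (rule eqI) (simp_all add: adj_scaleC)
    show "star A (x \<otimes>\<^bsub>A\<^esub> y) = star A y \<otimes>\<^bsub>A\<^esub> star A x" by (rule eqI) (simp_all add: adj_mult)
  qed (simp_all add: D nrm norm_scaleC norm_triangle_ineq norm_mult_ineq norm_adj_mult)
qed

text \<open>The inclusion of A as a direct summand of the product of all C*-algebras on its type.
  The second index type is \<open>unit\<close>, as one factor for each algebra is enough
  here.\<close>

definition emb :: "'a star_alg \<Rightarrow> 'a \<Rightarrow> ('a, unit) cprod" where
  "emb A x = mk_cprod (\<lambda>p. if fst p = A then x else \<zero>\<^bsub>fst p\<^esub>)"

context cstar_algebra
begin

lemma proj_emb: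
  assumes x: "x \<in> carrier A" and p: "cstar_algebra (fst p)"
  shows "proj (emb A x) p = (if fst p = A then x else \<zero>\<^bsub>fst p\<^esub>)"
  unfolding emb_def
  by (rule proj_mk[where K="nrm A x", OF _ _ p])
    (use x nrm_nonneg[OF x] in \<open>auto simp: cstar_algebra.zero_in cstar_algebra.nrm_zero\<close>)

lemma proj_emb_self: "x \<in> carrier A \<Longrightarrow> proj (emb A x) (A, ()) = x"
  using proj_emb[of x "(A, ())"] cstar_algebra_axioms by simp

lemma faithful_emb: "faithful_rep A (emb A)"
  unfolding faithful_rep_def isometric_rep_def star_rep_def
proof (intro conjI ballI allI)
  show "inj_on (emb A) (carrier A)"
    by (intro inj_onI) (metis proj_emb_self)
  note [simp] = proj_emb proj_simps mult_closed scale_closed star_closed cstar_algebra.zero_in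
    cstar_algebra.sum_zero_left
  have [simp]: "\<zero>\<^bsub>B\<^esub> \<otimes>\<^bsub>B\<^esub> \<zero>\<^bsub>B\<^esub> = \<zero>\<^bsub>B\<^esub>" "c \<odot>\<^bsub>B\<^esub> \<zero>\<^bsub>B\<^esub> = \<zero>\<^bsub>B\<^esub>" "star B \<zero>\<^bsub>B\<^esub> = \<zero>\<^bsub>B\<^esub>"
    if B: "cstar_algebra B" for c and B :: "'a star_alg"
  proof -
    interpret B: cstar_algebra B by fact
    show "\<zero>\<^bsub>B\<^esub> \<otimes>\<^bsub>B\<^esub> \<zero>\<^bsub>B\<^esub> = \<zero>\<^bsub>B\<^esub>" "c \<odot>\<^bsub>B\<^esub> \<zero>\<^bsub>B\<^esub> = \<zero>\<^bsub>B\<^esub>" "star B \<zero>\<^bsub>B\<^esub> = \<zero>\<^bsub>B\<^esub>"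
      using B.nrm_mult[of "\<zero>\<^bsub>B\<^esub>" "\<zero>\<^bsub>B\<^esub>"] B.nrm_scale[of "\<zero>\<^bsub>B\<^esub>" c] B.nrm_star[of "\<zero>\<^bsub>B\<^esub>"] B.mult_closed[of "\<zero>\<^bsub>B\<^esub>" "\<zero>\<^bsub>B\<^esub>"]
        B.scale_closed[of "\<zero>\<^bsub>B\<^esub>" c] B.star_closed[of "\<zero>\<^bsub>B\<^esub>"] B.nrm_nonneg[OF B.mult_closed[of "\<zero>\<^bsub>B\<^esub>" "\<zero>\<^bsub>B\<^esub>"]]
        B.nrm_eq_zero[OF B.mult_closed[of "\<zero>\<^bsub>B\<^esub>" "\<zero>\<^bsub>B\<^esub>"]] B.nrm_eq_zero[OF B.scale_closed[of "\<zero>\<^bsub>B\<^esub>" c]]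
        B.nrm_eq_zero[OF B.star_closed[of "\<zero>\<^bsub>B\<^esub>"]]
      by (simp_all add: B.nrm_zero)
  qed
  show "\<zero> \<in> carrier A" by simp
  show "emb A \<zero> = 0" by (rule cprod_eqI) simp
  fix x assume x: "x \<in> carrier A"
  show "star A x \<in> carrier A" using x by simp
  show "emb A (star A x) = adj (emb A x)" by (rule cprod_eqI) (simp add: x)
  show "c \<odot> x \<in> carrier A" for c using x by simp
  show "emb A (c \<odot> x) = scaleC c (emb A x)" for c by (rule cprod_eqI) (simp add: x)
  show "nrm A x = norm (emb A x)"
  proof (rule antisym)
    show "nrm A x \<le> norm (emb A x)"
      using norm_proj[of "(A, ())" "emb A x"] x cstar_algebra_axioms by simp
    show "norm (emb A x) \<le> nrm A x"
      using x nrm_nonneg[OF x] by (intro norm_cprod_le) (auto simp: cstar_algebra.nrm_zero)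
  qed
  fix y assume y: "y \<in> carrier A"
  show "x \<oplus> y \<in> carrier A" "x \<otimes> y \<in> carrier A" using x y by simp_all
  show "emb A (x \<oplus> y) = emb A x + emb A y" "emb A (x \<otimes> y) = emb A x * emb A y"
    by (rule cprod_eqI; simp add: x y)+
qed

text \<open>Coordinates are contractive, so a limit of elements that vanish in all factors other
  than A also vanishes there.\<close>

lemma closed_emb: "closed (emb A ` carrier A)"
proof (unfold closed_sequential_limits, intro allI impI)
  fix f l assume "(\<forall>n. f n \<in> emb A ` carrier A) \<and> f \<longlonglongrightarrow> l"
  then have f: "\<And>n. f n \<in> emb A ` carrier A" and l: "f \<longlonglongrightarrow> l" by auto
  have "l = emb A (proj l (A, ()))"
  proof (rule cprod_eqI)
    fix p :: "'a star_alg \<times> unit" assume p: "cstar_algebra (fst p)"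
    have in_A: "proj l (A, ()) \<in> carrier A"
      using proj_closed[of "(A, ())" l] cstar_algebra_axioms by simp
    show "proj l p = proj (emb A (proj l (A, ()))) p"
    proof (cases "fst p = A")
      case True then have "p = (A, ())" by (cases p) auto
      then show ?thesis using p in_A by (simp add: proj_emb)
    next
      case False
      have "nrm (fst p) (proj l p) \<le> norm (l - f n)" for n
      proof -
        obtain x where x: "x \<in> carrier A" "f n = emb A x" using f by blast
        interpret B: cstar_algebra "fst p" by fact
        have "proj (l - f n) p = proj l p"
          using p x False by (simp add: proj_diff proj_emb a_minus_def proj_closed)
        then show ?thesis using norm_proj[OF p, of "l - f n"] by simp
      qed
      moreover have "(\<lambda>n. norm (l - f n)) \<longlonglongrightarrow> 0"
        using tendsto_norm[OF tendsto_diff[OF tendsto_const[of l] l]] by simp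
      ultimately have "nrm (fst p) (proj l p) \<le> 0"
        by (intro LIMSEQ_le_const[where x=0]) auto
      then have "proj l p = \<zero>\<^bsub>fst p\<^esub>"
        using p by (metis cstar_algebra.nrm_eq_zero cstar_algebra.nrm_nonneg antisym proj_closed)
      then show ?thesis using False p in_A by (simp add: proj_emb)
    qed
  qed
  moreover have "proj l (A, ()) \<in> carrier A"
    using proj_closed[of "(A, ())" l] cstar_algebra_axioms by simp
  ultimately show "l \<in> emb A ` carrier A" by blast
qed

end

subsection \<open>Unitization\<close>

text \<open>
  The maximum with the modulus of the scalar part makes the operator norm definite even if the
  algebra already has a unit.
\<close>

datatype 'a unitz = Unitz (scalar: complex) (vec: 'a)

instantiation unitz :: (cstar_type) "{cstar_normed, one}"
begin

definition "0 = Unitz 0 0"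
definition "1 = Unitz 1 0"
definition "u + v = Unitz (scalar u + scalar v) (vec u + vec v)"
definition "u * v = Unitz (scalar u * scalar v) (scaleC (scalar u) (vec v) + scaleC (scalar v) (vec u) + vec u * vec v)"
definition "scaleC c u = Unitz (c * scalar u) (scaleC c (vec u))"
definition "adj u = Unitz (cnj (scalar u)) (adj (vec u))"
definition "scaleR r u = scaleC (complex_of_real r) (u :: 'a unitz)"
definition "- u = Unitz (- scalar u) (- vec u)"
definition "u - v = Unitz (scalar u - scalar v) (vec u - vec v)"
definition norm_unitz :: "'a unitz \<Rightarrow> real" where
  "norm u = max (cmod (scalar u)) (Sup {norm (scaleC (scalar u) b + vec u * b) | b. norm b \<le> 1})"
definition "dist u v = norm (u - v :: 'a unitz)"
definition "sgn u = scaleR (inverse (norm u)) (u :: 'a unitz)"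
definition "uniformity = (INF e\<in>{0 <..}. principal {(x, y). dist x (y :: 'a unitz) < e})"
definition "open U = (\<forall>x\<in>U. \<forall>\<^sub>F (x', y) in uniformity. x' = x \<longrightarrow> (y :: 'a unitz) \<in> U)"

lemmas unitz_defs = zero_unitz_def one_unitz_def plus_unitz_def times_unitz_def scaleC_unitz_def
  adj_unitz_def scaleR_unitz_def uminus_unitz_def minus_unitz_def

lemmas scaleC_simps = scaleC_add_right scaleC_add_left scaleC_scaleC scaleC_mult_left scaleC_mult_right
  scaleC_minus_right scaleC_minus_left scaleC_diff_right scaleC_one scaleC_zero_left scaleC_zero_right
  scaleC_minus1

definition act :: "'a unitz \<Rightarrow> 'a \<Rightarrow> 'a" where
  "act u b = scaleC (scalar u) b + vec u * b"

lemma act_bound: "norm (act u b) \<le> (cmod (scalar u) + norm (vec u)) * norm b"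
  unfolding act_def
  using norm_triangle_ineq[of "scaleC (scalar u) b" "vec u * b"] norm_mult_ineq[of "vec u" b]
  by (simp add: norm_scaleC algebra_simps)

lemma act_bdd: "bdd_above {norm (act u b) | b. norm b \<le> 1}"
proof (rule bdd_aboveI)
  fix x assume "x \<in> {norm (act u b) | b. norm b \<le> 1}"
  then obtain b where b: "x = norm (act u b)" "norm b \<le> 1" by auto
  have "(cmod (scalar u) + norm (vec u)) * norm b \<le> (cmod (scalar u) + norm (vec u)) * 1"
    using b by (intro mult_left_mono) auto
  then show "x \<le> cmod (scalar u) + norm (vec u)" using act_bound[of u b] b by simp
qed

lemma norm_unitz_alt: "norm u = max (cmod (scalar u)) (Sup {norm (act u b) | b. norm b \<le> 1})"
  unfolding norm_unitz_def act_def ..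

lemma scalar_le_norm: "cmod (scalar u) \<le> norm (u :: 'a unitz)"
  by (simp add: norm_unitz_alt)

lemma norm_unitz_nonneg: "0 \<le> norm (u :: 'a unitz)"
  using norm_ge_zero scalar_le_norm by (rule order_trans)

lemma act_scaleR: "act u (r *\<^sub>R b) = r *\<^sub>R act u b"
  by (simp add: act_def scaleC_simps scaleR_add_right mult.commute flip: scaleC_of_real)

lemma act_le: "norm (act u b) \<le> norm u * norm b"
proof (cases "b = 0")
  case True then show ?thesis by (simp add: act_def scaleC_zero_right)
next
  case False
  have "norm (act u (inverse (norm b) *\<^sub>R b)) \<le> norm u"
    unfolding norm_unitz_alt using False
    by (intro max.coboundedI2 cSup_upper act_bdd) (auto intro!: exI[of _ "inverse (norm b) *\<^sub>R b"])
  then show ?thesis using False by (simp add: act_scaleR field_simps)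
qed

lemma norm_unitz_le:
  fixes u :: "'a unitz"
  assumes "cmod (scalar u) \<le> K" "\<And>b. norm (act u b) \<le> K * norm b"
  shows "norm u \<le> K"
proof -
  have "0 \<le> K" using norm_ge_zero assms(1) by (rule order_trans)
  have "norm (act u b) \<le> K" if "norm b \<le> 1" for b
    using assms(2)[of b] mult_left_mono[OF that \<open>0 \<le> K\<close>] by simp
  moreover have "\<exists>b::'a. norm b \<le> 1" by (rule exI[of _ 0]) simp
  ultimately show ?thesis unfolding norm_unitz_alt
    using assms(1) by (intro max.boundedI cSup_least) auto
qed

lemma act_mult: "act (u * v) b = act u (act v b)"
  by (simp add: act_def unitz_defs scaleC_simps algebra_simps)

lemma adj_act: "adj (act u b) * act u b = adj b * act (adj u * u) b"
  by (simp add: act_def unitz_defs scaleC_simps algebra_simps adj_add adj_scaleC adj_mult)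

text \<open>Acting on \<open>adj (vec u)\<close> produces \<open>vec u * adj (vec u)\<close> up to a
  term controlled by the scalar part, and the C*-identity evaluates the former. The norm of the
  unitization is thus equivalent to the sum of the norms of the two parts, which gives its
  definiteness and completeness.\<close>

lemma vec_le_norm: "norm (vec u) \<le> 2 * norm (u :: 'a unitz)"
proof (cases "norm (vec u) = 0")
  case True then show ?thesis using norm_unitz_nonneg[of u] by simp
next
  case False
  have "norm (vec u * adj (vec u)) \<le> norm (act u (adj (vec u))) + norm (scaleC (scalar u) (adj (vec u)))"
    using norm_triangle_ineq4[of "act u (adj (vec u))" "scaleC (scalar u) (adj (vec u))"]
    by (simp add: act_def)
  also have "\<dots> \<le> norm u * norm (vec u) + norm u * norm (vec u)"
    using act_le[of u "adj (vec u)"] mult_right_mono[OF scalar_le_norm[of u] norm_ge_zero[of "vec u"]]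
    by (simp add: norm_scaleC norm_adj)
  finally have "norm (vec u) * norm (vec u) \<le> (2 * norm u) * norm (vec u)"
    by (simp add: norm_mult_adj power2_eq_square)
  then show ?thesis using False by simp
qed

text \<open>Left multiplication by b attains its norm at a multiple of \<open>adj b\<close>.\<close>

lemma norm_vec_unitz: "norm (Unitz 0 b) = norm (b :: 'a)"
proof (rule antisym)
  show "norm (Unitz 0 b) \<le> norm b"
    by (rule norm_unitz_le) (auto simp: act_def scaleC_simps norm_mult_ineq)
  show "norm b \<le> norm (Unitz 0 b)"
  proof (cases "norm b = 0")
    case False
    have "norm b * norm b \<le> norm (Unitz 0 b) * norm b"
      using act_le[of "Unitz 0 b" "adj b"]
      by (simp add: act_def scaleC_simps norm_mult_adj norm_adj power2_eq_square)
    then show ?thesis using False by simp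
  qed (simp add: norm_unitz_nonneg)
qed

instance
proof
  fix u v w :: "'a unitz" and c d :: complex and r s :: real
  note [simp] = unitz_defs scaleC_simps
  show "u + v + w = u + (v + w)" "u + v = v + u" "0 + u = u" "- u + u = 0" "u - v = u + - v"
    by (simp_all add: algebra_simps)
  show "u * v * w = u * (v * w)" by (simp add: algebra_simps)
  show "(u + v) * w = u * w + v * w" "u * (v + w) = u * v + u * w"
    by (simp_all add: algebra_simps)
  show "scaleC c (u + v) = scaleC c u + scaleC c v" "r *\<^sub>R (u + v) = r *\<^sub>R u + r *\<^sub>R v"
    "scaleC (c + d) u = scaleC c u + scaleC d u" "(r + s) *\<^sub>R u = r *\<^sub>R u + s *\<^sub>R u"
    "scaleC c (scaleC d u) = scaleC (c * d) u" "r *\<^sub>R s *\<^sub>R u = (r * s) *\<^sub>R u"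
    "scaleC (complex_of_real r) u = r *\<^sub>R u" "1 *\<^sub>R u = u"
    by (simp_all add: algebra_simps)
  show "scaleC c u * v = scaleC c (u * v)" "r *\<^sub>R u * v = r *\<^sub>R (u * v)"
    "u * scaleC c v = scaleC c (u * v)" "u * r *\<^sub>R v = r *\<^sub>R (u * v)"
    by (simp_all add: algebra_simps)
  show "adj (adj u) = u" "adj (u + v) = adj u + adj v" "adj (scaleC c u) = scaleC (cnj c) (adj u)"
    "adj (u * v) = adj v * adj u"
    by (simp_all add: adj_adj adj_add adj_scaleC adj_mult algebra_simps)
  have act_add: "act (u + v) b = act u b + act v b" for b
    by (simp add: act_def algebra_simps)
  have act_C: "act (scaleC c u) b = scaleC c (act u b)" for b c
    by (simp add: act_def algebra_simps)
  show "norm (u * v) \<le> norm u * norm v"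
  proof (rule norm_unitz_le)
    show "cmod (scalar (u * v)) \<le> norm u * norm v"
      using mult_mono[OF scalar_le_norm[of u] scalar_le_norm[of v]]
      by (simp add: norm_mult norm_unitz_nonneg)
    show "norm (act (u * v) b) \<le> norm u * norm v * norm b" for b
      unfolding act_mult
      using act_le[of u "act v b"] mult_left_mono[OF act_le[of v b] norm_unitz_nonneg[of u]]
      by (simp add: mult.assoc)
  qed
  show "norm (u + v) \<le> norm u + norm v"
  proof (rule norm_unitz_le)
    show "cmod (scalar (u + v)) \<le> norm u + norm v"
      using norm_triangle_ineq[of "scalar u" "scalar v"] scalar_le_norm[of u] scalar_le_norm[of v] by simp
    show "norm (act (u + v) b) \<le> (norm u + norm v) * norm b" for b
      unfolding act_add
      using norm_triangle_ineq[of "act u b" "act v b"] act_le[of u b] act_le[of v b]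
      by (simp add: distrib_right)
  qed
  have le: "norm (scaleC c u) \<le> cmod c * norm u" for c and u :: "'a unitz"
  proof (rule norm_unitz_le)
    show "cmod (scalar (scaleC c u)) \<le> cmod c * norm u"
      using scalar_le_norm[of u] by (simp add: norm_mult mult_left_mono)
    have "act (scaleC c u) b = scaleC c (act u b)" for b
      by (simp add: act_def algebra_simps)
    then show "norm (act (scaleC c u) b) \<le> cmod c * norm u * norm b" for b
      using mult_left_mono[OF act_le[of u b] norm_ge_zero[of c]] by (simp add: norm_scaleC mult.assoc)
  qed
  have norm_C: "norm (scaleC c u) = cmod c * norm u" for c
  proof (cases "c = 0")
    case True
    have "norm (scaleC 0 u) = 0" using le[of 0 u] norm_unitz_nonneg[of "scaleC 0 u"] by simp
    then show ?thesis using True by simp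
  next
    case False
    have "scaleC (inverse c) (scaleC c u) = u" using False by (cases u) (simp flip: mult.assoc)
    then have "cmod c * norm u \<le> cmod c * (cmod (inverse c) * norm (scaleC c u))"
      using le[of "inverse c" "scaleC c u"] by (intro mult_left_mono) auto
    also have "\<dots> = norm (scaleC c u)" using False by (simp add: norm_inverse)
    finally show ?thesis using le[of c u] by simp
  qed
  show "norm (scaleC c u) = cmod c * norm u" by (rule norm_C)
  show "norm (r *\<^sub>R u) = \<bar>r\<bar> * norm u"
    using norm_C[of "complex_of_real r"] by (simp del: scaleC_unitz_def)
  show "norm u = 0 \<longleftrightarrow> u = 0"
  proof
    assume "norm u = 0"
    then show "u = 0" using scalar_le_norm[of u] vec_le_norm[of u] by (cases u) simp
  qed (use norm_vec_unitz[of 0] in simp)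
  have le_star: "(norm u)\<^sup>2 \<le> norm (adj u * u)" for u :: "'a unitz"
  proof -
    have "norm u \<le> sqrt (norm (adj u * u))"
    proof (rule norm_unitz_le)
      have "(cmod (scalar u))\<^sup>2 \<le> norm (adj u * u)"
        using scalar_le_norm[of "adj u * u"] by (simp add: norm_mult power2_eq_square)
      then show "cmod (scalar u) \<le> sqrt (norm (adj u * u))" by (rule real_le_rsqrt)
      fix b
      \<comment> \<open>The argument for operators on a Hilbert space, with \<open>adj b * _\<close>
        in the role of the inner product.\<close>
      have "(norm (act u b))\<^sup>2 = norm (adj b * act (adj u * u) b)"
        by (metis norm_adj_mult adj_act)
      also have "\<dots> \<le> norm b * (norm (adj u * u) * norm b)"
        using norm_mult_ineq[of "adj b" "act (adj u * u) b"]
          mult_left_mono[OF act_le[of "adj u * u" b] norm_ge_zero[of b]] by (simp add: norm_adj del: unitz_defs)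
      finally have "(norm (act u b))\<^sup>2 \<le> norm (adj u * u) * (norm b)\<^sup>2"
        by (simp add: power2_eq_square mult_ac del: unitz_defs)
      from real_le_rsqrt[OF this] show "norm (act u b) \<le> sqrt (norm (adj u * u)) * norm b"
        by (simp add: real_sqrt_mult del: unitz_defs)
    qed
    from power_mono[OF this norm_unitz_nonneg, of 2] show ?thesis
      by (simp add: norm_unitz_nonneg del: unitz_defs)
  qed
  have mult_le: "norm (adj u * u) \<le> norm (adj u) * norm u" for u :: "'a unitz"
  proof (rule norm_unitz_le)
    show "cmod (scalar (adj u * u)) \<le> norm (adj u) * norm u"
      using mult_mono[OF scalar_le_norm[of "adj u"] scalar_le_norm[of u]]
      by (simp add: norm_mult norm_unitz_nonneg)
    show "norm (act (adj u * u) b) \<le> norm (adj u) * norm u * norm b" for b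
      unfolding act_mult
      using act_le[of "adj u" "act u b"] mult_left_mono[OF act_le[of u b] norm_unitz_nonneg[of "adj u"]]
      by (simp add: mult.assoc del: unitz_defs)
  qed
  have le_adj: "norm u \<le> norm (adj u)" for u :: "'a unitz"
  proof (cases "norm u = 0")
    case False
    have "norm u * norm u \<le> norm (adj u) * norm u"
      using le_star[of u] mult_le[of u] by (simp add: power2_eq_square del: unitz_defs)
    then show ?thesis using False norm_unitz_nonneg[of u] by (simp del: unitz_defs)
  qed (simp add: norm_unitz_nonneg del: unitz_defs)
  have "adj (adj u) = u" by (simp add: adj_adj)
  then have "norm (adj u) = norm u"
    using le_adj[of u] le_adj[of "adj u"] by (metis antisym)
  then show "norm (adj u * u) = (norm u)\<^sup>2"
    using le_star[of u] mult_le[of u] by (simp add: power2_eq_square del: unitz_defs)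
qed (rule dist_unitz_def sgn_unitz_def uniformity_unitz_def open_unitz_def)+

end

instance unitz :: (cstar_type) cstar_type
proof
  fix X :: "nat \<Rightarrow> 'a unitz"
  assume X: "Cauchy X"
  have d1: "dist (scalar u) (scalar v) \<le> 2 * dist u v" and d2: "dist (vec u) (vec v) \<le> 2 * dist u v"
    for u v :: "'a unitz"
    using scalar_le_norm[of "u - v"] vec_le_norm[of "u - v"] norm_ge_zero[of "scalar u - scalar v"]
    unfolding dist_norm minus_unitz_def unitz.sel by linarith+
  have C: "Cauchy (\<lambda>n. f (X n))"
    if d: "\<And>u v. dist (f u) (f v) \<le> 2 * dist u v" for f :: "'a unitz \<Rightarrow> 'c::metric_space"
  proof (rule metric_CauchyI)
    fix e :: real assume "e > 0"
    then obtain M where "\<forall>m\<ge>M. \<forall>n\<ge>M. dist (X m) (X n) < e / 2" using metric_CauchyD[OF X, of "e/2"] by auto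
    then show "\<exists>M. \<forall>m\<ge>M. \<forall>n\<ge>M. dist (f (X m)) (f (X n)) < e"
      using d by (intro exI[of _ M]) (smt (verit) field_sum_of_halves)
  qed
  obtain l where l: "(\<lambda>n. scalar (X n)) \<longlonglongrightarrow> l"
    using C[OF d1] Cauchy_convergent convergent_def by blast
  obtain x where x: "(\<lambda>n. vec (X n)) \<longlonglongrightarrow> x"
    using C[OF d2] Cauchy_convergent convergent_def by blast
  have le: "norm (u :: 'a unitz) \<le> cmod (scalar u) + norm (vec u)" for u
    by (rule norm_unitz_le[OF _ act_bound]) simp
  have "(\<lambda>n. cmod (scalar (X n) - l) + norm (vec (X n) - x)) \<longlonglongrightarrow> 0 + 0"
    using l x by (intro tendsto_add tendsto_norm_zero) (simp_all add: LIM_zero)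
  then have lim: "(\<lambda>n. cmod (scalar (X n) - l) + norm (vec (X n) - x)) \<longlonglongrightarrow> 0" by simp
  have "\<forall>n. norm (X n - Unitz l x) \<le> cmod (scalar (X n) - l) + norm (vec (X n) - x)"
    using le[of "X _ - Unitz l x"] by (simp add: minus_unitz_def)
  from Lim_null_comparison[OF always_eventually[OF this] lim] have "(\<lambda>n. X n - Unitz l x) \<longlonglongrightarrow> 0"
    .
  then show "convergent X" using LIM_zero_cancel convergent_def by blast
qed

instance unitz :: (cstar_type) real_normed_algebra_1
proof
  fix u :: "'a unitz"
  show "1 * u = u" "u * 1 = u" by (cases u; simp add: unitz_defs scaleC_simps)+
  show "(0::'a unitz) \<noteq> 1" by (simp add: unitz_defs)
  show "norm (1::'a unitz) = 1"
    by (intro antisym norm_unitz_le)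
      (use scalar_le_norm[of "1::'a unitz"] in \<open>auto simp: act_def unitz_defs scaleC_simps\<close>)
qed

lemma Unitz_add: "Unitz 0 (x + y) = Unitz 0 x + Unitz 0 y"
  and Unitz_mult: "Unitz 0 (x * y) = Unitz 0 x * Unitz 0 y"
  and Unitz_scaleC: "Unitz 0 (scaleC c x) = scaleC c (Unitz 0 x)"
  and Unitz_adj: "Unitz 0 (adj x) = adj (Unitz 0 x)"
  by (simp_all add: unitz_defs scaleC_simps)

subsection \<open>Positive elements\<close>

text \<open>Positivity without spectra: for self-adjoint x the bound says that the spectrum is
  contained in the interval from 0 to 2 t. In this form sums and nonnegative multiples need only the
  triangle inequality.\<close>

definition psd :: "'a::{cstar_type, real_normed_algebra_1} \<Rightarrow> bool" where
  "psd x \<longleftrightarrow> adj x = x \<and> (\<exists>t\<ge>0. norm (t *\<^sub>R 1 - x) \<le> t)"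

context
  fixes dummy :: "'a::{cstar_type, real_normed_algebra_1}"
begin

lemma adj_one: "adj 1 = (1 :: 'a)"
  by (metis adj_adj adj_mult mult.right_neutral)

lemma psd_zero: "psd (0 :: 'a)"
  unfolding psd_def by (auto simp: adj_zero intro!: exI[of _ 0])

lemma psd_add:
  assumes "psd x" "psd (y :: 'a)" shows "psd (x + y)"
proof -
  obtain t s where ts: "t \<ge> 0" "norm (t *\<^sub>R 1 - x) \<le> t" "s \<ge> 0" "norm (s *\<^sub>R 1 - y) \<le> s"
    using assms by (auto simp: psd_def)
  have "norm ((t + s) *\<^sub>R 1 - (x + y)) \<le> t + s"
    using norm_triangle_ineq[of "t *\<^sub>R 1 - x" "s *\<^sub>R 1 - y"] ts by (simp add: algebra_simps)
  then show ?thesis using assms ts by (auto simp: psd_def adj_add intro!: exI[of _ "t + s"])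
qed

lemma psd_scale:
  assumes "psd (x :: 'a)" "r \<ge> 0" shows "psd (r *\<^sub>R x)"
proof -
  obtain t where t: "t \<ge> 0" "norm (t *\<^sub>R 1 - x) \<le> t" using assms by (auto simp: psd_def)
  have "norm ((r * t) *\<^sub>R 1 - r *\<^sub>R x) = r * norm (t *\<^sub>R 1 - x)"
    using assms(2) by (simp flip: scaleR_scaleR scaleR_diff_right)
  then show ?thesis using assms t by (auto simp: psd_def adj_scaleR mult_left_mono intro!: exI[of _ "r * t"])
qed

text \<open>For t > 0 the element h = 1 - x / t has norm at most 1. If g is its quasi-root, then 1 -
  g is a square root of 1 - h = x / t.\<close>

lemma psd_sqrt:
  assumes "psd (x :: 'a)"
  obtains r where "psd r" "r * r = x" "\<And>b. x * b = b * x \<Longrightarrow> r * b = b * r"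
proof -
  obtain t where t: "t \<ge> 0" "norm (t *\<^sub>R 1 - x) \<le> t" and adj: "adj x = x"
    using assms by (auto simp: psd_def)
  show thesis
  proof (cases "t = 0")
    case True
    then have "x = 0" using t by simp
    then show thesis using psd_zero by (intro that[of 0]) auto
  next
    case False
    define h where "h = 1 - (1/t) *\<^sub>R x"
    have "h = (1/t) *\<^sub>R (t *\<^sub>R 1 - x)" using False by (simp add: h_def scaleR_diff_right)
    then have "norm h = norm (t *\<^sub>R 1 - x) / t" using t by simp
    then have nh: "norm h \<le> 1" using t False by simp
    have ah: "adj h = h" by (simp add: h_def adj_diff adj_scaleR adj_one adj)
    obtain g where "quasi_root h g" using quasi_root_exists[OF nh ah] ..
    note g = quasi_rootD[OF this]
    have "psd (1 - g)"
      using g(2,3) by (auto simp: psd_def adj_diff adj_one intro!: exI[of _ 1])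
    moreover have "(1 - g) * (1 - g) = 1 - (2 *\<^sub>R g - g * g)"
      by (simp add: algebra_simps scaleR_2)
    then have sq: "(1 - g) * (1 - g) = (1/t) *\<^sub>R x" by (simp add: g(1) h_def)
    ultimately show thesis
    proof (intro that[of "sqrt t *\<^sub>R (1 - g)"] psd_scale)
      show "(sqrt t *\<^sub>R (1 - g)) * (sqrt t *\<^sub>R (1 - g)) = x"
        using t False by (simp add: sq)
      show "(sqrt t *\<^sub>R (1 - g)) * b = b * (sqrt t *\<^sub>R (1 - g))" if "x * b = b * x" for b
        using g(4)[of b] that by (simp add: h_def algebra_simps)
    qed (use t in auto)
  qed
qed

text \<open>The element u = r + \<i> s satisfies \<open>adj u * u = t *\<^sub>R 1\<close>, so its
  norm is \<open>sqrt t\<close>, and r is the real part of u.\<close>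

lemma norm_le_unitary_part:
  assumes "adj r = r" "adj s = (s :: 'a)" "r * s = s * r" "r * r + s * s = t *\<^sub>R 1" "t \<ge> 0"
  shows "norm (r * r) \<le> t"
proof -
  define u where "u = r + scaleC \<i> s"
  have "adj u * u = r * r + s * s"
    by (simp add: u_def adj_add adj_scaleC assms scaleC_simps algebra_simps)
  then have "(norm u)\<^sup>2 = t" using norm_adj_mult[of u] assms by simp
  moreover have "2 *\<^sub>R r = u + adj u"
    by (simp add: u_def adj_add adj_scaleC assms scaleC_simps scaleR_2)
  then have "norm (2 *\<^sub>R r) \<le> norm u + norm (adj u)" by (simp only: norm_triangle_ineq)
  then have "norm r \<le> norm u" by (simp add: norm_adj)
  then have "(norm r)\<^sup>2 \<le> (norm u)\<^sup>2" by (simp add: power_mono)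
  ultimately show ?thesis using norm_adj_mult[of r] assms(1) by simp
qed

text \<open>For a contraction r let g be the quasi-root of r r. Then (1 - g) (1 - g) + r r = 1, and
  \<open>norm_le_unitary_part\<close> bounds the norm of 1 - r r by 1, which is positivity of r r
  with t = 1. A general r is scaled.\<close>

lemma psd_square:
  assumes r: "adj r = (r :: 'a)" shows "psd (r * r)"
proof -
  have unit: "psd (r * r)" if r: "adj r = r" "norm r \<le> 1" for r :: 'a
  proof -
    have nr: "norm (r * r) \<le> 1" and ar: "adj (r * r) = r * r"
      using r norm_mult_ineq[of r r] mult_mono[OF r(2) r(2)] by (auto simp: adj_mult)
    obtain g where "quasi_root (r * r) g" using quasi_root_exists[OF nr ar] ..
    note g = quasi_rootD[OF this]
    have "g * r = r * g" using g(4)[of r] by (simp add: mult.assoc)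
    then have "(1 - g) * r = r * (1 - g)" by (simp add: algebra_simps)
    moreover have "(1 - g) * (1 - g) = 1 - (2 *\<^sub>R g - g * g)"
      by (simp add: algebra_simps scaleR_2)
    then have sum: "(1 - g) * (1 - g) + r * r = 1 *\<^sub>R 1" by (simp add: g(1))
    ultimately have "norm ((1 - g) * (1 - g)) \<le> 1"
      using r g(2) by (intro norm_le_unitary_part[of _ r]) (auto simp: adj_diff adj_one)
    moreover have "1 - r * r = (1 - g) * (1 - g)" using sum by (simp add: algebra_simps)
    ultimately show ?thesis using r by (auto simp: psd_def adj_mult intro!: exI[of _ 1])
  qed
  show ?thesis
  proof (cases "r = 0")
    case False
    define s where "s = inverse (norm r) *\<^sub>R r"
    have "psd (s * s)" using False r by (intro unit) (auto simp: s_def adj_scaleR)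
    then have "psd ((norm r * norm r) *\<^sub>R (s * s))" by (rule psd_scale) simp
    moreover have "r = norm r *\<^sub>R s" using False by (simp add: s_def)
    then have "r * r = (norm r * norm r) *\<^sub>R (s * s)" by (metis mult_scaleR_left mult_scaleR_right scaleR_scaleR)
    ultimately show ?thesis by simp
  qed (simp add: psd_zero)
qed

text \<open>Roots r of x and s of - x commute and satisfy r r + s s = 0, so
  \<open>norm_le_unitary_part\<close> applies with t = 0.\<close>

lemma psd_uminus_eq_0:
  assumes "psd x" "psd (- x)" shows "(x :: 'a) = 0"
proof -
  obtain r where r: "psd r" "r * r = x" "\<And>b. x * b = b * x \<Longrightarrow> r * b = b * r"
    using psd_sqrt[OF assms(1)] by blast
  obtain s where s: "psd s" "s * s = - x" using psd_sqrt[OF assms(2)] by blast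
  have "x = - (s * s)" using s by simp
  then have "x * s = s * x" by (simp add: mult.assoc)
  then have rs: "r * s = s * r" by (rule r(3))
  have "norm (r * r) \<le> 0"
    using r(1,2) s rs by (intro norm_le_unitary_part[of r s]) (auto simp: psd_def)
  then show ?thesis using r(2) by simp
qed

text \<open>If x > t, then the n-th power of t / x tends to 0 even after multiplication by A + B n,
  which contradicts the bound. Only exponents that are powers of 2 are used, since for these the
  norm of a power of a self-adjoint element is the power of its norm.\<close>

lemma geometric_domination:
  fixes x t A B :: real
  assumes x: "0 \<le> x" and t: "0 < t" and bound: "\<And>k. x ^ (2 ^ k) \<le> t ^ (2 ^ k) * (A + B * 2 ^ k)"
  shows "x \<le> t"
proof (rule ccontr)
  assume "\<not> x \<le> t"
  then have y: "0 < t / x" "t / x < 1" using t by auto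
  have "(\<lambda>n. A * (t/x) ^ n + B * (of_nat n * (t/x) ^ n)) \<longlonglongrightarrow> A * 0 + B * 0"
    using y by (intro tendsto_intros powser_times_n_limit_0 LIMSEQ_power_zero) auto
  moreover have "strict_mono (\<lambda>k. 2 ^ k :: nat)" by (auto simp: strict_mono_def)
  ultimately have "(\<lambda>k. A * (t/x) ^ (2 ^ k) + B * (of_nat (2 ^ k) * (t/x) ^ (2 ^ k))) \<longlonglongrightarrow> A * 0 + B * 0"
    using LIMSEQ_subseq_LIMSEQ[of "\<lambda>n. A * (t/x) ^ n + B * (of_nat n * (t/x) ^ n)" _ "\<lambda>k. 2 ^ k"]
    by (auto simp: o_def)
  moreover have "1 \<le> A * (t/x) ^ (2 ^ k) + B * (of_nat (2 ^ k) * (t/x) ^ (2 ^ k))" for k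
  proof -
    have "x ^ (2 ^ k) > 0" using y t by (simp add: zero_less_divide_iff)
    moreover have "A * (t/x) ^ (2 ^ k) + B * (of_nat (2 ^ k) * (t/x) ^ (2 ^ k)) =
        t ^ (2 ^ k) * (A + B * 2 ^ k) / x ^ (2 ^ k)"
      by (simp add: power_divide add_divide_distrib algebra_simps)
    ultimately show ?thesis using bound[of k] by simp
  qed
  ultimately have "1 \<le> A * 0 + B * 0"
    by (intro LIMSEQ_le_const) auto
  then show False by simp
qed

lemma adj_power: "adj x = (x :: 'a) \<Longrightarrow> adj (x ^ n) = x ^ n"
  by (induction n) (auto simp: adj_one adj_mult power_commutes)

lemma norm_selfadj_power: "adj x = (x :: 'a) \<Longrightarrow> norm (x ^ (2 ^ k)) = norm x ^ (2 ^ k)"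
proof (induction k)
  case (Suc k)
  have "norm (x ^ (2 ^ k) * x ^ (2 ^ k)) = (norm (x ^ (2 ^ k)))\<^sup>2"
    using norm_adj_mult[of "x ^ (2 ^ k)"] Suc by (simp add: adj_power)
  then show ?case using Suc by (simp add: mult_2 power_add power2_eq_square)
qed simp

text \<open>
  The powers \<open>(t - z\<^sup>* z)\<^sup>n\<close> are expressed by \<open>(t - z z\<^sup>*)\<^sup>n\<close>, so they grow like \<open>n t\<^sup>n\<close> at most. This replaces
  the comparison of the spectra of \<open>z\<^sup>* z\<close> and \<open>z z\<^sup>*\<close>.
\<close>

lemma psd_commute:
  assumes "psd (z * adj z)" shows "psd (adj z * (z :: 'a))"
proof -
  obtain t where t: "t \<ge> 0" "norm (t *\<^sub>R 1 - z * adj z) \<le> t" using assms by (auto simp: psd_def)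
  define v where "v = t *\<^sub>R 1 - adj z * z"
  define w where "w = t *\<^sub>R 1 - z * adj z"
  show ?thesis
  proof (cases "t = 0")
    case True
    then have "z = 0" using t norm_mult_adj[of z] by simp
    then show ?thesis by (simp add: psd_zero)
  next
    case False
    then have t0: "t > 0" using t by simp
    have comm: "v ^ n * adj z = adj z * w ^ n" for n
    proof (induction n)
      case (Suc n)
      have "v * adj z = adj z * w" by (simp add: v_def w_def algebra_simps)
      then show ?case using Suc
        by (metis mult.assoc power_Suc power_Suc2)
    qed simp
    have bound: "norm (v ^ n) \<le> t ^ n * (1 + (norm z)\<^sup>2 / t * real n)" for n
    proof (induction n)
      case (Suc n)
      \<comment> \<open>Since \<open>adj z\<close> intertwines v and w, the term
        \<open>v ^ n * adj z * z\<close> is expressed by \<open>w ^ n\<close>, whose norm is at most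
        \<open>t ^ n\<close>.\<close>
      have "v ^ Suc n = t *\<^sub>R v ^ n - adj z * w ^ n * z"
        by (subst comm[symmetric]) (simp add: power_Suc2 v_def algebra_simps del: power_Suc)
      then have "norm (v ^ Suc n) \<le> t * norm (v ^ n) + norm (adj z * w ^ n * z)"
        using norm_triangle_ineq4[of "t *\<^sub>R v ^ n" "adj z * w ^ n * z"] t0 by simp
      moreover have "norm (adj z * w ^ n * z) \<le> norm z * t ^ n * norm z"
      proof -
        have "norm (w ^ n) \<le> t ^ n"
          using norm_power_ineq[of w n] power_mono[OF t(2), of n] by (simp add: w_def)
        then have "norm (adj z) * norm (w ^ n) * norm z \<le> norm z * t ^ n * norm z"
          by (intro mult_right_mono mult_mono) (auto simp: norm_adj)
        moreover have "norm (adj z * w ^ n * z) \<le> norm (adj z) * norm (w ^ n) * norm z"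
          using norm_mult_ineq[of "adj z * w ^ n" z] norm_mult_ineq[of "adj z" "w ^ n"]
          by (meson mult_right_mono norm_ge_zero order_trans)
        ultimately show ?thesis by simp
      qed
      moreover have "t * norm (v ^ n) \<le> t * (t ^ n * (1 + (norm z)\<^sup>2 / t * real n))"
        using Suc t0 by simp
      moreover have "t * (t ^ n * (1 + (norm z)\<^sup>2 / t * real n)) + norm z * t ^ n * norm z =
          t ^ Suc n * (1 + (norm z)\<^sup>2 / t * real (Suc n))"
        using t0 by (simp add: field_simps power2_eq_square)
      ultimately show ?case by linarith
    qed simp
    have adj_v: "adj v = v" by (simp add: v_def adj_diff adj_scaleR adj_one adj_mult adj_adj)
    \<comment> \<open>The norm of the power \<open>2 ^ k\<close> of the self-adjoint v is exact, so
      the linear growth factor in \<open>bound\<close> is harmless.\<close>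
    have "norm v \<le> t"
      by (rule geometric_domination[where A=1 and B="(norm z)\<^sup>2 / t"])
        (use bound[of "2 ^ _"] t0 in \<open>auto simp flip: norm_selfadj_power[OF adj_v]\<close>)
    then show ?thesis using t by (auto simp: psd_def v_def adj_mult adj_adj)
  qed
qed

text \<open>Let h = \<open>adj y * y\<close>, let r be the absolute value of h, and let n = r - h,
  which is twice the negative part. From h n = - r n one finds for z = y n that
  \<open>adj z * z\<close> is the negative of a square. On the other hand, \<open>z * adj z\<close>
  is the sum of the squares of the real and imaginary parts, up to a positive factor, minus
  \<open>adj z * z\<close>, hence positive; by \<open>psd_commute\<close> so is
  \<open>adj z * z\<close>. Both signs force z = 0, then n = 0, and h = r is positive.\<close>

lemma psd_adj_mult: "psd (adj y * (y :: 'a))"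
proof -
  define h where "h = adj y * y"
  have h: "adj h = h" by (simp add: h_def adj_mult adj_adj)
  obtain r where r: "psd r" "r * r = h * h" "\<And>b. h * h * b = b * (h * h) \<Longrightarrow> r * b = b * r"
    using psd_sqrt[OF psd_square[OF h]] by blast
  obtain c where c: "psd c" "c * c = r" "\<And>b. r * b = b * r \<Longrightarrow> c * b = b * c"
    using psd_sqrt[OF r(1)] by blast
  have rh: "r * h = h * r" using r(3)[of h] by (simp add: mult.assoc)
  define n where "n = r - h"
  have adjs: "adj r = r" "adj c = c" "adj n = n"
    using r(1) c(1) h by (auto simp: psd_def n_def adj_diff)
  have cn: "c * n = n * c" using c(3)[of n] rh by (simp add: n_def algebra_simps)
  have hn: "h * n = - (r * n)" using r(2) rh by (simp add: n_def algebra_simps)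
  define z where "z = y * n"
  have "adj z * z = n * (h * n)" by (simp add: z_def h_def adj_mult adjs mult.assoc)
  also have "\<dots> = - ((c * n) * (c * n))" by (simp add: hn c(2)[symmetric] cn mult.assoc)
  finally have zz: "adj z * z = - ((c * n) * (c * n))" .
  have q: "psd ((c * n) * (c * n))" by (rule psd_square) (simp add: adj_mult adjs cn)
  define a where "a = z + adj z"
  define b where "b = scaleC \<i> (z - adj z)"
  have ab: "adj a = a" "adj b = b"
    by (simp_all add: a_def b_def adj_add adj_diff adj_adj adj_scaleC scaleC_simps add.commute)
  have "z * adj z = (1/2) *\<^sub>R (a * a + b * b) + (c * n) * (c * n)"
  proof -
    have "a * a + b * b = 2 *\<^sub>R (z * adj z + adj z * z)"
      by (simp add: a_def b_def scaleC_simps algebra_simps scaleR_2)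
    then show ?thesis using zz by simp
  qed
  then have "psd (z * adj z)"
    using psd_square ab q by (auto intro!: psd_add psd_scale)
  then have "psd (adj z * z)" by (rule psd_commute)
  then have "adj z * z = 0" using q zz by (intro psd_uminus_eq_0) auto
  then have "z = 0" by (rule adj_mult_eq_0)
  then have "h * n = 0" by (simp add: h_def mult.assoc flip: z_def)
  then have "adj n * n = 0" using hn by (simp add: adjs) (simp add: n_def left_diff_distrib)
  then have "n = 0" by (rule adj_mult_eq_0)
  then show ?thesis using r(1) by (simp add: n_def h_def)
qed

text \<open>With t = \<open>norm (x + y)\<close> the element t - x is the sum of the positive
  elements t - (x + y) and y. The roots of x and of t - x commute and their squares add up to
  t.\<close>

lemma norm_psd_mono:
  assumes "psd x" "psd (y :: 'a)" shows "norm x \<le> norm (x + y)"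
proof -
  define t where "t = norm (x + y)"
  have "psd (t *\<^sub>R 1 - (x + y))"
    using assms unfolding psd_def t_def
    by (intro conjI exI[of _ "norm (x + y)"]) (simp_all add: adj_diff adj_add adj_scaleR adj_one add.commute)
  from psd_add[OF this assms(2)] have "psd (t *\<^sub>R 1 - x)" by simp
  then obtain s where s: "psd s" "s * s = t *\<^sub>R 1 - x" using psd_sqrt by blast
  obtain r where r: "psd r" "r * r = x" "\<And>b. x * b = b * x \<Longrightarrow> r * b = b * r"
    using psd_sqrt[OF assms(1)] by blast
  have "x = t *\<^sub>R 1 - s * s" using s by simp
  then have "x * s = s * x" by (simp only: left_diff_distrib right_diff_distrib) (simp add: mult.assoc)
  then have "r * s = s * r" by (rule r(3))
  then show ?thesis
    using norm_le_unitary_part[of r s t] r(1,2) s by (simp add: psd_def t_def)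
qed

end

subsection \<open>States\<close>

definition sublinear :: "('a::real_vector \<Rightarrow> real) \<Rightarrow> bool" where
  "sublinear p \<longleftrightarrow> (\<forall>x y. p (x + y) \<le> p x + p y) \<and> (\<forall>c>0. \<forall>x. p (c *\<^sub>R x) = c * p x)"

lemma sublinearD:
  assumes "sublinear p"
  shows "p (x + y) \<le> p x + p y" "c > 0 \<Longrightarrow> p (c *\<^sub>R x) = c * p x" "p 0 = 0" "- p (- x) \<le> p x"
proof -
  show 1: "p (x + y) \<le> p x + p y" "c > 0 \<Longrightarrow> p (c *\<^sub>R x) = c * p x" for x y c
    using assms by (auto simp: sublinear_def)
  show 2: "p 0 = 0" using 1(2)[of 2 0] by simp
  show "- p (- x) \<le> p x" using 1(1)[of x "- x"] 2 by simp
qed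

lemma sublinearI:
  assumes "\<And>x y. p (x + y) \<le> p x + p y" "\<And>c x. c > 0 \<Longrightarrow> p (c *\<^sub>R x) \<le> c * p x"
  shows "sublinear p"
  unfolding sublinear_def
proof (intro conjI allI impI antisym)
  fix c :: real and x assume c: "c > 0"
  have "p x \<le> inverse c * p (c *\<^sub>R x)" using assms(2)[of "inverse c" "c *\<^sub>R x"] c by simp
  then show "c * p x \<le> p (c *\<^sub>R x)" using c by (simp add: field_simps)
qed (use assms in auto)

text \<open>Lowers p just enough to admit the slope \<open>p h\<close> in the direction h: at - h
  the new value is at most - \<open>p h\<close>. A linear functional below the tilted functional
  therefore takes the value \<open>p h\<close> at h.\<close>

definition tilt :: "('a::real_vector \<Rightarrow> real) \<Rightarrow> 'a \<Rightarrow> 'a \<Rightarrow> real" where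
  "tilt p h x = (INF t\<in>{0..}. p (x + t *\<^sub>R h) - t * p h)"

lemma tilt:
  assumes p: "sublinear p"
  shows "sublinear (tilt p h)" "tilt p h x \<le> p x" "tilt p h (- h) \<le> - p h"
proof -
  have hom: "p (t *\<^sub>R h) = t * p h" if "t \<ge> 0" for t
    using sublinearD(2,3)[OF p] that by (cases "t = 0") auto
  have bdd: "bdd_below ((\<lambda>t. p (x + t *\<^sub>R h) - t * p h) ` {0..})" for x
  proof (rule bdd_belowI2)
    fix t :: real assume "t \<in> {0..}"
    then show "- p (- x) \<le> p (x + t *\<^sub>R h) - t * p h"
      using sublinearD(1)[OF p, of "x + t *\<^sub>R h" "- x"] hom[of t] by simp
  qed
  have le: "tilt p h x \<le> p (x + t *\<^sub>R h) - t * p h" if "t \<ge> 0" for t x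
    unfolding tilt_def using that by (intro cINF_lower bdd) auto
  have ge: "K \<le> tilt p h x" if "\<And>t. t \<ge> 0 \<Longrightarrow> K \<le> p (x + t *\<^sub>R h) - t * p h" for K x
    unfolding tilt_def using that by (intro cINF_greatest) auto
  show "tilt p h x \<le> p x" using le[of 0 x] by simp
  show "tilt p h (- h) \<le> - p h" using le[of 1 "-h"] sublinearD(3)[OF p] by simp
  show "sublinear (tilt p h)"
  proof (rule sublinearI)
    fix x y
    have "tilt p h (x + y) - (p (y + s *\<^sub>R h) - s * p h) \<le> tilt p h x" if s: "s \<ge> 0" for s
    proof (rule ge)
      fix t :: real assume t: "t \<ge> 0"
      have "tilt p h (x + y) \<le> p (x + y + (t + s) *\<^sub>R h) - (t + s) * p h" using s t by (intro le) auto
      also have "p (x + y + (t + s) *\<^sub>R h) \<le> p (x + t *\<^sub>R h) + p (y + s *\<^sub>R h)"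
        using sublinearD(1)[OF p, of "x + t *\<^sub>R h" "y + s *\<^sub>R h"] by (simp add: algebra_simps)
      finally show "tilt p h (x + y) - (p (y + s *\<^sub>R h) - s * p h) \<le> p (x + t *\<^sub>R h) - t * p h"
        by (simp add: algebra_simps)
    qed
    then have "tilt p h (x + y) - tilt p h x \<le> tilt p h y"
      by (intro ge) (simp add: algebra_simps)
    then show "tilt p h (x + y) \<le> tilt p h x + tilt p h y" by simp
  next
    fix c :: real and x assume c: "c > 0"
    have "inverse c * tilt p h (c *\<^sub>R x) \<le> tilt p h x"
    proof (rule ge)
      fix t :: real assume t: "t \<ge> 0"
      have "tilt p h (c *\<^sub>R x) \<le> p (c *\<^sub>R x + (c * t) *\<^sub>R h) - (c * t) * p h" using c t by (intro le) auto
      also have "c *\<^sub>R x + (c * t) *\<^sub>R h = c *\<^sub>R (x + t *\<^sub>R h)" by (simp add: scaleR_add_right)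
      also have "p (c *\<^sub>R (x + t *\<^sub>R h)) = c * p (x + t *\<^sub>R h)" by (rule sublinearD(2)[OF p c])
      finally show "inverse c * tilt p h (c *\<^sub>R x) \<le> p (x + t *\<^sub>R h) - t * p h"
        using c by (simp add: field_simps)
    qed
    then show "tilt p h (c *\<^sub>R x) \<le> c * tilt p h x" using c by (simp add: field_simps)
  qed
qed

text \<open>A minimal sublinear functional coincides with all its tilts, and is therefore linear.\<close>

lemma hahn_banach_sublinear:
  assumes p: "sublinear (p :: 'a::real_vector \<Rightarrow> real)"
  obtains f where "linear f" "\<And>x. f x \<le> p x"
proof -
  define S where "S = {q. sublinear q \<and> q \<le> p}"
  have "\<exists>m\<in>S. \<forall>q\<in>S. q \<le> m \<longrightarrow> q = m"
  \<comment> \<open>The order is reversed, so that a maximal element is a minimal sublinear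
    functional.\<close>
  proof (rule predicate_Zorn)
    show "partial_order_on S (relation_of (\<lambda>q m. m \<le> q) S)"
      by (auto simp: partial_order_on_def preorder_on_def refl_on_def trans_def antisym_def relation_of_def)
    fix C assume "C \<in> Chains (relation_of (\<lambda>q m. m \<le> q) S)"
    then have CS: "C \<subseteq> S" and chain: "\<And>q r. q \<in> C \<Longrightarrow> r \<in> C \<Longrightarrow> q \<le> r \<or> r \<le> q"
      by (auto simp: Chains_def relation_of_def)
    show "\<exists>u\<in>S. \<forall>q\<in>C. u \<le> q"
    proof (cases "C = {}")
      case True then show ?thesis using p by (auto simp: S_def)
    next
      case False
      define u where "u x = (INF q\<in>C. q x)" for x
      have bdd: "bdd_below ((\<lambda>q. q x) ` C)" for x
      proof (rule bdd_belowI2)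
        fix q assume "q \<in> C"
        then have "sublinear q" "q (- x) \<le> p (- x)" using CS by (auto simp: S_def le_fun_def)
        then show "- p (- x) \<le> q x" using sublinearD(4)[of q x] by linarith
      qed
      have le: "u x \<le> q x" if "q \<in> C" for q x
        unfolding u_def using that by (intro cINF_lower bdd)
      have ge: "K \<le> u x" if "\<And>q. q \<in> C \<Longrightarrow> K \<le> q x" for K x
        unfolding u_def using that False by (intro cINF_greatest)
      have "sublinear u"
      proof (rule sublinearI)
        fix x y
        have "u (x + y) - r y \<le> u x" if r: "r \<in> C" for r
        proof (rule ge)
          fix q assume q: "q \<in> C"
          \<comment> \<open>Subadditivity passes to the pointwise infimum because two members of the
            chain have a member below both.\<close>
          obtain s where s: "s \<in> C" "s \<le> q" "s \<le> r" using chain[OF q r] q r by auto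
          then have "sublinear s" using CS by (auto simp: S_def)
          then have "u (x + y) \<le> s x + s y" using le[OF s(1), of "x + y"] sublinearD(1) order_trans by blast
          then show "u (x + y) - r y \<le> q x" using add_mono[of "s x" "q x" "s y" "r y"] le_funD[OF s(2), of x] le_funD[OF s(3), of y] by linarith
        qed
        then have "u (x + y) - u x \<le> u y" by (intro ge) (simp add: algebra_simps)
        then show "u (x + y) \<le> u x + u y" by simp
      next
        fix c :: real and x assume c: "c > 0"
        have "inverse c * u (c *\<^sub>R x) \<le> u x"
        proof (rule ge)
          fix q assume q: "q \<in> C"
          then have "sublinear q" using CS by (auto simp: S_def)
          then show "inverse c * u (c *\<^sub>R x) \<le> q x"
            using le[OF q, of "c *\<^sub>R x"] c sublinearD(2)[of q c x] by (simp add: field_simps)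
        qed
        then show "u (c *\<^sub>R x) \<le> c * u x" using c by (simp add: field_simps)
      qed
      moreover obtain q where "q \<in> C" using False by blast
      then have "u \<le> q" "q \<le> p" using le CS by (auto simp: S_def le_fun_def)
      then have "u \<le> p" by (rule order_trans)
      ultimately show ?thesis using le by (auto simp: S_def le_fun_def intro!: bexI[of _ u])
    qed
  qed
  then obtain m where m: "sublinear m" "m \<le> p" and min: "\<And>q. sublinear q \<Longrightarrow> q \<le> m \<Longrightarrow> q = m"
    by (auto simp: S_def)
  have neg: "m (- h) = - m h" for h
  proof -
    have "tilt m h = m" using tilt(1,2)[OF m(1)] by (intro min) (auto simp: le_fun_def)
    then have "m (- h) \<le> - m h" using tilt(3)[OF m(1), of h] by simp
    then show ?thesis using sublinearD(4)[OF m(1), of h] by simp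
  qed
  have add: "m (x + y) = m x + m y" for x y
    using sublinearD(1)[OF m(1), of x y] sublinearD(1)[OF m(1), of "x + y" "- y"] by (simp add: neg)
  have "m (c *\<^sub>R x) = c * m x" for c x
  proof (cases c "0::real" rule: linorder_cases)
    case less
    then have "m ((- c) *\<^sub>R x) = - c * m x" using sublinearD(2)[OF m(1), of "- c" x] by simp
    then show ?thesis using neg[of "c *\<^sub>R x"] by simp
  qed (use sublinearD(2,3)[OF m(1)] in auto)
  then have "linear m" by (intro linearI add) simp
  then show thesis using that m(2) by (auto simp: le_fun_def)
qed

text \<open>The functional p measures the distance of the real part of x from the cone of negative
  elements. A linear functional below p is nonnegative on positive elements, vanishes on
  skew-adjoint ones and is bounded by the norm. Tilting p at h = \<open>adj a * a\<close> forces the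
  value \<open>p h\<close>, which is \<open>norm h\<close> by \<open>norm_psd_mono\<close>. The real
  functional f is complexified as f x - \<i> f (\<i> x).\<close>

lemma state_exists_unital:
  fixes a :: "'a::{cstar_type, real_normed_algebra_1}"
  obtains F :: "'a \<Rightarrow> complex" where "\<And>x y. F (x + y) = F x + F y" "\<And>c x. F (scaleC c x) = c * F x"
    "\<And>x. \<exists>r\<ge>0. F (adj x * x) = complex_of_real r" "\<And>x. cmod (F x) \<le> norm x"
    "F (adj a * a) = complex_of_real ((norm a)\<^sup>2)"
proof -
  define R :: "'a \<Rightarrow> 'a" where "R x = (1/2) *\<^sub>R (x + adj x)" for x
  define p :: "'a \<Rightarrow> real" where "p x = (INF y\<in>{y. psd y}. norm (R x + y))" for x
  have R_add: "R (x + y) = R x + R y" for x y by (simp add: R_def adj_add scaleR_add_right algebra_simps)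
  have R_scale: "R (c *\<^sub>R x) = c *\<^sub>R R x" for c x by (simp add: R_def adj_scaleR scaleR_add_right)
  have R_psd: "R x = x" if "psd x" for x
    using that by (simp add: R_def psd_def flip: scaleR_2)
  have le: "p x \<le> norm (R x + y)" if "psd y" for x y
    unfolding p_def using that by (intro cINF_lower bdd_belowI2[where m=0]) auto
  have ge: "K \<le> p x" if "\<And>y. psd y \<Longrightarrow> K \<le> norm (R x + y)" for K x
    unfolding p_def using that psd_zero by (intro cINF_greatest) auto
  have sub: "sublinear p"
  proof (rule sublinearI)
    fix x y
    have "p (x + y) - norm (R y + w) \<le> p x" if w: "psd w" for w
    proof (rule ge)
      fix v :: 'a assume v: "psd v"
      have "p (x + y) \<le> norm ((R x + v) + (R y + w))"
        using le[OF psd_add[OF v w], of "x + y"] by (simp add: R_add algebra_simps)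
      then show "p (x + y) - norm (R y + w) \<le> norm (R x + v)"
        using norm_triangle_ineq[of "R x + v" "R y + w"] by linarith
    qed
    then have "p (x + y) - p x \<le> p y" by (intro ge) (simp add: algebra_simps)
    then show "p (x + y) \<le> p x + p y" by simp
  next
    fix c :: real and x assume c: "c > 0"
    have "inverse c * p (c *\<^sub>R x) \<le> p x"
    proof (rule ge)
      fix y :: 'a assume y: "psd y"
      have "p (c *\<^sub>R x) \<le> norm (R (c *\<^sub>R x) + c *\<^sub>R y)" using c y by (intro le psd_scale) auto
      also have "R (c *\<^sub>R x) + c *\<^sub>R y = c *\<^sub>R (R x + y)" by (simp add: R_scale scaleR_add_right)
      also have "norm (c *\<^sub>R (R x + y)) = c * norm (R x + y)" using c by simp
      finally show "inverse c * p (c *\<^sub>R x) \<le> norm (R x + y)" using c by (simp add: field_simps)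
    qed
    then show "p (c *\<^sub>R x) \<le> c * p x" using c by (simp add: field_simps)
  qed
  define h where "h = adj a * a"
  have h: "psd h" by (simp add: h_def psd_adj_mult)
  obtain f where f: "linear f" "\<And>x. f x \<le> tilt p h x"
    using hahn_banach_sublinear[OF tilt(1)[OF sub]] by blast
  have fp: "f x \<le> p x" for x using f(2)[of x] tilt(2)[OF sub] by (rule order_trans)
  note lin = linear_add[OF f(1)] linear_scale[OF f(1)] linear_neg[OF f(1)]
  have psd: "f x \<ge> 0" if "psd x" for x
  proof -
    have "p (- x) \<le> 0" using le[OF that, of "- x"] that R_scale[of "-1" x] by (simp add: R_psd)
    then show ?thesis using fp[of "- x"] lin(3)[of x] by simp
  qed
  have skew: "f x = 0" if "adj x = - x" for x
  proof -
    have "p x \<le> 0" "p (- x) \<le> 0"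
      using le[OF psd_zero, of x] le[OF psd_zero, of "- x"] that by (auto simp: R_def adj_minus)
    then show ?thesis using fp[of x] fp[of "- x"] lin(3)[of x] by simp
  qed
  have f_norm: "f x \<le> norm x" for x
  proof -
    have "norm (R x) \<le> norm x"
      using norm_triangle_ineq[of x "adj x"] by (simp add: R_def norm_adj)
    then show ?thesis using fp[of x] le[OF psd_zero, of x] by simp
  qed
  have "p h = (norm a)\<^sup>2"
    unfolding norm_adj_mult[symmetric] h_def[symmetric]
  proof (rule antisym)
    show "p h \<le> norm h" using le[OF psd_zero, of h] h by (simp add: R_psd)
    show "norm h \<le> p h" using norm_psd_mono[OF h] h by (intro ge) (simp add: R_psd)
  qed
  then have fh: "f h = (norm a)\<^sup>2"
    using fp[of h] f(2)[of "- h"] tilt(3)[OF sub, of h] lin(3)[of h] by simp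
  have f_C: "f (scaleC c x) = Re c * f x + Im c * f (scaleC \<i> x)" for c x
  proof -
    have "scaleC c x = Re c *\<^sub>R x + Im c *\<^sub>R scaleC \<i> x"
      by (subst complex_eq[of c]) (simp add: scaleC_add_left scaleC_scaleC mult.commute flip: scaleC_of_real)
    then show ?thesis by (simp add: lin)
  qed
  define F where "F x = Complex (f x) (- f (scaleC \<i> x))" for x
  have F_C: "F (scaleC c x) = c * F x" for c x
    using f_C[of c x] f_C[of "\<i> * c" x] by (simp add: F_def complex_eq_iff scaleC_scaleC)
  have sq: "F (adj x * x) = complex_of_real (f (adj x * x))" for x
    using skew[of "scaleC \<i> (adj x * x)"]
    by (simp add: F_def complex_eq_iff adj_scaleC adj_mult adj_adj scaleC_minus_left)
  show thesis
  proof (rule that[of F])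
    show "F (x + y) = F x + F y" for x y by (simp add: F_def complex_eq_iff scaleC_add_right lin)
    show "F (scaleC c x) = c * F x" for c x by (rule F_C)
    show "\<exists>r\<ge>0. F (adj x * x) = complex_of_real r" for x
      using sq psd[OF psd_adj_mult] by blast
    show "F (adj a * a) = complex_of_real ((norm a)\<^sup>2)" using sq[of a] fh by (simp add: h_def)
    show "cmod (F x) \<le> norm x" for x
    proof -
      \<comment> \<open>Rotating x by the phase of \<open>F x\<close> makes the value real, where
        the bound for f applies.\<close>
      define c where "c = cnj (sgn (F x))"
      have "F (scaleC c x) = complex_of_real (cmod (F x))"
        unfolding F_C c_def by (cases "F x = 0")
          (auto simp: sgn_div_norm complex_norm_square[symmetric] scaleR_conv_of_real power2_eq_square field_simps)
      then have "cmod (F x) = f (scaleC c x)" by (simp add: F_def complex_eq_iff)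
      also have "\<dots> \<le> cmod c * norm x" using f_norm[of "scaleC c x"] by (simp add: norm_scaleC)
      also have "\<dots> \<le> 1 * norm x"
        by (intro mult_right_mono) (auto simp: c_def norm_sgn)
      finally show ?thesis by simp
    qed
  qed
qed

text \<open>Restriction of a functional on the unitization, which contains the algebra
  isometrically.\<close>

lemma state_exists:
  fixes a :: "'a::cstar_type"
  obtains F :: "'a \<Rightarrow> complex" where "\<And>x y. F (x + y) = F x + F y" "\<And>c x. F (scaleC c x) = c * F x"
    "\<And>x. \<exists>r\<ge>0. F (adj x * x) = complex_of_real r" "\<And>x. cmod (F x) \<le> norm x"
    "F (adj a * a) = complex_of_real ((norm a)\<^sup>2)"
proof -
  obtain F :: "'a unitz \<Rightarrow> complex" where F: "\<And>x y. F (x + y) = F x + F y" "\<And>c x. F (scaleC c x) = c * F x"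
    "\<And>x. \<exists>r\<ge>0. F (adj x * x) = complex_of_real r" "\<And>x. cmod (F x) \<le> norm x"
    "F (adj (Unitz 0 a) * Unitz 0 a) = complex_of_real ((norm (Unitz 0 a))\<^sup>2)"
    by (rule state_exists_unital[of "Unitz 0 a"]) blast
  show thesis
    using F F(4)[of "Unitz 0 _"]
    by (intro that[of "\<lambda>x. F (Unitz 0 x)"])
      (simp_all add: Unitz_add Unitz_mult Unitz_scaleC Unitz_adj norm_vec_unitz)
qed

subsection \<open>Quotients and completions\<close>

text \<open>Null sequences and tensor relations both turn out to be the relation of having equal
  images under a map into a C*-algebra. In this form the quotient operations are well defined for
  the same reason in both cases.\<close>

definition fiber_rel :: "'b star_alg \<Rightarrow> ('b \<Rightarrow> 'a) \<Rightarrow> ('b \<times> 'b) set" where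
  "fiber_rel S L = {(x, y). x \<in> carrier S \<and> y \<in> carrier S \<and> L x = L y}"

definition fiber_val :: "('b \<Rightarrow> 'a) \<Rightarrow> 'b set \<Rightarrow> 'a" where
  "fiber_val L X = L (SOME x. x \<in> X)"

lemma fiber_val_eq:
  assumes "x \<in> carrier S"
  shows "fiber_val L (fiber_rel S L `` {x}) = L x"
proof -
  have "x \<in> fiber_rel S L `` {x}" using assms by (simp add: fiber_rel_def)
  moreover have "L y = L x" if "y \<in> fiber_rel S L `` {x}" for y using that by (simp add: fiber_rel_def)
  ultimately show ?thesis unfolding fiber_val_def by (meson someI)
qed

lemma fiber_class_eqI:
  assumes "L x = L y" "x \<in> carrier S" "y \<in> carrier S"
  shows "fiber_rel S L `` {x} = fiber_rel S L `` {y}"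
  using assms by (auto simp: fiber_rel_def)

lemma fiber_UN:
  assumes x: "x \<in> carrier S" and g: "\<And>y. y \<in> carrier S \<Longrightarrow> L y = L x \<Longrightarrow> G y = G x"
  shows "(\<Union>y\<in>fiber_rel S L `` {x}. G y) = G x"
proof -
  have "y \<in> carrier S" "L y = L x" if "y \<in> fiber_rel S L `` {x}" for y
    using that by (auto simp: fiber_rel_def)
  then have "G y = G x" if "y \<in> fiber_rel S L `` {x}" for y using that g by blast
  moreover have "x \<in> fiber_rel S L `` {x}" using x by (simp add: fiber_rel_def)
  ultimately show ?thesis by blast
qed

lemma quotient_class:
  assumes "X \<in> carrier S // fiber_rel S L"
  obtains x where "x \<in> carrier S" "X = fiber_rel S L `` {x}"
  using assms by (auto elim: quotientE)

text \<open>The operations and the norm of S depend on the fibres of L only, because L preserves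
  them. Hence L factors through the quotient, injectively and isometrically.\<close>

lemma quotient_rep:
  fixes L :: "'b \<Rightarrow> 'a::cstar_type"
  assumes iso: "isometric_rep S L"
  defines "R \<equiv> fiber_rel S L"
  shows "faithful_rep (quotient_alg S R) (fiber_val L)"
    and "fiber_val L ` carrier (quotient_alg S R) = L ` carrier S"
proof -
  have rep: "star_rep S L" and nrm: "\<And>x. x \<in> carrier S \<Longrightarrow> nrm S x = norm (L x)"
    using iso by (auto simp: isometric_rep_def)
  note D = star_repD[OF rep]
  have val: "fiber_val L (R `` {x}) = L x" if "x \<in> carrier S" for x
    using that by (simp add: R_def fiber_val_eq)
  have cls: "R `` {x} \<in> carrier S // R" if "x \<in> carrier S" for x
    using that by (rule quotientI)
  have UN: "(\<Union>y\<in>R `` {x}. R `` {g y}) = R `` {g x}"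
    if x: "x \<in> carrier S" and g: "\<And>y. y \<in> carrier S \<Longrightarrow> g y \<in> carrier S"
      and Lg: "\<And>y. y \<in> carrier S \<Longrightarrow> L y = L x \<Longrightarrow> L (g y) = L (g x)" for x g
    unfolding R_def
  proof (rule fiber_UN[OF x])
    fix y assume "y \<in> carrier S" "L y = L x"
    then show "fiber_rel S L `` {g y} = fiber_rel S L `` {g x}"
      by (intro fiber_class_eqI Lg g x)
  qed
  have UN2: "(\<Union>x'\<in>R `` {x}. \<Union>y'\<in>R `` {y}. R `` {g x' y'}) = R `` {g x y}"
    if x: "x \<in> carrier S" and y: "y \<in> carrier S"
      and g: "\<And>x y. x \<in> carrier S \<Longrightarrow> y \<in> carrier S \<Longrightarrow> g x y \<in> carrier S"
      and Lg: "\<And>x' y'. x' \<in> carrier S \<Longrightarrow> y' \<in> carrier S \<Longrightarrow> L x' = L x \<Longrightarrow> L y' = L y \<Longrightarrow>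
        L (g x' y') = L (g x y)"
    for x y g
  proof -
    have inner: "(\<Union>y'\<in>R `` {y}. R `` {g x' y'}) = R `` {g x y}" if x': "x' \<in> carrier S" "L x' = L x" for x'
    proof -
      have "(\<Union>y'\<in>R `` {y}. R `` {g x' y'}) = R `` {g x' y}"
      proof (rule UN[OF y g[OF x'(1)]])
        fix z assume "z \<in> carrier S" "L z = L y"
        from Lg[OF x'(1) this(1) x'(2) this(2)] Lg[OF x'(1) y x'(2) refl]
        show "L (g x' z) = L (g x' y)" by (rule trans[OF _ sym])
      qed
      also have "\<dots> = R `` {g x y}"
        unfolding R_def by (rule fiber_class_eqI[OF Lg[OF x'(1) y x'(2) refl] g[OF x'(1) y] g[OF x y]])
      finally show ?thesis .
    qed
    have "(\<Union>x'\<in>fiber_rel S L `` {x}. \<Union>y'\<in>R `` {y}. R `` {g x' y'}) = (\<Union>y'\<in>R `` {y}. R `` {g x y'})"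
      by (rule fiber_UN[OF x]) (simp only: inner x)
    also have "\<dots> = R `` {g x y}" by (rule inner[OF x refl])
    finally show ?thesis by (simp only: R_def)
  qed
  show "fiber_val L ` carrier (quotient_alg S R) = L ` carrier S"
    by (force simp: quotient_alg_def R_def image_iff val[unfolded R_def] intro!: cls[unfolded R_def] elim!: quotient_class)
  show "faithful_rep (quotient_alg S R) (fiber_val L)"
    unfolding faithful_rep_def isometric_rep_def star_rep_def
  proof (intro conjI ballI allI)
    show "inj_on (fiber_val L) (carrier (quotient_alg S R))"
    proof (rule inj_onI)
      fix X Y assume "X \<in> carrier (quotient_alg S R)" "Y \<in> carrier (quotient_alg S R)"
        and eq: "fiber_val L X = fiber_val L Y"
      then obtain x y where "x \<in> carrier S" "X = R `` {x}" "y \<in> carrier S" "Y = R `` {y}"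
        by (auto simp: quotient_alg_def R_def elim!: quotient_class)
      moreover from this have "L x = L y" using eq by (simp add: val)
      ultimately show "X = Y" by (simp add: R_def fiber_class_eqI[of L x y])
    qed
    show "\<zero>\<^bsub>quotient_alg S R\<^esub> \<in> carrier (quotient_alg S R)" "fiber_val L \<zero>\<^bsub>quotient_alg S R\<^esub> = 0"
      by (simp_all add: quotient_alg_def cls val D)
    fix X assume "X \<in> carrier (quotient_alg S R)"
    then obtain x where x: "x \<in> carrier S" and X: "X = R `` {x}"
      by (auto simp: quotient_alg_def R_def elim: quotient_class)
    have 1: "star (quotient_alg S R) X = R `` {star S x}"
      unfolding X quotient_alg_def star_alg.simps using x by (intro UN) (auto simp: D)
    then show "star (quotient_alg S R) X \<in> carrier (quotient_alg S R)"
      "fiber_val L (star (quotient_alg S R) X) = adj (fiber_val L X)"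
      unfolding 1 by (simp_all add: quotient_alg_def cls val D X x)
    have 2: "c \<odot>\<^bsub>quotient_alg S R\<^esub> X = R `` {c \<odot>\<^bsub>S\<^esub> x}" for c
      unfolding X quotient_alg_def module.simps using x by (intro UN) (auto simp: D)
    then show "c \<odot>\<^bsub>quotient_alg S R\<^esub> X \<in> carrier (quotient_alg S R)"
      "fiber_val L (c \<odot>\<^bsub>quotient_alg S R\<^esub> X) = scaleC c (fiber_val L X)" for c
      unfolding 2 by (simp_all add: quotient_alg_def cls val D X x)
    have "x \<in> R `` {x}" using x by (simp add: R_def fiber_rel_def)
    then have "(THE r. \<forall>y\<in>R `` {x}. nrm S y = r) = nrm S x"
      by (intro the_equality) (auto simp: R_def fiber_rel_def nrm)
    then show "nrm (quotient_alg S R) X = norm (fiber_val L X)"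
      by (simp add: quotient_alg_def X val x nrm)
    fix Y assume "Y \<in> carrier (quotient_alg S R)"
    then obtain y where y: "y \<in> carrier S" and Y: "Y = R `` {y}"
      by (auto simp: quotient_alg_def R_def elim: quotient_class)
    have 3: "X \<oplus>\<^bsub>quotient_alg S R\<^esub> Y = R `` {x \<oplus>\<^bsub>S\<^esub> y}"
      unfolding X Y quotient_alg_def ring.simps using x y by (intro UN2) (auto simp: D)
    then show "X \<oplus>\<^bsub>quotient_alg S R\<^esub> Y \<in> carrier (quotient_alg S R)"
      "fiber_val L (X \<oplus>\<^bsub>quotient_alg S R\<^esub> Y) = fiber_val L X + fiber_val L Y"
      unfolding 3 by (simp_all add: quotient_alg_def cls val D X Y x y)
    have 4: "X \<otimes>\<^bsub>quotient_alg S R\<^esub> Y = R `` {x \<otimes>\<^bsub>S\<^esub> y}"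
      unfolding X Y quotient_alg_def monoid.simps using x y by (intro UN2) (auto simp: D)
    then show "X \<otimes>\<^bsub>quotient_alg S R\<^esub> Y \<in> carrier (quotient_alg S R)"
      "fiber_val L (X \<otimes>\<^bsub>quotient_alg S R\<^esub> Y) = fiber_val L X * fiber_val L Y"
      unfolding 4 by (simp_all add: quotient_alg_def cls val D X Y x y)
  qed
qed

lemma quotient_map_fiber:
  assumes X: "X \<in> carrier (quotient_alg S (fiber_rel S L))"
    and g: "\<And>x. x \<in> carrier S \<Longrightarrow> g x \<in> carrier S" "\<And>x. x \<in> carrier S \<Longrightarrow> L (g x) = \<gamma> (L x)"
  shows "quotient_map (fiber_rel S L) g X \<in> carrier (quotient_alg S (fiber_rel S L))"
    and "fiber_val L (quotient_map (fiber_rel S L) g X) = \<gamma> (fiber_val L X)"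
proof -
  obtain x where x: "x \<in> carrier S" and X: "X = fiber_rel S L `` {x}"
    using X by (auto simp: quotient_alg_def elim: quotient_class)
  have 1: "quotient_map (fiber_rel S L) g X = fiber_rel S L `` {g x}"
    unfolding quotient_map_def X using x by (intro fiber_UN fiber_class_eqI) (auto simp: g)
  then show "quotient_map (fiber_rel S L) g X \<in> carrier (quotient_alg S (fiber_rel S L))"
    "fiber_val L (quotient_map (fiber_rel S L) g X) = \<gamma> (fiber_val L X)"
    by (simp_all add: quotient_alg_def quotientI X x g fiber_val_eq)
qed

text \<open>
  \<open>realizes K \<kappa> h I \<gamma>\<close>: the algebra \<open>K\<close> with the grading \<open>\<kappa>\<close> is identified by \<open>h\<close> with \<open>I\<close> and \<open>\<gamma>\<close>.
\<close>

definition realizes ::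
  "'b star_alg \<Rightarrow> ('b \<Rightarrow> 'b) \<Rightarrow> ('b \<Rightarrow> 'a::cstar_type) \<Rightarrow> 'a set \<Rightarrow> ('a \<Rightarrow> 'a) \<Rightarrow> bool" where
  "realizes K \<kappa> h I \<gamma> \<longleftrightarrow> faithful_rep K h \<and> h ` carrier K = I \<and>
     (\<forall>x\<in>carrier K. \<kappa> x \<in> carrier K \<and> h (\<kappa> x) = \<gamma> (h x))"

lemma realizesD:
  assumes "realizes K \<kappa> h I \<gamma>"
  shows "faithful_rep K h" "star_rep K h" "inj_on h (carrier K)" "h ` carrier K = I"
    "x \<in> carrier K \<Longrightarrow> \<kappa> x \<in> carrier K" "x \<in> carrier K \<Longrightarrow> h (\<kappa> x) = \<gamma> (h x)"
    "x \<in> carrier K \<Longrightarrow> nrm K x = norm (h x)" "x \<in> carrier K \<Longrightarrow> h x \<in> I"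
  using assms by (auto simp: realizes_def faithful_rep_def isometric_rep_def)

definition grading_on :: "'a::cstar_type set \<Rightarrow> ('a \<Rightarrow> 'a) \<Rightarrow> bool" where
  "grading_on I \<gamma> \<longleftrightarrow> closed I \<and> star_closed I \<and> star_hom_on I \<gamma> \<and> (\<forall>x\<in>I. \<gamma> x \<in> I \<and> \<gamma> (\<gamma> x) = x)"

lemma grading_onD:
  assumes "grading_on I \<gamma>"
  shows "closed I" "star_closed I" "star_hom_on I \<gamma>" "x \<in> I \<Longrightarrow> \<gamma> x \<in> I" "x \<in> I \<Longrightarrow> \<gamma> (\<gamma> x) = x"
  using assms by (auto simp: grading_on_def)

text \<open>Both \<gamma> and its inverse, again \<gamma>, are contractive.\<close>

lemma norm_grading: "grading_on I \<gamma> \<Longrightarrow> x \<in> I \<Longrightarrow> norm (\<gamma> x) = norm x"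
  using star_hom_contractive[of I \<gamma> x] star_hom_contractive[of I \<gamma> "\<gamma> x"]
  by (force simp: grading_on_def)

lemma continuous_on_grading:
  assumes "grading_on I \<gamma>" shows "continuous_on I \<gamma>"
  unfolding continuous_on_iff
proof (intro ballI allI impI)
  note G = grading_onD[OF assms]
  fix x e assume x: "x \<in> I" and "(0::real) < e"
  have "dist (\<gamma> y) (\<gamma> x) = dist y x" if "y \<in> I" for y
    using norm_grading[OF assms, of "y - x"] star_hom_on_diff[OF G(2,3) that x] x that star_closedD(8)[OF G(2)]
    by (simp add: dist_norm)
  then show "\<exists>d>0. \<forall>y\<in>I. dist y x < d \<longrightarrow> dist (\<gamma> y) (\<gamma> x) < e" using \<open>0 < e\<close> by auto
qed

lemma realizes_cstar:
  assumes "realizes K \<kappa> h I \<gamma>" "closed I"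
  shows "cstar_algebra K"
  using assms by (intro cstar_algebra_of_rep[of K h]) (auto simp: realizes_def)

lemma star_iso_via:
  assumes K: "faithful_rep K h" and K': "faithful_rep K' h'"
    and f: "bij_betw f (carrier K) (carrier K')"
    and \<psi>: "\<And>x. x \<in> carrier K \<Longrightarrow> h' (f x) = \<psi> (h x)" "star_hom_on (h ` carrier K) \<psi>"
  shows "star_iso K K' f"
proof -
  note D = star_repD[OF faithful_repD(1)[OF K]] and D' = star_repD[OF faithful_repD(1)[OF K']]
  note eqI = inj_onD[OF faithful_repD(2)[OF K']] and hom = star_hom_onD[OF \<psi>(2)]
  have in': "f x \<in> carrier K'" if "x \<in> carrier K" for x using f that by (auto simp: bij_betw_def)
  show ?thesis unfolding star_iso_def
  proof (intro conjI ballI allI f)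
    fix x assume x: "x \<in> carrier K"
    show "f (star K x) = star K' (f x)" by (rule eqI) (simp_all add: \<psi>(1) hom D D' in' x)
    show "f (c \<odot>\<^bsub>K\<^esub> x) = c \<odot>\<^bsub>K'\<^esub> f x" for c by (rule eqI) (simp_all add: \<psi>(1) hom D D' in' x)
    fix y assume y: "y \<in> carrier K"
    show "f (x \<oplus>\<^bsub>K\<^esub> y) = f x \<oplus>\<^bsub>K'\<^esub> f y" by (rule eqI) (simp_all add: \<psi>(1) hom D D' in' x y)
    show "f (x \<otimes>\<^bsub>K\<^esub> y) = f x \<otimes>\<^bsub>K'\<^esub> f y" by (rule eqI) (simp_all add: \<psi>(1) hom D D' in' x y)
  qed
qed

lemma realizes_graded_cstar:
  assumes K: "realizes K \<kappa> h I \<gamma>" and \<gamma>: "grading_on I \<gamma>"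
  shows "graded_cstar K \<kappa>"
proof -
  note R = realizesD[OF K] and G = grading_onD[OF \<gamma>]
  have invol: "\<kappa> (\<kappa> x) = x" if "x \<in> carrier K" for x
    using that by (intro inj_onD[OF R(3)]) (auto simp: R(5,6) G(5) R(8))
  then have "bij_betw \<kappa> (carrier K) (carrier K)"
    by (intro bij_betw_byWitness[where f'=\<kappa>]) (auto simp: R(5))
  then have "star_iso K K \<kappa>"
    using R(4,6) G(3) by (intro star_iso_via[OF R(1) R(1), of _ \<gamma>]) auto
  then show ?thesis using realizes_cstar[OF K G(1)] invol by (simp add: graded_cstar_def)
qed

text \<open>Two graded algebras with the same concrete model are isomorphic through h followed by
  the inverse of h'. This is the only way in which isomorphisms are produced in the end.\<close>

lemma realizes_graded_isomorphic:
  assumes K: "realizes K \<kappa> h I \<gamma>" and K': "realizes K' \<kappa>' h' I \<gamma>" and \<gamma>: "grading_on I \<gamma>"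
  shows "graded_isomorphic K \<kappa> K' \<kappa>'"
proof -
  note R = realizesD[OF K] and R' = realizesD[OF K'] and G = grading_onD[OF \<gamma>]
  define f where "f = inv_into (carrier K') h' \<circ> h"
  have bij: "bij_betw f (carrier K) (carrier K')"
    unfolding f_def using R(3,4) R'(3,4)
    by (intro bij_betw_trans[of h _ I] bij_betw_inv_into) (auto simp: bij_betw_def)
  have h'f: "h' (f x) = h x" if "x \<in> carrier K" for x
    using R(8)[OF that] R'(4) by (auto simp: f_def f_inv_into_f)
  have "star_iso K K' f"
    by (rule star_iso_via[OF R(1) R'(1) bij, of "\<lambda>x. x"]) (simp_all add: h'f star_hom_on_def)
  moreover have "f (\<kappa> x) = \<kappa>' (f x)" if x: "x \<in> carrier K" for x
  proof -
    have "f x \<in> carrier K'" using bij x by (auto simp: bij_betw_def)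
    then show ?thesis using x bij
      by (intro inj_onD[OF R'(3)]) (auto simp: h'f R R' bij_betw_def)
  qed
  ultimately show ?thesis
    using realizes_graded_cstar[OF K \<gamma>] realizes_graded_cstar[OF K' \<gamma>]
    by (auto simp: graded_isomorphic_def)
qed

text \<open>A Cauchy sequence of S is sent to the limit of its image. Two sequences differ by a null
  sequence exactly if these limits agree, so the completion is a quotient by fibres and its image is
  the closure. Here f need not be injective, as the norm of S may be only a seminorm.\<close>

lemma completion_realizes:
  fixes f :: "'b \<Rightarrow> 'a::cstar_type"
  assumes grp: "abelian_group S" and iso: "isometric_rep S f"
    and g: "\<And>x. x \<in> carrier S \<Longrightarrow> g x \<in> carrier S" "\<And>x. x \<in> carrier S \<Longrightarrow> f (g x) = \<gamma> (f x)"
    and \<gamma>: "continuous_on (closure (f ` carrier S)) \<gamma>"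
  shows "\<exists>h. realizes (completion S) (completion_map S g) h (closure (f ` carrier S)) \<gamma>"
proof -
  have rep: "star_rep S f" and nrm: "\<And>x. x \<in> carrier S \<Longrightarrow> nrm S x = norm (f x)"
    using iso by (auto simp: isometric_rep_def)
  note D = star_repD[OF rep] and diff = rep_diff[OF grp rep]
  have cauchy: "x \<in> cauchy_seqs S \<longleftrightarrow> (\<forall>n. x n \<in> carrier S) \<and> convergent (\<lambda>n. f (x n))" for x
  proof -
    have "x \<in> cauchy_seqs S \<longleftrightarrow> (\<forall>n. x n \<in> carrier S) \<and> Cauchy (\<lambda>n. f (x n))"
      by (auto simp: cauchy_seqs_def Cauchy_def dist_norm nrm diff)
    then show ?thesis by (simp add: Cauchy_convergent_iff)
  qed
  define L where "L x = lim (\<lambda>n. f (x n))" for x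
  have L: "(\<lambda>n. f (x n)) \<longlonglongrightarrow> L x" if "x \<in> cauchy_seqs S" for x
    using that by (simp add: L_def cauchy convergent_LIMSEQ_iff)
  have LI: "x \<in> cauchy_seqs S" "L x = l" if "\<And>n. x n \<in> carrier S" "(\<lambda>n. f (x n)) \<longlonglongrightarrow> l" for x l
    using that by (auto simp: L_def cauchy limI convergentI)
  have in_S: "x n \<in> carrier S" if "x \<in> cauchy_seqs S" for x n using that by (simp add: cauchy)
  have isoL: "isometric_rep (cauchy_alg S) L"
    unfolding isometric_rep_def star_rep_def cauchy_alg_def star_alg.simps ring.simps monoid.simps module.simps
      partial_object.simps
  proof (intro conjI ballI allI)
    show "(\<lambda>_. \<zero>\<^bsub>S\<^esub>) \<in> cauchy_seqs S" "L (\<lambda>_. \<zero>\<^bsub>S\<^esub>) = 0"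
      using LI[of "\<lambda>_. \<zero>\<^bsub>S\<^esub>" 0] by (simp_all add: D)
    fix x assume x: "x \<in> cauchy_seqs S"
    show "lim (\<lambda>n. nrm S (x n)) = norm (L x)"
      using tendsto_norm[OF L[OF x]] x by (intro limI) (simp add: nrm in_S)
    show "(\<lambda>n. star S (x n)) \<in> cauchy_seqs S" "L (\<lambda>n. star S (x n)) = adj (L x)"
      using LI[of "\<lambda>n. star S (x n)" "adj (L x)"] by (simp_all add: D in_S x tendsto_adj L)
    show "(\<lambda>n. c \<odot>\<^bsub>S\<^esub> x n) \<in> cauchy_seqs S" "L (\<lambda>n. c \<odot>\<^bsub>S\<^esub> x n) = scaleC c (L x)" for c
      using LI[of "\<lambda>n. c \<odot>\<^bsub>S\<^esub> x n" "scaleC c (L x)"] by (simp_all add: D in_S x tendsto_scaleC L)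
    fix y assume y: "y \<in> cauchy_seqs S"
    show "(\<lambda>n. x n \<oplus>\<^bsub>S\<^esub> y n) \<in> cauchy_seqs S" "L (\<lambda>n. x n \<oplus>\<^bsub>S\<^esub> y n) = L x + L y"
      using LI[of "\<lambda>n. x n \<oplus>\<^bsub>S\<^esub> y n" "L x + L y"] by (simp_all add: D in_S x y tendsto_add L)
    show "(\<lambda>n. x n \<otimes>\<^bsub>S\<^esub> y n) \<in> cauchy_seqs S" "L (\<lambda>n. x n \<otimes>\<^bsub>S\<^esub> y n) = L x * L y"
      using LI[of "\<lambda>n. x n \<otimes>\<^bsub>S\<^esub> y n" "L x * L y"] by (simp_all add: D in_S x y tendsto_mult L)
  qed
  have carr: "carrier (cauchy_alg S) = cauchy_seqs S" by (simp add: cauchy_alg_def)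
  have null: "null_rel S = fiber_rel (cauchy_alg S) L"
  proof -
    have "(\<lambda>n. nrm S (x n \<ominus>\<^bsub>S\<^esub> y n)) \<longlonglongrightarrow> 0 \<longleftrightarrow> L x = L y"
      if x: "x \<in> cauchy_seqs S" and y: "y \<in> cauchy_seqs S" for x y
    proof -
      have "(\<lambda>n. nrm S (x n \<ominus>\<^bsub>S\<^esub> y n)) = (\<lambda>n. norm (f (x n) - f (y n)))"
        using x y by (simp add: nrm diff in_S)
      moreover have "(\<lambda>n. norm (f (x n) - f (y n))) \<longlonglongrightarrow> norm (L x - L y)"
        by (intro tendsto_intros L x y)
      ultimately show ?thesis using LIMSEQ_unique by fastforce
    qed
    then show ?thesis by (auto simp: null_rel_def fiber_rel_def carr)
  qed
  have im: "L ` cauchy_seqs S = closure (f ` carrier S)"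
  proof (intro equalityI subsetI)
    fix l assume "l \<in> L ` cauchy_seqs S"
    then obtain x where x: "x \<in> cauchy_seqs S" "l = L x" by blast
    then show "l \<in> closure (f ` carrier S)"
      unfolding closure_sequential using L[OF x(1)] in_S[OF x(1)] by (intro exI[of _ "\<lambda>n. f (x n)"]) simp
  next
    fix l assume "l \<in> closure (f ` carrier S)"
    then obtain u where u: "\<And>n. u n \<in> f ` carrier S" "u \<longlonglongrightarrow> l" by (auto simp: closure_sequential)
    from u(1) have "\<forall>n. \<exists>x. x \<in> carrier S \<and> u n = f x" by blast
    then obtain x where x: "\<forall>n. x n \<in> carrier S \<and> u n = f (x n)" by (elim choice[THEN exE])
    then have "u = (\<lambda>n. f (x n))" by (simp add: fun_eq_iff)
    then have "(\<lambda>n. f (x n)) \<longlonglongrightarrow> l" using u(2) by (simp only:)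
    from LI[OF conjunct1[OF x[rule_format]] this] show "l \<in> L ` cauchy_seqs S" by blast
  qed
  have G: "(\<lambda>n. g (x n)) \<in> cauchy_seqs S" "L (\<lambda>n. g (x n)) = \<gamma> (L x)" if x: "x \<in> cauchy_seqs S" for x
  proof -
    have "(\<lambda>n. \<gamma> (f (x n))) \<longlonglongrightarrow> \<gamma> (L x)"
      using x im closure_subset[of "f ` carrier S"]
      by (intro continuous_on_tendsto_compose[OF \<gamma> L] always_eventually) (auto simp: in_S)
    then show "(\<lambda>n. g (x n)) \<in> cauchy_seqs S" "L (\<lambda>n. g (x n)) = \<gamma> (L x)"
      using LI[of "\<lambda>n. g (x n)" "\<gamma> (L x)"] by (simp_all add: g in_S x)
  qed
  show ?thesis
    unfolding realizes_def completion_def completion_map_def null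
    using quotient_rep[OF isoL] G
    by (intro exI[of _ "fiber_val L"] conjI ballI quotient_map_fiber) (auto simp: carr im)
qed

subsection \<open>Evaluating elements of the free algebra\<close>

lemma lookup_scale_fun: "Poly_Mapping.lookup (scale_fun c x) w = c * Poly_Mapping.lookup x w"
  by (simp add: scale_fun_def Poly_Mapping.map.rep_eq when_def)

lemma keys_scale_fun: "Poly_Mapping.keys (scale_fun c x) \<subseteq> Poly_Mapping.keys x"
  by (auto simp: in_keys_iff lookup_scale_fun)

lemma keys_sum_subset:
  assumes "\<And>i. i \<in> A \<Longrightarrow> Poly_Mapping.keys (f i) \<subseteq> W"
  shows "Poly_Mapping.keys (sum f A) \<subseteq> W"
  using assms
proof (induction A rule: infinite_finite_induct)
  case (insert i A)
  then show ?case using Poly_Mapping.keys_add[of "f i" "sum f A"] by auto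
qed auto

definition lift :: "('w \<Rightarrow> 'a::cstar_type) \<Rightarrow> ('w \<Rightarrow>\<^sub>0 complex) \<Rightarrow> 'a" where
  "lift g x = (\<Sum>w\<in>Poly_Mapping.keys x. scaleC (Poly_Mapping.lookup x w) (g w))"

lemma lift_add: "lift g (x + y) = lift g x + lift g y"
  unfolding lift_def
  by (rule setsum_keys_plus_distrib) (auto simp: scaleC_zero_left scaleC_add_left)

lemma lift_zero: "lift g 0 = 0"
  by (simp add: lift_def)

lemma lift_single: "lift g (Poly_Mapping.single w c) = scaleC c (g w)"
  by (simp add: lift_def scaleC_zero_left)

lemma lift_sum: "lift g (sum f A) = (\<Sum>i\<in>A. lift g (f i))"
  by (induction A rule: infinite_finite_induct) (auto simp: lift_zero lift_add)

lemma lift_superset: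
  assumes "finite W" "Poly_Mapping.keys x \<subseteq> W"
  shows "lift g x = (\<Sum>w\<in>W. scaleC (Poly_Mapping.lookup x w) (g w))"
  unfolding lift_def using assms
  by (intro sum.mono_neutral_left) (auto simp: in_keys_iff scaleC_zero_left)

lemma lift_scale: "lift g (scale_fun c x) = scaleC c (lift g x)"
  by (subst lift_superset[OF finite_keys keys_scale_fun])
    (simp add: lift_def lookup_scale_fun scaleC_sum scaleC_scaleC)

lemma lift_minus: "lift g (- x) = - lift g x"
  using lift_add[of g x "- x"] by (simp add: lift_zero add_eq_0_iff)

lemma lift_diff: "lift g (x - y) = lift g x - lift g y"
  using lift_add[of g x "- y"] by (simp add: lift_minus)

lemma lift_cong: "(\<And>w. w \<in> Poly_Mapping.keys x \<Longrightarrow> g w = h w) \<Longrightarrow> lift g x = lift h x"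
  by (simp add: lift_def)

lemma norm_lift_le:
  assumes "\<And>w. w \<in> Poly_Mapping.keys x \<Longrightarrow> norm (g w) \<le> 1"
  shows "norm (lift g x) \<le> (\<Sum>w\<in>Poly_Mapping.keys x. cmod (Poly_Mapping.lookup x w))"
  unfolding lift_def
  by (rule sum_norm_le) (use assms in \<open>auto simp: norm_scaleC intro!: mult_left_le\<close>)

text \<open>\<open>lv\<close>, \<open>wv\<close> and \<open>fv\<close> are the counterparts in the
  type class of \<open>letter\<close>, \<open>word_value\<close> and \<open>free_value\<close>; the
  link is \<open>free_value_rep\<close>.\<close>

definition lv :: "('l \<Rightarrow> 'a::cstar_type) \<Rightarrow> 'l \<times> bool \<Rightarrow> 'a" where
  "lv t = (\<lambda>(x, s). if s then adj (t x) else t x)"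

fun wv :: "('l \<Rightarrow> 'a::cstar_type) \<Rightarrow> 'l word \<Rightarrow> 'a" where
  "wv t [] = 0"
| "wv t [x] = lv t x"
| "wv t (x # y # w) = lv t x * wv t (y # w)"

abbreviation fv :: "('l \<Rightarrow> 'a::cstar_type) \<Rightarrow> ('l word \<Rightarrow>\<^sub>0 complex) \<Rightarrow> 'a" where
  "fv t \<equiv> lift (wv t)"

abbreviation words :: "'l pgraph \<Rightarrow> 'l word set" where
  "words L \<equiv> {w. w \<noteq> [] \<and> fst ` set w \<subseteq> mor L}"

lemma carrier_free: "carrier (free_star_alg k a L c) = {x. Poly_Mapping.keys x \<subseteq> words L}"
  by (auto simp: free_star_alg_def)

lemma wv_Cons: "w \<noteq> [] \<Longrightarrow> wv t (x # w) = lv t x * wv t w"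
  by (cases w) auto

lemma wv_append: "u \<noteq> [] \<Longrightarrow> v \<noteq> [] \<Longrightarrow> wv t (u @ v) = wv t u * wv t v"
  by (induction t u rule: wv.induct) (auto simp: wv_Cons mult.assoc)

lemma wv_rev: "wv t (rev (map (apsnd Not) w)) = adj (wv t w)"
proof (induction t w rule: wv.induct)
  case (3 t x y w)
  have "wv t (rev (map (apsnd Not) (x # y # w))) =
      wv t (rev (map (apsnd Not) (y # w))) * wv t [apsnd Not x]"
    using wv_append[of "rev (map (apsnd Not) (y # w))" "[apsnd Not x]" t] by simp
  then show ?case using 3 by (cases x) (simp add: adj_mult lv_def adj_adj)
qed (auto simp: adj_zero lv_def adj_adj split: prod.split)

lemma wv_hom:
  assumes K: "star_closed K" and \<psi>: "star_hom_on K \<psi>" and t: "\<And>x. x \<in> mor L \<Longrightarrow> t x \<in> K"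
    and w: "w \<in> words L"
  shows "wv t w \<in> K" "\<psi> (wv t w) = wv (\<lambda>x. \<psi> (t x)) w"
proof -
  have letter: "lv t p \<in> K \<and> \<psi> (lv t p) = lv (\<lambda>x. \<psi> (t x)) p" if "fst p \<in> mor L" for p
    using that t by (cases p) (auto simp: lv_def star_closedD[OF K] star_hom_onD[OF \<psi>])
  have "w \<noteq> [] \<Longrightarrow> fst ` set w \<subseteq> mor L \<Longrightarrow> wv t w \<in> K \<and> \<psi> (wv t w) = wv (\<lambda>x. \<psi> (t x)) w"
  proof (induction w)
    case (Cons x w)
    then show ?case using letter[of x]
      by (cases "w = []") (auto simp: wv_Cons star_closedD[OF K] star_hom_onD[OF \<psi>])
  qed simp
  then show "wv t w \<in> K" "\<psi> (wv t w) = wv (\<lambda>x. \<psi> (t x)) w" using w by auto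
qed

lemma fv_hom:
  assumes K: "star_closed K" and \<psi>: "star_hom_on K \<psi>" and t: "\<And>x. x \<in> mor L \<Longrightarrow> t x \<in> K"
    and x: "x \<in> carrier (free_star_alg k a L c)"
  shows "fv t x \<in> K" "\<psi> (fv t x) = fv (\<lambda>x. \<psi> (t x)) x"
proof -
  have w: "wv t w \<in> K" "\<psi> (wv t w) = wv (\<lambda>x. \<psi> (t x)) w" if "w \<in> Poly_Mapping.keys x" for w
  proof -
    have wL: "w \<in> words L" using that x by (auto simp: carrier_free)
    show "wv t w \<in> K" by (rule wv_hom(1)[OF K \<psi> _ wL]) (rule t)
    show "\<psi> (wv t w) = wv (\<lambda>x. \<psi> (t x)) w" by (rule wv_hom(2)[OF K \<psi> _ wL]) (rule t)
  qed
  have s: "scaleC (Poly_Mapping.lookup x w) (wv t w) \<in> K" if "w \<in> Poly_Mapping.keys x" for w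
    by (rule star_closedD(5)[OF K w(1)[OF that]])
  then show "fv t x \<in> K" unfolding lift_def by (rule star_closedD(9)[OF K])
  have "\<psi> (fv t x) = (\<Sum>w\<in>Poly_Mapping.keys x. \<psi> (scaleC (Poly_Mapping.lookup x w) (wv t w)))"
    unfolding lift_def by (rule star_hom_on_sum[OF K \<psi> s])
  also have "\<dots> = fv (\<lambda>x. \<psi> (t x)) x"
    unfolding lift_def by (intro sum.cong refl) (simp add: w star_hom_onD(4)[OF \<psi>])
  finally show "\<psi> (fv t x) = fv (\<lambda>x. \<psi> (t x)) x" .
qed

lemma fv_in:
  assumes "star_closed K" "\<And>x. x \<in> mor L \<Longrightarrow> t x \<in> K" "x \<in> carrier (free_star_alg k a L c)"
  shows "fv t x \<in> K"
proof -
  have "star_hom_on K (\<lambda>x. x)" by (simp add: star_hom_on_def)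
  then show ?thesis using assms by (intro fv_hom(1)[of K "\<lambda>x. x"])
qed

lemma fv_cong:
  assumes "\<And>x. x \<in> mor L \<Longrightarrow> t x = u x" "x \<in> carrier (free_star_alg k a L c)"
  shows "fv t x = fv u x"
proof (rule lift_cong)
  fix w assume "w \<in> Poly_Mapping.keys x"
  then have "fst ` set w \<subseteq> mor L" using assms(2) by (auto simp: carrier_free)
  then show "wv t w = wv u w"
    by (induction w rule: induct_list012) (auto simp: lv_def assms(1))
qed

lemma free_mult_eq: "x \<otimes>\<^bsub>free_star_alg k a L c\<^esub> y =
   (\<Sum>u\<in>Poly_Mapping.keys x. \<Sum>v\<in>Poly_Mapping.keys y.
      Poly_Mapping.single (u @ v) (Poly_Mapping.lookup x u * Poly_Mapping.lookup y v))"
  by (simp add: free_star_alg_def)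

lemma star_rep_free: "star_rep (free_star_alg k a L c) (fv t)"
  unfolding star_rep_def
proof (intro conjI ballI allI)
  let ?F = "free_star_alg k a L c"
  show "\<zero>\<^bsub>?F\<^esub> \<in> carrier ?F" by (simp add: carrier_free) (simp add: free_star_alg_def)
  show "fv t \<zero>\<^bsub>?F\<^esub> = 0" by (simp add: free_star_alg_def lift_zero)
  fix x assume x: "x \<in> carrier ?F"
  then have xw: "w \<in> words L" if "w \<in> Poly_Mapping.keys x" for w using that by (auto simp: carrier_free)
  have st: "star ?F x = (\<Sum>w\<in>Poly_Mapping.keys x.
      Poly_Mapping.single (rev (map (apsnd Not) w)) (cnj (Poly_Mapping.lookup x w)))"
    by (simp add: free_star_alg_def)
  show "star ?F x \<in> carrier ?F"
    unfolding carrier_free st mem_Collect_eq using xw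
    by (intro keys_sum_subset) (force split: if_splits)
  show "fv t (star ?F x) = adj (fv t x)"
    unfolding st lift_sum lift_single wv_rev by (simp add: lift_def adj_sum adj_scaleC)
  show "c' \<odot>\<^bsub>?F\<^esub> x \<in> carrier ?F" for c'
    using x keys_scale_fun[of c' x] unfolding carrier_free by (auto simp: free_star_alg_def)
  show "fv t (c' \<odot>\<^bsub>?F\<^esub> x) = scaleC c' (fv t x)" for c'
    by (simp add: free_star_alg_def lift_scale)
  fix y assume y: "y \<in> carrier ?F"
  then have yw: "w \<in> words L" if "w \<in> Poly_Mapping.keys y" for w using that by (auto simp: carrier_free)
  show "x \<oplus>\<^bsub>?F\<^esub> y \<in> carrier ?F"
    using x y Poly_Mapping.keys_add[of x y] unfolding carrier_free by (auto simp: free_star_alg_def)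
  show "fv t (x \<oplus>\<^bsub>?F\<^esub> y) = fv t x + fv t y"
    by (simp add: free_star_alg_def lift_add)
  show "x \<otimes>\<^bsub>?F\<^esub> y \<in> carrier ?F"
    unfolding carrier_free free_mult_eq mem_Collect_eq using xw yw
    by (intro keys_sum_subset) (force split: if_splits)
  show "fv t (x \<otimes>\<^bsub>?F\<^esub> y) = fv t x * fv t y"
    unfolding free_mult_eq lift_sum lift_single
    unfolding lift_def sum_product
    using xw yw by (intro sum.cong refl)
      (auto simp: wv_append scaleC_mult_left scaleC_mult_right scaleC_scaleC mult.commute)
qed

lemma abelian_group_free: "abelian_group (free_star_alg k a L c)"
proof (rule abelian_groupI)
  let ?F = "free_star_alg k a L c"
  fix x y z assume xy: "x \<in> carrier ?F" "y \<in> carrier ?F"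
  show "x \<oplus>\<^bsub>?F\<^esub> y \<in> carrier ?F" using star_repD(3)[OF star_rep_free] xy .
  show "\<exists>y\<in>carrier ?F. y \<oplus>\<^bsub>?F\<^esub> x = \<zero>\<^bsub>?F\<^esub>"
    using xy by (intro bexI[of _ "- x"]) (auto simp: carrier_free, auto simp: free_star_alg_def)
qed (auto simp: free_star_alg_def add_ac)

subsection \<open>Families satisfying the graph relations\<close>

text \<open>The relations of \<open>graph_family\<close> for elements of a type, where carriers and
  \<open>finsum\<close> are replaced by the type and its sums; the link is
  \<open>graph_family_rep\<close>.\<close>

definition tfam :: "nat \<Rightarrow> nat \<Rightarrow> 'l pgraph \<Rightarrow> ('l \<Rightarrow> 'l \<Rightarrow> complex) \<Rightarrow> ('l \<Rightarrow> 'a::cstar_type) \<Rightarrow> bool" where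
  "tfam k a L c t \<longleftrightarrow>
     (\<forall>v\<in>objs L. t v * t v = t v \<and> adj (t v) = t v) \<and>
     (\<forall>v\<in>objs L. \<forall>w\<in>objs L. v \<noteq> w \<longrightarrow> t v * t w = 0) \<and>
     (\<forall>x\<in>mor L. \<forall>y\<in>mor L. src L x = rng L y \<longrightarrow> t x * t y = scaleC (c x y) (t (cmp L x y))) \<and>
     (\<forall>x\<in>mor L. adj (t x) * t x = t (src L x)) \<and>
     (\<forall>v\<in>objs L. \<forall>p\<in>Pmon k a. t v = (\<Sum>x\<in>paths_to L v p. t x * adj (t x)))"

lemma tfam_zero: "tfam k a L c (\<lambda>_. 0)"
  by (simp add: tfam_def adj_zero scaleC_zero_right)

lemma rep_finsum:
  assumes E: "abelian_group E" and h: "star_rep E h" and f: "f \<in> I \<rightarrow> carrier E"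
  shows "finsum E f I \<in> carrier E" "h (finsum E f I) = (\<Sum>i\<in>I. h (f i))"
proof -
  interpret abelian_group E by (fact E)
  show "finsum E f I \<in> carrier E" using f by (rule finsum_closed)
  show "h (finsum E f I) = (\<Sum>i\<in>I. h (f i))"
    using f
  proof (induction I rule: infinite_finite_induct)
    case (insert i I)
    then have "finsum E f (insert i I) = f i \<oplus>\<^bsub>E\<^esub> finsum E f I" by (intro finsum_insert) auto
    then show ?case using insert by (simp add: star_repD[OF h] finsum_closed)
  qed (auto simp: star_repD[OF h] finsum_infinite)
qed

context small_category
begin

lemma objs_mor: "v \<in> objs L \<Longrightarrow> v \<in> mor L"
  by (simp add: objs_def)

lemma graph_family_rep:
  assumes E: "abelian_group E" and h: "star_rep E h" "inj_on h (carrier E)"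
    and t: "\<And>x. x \<in> mor L \<Longrightarrow> t x \<in> carrier E"
  shows "graph_family k a L c E t \<longleftrightarrow> tfam k a L c (\<lambda>x. h (t x))"
proof -
  note D = star_repD[OF h(1)] and [simp] = t objs_mor
  have eq: "x = y \<longleftrightarrow> h x = h y" if "x \<in> carrier E" "y \<in> carrier E" for x y
    using inj_on_eq_iff[OF h(2) that] by simp
  have [simp]: "src L x \<in> mor L" if "x \<in> mor L" for x
    using src_obj[OF that] by (rule objs_mor)
  have P: "x \<in> paths_to L v p \<Longrightarrow> x \<in> mor L" for x v p by (simp add: paths_to_def)
  have fs: "finsum E (\<lambda>x. t x \<otimes>\<^bsub>E\<^esub> star E (t x)) (paths_to L v p) \<in> carrier E"
    "h (finsum E (\<lambda>x. t x \<otimes>\<^bsub>E\<^esub> star E (t x)) (paths_to L v p)) =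
      (\<Sum>x\<in>paths_to L v p. h (t x) * adj (h (t x)))" for v p
    using rep_finsum[OF E h(1), of "\<lambda>x. t x \<otimes>\<^bsub>E\<^esub> star E (t x)" "paths_to L v p"]
    by (auto simp: D P)
  show ?thesis
    unfolding graph_family_def tfam_def
    by (simp add: eq D fs cmp_closed)
qed

lemma tfam_cong:
  assumes eq: "\<And>x. x \<in> mor L \<Longrightarrow> t x = u x"
  shows "tfam k a L c t = tfam k a L c u"
proof -
  have P: "(\<Sum>x\<in>paths_to L v p. t x * adj (t x)) = (\<Sum>x\<in>paths_to L v p. u x * adj (u x))" for v p
    by (rule sum.cong) (simp_all add: paths_to_def eq)
  have "src L x \<in> mor L" if "x \<in> mor L" for x
    using src_obj[OF that] by (rule objs_mor)
  then show ?thesis unfolding tfam_def P by (simp add: eq objs_mor cmp_closed)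
qed

lemma tfam_norm_le:
  assumes "tfam k a L c t" "x \<in> mor L" shows "norm (t x) \<le> 1"
proof -
  have "norm (t (src L x)) \<le> 1"
    using assms src_obj by (intro norm_proj_le_1) (auto simp: tfam_def)
  then have "(norm (t x))\<^sup>2 \<le> 1" using assms norm_adj_mult[of "t x"] by (auto simp: tfam_def)
  then show ?thesis by (simp add: power2_le_iff_abs_le abs_square_le_1)
qed

lemma tfam_wv_norm_le:
  assumes t: "tfam k a L c t" and w: "w \<in> words L"
  shows "norm (wv t w) \<le> 1"
proof -
  have letter: "norm (lv t p) \<le> 1" if "fst p \<in> mor L" for p
    using tfam_norm_le[OF t that] by (cases p) (auto simp: lv_def norm_adj)
  have "w \<noteq> [] \<Longrightarrow> fst ` set w \<subseteq> mor L \<Longrightarrow> norm (wv t w) \<le> 1"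
  proof (induction w)
    case (Cons x w)
    show ?case
    proof (cases "w = []")
      case False
      then have "norm (lv t x) * norm (wv t w) \<le> 1 * 1" using Cons letter[of x] by (intro mult_mono) auto
      then show ?thesis using False norm_mult_ineq[of "lv t x" "wv t w"] by (simp add: wv_Cons)
    qed (use Cons letter in auto)
  qed simp
  then show ?thesis using w by auto
qed

end

lemma free_value_rep:
  assumes E: "abelian_group E" and h: "star_rep E h"
    and t: "\<And>x. x \<in> mor L \<Longrightarrow> t x \<in> carrier E" and x: "x \<in> carrier (free_star_alg k a L c)"
  shows "free_value E t x \<in> carrier E" "h (free_value E t x) = fv (\<lambda>x. h (t x)) x"
proof -
  note D = star_repD[OF h]
  have letter: "letter E t p \<in> carrier E \<and> h (letter E t p) = lv (\<lambda>x. h (t x)) p" if "fst p \<in> mor L" for p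
    using that t by (cases p) (auto simp: letter_def lv_def D)
  have "fst ` set w \<subseteq> mor L \<Longrightarrow> word_value E t w \<in> carrier E \<and> h (word_value E t w) = wv (\<lambda>x. h (t x)) w" for w
    by (induction w rule: induct_list012) (use letter in \<open>auto simp: D\<close>)
  then have w: "word_value E t w \<in> carrier E" "h (word_value E t w) = wv (\<lambda>x. h (t x)) w"
    if "w \<in> Poly_Mapping.keys x" for w using that x by (auto simp: carrier_free)
  show "free_value E t x \<in> carrier E" "h (free_value E t x) = fv (\<lambda>x. h (t x)) x"
    unfolding free_value_def lift_def
    using rep_finsum[OF E h, of "\<lambda>w. Poly_Mapping.lookup x w \<odot>\<^bsub>E\<^esub> word_value E t w" "Poly_Mapping.keys x"] w
    by (auto simp: D)
qed

subsection \<open>The universal norm\<close>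

text \<open>A copy of the subalgebra K whose elements are renamed by j. With real names it becomes
  one of the algebras over which \<open>universal_norm\<close> takes the supremum.\<close>

definition transported :: "('a::cstar_type \<Rightarrow> 'b) \<Rightarrow> 'a set \<Rightarrow> 'b star_alg" where
  "transported j K = (let i = inv_into K j in
     \<lparr>carrier = j ` K, mult = (\<lambda>x y. j (i x * i y)), one = undefined, zero = j 0,
      add = (\<lambda>x y. j (i x + i y)), smult = (\<lambda>c x. j (scaleC c (i x))),
      star = (\<lambda>x. j (adj (i x))), nrm = (\<lambda>x. norm (i x))\<rparr>)"

lemma faithful_transported:
  assumes j: "inj_on j K" and K: "star_closed K"
  shows "faithful_rep (transported j K) (inv_into K j)" "inv_into K j ` carrier (transported j K) = K"
  using j star_closedD[OF K]
  by (auto simp: faithful_rep_def isometric_rep_def star_rep_def transported_def Let_def inj_on_inv_into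
      image_image cong: image_cong)

text \<open>A point of the closure is determined by the set of those balls of radius 1 / (m + 1)
  around points of Q to which it belongs. There are countably many such balls, and sets of natural
  numbers inject into the reals.\<close>

lemma real_names:
  fixes Q :: "'a::metric_space set"
  assumes Q: "countable Q"
  obtains j :: "'a \<Rightarrow> real" where "inj_on j (closure Q)"
proof (cases "Q = {}")
  case True then show ?thesis using that[of "\<lambda>_. 0"] by simp
next
  case False
  obtain h :: "nat set \<Rightarrow> real" where h: "inj h"
    using nat_sets_lepoll_reals01 by (auto simp: lepoll_def)
  define q where "q = from_nat_into Q"
  have q: "range q = Q" using False Q by (simp add: q_def)
  define D where "D x = {n. dist x (q (fst (prod_decode n))) < 1 / Suc (snd (prod_decode n))}" for x
  have "inj_on D (closure Q)"
  proof (rule inj_onI, rule ccontr)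
    fix x y assume x: "x \<in> closure Q" and y: "y \<in> closure Q" and "D x = D y" "x \<noteq> y"
    then have "0 < dist x y / 2" by simp
    then obtain m where m: "1 / real (Suc m) < dist x y / 2" by (rule nat_approx_posE)
    have "\<exists>z\<in>Q. dist z x < 1 / real (Suc m)"
      using x unfolding closure_approachable by (elim allE[of _ "1 / real (Suc m)"]) simp
    then obtain z where z: "z \<in> Q" "dist z x < 1 / real (Suc m)" ..
    then have "z \<in> range q" by (simp only: q)
    then obtain n where "z = q n" ..
    then have n: "dist x (q n) < 1 / real (Suc m)" using z(2) by (simp only: dist_commute)
    then have "prod_encode (n, m) \<in> D x" by (simp add: D_def)
    then have "prod_encode (n, m) \<in> D y" by (simp only: \<open>D x = D y\<close>)
    then have "dist y (q n) < 1 / real (Suc m)" by (simp add: D_def)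
    then show False using n m dist_triangle2[of x y "q n"] by linarith
  qed
  then have "inj_on (h \<circ> D) (closure Q)" using h by (intro comp_inj_on) (auto intro: inj_on_subset)
  then show thesis by (rule that)
qed

text \<open>The combinations of words with rational real and imaginary parts of the coefficients
  form a countable set that is dense in the values.\<close>

lemma fv_separable:
  fixes t :: "'l \<Rightarrow> 'a::cstar_type"
  assumes mor: "countable (mor L)"
  obtains Q where "countable Q" "fv t ` carrier (free_star_alg k a L c) \<subseteq> closure Q"
proof -
  \<comment> \<open>Lists may repeat a word, so that sums correspond to concatenation.\<close>
  define G where "G l = (\<Sum>(w, p, q)\<leftarrow>l. scaleC (Complex (of_rat p) (of_rat q)) (wv t w))"
    for l :: "('l word \<times> rat \<times> rat) list"
  define Q where "Q = G ` lists (words L \<times> UNIV)"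
  have "words L \<subseteq> lists (mor L \<times> UNIV)" by (force simp: lists_eq_set)
  then have "countable (words L)"
    by (rule countable_subset) (intro countable_lists countable_SIGMA mor, simp)
  then have cQ: "countable Q"
    unfolding Q_def by (intro countable_image countable_lists countable_SIGMA) auto
  have add: "x + y \<in> closure Q" if x: "x \<in> closure Q" and y: "y \<in> closure Q" for x y
  proof -
    obtain f where f: "\<And>n. f n \<in> Q" "f \<longlonglongrightarrow> x" using x by (auto simp: closure_sequential)
    obtain g where g: "\<And>n. g n \<in> Q" "g \<longlonglongrightarrow> y" using y by (auto simp: closure_sequential)
    have "u + v \<in> Q" if "u \<in> Q" "v \<in> Q" for u v
    proof -
      obtain l m where "u = G l" "v = G m" "l \<in> lists (words L \<times> UNIV)" "m \<in> lists (words L \<times> UNIV)"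
        using \<open>u \<in> Q\<close> \<open>v \<in> Q\<close> by (auto simp: Q_def)
      then have "u + v = G (l @ m)" "l @ m \<in> lists (words L \<times> UNIV)" by (auto simp: G_def)
      then show ?thesis unfolding Q_def by blast
    qed
    then show ?thesis
      unfolding closure_sequential using f g tendsto_add[OF f(2) g(2)] by (intro exI[of _ "\<lambda>n. f n + g n"]) simp
  qed
  have "[] \<in> lists (words L \<times> UNIV)" by simp
  then have "G [] \<in> Q" unfolding Q_def by (rule imageI)
  then have zero: "0 \<in> closure Q" using closure_subset by (auto simp: G_def)
  have rat: "\<exists>f :: nat \<Rightarrow> rat. (\<lambda>n. of_rat (f n)) \<longlonglongrightarrow> r" for r :: real
  proof -
    have "r \<in> closure \<rat>" by (simp add: Rats_closure_real)
    then obtain u where u: "\<forall>n. u n \<in> \<rat>" "u \<longlonglongrightarrow> r" by (auto simp: closure_sequential)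
    then have "\<forall>n. \<exists>q. u n = of_rat q" by (auto simp: Rats_def)
    then obtain f where "\<forall>n. u n = of_rat (f n)" by (elim choice[THEN exE])
    then have "u = (\<lambda>n. of_rat (f n))" by (simp add: fun_eq_iff)
    then show ?thesis using u(2) by (auto simp del: tendsto_def)
  qed
  have single: "scaleC z (wv t w) \<in> closure Q" if w: "w \<in> words L" for z w
  proof -
    obtain f g where f: "(\<lambda>n. of_rat (f n)) \<longlonglongrightarrow> Re z" and g: "(\<lambda>n. of_rat (g n)) \<longlonglongrightarrow> Im z"
      using rat by blast
    have "(\<lambda>n. of_rat (f n) *\<^sub>R wv t w + of_rat (g n) *\<^sub>R scaleC \<i> (wv t w)) \<longlonglongrightarrow>
        Re z *\<^sub>R wv t w + Im z *\<^sub>R scaleC \<i> (wv t w)"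
      by (intro tendsto_intros f g)
    moreover have C: "scaleC (Complex p q) y = p *\<^sub>R y + q *\<^sub>R scaleC \<i> y" for p q and y :: 'a
    proof -
      have "Complex p q = complex_of_real p + complex_of_real q * \<i>" by (simp add: complex_eq_iff)
      then show ?thesis by (simp add: scaleC_add_left flip: scaleC_of_real scaleC_scaleC)
    qed
    ultimately have lim: "(\<lambda>n. scaleC (Complex (of_rat (f n)) (of_rat (g n))) (wv t w)) \<longlonglongrightarrow> scaleC z (wv t w)"
      using C[of "Re z" "Im z" "wv t w"] by simp
    have "scaleC (Complex (of_rat p) (of_rat q)) (wv t w) \<in> Q" for p q
    proof -
      have "G [(w, p, q)] \<in> Q" unfolding Q_def using w by (intro imageI) auto
      then show ?thesis by (simp add: G_def)
    qed
    then have "\<forall>n. scaleC (Complex (of_rat (f n)) (of_rat (g n))) (wv t w) \<in> Q" by blast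
    with lim show ?thesis unfolding closure_sequential
      by (intro exI[of _ "\<lambda>n. scaleC (Complex (of_rat (f n)) (of_rat (g n))) (wv t w)"]) simp
  qed
  have "fv t x \<in> closure Q" if x: "x \<in> carrier (free_star_alg k a L c)" for x
  proof -
    have "(\<Sum>w\<in>W. scaleC (Poly_Mapping.lookup x w) (wv t w)) \<in> closure Q" if "W \<subseteq> words L" for W
      using that by (induction W rule: infinite_finite_induct) (auto simp: zero add single)
    then show ?thesis unfolding lift_def using x by (simp add: carrier_free)
  qed
  then show thesis using cQ by (intro that) auto
qed

context small_category
begin

text \<open>The generators are partial isometries, so all words have norm at most 1 and the sum of
  the moduli of the coefficients bounds the set, as \<open>Sup\<close> requires.\<close>

lemma universal_upper:
  assumes E: "cstar_algebra (E :: real star_alg)" and t: "graph_family k a L c E t"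
    and x: "x \<in> carrier (free_star_alg k a L c)"
  shows "nrm E (free_value E t x) \<le> universal_norm k a L c x"
proof -
  have le: "nrm E (free_value E t x) \<le> (\<Sum>w\<in>Poly_Mapping.keys x. cmod (Poly_Mapping.lookup x w))"
    if E: "cstar_algebra (E :: real star_alg)" and t: "graph_family k a L c E t" for E t
  proof -
    interpret E: cstar_algebra E by (fact E)
    note R = faithful_repD[OF E.faithful_emb]
    have tc: "t x \<in> carrier E" if "x \<in> mor L" for x using t that by (simp add: graph_family_def)
    note fvr = free_value_rep[OF E.abelian_group_axioms R(1) tc x]
    have fam: "tfam k a L c (\<lambda>x. emb E (t x))"
      using graph_family_rep[OF E.abelian_group_axioms R(1,2) tc] t by simp
    have "norm (fv (\<lambda>x. emb E (t x)) x) \<le> (\<Sum>w\<in>Poly_Mapping.keys x. cmod (Poly_Mapping.lookup x w))"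
      using x by (intro norm_lift_le tfam_wv_norm_le[OF fam]) (auto simp: carrier_free)
    then show ?thesis using fvr by (simp add: R(3))
  qed
  have "bdd_above {nrm E (free_value E t x) | (E :: real star_alg) t. cstar_algebra E \<and> graph_family k a L c E t}"
    by (rule bdd_aboveI[of _ "\<Sum>w\<in>Poly_Mapping.keys x. cmod (Poly_Mapping.lookup x w)"]) (auto intro: le)
  then show ?thesis unfolding universal_norm_def using E t by (intro cSup_upper) auto
qed

text \<open>The zero algebra with the zero family shows that the supremum is over a nonempty
  set.\<close>

lemma universal_least:
  assumes "\<And>E t. cstar_algebra (E :: real star_alg) \<Longrightarrow> graph_family k a L c E t \<Longrightarrow>
      nrm E (free_value E t x) \<le> r"
  shows "universal_norm k a L c x \<le> r"
proof -
  have 0: "star_closed {0 :: (real, unit) cprod}"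
    by (auto simp: star_closed_def adj_zero scaleC_zero_right)
  define E :: "real star_alg" where "E = transported (\<lambda>_. 0) {0 :: (real, unit) cprod}"
  have inj: "inj_on (\<lambda>_. 0 :: real) {0 :: (real, unit) cprod}" by simp
  note E = faithful_transported[OF inj 0, folded E_def]
  have cs: "cstar_algebra E" by (rule cstar_algebra_of_rep[OF E(1)]) (simp add: E(2))
  have car: "0 \<in> carrier E" by (simp add: E_def transported_def Let_def)
  then have "inv_into {0 :: (real, unit) cprod} (\<lambda>_. 0) (0 :: real) = 0" using E(2) by blast
  then have "tfam k a L c (\<lambda>_. inv_into {0 :: (real, unit) cprod} (\<lambda>_. 0 :: real) 0)"
    using tfam_zero by simp
  then have "graph_family k a L c E (\<lambda>_. 0)"
    using graph_family_rep[OF _ faithful_repD(1,2)[OF E(1)], of "\<lambda>_. 0"] cs car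
    by (simp add: cstar_algebra_def)
  then show ?thesis
    unfolding universal_norm_def using cs by (intro cSup_least) (auto intro: assms)
qed

text \<open>The closed algebra generated by t is separable, so its elements can be named by real
  numbers and t takes part in the supremum. The restriction to real carriers in
  \<open>universal_norm\<close> thus loses no family.\<close>

lemma tfam_universal:
  fixes t :: "'l \<Rightarrow> 'a::cstar_type"
  assumes mor: "countable (mor L)" and t: "tfam k a L c t" and x: "x \<in> carrier (free_star_alg k a L c)"
  shows "norm (fv t x) \<le> universal_norm k a L c x"
proof -
  let ?F = "free_star_alg k a L c"
  define K where "K = closure (fv t ` carrier ?F)"
  have K: "star_closed K" unfolding K_def by (intro star_closed_closure star_closed_image star_rep_free)
  obtain Q where Q: "countable Q" "fv t ` carrier ?F \<subseteq> closure Q" using fv_separable[OF mor] .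
  obtain j :: "'a \<Rightarrow> real" where "inj_on j (closure Q)" using real_names[OF Q(1)] .
  moreover have "K \<subseteq> closure Q" unfolding K_def using Q(2) by (intro closure_minimal) auto
  ultimately have j: "inj_on j K" by (rule inj_on_subset)
  define E where "E = transported j K"
  note F = faithful_transported[OF j K, folded E_def]
  note R = faithful_repD[OF F(1)]
  have cs: "cstar_algebra E" by (rule cstar_algebra_of_rep[OF F(1)]) (simp add: F(2), simp add: K_def)
  then have grp: "abelian_group E" by (simp add: cstar_algebra_def)
  have tK: "t x \<in> K" if "x \<in> mor L" for x
  proof -
    have "fv t (Poly_Mapping.single [(x, False)] 1) = t x" by (simp add: lift_single scaleC_one lv_def)
    moreover have "Poly_Mapping.single [(x, False)] 1 \<in> carrier ?F" using that by (simp add: carrier_free)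
    ultimately have "t x \<in> fv t ` carrier ?F" by (rule image_eqI[OF sym])
    then show ?thesis unfolding K_def by (rule closure_subset[THEN subsetD])
  qed
  have jt: "j (t x) \<in> carrier E" "inv_into K j (j (t x)) = t x" if "x \<in> mor L" for x
    using tK[OF that] j by (auto simp: E_def transported_def Let_def)
  have "tfam k a L c (\<lambda>x. inv_into K j (j (t x)))"
    using t by (subst tfam_cong[where u=t]) (simp_all add: jt)
  then have fam: "graph_family k a L c E (\<lambda>x. j (t x))"
    using graph_family_rep[OF grp R(1,2), of "\<lambda>x. j (t x)"] jt by simp
  note fvr = free_value_rep[OF grp R(1), of L "\<lambda>x. j (t x)", OF jt(1) x]
  have "fv t x = fv (\<lambda>x. inv_into K j (j (t x))) x"
    by (rule fv_cong[OF _ x]) (simp add: jt)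
  then have "norm (fv t x) = nrm E (free_value E (\<lambda>x. j (t x)) x)"
    using fvr by (simp add: R(3))
  then show ?thesis using universal_upper[OF cs fam x] by simp
qed

end

subsection \<open>The universal family\<close>

text \<open>The coordinate projection at the algebra E and the function t, with E again embedded
  into a type of the class so that it becomes a *-homomorphism between such types.\<close>

definition pr :: "real star_alg \<Rightarrow> ('l \<Rightarrow> real) \<Rightarrow> (real, 'l \<Rightarrow> real) cprod \<Rightarrow> (real, unit) cprod" where
  "pr E t f = emb E (proj f (E, t))"

lemma pr_hom:
  assumes "cstar_algebra E" shows "star_hom_on UNIV (pr E t)"
proof -
  interpret E: cstar_algebra E by fact
  note D = star_repD[OF faithful_repD(1)[OF E.faithful_emb]]
  have c: "cstar_algebra (fst (E, t))" using assms by simp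
  show ?thesis
    using proj_closed[OF c] by (simp add: star_hom_on_def pr_def proj_simps[OF c] D)
qed

lemma pr_simps:
  assumes "cstar_algebra E"
  shows "pr E t (f + g) = pr E t f + pr E t g" "pr E t (f * g) = pr E t f * pr E t g"
    "pr E t (adj f) = adj (pr E t f)" "pr E t (scaleC c f) = scaleC c (pr E t f)" "pr E t 0 = 0"
  using star_hom_onD[OF pr_hom[OF assms]] star_hom_on_zero[OF star_closed_UNIV pr_hom[OF assms]] by simp_all

lemma norm_pr: "cstar_algebra E \<Longrightarrow> norm (pr E t f) = nrm E (proj f (E, t))"
  using cstar_algebra.faithful_emb[of E] proj_closed[of "(E, t)" f] by (simp add: pr_def faithful_repD)

lemma norm_pr_le: "cstar_algebra E \<Longrightarrow> norm (pr E t f) \<le> norm f"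
  using norm_proj[of "(E, t)" f] by (simp add: norm_pr)

lemma pr_eqI:
  assumes "\<And>E t. cstar_algebra E \<Longrightarrow> pr E t f = pr E t g"
  shows "f = g"
proof (rule cprod_eqI)
  fix p :: "real star_alg \<times> ('a \<Rightarrow> real)" assume p: "cstar_algebra (fst p)"
  then interpret cstar_algebra "fst p" .
  have "emb (fst p) (proj f p) = emb (fst p) (proj g p)"
    using assms[OF p, of "snd p"] by (simp add: pr_def)
  then show "proj f p = proj g p"
    using faithful_repD(2)[OF faithful_emb] proj_closed[OF p] by (auto dest: inj_onD)
qed

text \<open>The universal family. The factors of the product are indexed by an algebra together with
  a candidate family t; the coordinate is t itself if it satisfies the relations, and the zero
  family otherwise.\<close>

definition gen ::
  "nat \<Rightarrow> nat \<Rightarrow> 'l pgraph \<Rightarrow> ('l \<Rightarrow> 'l \<Rightarrow> complex) \<Rightarrow> 'l \<Rightarrow> (real, 'l \<Rightarrow> real) cprod" where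
  "gen k a L c x = mk_cprod (\<lambda>(E, t). if graph_family k a L c E t \<and> x \<in> mor L then t x else \<zero>\<^bsub>E\<^esub>)"

text \<open>Values outside the carrier are kept, so that the operation is an involution on arbitrary
  functions and not only on families.\<close>

definition sgn_family :: "('l \<Rightarrow> bit) \<Rightarrow> real star_alg \<Rightarrow> ('l \<Rightarrow> real) \<Rightarrow> 'l \<Rightarrow> real" where
  "sgn_family s E t x = (if t x \<in> carrier E then bit_sign (s x) \<odot>\<^bsub>E\<^esub> t x else t x)"

text \<open>The grading acts by permuting the factors: the coordinate at t is replaced by the
  coordinate at t with signs. This is visibly a *-homomorphism of the whole product.\<close>

definition regrade :: "('l \<Rightarrow> bit) \<Rightarrow> (real, 'l \<Rightarrow> real) cprod \<Rightarrow> (real, 'l \<Rightarrow> real) cprod" where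
  "regrade s f = mk_cprod (\<lambda>(E, t). proj f (E, sgn_family s E t))"

lemma bit_sign_simps [simp]:
  "bit_sign 0 = 1" "bit_sign 1 = -1" "bit_sign b * bit_sign b = 1" "cnj (bit_sign b) = bit_sign b"
  "bit_sign (b + b') = bit_sign b * bit_sign b'"
  by (cases b; cases b'; simp add: bit_sign_def)+

lemma proj_regrade:
  assumes E: "cstar_algebra E"
  shows "proj (regrade s f) (E, t) = proj f (E, sgn_family s E t)"
proof -
  have "proj (regrade s f) (E, t) = (\<lambda>(E, t). proj f (E, sgn_family s E t)) (E, t)"
    unfolding regrade_def
  proof (rule proj_mk[where K="norm f"])
    fix p :: "real star_alg \<times> ('a \<Rightarrow> real)" assume p: "cstar_algebra (fst p)"
    show "(case p of (E, t) \<Rightarrow> proj f (E, sgn_family s E t)) \<in> carrier (fst p)"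
      "nrm (fst p) (case p of (E, t) \<Rightarrow> proj f (E, sgn_family s E t)) \<le> norm f"
      using p by (auto split: prod.split intro: proj_closed[of "(_, _)", simplified] norm_proj[of "(_, _)", simplified])
  qed (use E in simp)
  then show ?thesis by simp
qed

lemma pr_regrade: "cstar_algebra E \<Longrightarrow> pr E t (regrade s f) = pr E (sgn_family s E t) f"
  by (simp add: pr_def proj_regrade)

lemma regrade_hom: "star_hom_on UNIV (regrade s)"
  unfolding star_hom_on_def by (auto intro!: pr_eqI simp: pr_regrade pr_simps)

lemma continuous_on_star_hom:
  assumes K: "closed K" "star_closed K" and \<psi>: "star_hom_on K \<psi>"
  shows "continuous_on K \<psi>"
  unfolding continuous_on_iff
proof (intro ballI allI impI)
  fix x e assume x: "x \<in> K" and e: "(0::real) < e"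
  have "dist (\<psi> y) (\<psi> x) \<le> dist y x" if y: "y \<in> K" for y
    using star_hom_contractive[OF K \<psi>, of "y - x"] star_closedD(8)[OF K(2) y x]
    by (simp add: dist_norm star_hom_on_diff[OF K(2) \<psi> y x])
  then show "\<exists>d>0. \<forall>y\<in>K. dist y x < d \<longrightarrow> dist (\<psi> y) (\<psi> x) < e" using e by (meson le_less_trans)
qed

lemma wv_sign:
  "w \<noteq> [] \<Longrightarrow> wv (\<lambda>x. scaleC (bit_sign (s x)) (t x)) w = scaleC (prod_list (map (\<lambda>(y, _). bit_sign (s y)) w)) (wv t w)"
  by (induction w rule: induct_list012)
    (auto simp: lv_def adj_scaleC scaleC_scaleC scaleC_mult_left scaleC_mult_right mult.commute)

lemma free_grading:
  assumes x: "x \<in> carrier (free_star_alg k a L c)"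
  shows "free_grading k a L x \<in> carrier (free_star_alg k a L c)"
    and "fv t (free_grading k a L x) = fv (\<lambda>x. scaleC (bit_sign (graph_parity k a L x)) (t x)) x"
proof -
  have w: "w \<in> words L" if "w \<in> Poly_Mapping.keys x" for w using x that by (auto simp: carrier_free)
  show "free_grading k a L x \<in> carrier (free_star_alg k a L c)"
    unfolding carrier_free free_grading_def mem_Collect_eq using w
    by (intro keys_sum_subset) (auto split: if_splits)
  show "fv t (free_grading k a L x) = fv (\<lambda>x. scaleC (bit_sign (graph_parity k a L x)) (t x)) x"
    unfolding free_grading_def lift_sum lift_single
    unfolding lift_def using w
    by (intro sum.cong refl) (simp add: wv_sign scaleC_scaleC mult.commute)
qed

context small_category
begin

lemma tfam_pr:
  assumes "\<And>E t. cstar_algebra E \<Longrightarrow> tfam k a L c (\<lambda>x. pr E t (u x))"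
  shows "tfam k a L c u"
proof -
  have sum: "pr E t (\<Sum>x\<in>X. u x * adj (u x)) = (\<Sum>x\<in>X. pr E t (u x) * adj (pr E t (u x)))"
    if "cstar_algebra E" for E t X
    using that by (subst star_hom_on_sum[OF star_closed_UNIV pr_hom]) (auto simp: pr_simps)
  show ?thesis
    using assms unfolding tfam_def
    by (auto intro!: pr_eqI simp: pr_simps sum)
qed

lemma family_carrier: "graph_family k a L c E t \<Longrightarrow> x \<in> mor L \<Longrightarrow> t x \<in> carrier E"
  by (simp add: graph_family_def)

lemma family_tfam:
  assumes E: "cstar_algebra E" and t: "\<And>x. x \<in> mor L \<Longrightarrow> t x \<in> carrier E"
  shows "graph_family k a L c E t \<longleftrightarrow> tfam k a L c (\<lambda>x. emb E (t x))"
proof -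
  interpret E: cstar_algebra E by (fact E)
  show ?thesis
    using t by (intro graph_family_rep E.abelian_group_axioms faithful_repD[OF E.faithful_emb])
qed

lemma pr_gen:
  assumes E: "cstar_algebra E" and x: "x \<in> mor L"
  shows "pr E t (gen k a L c x) = (if graph_family k a L c E t then emb E (t x) else 0)"
proof -
  interpret E: cstar_algebra E by (fact E)
  have "proj (gen k a L c x) (E, t) =
      (\<lambda>(E, t). if graph_family k a L c E t \<and> x \<in> mor L then t x else \<zero>\<^bsub>E\<^esub>) (E, t)"
    unfolding gen_def
  proof (rule proj_mk[where K=1])
    fix p :: "real star_alg \<times> ('l \<Rightarrow> real)" assume p: "cstar_algebra (fst p)"
    obtain F u where [simp]: "p = (F, u)" by (cases p)
    interpret F: cstar_algebra F using p by simp
    have "nrm F (u x) \<le> 1" if u: "graph_family k a L c F u"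
    proof -
      have "tfam k a L c (\<lambda>x. emb F (u x))"
        using u family_tfam[OF F.cstar_algebra_axioms] family_carrier by blast
      from tfam_norm_le[OF this x] show ?thesis
        using family_carrier[OF u x] by (simp add: faithful_repD(3)[OF F.faithful_emb])
    qed
    then show "(case p of (E, t) \<Rightarrow> if graph_family k a L c E t \<and> x \<in> mor L then t x else \<zero>\<^bsub>E\<^esub>) \<in> carrier (fst p)"
      "nrm (fst p) (case p of (E, t) \<Rightarrow> if graph_family k a L c E t \<and> x \<in> mor L then t x else \<zero>\<^bsub>E\<^esub>) \<le> 1"
      using family_carrier by (auto simp: F.nrm_zero)
  qed (use E in simp)
  then show ?thesis using x star_repD(2)[OF faithful_repD(1)[OF E.faithful_emb]] by (simp add: pr_def)
qed

lemma tfam_gen: "tfam k a L c (gen k a L c)"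
proof (rule tfam_pr)
  fix E :: "real star_alg" and t assume E: "cstar_algebra E"
  show "tfam k a L c (\<lambda>x. pr E t (gen k a L c x))"
  proof (cases "graph_family k a L c E t")
    case True
    then have "tfam k a L c (\<lambda>x. emb E (t x))" using family_tfam[OF E] family_carrier by blast
    then show ?thesis using True E by (subst tfam_cong[where u="\<lambda>x. emb E (t x)"]) (simp_all add: pr_gen)
  next
    case False
    then show ?thesis using E tfam_zero by (subst tfam_cong[where u="\<lambda>x. 0"]) (simp_all add: pr_gen)
  qed
qed

lemma pr_fv_gen:
  assumes E: "cstar_algebra E" and t: "graph_family k a L c E t"
    and x: "x \<in> carrier (free_star_alg k a L c)"
  shows "pr E t (fv (gen k a L c) x) = emb E (free_value E t x)" "free_value E t x \<in> carrier E"
proof -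
  interpret E: cstar_algebra E by (fact E)
  note R = free_value_rep[OF E.abelian_group_axioms faithful_repD(1)[OF E.faithful_emb] family_carrier[OF t] x]
  have "pr E t (fv (gen k a L c) x) = fv (\<lambda>x. pr E t (gen k a L c x)) x"
    by (rule fv_hom[OF star_closed_UNIV pr_hom[OF E] UNIV_I x])
  also have "\<dots> = fv (\<lambda>x. emb E (t x)) x" by (rule fv_cong[OF _ x]) (simp add: pr_gen[OF E] t)
  finally show "pr E t (fv (gen k a L c) x) = emb E (free_value E t x)" using R(2) by simp
  show "free_value E t x \<in> carrier E" by (rule R(1))
qed

text \<open>\<open>gen\<close> is itself a family, hence dominated by the universal norm; and every
  family of the supremum is one of its coordinates.\<close>

lemma norm_fv_gen:
  assumes mor: "countable (mor L)" and x: "x \<in> carrier (free_star_alg k a L c)"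
  shows "norm (fv (gen k a L c) x) = universal_norm k a L c x"
proof (rule antisym)
  show "norm (fv (gen k a L c) x) \<le> universal_norm k a L c x"
    by (rule tfam_universal[OF mor tfam_gen x])
  show "universal_norm k a L c x \<le> norm (fv (gen k a L c) x)"
  proof (rule universal_least)
    fix E :: "real star_alg" and t assume E: "cstar_algebra E" and t: "graph_family k a L c E t"
    then show "nrm E (free_value E t x) \<le> norm (fv (gen k a L c) x)"
      using norm_pr_le[OF E, of t "fv (gen k a L c) x"] pr_fv_gen[OF E t x]
      by (simp add: faithful_repD(3)[OF cstar_algebra.faithful_emb[OF E]])
  qed
qed

lemma tfam_sign:
  fixes t :: "'l \<Rightarrow> 'b::cstar_type"
  assumes t: "tfam k a L c t"
    and s: "\<And>v. v \<in> objs L \<Longrightarrow> s v = 0"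
      "\<And>x y. x \<in> mor L \<Longrightarrow> y \<in> mor L \<Longrightarrow> src L x = rng L y \<Longrightarrow> s (cmp L x y) = s x + s y"
  shows "tfam k a L c (\<lambda>x. scaleC (bit_sign (s x)) (t x))"
  using t s src_obj unfolding tfam_def
  by (auto simp: scaleC_mult_left scaleC_mult_right scaleC_scaleC adj_scaleC scaleC_one mult_ac scaleC_zero_right)

text \<open>An additive sign preserves the relations, and as it is an involution one implication
  gives both.\<close>

lemma sgn_family:
  assumes E: "cstar_algebra E"
    and s: "\<And>v. v \<in> objs L \<Longrightarrow> s v = 0"
      "\<And>x y. x \<in> mor L \<Longrightarrow> y \<in> mor L \<Longrightarrow> src L x = rng L y \<Longrightarrow> s (cmp L x y) = s x + s y"
  shows "graph_family k a L c E (sgn_family s E t) \<longleftrightarrow> graph_family k a L c E t"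
proof -
  interpret E: cstar_algebra E by (fact E)
  note D = star_repD[OF faithful_repD(1)[OF E.faithful_emb]]
  have imp: "graph_family k a L c E (sgn_family s E t)" if t: "graph_family k a L c E t" for t
  proof -
    note tc = family_carrier[OF t]
    have sc: "sgn_family s E t x \<in> carrier E" if "x \<in> mor L" for x
      using tc[OF that] by (simp add: sgn_family_def E.scale_closed)
    have "tfam k a L c (\<lambda>x. emb E (t x))" using t family_tfam[OF E tc] by simp
    then have "tfam k a L c (\<lambda>x. scaleC (bit_sign (s x)) (emb E (t x)))"
      by (rule tfam_sign) (simp_all add: s)
    moreover have "emb E (sgn_family s E t x) = scaleC (bit_sign (s x)) (emb E (t x))" if "x \<in> mor L" for x
      using tc[OF that] by (simp add: sgn_family_def D(10))
    then have "tfam k a L c (\<lambda>x. emb E (sgn_family s E t x)) =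
        tfam k a L c (\<lambda>x. scaleC (bit_sign (s x)) (emb E (t x)))"
      by (rule tfam_cong)
    ultimately have "tfam k a L c (\<lambda>x. emb E (sgn_family s E t x))" by simp
    then show ?thesis using family_tfam[OF E sc] by simp
  qed
  have "sgn_family s E (sgn_family s E t) = t"
    by (simp add: fun_eq_iff sgn_family_def E.scale_closed E.scale_one E.scale_scale[symmetric])
  then show ?thesis using imp[of t] imp[of "sgn_family s E t"] by (auto simp only:)
qed

end

context P_graph
begin

lemma reduce2_zero: "reduce2 k 0 i = 0"
  by (auto simp: reduce2_def zero_prod_def zero_fun_def)

lemma parity_obj: "v \<in> objs L \<Longrightarrow> graph_parity k a L v = 0"
  by (simp add: graph_parity_def pdeg_obj parity_def reduce2_zero)

lemma reduce2_add: "reduce2 k (p + q) i = reduce2 k p i + reduce2 k q i"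
  by (simp add: reduce2_def)

lemma parity_cmp:
  assumes "x \<in> mor L" "y \<in> mor L" "src L x = rng L y"
  shows "graph_parity k a L (cmp L x y) = graph_parity k a L x + graph_parity k a L y"
  unfolding graph_parity_def pdeg_cmp[OF assms] parity_def reduce2_add sum.distrib ..

abbreviation (input) "psign x \<equiv> bit_sign (graph_parity k a L x)"

lemma regrade_gen:
  assumes x: "x \<in> mor L"
  shows "regrade (graph_parity k a L) (gen k a L c x) = scaleC (psign x) (gen k a L c x)"
proof (rule pr_eqI)
  fix E :: "real star_alg" and t assume E: "cstar_algebra E"
  interpret E: cstar_algebra E by (fact E)
  show "pr E t (regrade (graph_parity k a L) (gen k a L c x)) = pr E t (scaleC (psign x) (gen k a L c x))"
    using x family_carrier[of k a c E t x]
    by (simp add: pr_regrade E pr_gen pr_simps sgn_family[OF E parity_obj parity_cmp] sgn_family_def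
      star_repD(10)[OF faithful_repD(1)[OF E.faithful_emb]] scaleC_zero_right)
qed

text \<open>Evaluation at the universal family is isometric for the universal norm
  (\<open>norm_fv_gen\<close>), so \<open>completion_realizes\<close> identifies the graph algebra
  with the closed algebra generated by that family.\<close>

lemma graph_algebra_realized:
  fixes c :: "'l \<Rightarrow> 'l \<Rightarrow> complex"
  defines "I \<equiv> closure (fv (gen k a L c) ` carrier (free_star_alg k a L c))"
    and "\<gamma> \<equiv> regrade (graph_parity k a L)"
  shows "grading_on I \<gamma>" and "\<exists>h. realizes (graph_cstar k a L c) (graph_grading k a L c) h I \<gamma>"
proof -
  let ?F = "free_star_alg k a L c" and ?s = "\<lambda>x. scaleC (psign x) (gen k a L c x)"
  have cont: "continuous_on UNIV \<gamma>"
    unfolding \<gamma>_def by (intro continuous_on_star_hom regrade_hom star_closed_UNIV closed_UNIV)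
  have \<gamma>fv: "\<gamma> (fv (gen k a L c) x) = fv ?s x" if x: "x \<in> carrier ?F" for x
  proof -
    have "\<gamma> (fv (gen k a L c) x) = fv (\<lambda>x. \<gamma> (gen k a L c x)) x"
      unfolding \<gamma>_def by (rule fv_hom[OF star_closed_UNIV regrade_hom UNIV_I x])
    also have "\<dots> = fv ?s x" using x by (intro fv_cong) (simp_all add: \<gamma>_def regrade_gen)
    finally show ?thesis .
  qed
  have \<gamma>\<gamma>: "\<gamma> (fv ?s x) = fv (gen k a L c) x" if x: "x \<in> carrier ?F" for x
  proof -
    have "\<gamma> (fv ?s x) = fv (\<lambda>x. \<gamma> (?s x)) x"
      unfolding \<gamma>_def by (rule fv_hom[OF star_closed_UNIV regrade_hom UNIV_I x])
    also have "\<dots> = fv (gen k a L c) x"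
      using x by (intro fv_cong) (simp_all add: \<gamma>_def star_hom_onD[OF regrade_hom] regrade_gen scaleC_scaleC scaleC_one)
    finally show ?thesis .
  qed
  have iso: "isometric_rep ?F (fv (gen k a L c))"
    using star_rep_free norm_fv_gen[OF countable_mor]
    by (auto simp: isometric_rep_def free_star_alg_def)
  show "\<exists>h. realizes (graph_cstar k a L c) (graph_grading k a L c) h I \<gamma>"
    unfolding graph_cstar_def graph_grading_def I_def
    by (rule completion_realizes[OF abelian_group_free iso])
      (auto simp: free_grading \<gamma>fv intro: continuous_on_subset[OF cont])
  \<comment> \<open>Checked on the dense image, where \<gamma> acts as
    \<open>free_grading\<close>.\<close>
  have "\<gamma> ` I \<subseteq> I"
    unfolding I_def
  proof (rule image_closure_subset)
    show "continuous_on (closure (fv (gen k a L c) ` carrier ?F)) \<gamma>" by (rule continuous_on_subset[OF cont]) simp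
    show "\<gamma> ` fv (gen k a L c) ` carrier ?F \<subseteq> closure (fv (gen k a L c) ` carrier ?F)"
    proof (intro subsetI, elim imageE, clarify)
      fix x assume x: "x \<in> carrier ?F"
      have "\<gamma> (fv (gen k a L c) x) = fv (gen k a L c) (free_grading k a L x)"
        by (simp add: \<gamma>fv[OF x] free_grading(2)[OF x])
      then have "\<gamma> (fv (gen k a L c) x) \<in> fv (gen k a L c) ` carrier ?F"
        using free_grading(1)[OF x] by (rule image_eqI)
      then show "\<gamma> (fv (gen k a L c) x) \<in> closure (fv (gen k a L c) ` carrier ?F)"
        by (rule closure_subset[THEN subsetD])
    qed
  qed simp
  moreover have "\<gamma> (\<gamma> x) = x" if "x \<in> I" for x
  proof -
    have "closed {x. \<gamma> (\<gamma> x) = x}"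
      by (intro closed_Collect_eq continuous_on_compose2[OF cont cont] continuous_intros) auto
    moreover have "fv (gen k a L c) ` carrier ?F \<subseteq> {x. \<gamma> (\<gamma> x) = x}" by (auto simp: \<gamma>fv \<gamma>\<gamma>)
    ultimately show ?thesis using closure_minimal that unfolding I_def by blast
  qed
  ultimately show "grading_on I \<gamma>"
    unfolding grading_on_def I_def \<gamma>_def
    using star_closed_closure[OF star_closed_image[OF star_rep_free]] regrade_hom[of "graph_parity k a L"]
    by (auto simp: star_hom_on_def)
qed

end

subsection \<open>The crossed product by a grading\<close>

text \<open>
  The pair \<open>(x, y)\<close> stands for \<open>x + y e\<close>, with \<open>e\<close> a self-adjoint unitary such that \<open>e x = \<gamma> x e\<close>.
\<close>

definition cmul :: "('a::cstar_type \<Rightarrow> 'a) \<Rightarrow> 'a \<times> 'a \<Rightarrow> 'a \<times> 'a \<Rightarrow> 'a \<times> 'a" where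
  "cmul \<gamma> P Q = (fst P * fst Q + snd P * \<gamma> (snd Q), fst P * snd Q + snd P * \<gamma> (fst Q))"

definition cadj :: "('a::cstar_type \<Rightarrow> 'a) \<Rightarrow> 'a \<times> 'a \<Rightarrow> 'a \<times> 'a" where
  "cadj \<gamma> P = (adj (fst P), \<gamma> (adj (snd P)))"

definition cscale :: "complex \<Rightarrow> 'a::cstar_type \<times> 'a \<Rightarrow> 'a \<times> 'a" where
  "cscale c P = (scaleC c (fst P), scaleC c (snd P))"

text \<open>\<open>graded_state\<close> for the concrete model I of an algebra.\<close>

definition gstate :: "'a::cstar_type set \<Rightarrow> ('a \<Rightarrow> 'a) \<Rightarrow> ('a \<Rightarrow> complex) \<Rightarrow> bool" where
  "gstate I \<gamma> \<phi> \<longleftrightarrow>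
     (\<forall>x\<in>I. \<forall>y\<in>I. \<phi> (x + y) = \<phi> x + \<phi> y) \<and> (\<forall>c. \<forall>x\<in>I. \<phi> (scaleC c x) = c * \<phi> x) \<and>
     (\<forall>x\<in>I. \<exists>r\<ge>0. \<phi> (adj x * x) = complex_of_real r) \<and> (\<forall>x\<in>I. cmod (\<phi> x) \<le> norm x) \<and>
     (SUP x\<in>{x \<in> I. norm x \<le> 1}. cmod (\<phi> x)) = 1 \<and> (\<forall>x\<in>I. \<phi> (\<gamma> x) = \<phi> x)"

text \<open>The functional x + y e -> \<phi> x, evaluated at the square of P. It is the product of
  \<phi> with the state of the Clifford algebra that vanishes at e.\<close>

definition cform :: "('a::cstar_type \<Rightarrow> 'a) \<Rightarrow> ('a \<Rightarrow> complex) \<Rightarrow> 'a \<times> 'a \<Rightarrow> complex" where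
  "cform \<gamma> \<phi> P = \<phi> (fst (cmul \<gamma> (cadj \<gamma> P) P))"

text \<open>What \<open>minimal_norm\<close> becomes when the second factor has a single invariant
  state; compare \<open>minimal_norm_eq\<close>.\<close>

definition cnorm :: "'a::cstar_type set \<Rightarrow> ('a \<Rightarrow> 'a) \<Rightarrow> 'a \<times> 'a \<Rightarrow> real" where
  "cnorm I \<gamma> P = sqrt (Sup (insert 0 {Re (cform \<gamma> \<phi> (cmul \<gamma> P Q)) / Re (cform \<gamma> \<phi> Q) | \<phi> Q.
     gstate I \<gamma> \<phi> \<and> Q \<in> I \<times> I \<and> cform \<gamma> \<phi> Q \<noteq> 0}))"

definition crossed :: "'a::cstar_type set \<Rightarrow> ('a \<Rightarrow> 'a) \<Rightarrow> ('a \<times> 'a) star_alg" where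
  "crossed I \<gamma> = \<lparr>carrier = I \<times> I, mult = cmul \<gamma>, one = undefined, zero = 0, add = (+),
     smult = cscale, star = cadj \<gamma>, nrm = cnorm I \<gamma>\<rparr>"

text \<open>The numbers are the values of a positive form at a vector x + c y. That they are real
  for c = 1 and c = \<i> forces hermitian symmetry; their sign at c = - t \<open>cnj z\<close>, with
  t = 1 / q, gives the inequality.\<close>

lemma cauchy_schwarz_aux:
  fixes z w :: complex and p q :: real
  assumes pos: "\<And>c. \<exists>r\<ge>0. of_real p + c * z + cnj c * w + of_real ((cmod c)\<^sup>2) * of_real q = complex_of_real r"
    and q: "q \<ge> 0" and p: "p \<ge> 0"
  shows "w = cnj z" "(cmod z)\<^sup>2 \<le> p * q"
proof -
  have im: "Im (c * z + cnj c * w) = 0" for c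
  proof -
    obtain r where "of_real p + c * z + cnj c * w + of_real ((cmod c)\<^sup>2) * of_real q = complex_of_real r"
      using pos[of c] by blast
    then have "Im (of_real p + c * z + cnj c * w + of_real ((cmod c)\<^sup>2) * of_real q) = 0" by simp
    then show ?thesis by simp
  qed
  from im[of 1] im[of \<i>] show w: "w = cnj z" by (auto simp: complex_eq_iff)
  have re: "0 \<le> p + 2 * Re (c * z) + (cmod c)\<^sup>2 * q" for c
  proof -
    obtain r where r: "r \<ge> 0" "of_real p + c * z + cnj c * w + of_real ((cmod c)\<^sup>2) * of_real q = complex_of_real r"
      using pos[of c] by blast
    then have "Re (of_real p + c * z + cnj c * w + of_real ((cmod c)\<^sup>2) * of_real q) \<ge> 0" by simp
    then show ?thesis by (simp add: w)
  qed
  have sq: "0 \<le> p - 2 * t * (cmod z)\<^sup>2 + t\<^sup>2 * (cmod z)\<^sup>2 * q" for t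
  proof -
    have "Re (cnj z * z) = (cmod z)\<^sup>2" by (simp add: cmod_power2) (simp add: power2_eq_square)
    then have "Re (of_real (- t) * cnj z * z) = - t * (cmod z)\<^sup>2"
      unfolding mult.assoc by (simp only: Re_complex_of_real Im_complex_of_real times_complex.sel)
    moreover have "(cmod (of_real (- t) * cnj z))\<^sup>2 = t\<^sup>2 * (cmod z)\<^sup>2"
      by (simp add: norm_mult power_mult_distrib)
    ultimately show ?thesis using re[of "of_real (- t) * cnj z"] by simp
  qed
  show "(cmod z)\<^sup>2 \<le> p * q"
  proof (cases "q = 0")
    case True
    have "(cmod z)\<^sup>2 = 0"
    proof (rule ccontr)
      assume "(cmod z)\<^sup>2 \<noteq> 0"
      \<comment> \<open>For q = 0 the expression is affine in t, and this t makes it equal to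
        -1.\<close>
      then show False using sq[of "(p + 1) / (2 * (cmod z)\<^sup>2)"] True by simp
    qed
    then show ?thesis using True by simp
  next
    case False
    then have "0 \<le> q * (p - 2 * (1/q) * (cmod z)\<^sup>2 + (1/q)\<^sup>2 * (cmod z)\<^sup>2 * q)"
      using sq[of "1/q"] q by (intro mult_nonneg_nonneg) auto
    also have "\<dots> = p * q - (cmod z)\<^sup>2" using False by (simp add: field_simps power2_eq_square)
    finally show ?thesis by simp
  qed
qed

section \<open>Positive functionals and invariant states on a closed subalgebra\<close>

definition pos_functional :: "'a::cstar_type set \<Rightarrow> ('a \<Rightarrow> complex) \<Rightarrow> bool" where
  "pos_functional I \<phi> \<longleftrightarrow>
     (\<forall>x\<in>I. \<forall>y\<in>I. \<phi> (x + y) = \<phi> x + \<phi> y) \<and> (\<forall>c. \<forall>x\<in>I. \<phi> (scaleC c x) = c * \<phi> x) \<and>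
     (\<forall>x\<in>I. \<exists>r\<ge>0. \<phi> (adj x * x) = complex_of_real r)"

lemma pos_functionalD:
  assumes "pos_functional I \<phi>"
  shows "x \<in> I \<Longrightarrow> y \<in> I \<Longrightarrow> \<phi> (x + y) = \<phi> x + \<phi> y" "x \<in> I \<Longrightarrow> \<phi> (scaleC c x) = c * \<phi> x"
    "x \<in> I \<Longrightarrow> \<phi> (adj x * x) = complex_of_real (Re (\<phi> (adj x * x)))" "x \<in> I \<Longrightarrow> Re (\<phi> (adj x * x)) \<ge> 0"
proof -
  show "x \<in> I \<Longrightarrow> y \<in> I \<Longrightarrow> \<phi> (x + y) = \<phi> x + \<phi> y" "x \<in> I \<Longrightarrow> \<phi> (scaleC c x) = c * \<phi> x"
    using assms by (auto simp: pos_functional_def)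
  show "\<phi> (adj x * x) = complex_of_real (Re (\<phi> (adj x * x)))" "Re (\<phi> (adj x * x)) \<ge> 0" if "x \<in> I"
  proof -
    obtain r where "r \<ge> 0" "\<phi> (adj x * x) = complex_of_real r"
      using assms \<open>x \<in> I\<close> unfolding pos_functional_def by blast
    then show "\<phi> (adj x * x) = complex_of_real (Re (\<phi> (adj x * x)))" "Re (\<phi> (adj x * x)) \<ge> 0" by simp_all
  qed
qed

lemma gstateD:
  assumes "gstate I \<gamma> \<phi>"
  shows "pos_functional I \<phi>" "x \<in> I \<Longrightarrow> cmod (\<phi> x) \<le> norm x" "x \<in> I \<Longrightarrow> \<phi> (\<gamma> x) = \<phi> x"
  using assms by (auto simp: gstate_def pos_functional_def)

context
  fixes I :: "'a::cstar_type set"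
  assumes I: "closed I" "star_closed I"
begin

lemma functional_cauchy_schwarz:
  assumes \<phi>: "pos_functional I \<phi>" and x: "x \<in> I" and y: "y \<in> I"
  shows "(cmod (\<phi> (adj x * y)))\<^sup>2 \<le> Re (\<phi> (adj x * x)) * Re (\<phi> (adj y * y))"
proof -
  note F = pos_functionalD[OF \<phi>] and cl = star_closedD[OF I(2)]
  show ?thesis
  proof (rule cauchy_schwarz_aux(2)[of _ _ "\<phi> (adj y * x)"])
    fix c
    let ?v = "x + scaleC c y"
    have "adj ?v * ?v = adj x * x + scaleC c (adj x * y) + scaleC (cnj c) (adj y * x) + scaleC (cnj c * c) (adj y * y)"
      by (simp add: adj_add adj_scaleC scaleC_simps algebra_simps)
    then have "\<phi> (adj ?v * ?v) = \<phi> (adj x * x) + c * \<phi> (adj x * y) + cnj c * \<phi> (adj y * x) + (cnj c * c) * \<phi> (adj y * y)"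
      using x y by (simp add: F(1,2) cl)
    also have "cnj c * c = of_real ((cmod c)\<^sup>2)" by (metis complex_norm_square mult.commute)
    finally have "of_real (Re (\<phi> (adj x * x))) + c * \<phi> (adj x * y) + cnj c * \<phi> (adj y * x) +
        of_real ((cmod c)\<^sup>2) * of_real (Re (\<phi> (adj y * y))) = complex_of_real (Re (\<phi> (adj ?v * ?v)))"
      using F(3)[OF x] F(3)[OF y] F(3)[of ?v] x y by (simp add: cl)
    moreover have "Re (\<phi> (adj ?v * ?v)) \<ge> 0" using x y by (intro F(4)) (simp add: cl)
    ultimately show "\<exists>r\<ge>0. of_real (Re (\<phi> (adj x * x))) + c * \<phi> (adj x * y) + cnj c * \<phi> (adj y * x) +
        of_real ((cmod c)\<^sup>2) * of_real (Re (\<phi> (adj y * y))) = complex_of_real r" by blast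
  qed (use F x y in auto)
qed

text \<open>
  For \<open>h = a\<^sup>* a\<close> of norm 1 and \<open>g = 1 - \<surd>(1 - h)\<close>, the difference \<open>x\<^sup>* x - x\<^sup>* h x\<close> is \<open>(x - g x)\<^sup>* (x - g x)\<close>.
\<close>

lemma functional_bounded:
  assumes \<phi>: "pos_functional I \<phi>" and a: "a \<in> I" and x: "x \<in> I"
  shows "Re (\<phi> (adj (a * x) * (a * x))) \<le> (norm a)\<^sup>2 * Re (\<phi> (adj x * x))"
proof (cases "a = 0")
  case True
  have "\<phi> 0 = 0" using pos_functionalD(2)[OF \<phi> x, of 0] by (simp add: scaleC_zero_left)
  then show ?thesis using True by simp
next
  case False
  note F = pos_functionalD[OF \<phi>] and cl = star_closedD[OF I(2)]
  define r where "r = inverse ((norm a)\<^sup>2)"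
  have r: "r > 0" using False by (simp add: r_def)
  define h where "h = r *\<^sub>R (adj a * a)"
  have nh: "norm h \<le> 1" using False r by (simp add: h_def norm_adj_mult r_def)
  have ah: "adj h = h" by (simp add: h_def adj_scaleR adj_mult adj_adj)
  have hI: "h \<in> I" using a by (simp add: h_def cl)
  obtain g where g': "quasi_root h g" using quasi_root_exists[OF nh ah] ..
  note g = quasi_rootD[OF g']
  have gI: "g \<in> I" by (rule g(5)[OF I hI])
  define y where "y = x - g * x"
  have y: "y \<in> I" using x gI by (simp add: y_def cl)
  have "adj y * y = adj x * x - adj x * (2 *\<^sub>R g - g * g) * x"
    by (simp add: y_def adj_diff adj_mult g(2) algebra_simps scaleR_2)
  also have "\<dots> = adj x * x - r *\<^sub>R (adj (a * x) * (a * x))"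
    unfolding g(1) by (simp add: h_def adj_mult mult.assoc)
  finally have "adj x * x = adj y * y + scaleC (of_real r) (adj (a * x) * (a * x))"
    by (simp add: scaleC_of_real)
  moreover have "\<phi> (adj y * y + scaleC (of_real r) (adj (a * x) * (a * x))) =
      \<phi> (adj y * y) + of_real r * \<phi> (adj (a * x) * (a * x))"
    using y a x by (simp add: F(1,2) cl)
  ultimately have "Re (\<phi> (adj x * x)) = Re (\<phi> (adj y * y)) + r * Re (\<phi> (adj (a * x) * (a * x)))" by simp
  then have "r * Re (\<phi> (adj (a * x) * (a * x))) \<le> Re (\<phi> (adj x * x))" using F(4)[OF y] by simp
  then show ?thesis using False by (simp add: r_def field_simps)
qed

context
  fixes \<gamma> :: "'a \<Rightarrow> 'a"
  assumes \<gamma>: "grading_on I \<gamma>"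
begin

text \<open>
  A state \<open>F\<close> with \<open>F (h\<^sup>4) = \<parallel>h\<parallel>\<^sup>4\<close> satisfies \<open>F (h\<^sup>2\<^sup>n) \<ge> \<parallel>h\<parallel>\<^sup>2\<^sup>n\<close>, since these numbers are logarithmically convex;
  its average with \<open>F \<circ> \<gamma>\<close> satisfies this up to the factor 2, which is irrelevant for large \<open>n\<close>.
\<close>

lemma norm_le_selfadj:
  assumes h: "h \<in> I" "adj h = h" and K: "K \<ge> 0"
    and bound: "\<And>\<phi> x. gstate I \<gamma> \<phi> \<Longrightarrow> x \<in> I \<Longrightarrow> Re (\<phi> (adj (h * x) * (h * x))) \<le> K\<^sup>2 * Re (\<phi> (adj x * x))"
  shows "norm h \<le> K"
proof (cases "h = 0")
  case True then show ?thesis using K by simp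
next
  case False
  then have nh: "norm h > 0" by simp
  note cl = star_closedD[OF I(2)] and G = grading_onD[OF \<gamma>]
  note hom = star_hom_onD[OF G(3)]
  obtain F :: "'a \<Rightarrow> complex" where F: "\<And>x y. F (x + y) = F x + F y" "\<And>c x. F (scaleC c x) = c * F x"
    "\<And>x. \<exists>r\<ge>0. F (adj x * x) = complex_of_real r" "\<And>x. cmod (F x) \<le> norm x"
    "F (adj (h * h) * (h * h)) = complex_of_real ((norm (h * h))\<^sup>2)"
    by (rule state_exists[of "h * h"]) blast
  have posF: "pos_functional I F" using F(1,2,3) by (simp add: pos_functional_def)
  \<comment> \<open>The power n + 1 of h, as there is no unit to start from; so \<open>v n\<close>
    below is the value of F at the power 2 n + 2.\<close>
  define y where "y n = ((*) h ^^ n) h" for n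
  have y0: "y 0 = h" and ySuc: "y (Suc n) = h * y n" for n by (simp_all add: y_def)
  have yI: "y n \<in> I" for n by (induction n) (simp_all add: y0 ySuc h cl)
  have hy: "h * y n = y n * h" for n
  proof (induction n)
    case (Suc n)
    then show ?case by (metis ySuc mult.assoc)
  qed (simp add: y0)
  have ay: "adj (y n) = y n" for n by (induction n) (simp_all add: y0 ySuc adj_mult h hy)
  define v where "v n = Re (F (adj (y n) * y n))" for n
  have v_nonneg: "v n \<ge> 0" for n using F(3)[of "y n"] by (auto simp: v_def)
  have v1: "v 1 = (norm h) ^ 4"
  proof -
    have "norm (h * h) = (norm h)\<^sup>2" using norm_adj_mult[of h] h by simp
    then have "(norm (h * h))\<^sup>2 = norm h ^ 4" by (simp flip: power_mult)
    then show ?thesis using F(5) by (simp add: v_def y0 ySuc)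
  qed
  have v0: "v 0 \<le> (norm h)\<^sup>2"
    using F(4)[of "h * h"] norm_adj_mult[of h] complex_Re_le_cmod[of "F (h * h)"] h by (simp add: v_def y0)
  \<comment> \<open>Cauchy-Schwarz for the powers n + 1 and n + 3 of h, whose product is the square
    of the power n + 2.\<close>
  have conv: "(v (Suc n))\<^sup>2 \<le> v n * v (Suc (Suc n))" for n
  proof -
    have "y n * (h * (h * y n)) = (y n * h) * (h * y n)" by (simp only: mult.assoc)
    then have "adj (y n) * y (Suc (Suc n)) = adj (y (Suc n)) * y (Suc n)"
      unfolding ay[of n] ay[of "Suc n"] by (simp only: ySuc hy[of n, symmetric])
    then have "(cmod (F (adj (y (Suc n)) * y (Suc n))))\<^sup>2 \<le> v n * v (Suc (Suc n))"
      using functional_cauchy_schwarz[OF posF yI yI, of n "Suc (Suc n)"] by (simp add: v_def)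
    moreover have "(v (Suc n))\<^sup>2 \<le> (cmod (F (adj (y (Suc n)) * y (Suc n))))\<^sup>2"
      using v_nonneg[of "Suc n"] unfolding v_def by (intro power_mono complex_Re_le_cmod)
    ultimately show ?thesis by simp
  qed
  \<comment> \<open>The ratio of the first two values is at least the square of
    \<open>norm h\<close>, and convexity makes the ratios increase.\<close>
  have grow: "v n > 0 \<and> (norm h)\<^sup>2 * v n \<le> v (Suc n)" for n
  proof (induction n)
    case 0
    have "v 1 \<le> (norm h)\<^sup>2 * v 0"
      using functional_bounded[OF posF h(1) h(1)] by (simp add: v_def y0 ySuc)
    then have "v 0 > 0" using v1 nh v_nonneg[of 0] by (cases "v 0 = 0") auto
    moreover have "(norm h)\<^sup>2 * v 0 \<le> (norm h)\<^sup>2 * (norm h)\<^sup>2" using v0 by (intro mult_left_mono) auto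
    ultimately show ?case using v1 by (simp flip: power_add)
  next
    case (Suc n)
    have pos: "v (Suc n) > 0"
      using Suc nh by (meson less_le_trans mult_pos_pos zero_less_power)
    have "v n * ((norm h)\<^sup>2 * v (Suc n)) = ((norm h)\<^sup>2 * v n) * v (Suc n)" by simp
    also have "\<dots> \<le> v (Suc n) * v (Suc n)" using Suc pos by (intro mult_right_mono) auto
    also have "\<dots> \<le> v n * v (Suc (Suc n))" using conv[of n] by (simp add: power2_eq_square)
    finally show ?case using Suc pos by simp
  qed
  have v_ge: "v n \<ge> v 0 * ((norm h)\<^sup>2) ^ n" for n
  proof (induction n)
    case (Suc n)
    have "v 0 * ((norm h)\<^sup>2) ^ Suc n = (norm h)\<^sup>2 * (v 0 * ((norm h)\<^sup>2) ^ n)" by simp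
    also have "\<dots> \<le> (norm h)\<^sup>2 * v n" using Suc by (intro mult_left_mono) auto
    also have "\<dots> \<le> v (Suc n)" using grow by simp
    finally show ?case .
  qed simp
  define \<psi> where "\<psi> x = (F x + F (\<gamma> x)) / 2" for x
  have \<psi>_add: "\<psi> (x + y) = \<psi> x + \<psi> y" if "x \<in> I" "y \<in> I" for x y
    using that by (simp add: \<psi>_def hom F(1) add_divide_distrib)
  have \<psi>_C: "\<psi> (scaleC c x) = c * \<psi> x" if "x \<in> I" for x c
    using that by (simp add: \<psi>_def hom F(2) distrib_left)
  have \<psi>_sq: "\<psi> (adj x * x) = complex_of_real ((Re (F (adj x * x)) + Re (F (adj (\<gamma> x) * \<gamma> x))) / 2)"
    if "x \<in> I" for x
    using that pos_functionalD(3)[OF posF, of x] pos_functionalD(3)[OF posF, of "\<gamma> x"] G(4)[of x]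
    by (simp add: \<psi>_def hom cl)
  have Fpos: "Re (F (adj x * x)) \<ge> 0" for x using F(3)[of x] by auto
  have \<psi>_le: "cmod (\<psi> x) \<le> norm x" if "x \<in> I" for x
    using norm_triangle_ineq[of "F x" "F (\<gamma> x)"] F(4)[of x] F(4)[of "\<gamma> x"] norm_grading[OF \<gamma> that]
    by (simp add: \<psi>_def norm_divide)
  have \<psi>_\<gamma>: "\<psi> (\<gamma> x) = \<psi> x" if "x \<in> I" for x
    using G(5)[OF that] by (simp add: \<psi>_def add.commute)
  let ?B = "{x \<in> I. norm x \<le> 1}"
  \<comment> \<open>The norm of \<psi>. A state must have norm 1, so \<psi> is divided by R, which
    is positive because \<psi> is positive at h h.\<close>
  define R where "R = (SUP x\<in>?B. cmod (\<psi> x))"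
  have bdd: "bdd_above ((\<lambda>x. cmod (\<psi> x)) ` ?B)"
    using \<psi>_le by (intro bdd_aboveI2[where M=1]) force
  have R_ge: "cmod (\<psi> x) \<le> R * norm x" if x: "x \<in> I" for x
  proof (cases "x = 0")
    case True then show ?thesis using \<psi>_le[OF x] by simp
  next
    case False
    let ?x = "scaleC (of_real (inverse (norm x))) x"
    have "cmod (\<psi> ?x) \<le> R"
      unfolding R_def using x False by (intro cSUP_upper bdd) (auto simp: cl norm_scaleC norm_inverse)
    then show ?thesis using x False by (simp add: \<psi>_C norm_mult norm_inverse norm_divide field_simps)
  qed
  have u0: "Re (\<psi> (adj (y n) * y n)) \<ge> v n / 2" for n
    unfolding \<psi>_sq[OF yI] using Fpos[of "\<gamma> (y n)"] by (simp add: v_def)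
  have "Re (\<psi> (adj (y 0) * y 0)) > 0" using u0[of 0] grow[of 0] by simp
  then have "0 < cmod (\<psi> (adj (y 0) * y 0))" using complex_Re_le_cmod less_le_trans by blast
  also have "\<dots> \<le> R * norm (adj (y 0) * y 0)" by (intro R_ge cl yI)
  finally have R: "R > 0" by (simp add: zero_less_mult_iff)
  define \<phi> where "\<phi> x = \<psi> x / of_real R" for x
  have "gstate I \<gamma> \<phi>"
    unfolding gstate_def
  proof (intro conjI ballI allI)
    show "(SUP x\<in>?B. cmod (\<phi> x)) = 1"
    proof (rule antisym)
      have ne: "?B \<noteq> {}" using cl(1) by force
      show "(SUP x\<in>?B. cmod (\<phi> x)) \<le> 1"
      proof (rule cSUP_least[OF ne])
        fix x assume x: "x \<in> ?B"
        have "cmod (\<psi> x) \<le> R" unfolding R_def using x by (intro cSUP_upper bdd)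
        then show "cmod (\<phi> x) \<le> 1" using R by (simp add: \<phi>_def norm_divide)
      qed
      have bdd': "bdd_above ((\<lambda>x. cmod (\<phi> x)) ` ?B)"
      proof (rule bdd_aboveI2[where M=1])
        fix x assume x: "x \<in> ?B"
        have "cmod (\<psi> x) \<le> R" unfolding R_def using x by (intro cSUP_upper bdd)
        then show "cmod (\<phi> x) \<le> 1" using R by (simp add: \<phi>_def norm_divide)
      qed
      have "R \<le> R * (SUP x\<in>?B. cmod (\<phi> x))"
        unfolding R_def[of]
      proof (rule cSUP_least[OF ne])
        fix x assume x: "x \<in> ?B"
        have "cmod (\<phi> x) \<le> (SUP x\<in>?B. cmod (\<phi> x))" by (rule cSUP_upper[OF x bdd'])
        then have "R * cmod (\<phi> x) \<le> R * (SUP x\<in>?B. cmod (\<phi> x))" using R by (intro mult_left_mono) auto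
        moreover have "R * cmod (\<phi> x) = cmod (\<psi> x)" using R by (simp add: \<phi>_def norm_divide)
        ultimately show "cmod (\<psi> x) \<le> (SUP x\<in>?B. cmod (\<psi> x)) * (SUP x\<in>?B. cmod (\<phi> x))"
          by (simp add: R_def)
      qed
      then show "1 \<le> (SUP x\<in>?B. cmod (\<phi> x))" using R by simp
    qed
    fix x assume x: "x \<in> I"
    show "\<phi> (x + y) = \<phi> x + \<phi> y" if "y \<in> I" for y using x that by (simp add: \<phi>_def \<psi>_add add_divide_distrib)
    show "\<phi> (scaleC c x) = c * \<phi> x" for c using x by (simp add: \<phi>_def \<psi>_C)
    show "\<exists>r\<ge>0. \<phi> (adj x * x) = complex_of_real r"
      unfolding \<phi>_def \<psi>_sq[OF x] using R Fpos[of x] Fpos[of "\<gamma> x"]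
      by (intro exI[of _ "(Re (F (adj x * x)) + Re (F (adj (\<gamma> x) * \<gamma> x))) / 2 / R"]) simp
    show "cmod (\<phi> x) \<le> norm x" using R_ge[OF x] R by (simp add: \<phi>_def norm_divide field_simps)
    show "\<phi> (\<gamma> x) = \<phi> x" using \<psi>_\<gamma>[OF x] by (simp add: \<phi>_def)
  qed
  define u where "u n = Re (\<psi> (adj (y n) * y n))" for n
  have step: "u (Suc n) \<le> K\<^sup>2 * u n" for n
  proof -
    have "Re (\<phi> (adj (y (Suc n)) * y (Suc n))) \<le> K\<^sup>2 * Re (\<phi> (adj (y n) * y n))"
      unfolding ySuc using \<open>gstate I \<gamma> \<phi>\<close> yI by (rule bound)
    then show ?thesis using R by (simp add: \<phi>_def u_def field_simps)
  qed
  have u_le: "u n \<le> (K\<^sup>2) ^ n * u 0" for n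
  proof (induction n)
    case (Suc n)
    have "K\<^sup>2 * u n \<le> K\<^sup>2 * ((K\<^sup>2) ^ n * u 0)" using Suc by (intro mult_left_mono) auto
    then show ?case using step[of n] by simp
  qed simp
  \<comment> \<open>The factor 2 comes from averaging. It is independent of n, so
    \<open>geometric_domination\<close> removes the constant.\<close>
  have bd: "((norm h)\<^sup>2) ^ n \<le> (K\<^sup>2) ^ n * (2 * u 0 / v 0)" for n
  proof -
    have "v 0 * ((norm h)\<^sup>2) ^ n \<le> 2 * ((K\<^sup>2) ^ n * u 0)"
      using v_ge[of n] u0[of n] u_le[of n] by (simp add: u_def)
    then show ?thesis using grow[of 0] by (simp add: field_simps)
  qed
  have "K \<noteq> 0"
  proof
    assume "K = 0"
    then show False using bd[of 1] nh by simp
  qed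
  have "(norm h)\<^sup>2 \<le> K\<^sup>2"
  proof (rule geometric_domination[where A="2 * u 0 / v 0" and B=0])
    show "((norm h)\<^sup>2) ^ (2 ^ k) \<le> (K\<^sup>2) ^ (2 ^ k) * (2 * u 0 / v 0 + 0 * 2 ^ k)" for k
      using bd[of "2 ^ k"] by (simp only: mult_zero_left add_0_right)
    show "0 < K\<^sup>2" using \<open>K \<noteq> 0\<close> by simp
  qed simp
  then show ?thesis using K by (rule power2_le_imp_le)
qed

text \<open>For h = \<open>adj a * a\<close> the hypothesis on a and
  \<open>functional_bounded\<close> for \<open>adj a\<close> give the constant
  \<open>norm a * K\<close>. The self-adjoint case then bounds the square of \<open>norm a\<close>
  by \<open>norm a * K\<close>.\<close>

lemma norm_le_of_states:
  assumes a: "a \<in> I" and K: "K \<ge> 0"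
    and bound: "\<And>\<phi> x. gstate I \<gamma> \<phi> \<Longrightarrow> x \<in> I \<Longrightarrow> Re (\<phi> (adj (a * x) * (a * x))) \<le> K\<^sup>2 * Re (\<phi> (adj x * x))"
  shows "norm a \<le> K"
proof -
  note cl = star_closedD[OF I(2)]
  have "norm (adj a * a) \<le> norm a * K"
  proof (rule norm_le_selfadj)
    fix \<phi> x assume \<phi>: "gstate I \<gamma> \<phi>" and x: "x \<in> I"
    have "Re (\<phi> (adj (adj a * (a * x)) * (adj a * (a * x)))) \<le> (norm a)\<^sup>2 * Re (\<phi> (adj (a * x) * (a * x)))"
      using functional_bounded[OF gstateD(1)[OF \<phi>], of "adj a" "a * x"] a x by (simp add: cl norm_adj)
    also have "\<dots> \<le> (norm a)\<^sup>2 * (K\<^sup>2 * Re (\<phi> (adj x * x)))"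
      using bound[OF \<phi> x] by (intro mult_left_mono) auto
    finally show "Re (\<phi> (adj (adj a * a * x) * (adj a * a * x))) \<le> (norm a * K)\<^sup>2 * Re (\<phi> (adj x * x))"
      by (simp add: mult.assoc power_mult_distrib)
  qed (use a K in \<open>auto simp: cl adj_mult adj_adj\<close>)
  then have "norm a * norm a \<le> norm a * K" by (simp add: norm_adj_mult power2_eq_square)
  then show ?thesis using K by (cases "norm a = 0") auto
qed

end

end

section \<open>The crossed product as a C*-algebra\<close>

lemma plane_cauchy_schwarz: "a * c + b * d \<le> sqrt (a\<^sup>2 + b\<^sup>2) * sqrt (c\<^sup>2 + d\<^sup>2)" for a b c d :: real
proof -
  have "(a * c + b * d)\<^sup>2 \<le> (a\<^sup>2 + b\<^sup>2) * (c\<^sup>2 + d\<^sup>2)"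
    using zero_le_power2[of "a * d - b * c"] by (simp add: power2_eq_square algebra_simps)
  then show ?thesis by (simp add: real_le_rsqrt flip: real_sqrt_mult)
qed

locale crossed_product =
  fixes I :: "'a::cstar_type set" and \<gamma> :: "'a \<Rightarrow> 'a"
  assumes grading: "grading_on I \<gamma>"
begin

lemmas G = grading_onD[OF grading]
lemmas cl = star_closedD[OF G(2)]
lemmas hom = star_hom_onD[OF G(3)]

lemma cmul_in: "P \<in> I \<times> I \<Longrightarrow> Q \<in> I \<times> I \<Longrightarrow> cmul \<gamma> P Q \<in> I \<times> I"
  by (auto simp: cmul_def cl G(4))

lemma cadj_in: "P \<in> I \<times> I \<Longrightarrow> cadj \<gamma> P \<in> I \<times> I"
  by (auto simp: cadj_def cl G(4))

lemma cscale_in: "P \<in> I \<times> I \<Longrightarrow> cscale c P \<in> I \<times> I"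
  by (auto simp: cscale_def cl)

lemma add_in: "P \<in> I \<times> I \<Longrightarrow> Q \<in> I \<times> I \<Longrightarrow> P + Q \<in> I \<times> I"
  by (cases P; cases Q) (auto simp: cl)

lemmas crossed_in = cmul_in cadj_in cscale_in add_in

lemma cmul_assoc:
  "P \<in> I \<times> I \<Longrightarrow> Q \<in> I \<times> I \<Longrightarrow> R \<in> I \<times> I \<Longrightarrow> cmul \<gamma> (cmul \<gamma> P Q) R = cmul \<gamma> P (cmul \<gamma> Q R)"
  by (auto simp: cmul_def cl G(4,5) hom algebra_simps)

lemma cmul_add_left:
  "P \<in> I \<times> I \<Longrightarrow> Q \<in> I \<times> I \<Longrightarrow> R \<in> I \<times> I \<Longrightarrow> cmul \<gamma> (P + Q) R = cmul \<gamma> P R + cmul \<gamma> Q R"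
  by (auto simp: cmul_def algebra_simps)

lemma cmul_add_right:
  "P \<in> I \<times> I \<Longrightarrow> Q \<in> I \<times> I \<Longrightarrow> R \<in> I \<times> I \<Longrightarrow> cmul \<gamma> R (P + Q) = cmul \<gamma> R P + cmul \<gamma> R Q"
  by (auto simp: cmul_def hom algebra_simps)

lemma cscale_simps:
  "cscale (c + d) P = cscale c P + cscale d P" "cscale c (P + Q) = cscale c P + cscale c Q"
  "cscale (c * d) P = cscale c (cscale d P)" "cscale 1 P = P"
  by (cases P; cases Q; simp add: cscale_def scaleC_simps)+

lemma cmul_scale_left: "cmul \<gamma> (cscale c P) Q = cscale c (cmul \<gamma> P Q)"
  by (simp add: cmul_def cscale_def scaleC_simps)

lemma cmul_scale_right: "Q \<in> I \<times> I \<Longrightarrow> cmul \<gamma> P (cscale c Q) = cscale c (cmul \<gamma> P Q)"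
  by (auto simp: cmul_def cscale_def scaleC_simps hom)

lemma cadj_cadj: "P \<in> I \<times> I \<Longrightarrow> cadj \<gamma> (cadj \<gamma> P) = P"
  by (auto simp: cadj_def adj_adj hom(3)[symmetric] G(4,5) cl)

lemma cadj_add: "P \<in> I \<times> I \<Longrightarrow> Q \<in> I \<times> I \<Longrightarrow> cadj \<gamma> (P + Q) = cadj \<gamma> P + cadj \<gamma> Q"
  by (auto simp: cadj_def adj_add hom cl)

lemma cadj_scale: "P \<in> I \<times> I \<Longrightarrow> cadj \<gamma> (cscale c P) = cscale (cnj c) (cadj \<gamma> P)"
  by (auto simp: cadj_def cscale_def adj_scaleC hom cl)

lemma cadj_cmul: "P \<in> I \<times> I \<Longrightarrow> Q \<in> I \<times> I \<Longrightarrow> cadj \<gamma> (cmul \<gamma> P Q) = cmul \<gamma> (cadj \<gamma> Q) (cadj \<gamma> P)"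
  by (auto simp: cadj_def cmul_def adj_add adj_mult hom(1,2) hom(3)[symmetric] G(4,5) cl add.commute)

text \<open>\<open>s \<phi>\<close> is the GNS seminorm of \<phi> on I, and \<open>q \<phi>\<close>
  that of x + y e -> \<phi> x on the crossed product. By invariance of \<phi> the latter is the
  Euclidean combination of the seminorms of x and y.\<close>

definition s :: "('a \<Rightarrow> complex) \<Rightarrow> 'a \<Rightarrow> real" where
  "s \<phi> x = sqrt (Re (\<phi> (adj x * x)))"

definition q :: "('a \<Rightarrow> complex) \<Rightarrow> 'a \<times> 'a \<Rightarrow> real" where
  "q \<phi> P = sqrt ((s \<phi> (fst P))\<^sup>2 + (s \<phi> (snd P))\<^sup>2)"

lemma q_nonneg: "q \<phi> P \<ge> 0"
  by (simp add: q_def)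

context
  fixes \<phi> assumes \<phi>: "gstate I \<gamma> \<phi>"
begin

lemmas F = pos_functionalD[OF gstateD(1)[OF \<phi>]]

lemma s_nonneg: "x \<in> I \<Longrightarrow> s \<phi> x \<ge> 0"
  using F(4) by (simp add: s_def)

lemma s_sq: "x \<in> I \<Longrightarrow> (s \<phi> x)\<^sup>2 = Re (\<phi> (adj x * x))"
  using F(4) by (simp add: s_def)

lemma s_cs: "x \<in> I \<Longrightarrow> y \<in> I \<Longrightarrow> cmod (\<phi> (adj x * y)) \<le> s \<phi> x * s \<phi> y"
  using functional_cauchy_schwarz[OF G(1,2) gstateD(1)[OF \<phi>], of x y]
  by (simp add: s_def real_le_rsqrt flip: real_sqrt_mult)

lemma s_add:
  assumes x: "x \<in> I" and y: "y \<in> I" shows "s \<phi> (x + y) \<le> s \<phi> x + s \<phi> y"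
proof -
  have "\<phi> (adj (x + y) * (x + y)) = \<phi> (adj x * x) + \<phi> (adj x * y) + (\<phi> (adj y * x) + \<phi> (adj y * y))"
    using x y by (simp add: adj_add distrib_left distrib_right F(1) cl)
  then have "(s \<phi> (x + y))\<^sup>2 \<le> (s \<phi> x)\<^sup>2 + s \<phi> x * s \<phi> y + (s \<phi> y * s \<phi> x + (s \<phi> y)\<^sup>2)"
    using x y s_cs[OF x y] s_cs[OF y x] complex_Re_le_cmod[of "\<phi> (adj x * y)"] complex_Re_le_cmod[of "\<phi> (adj y * x)"]
    by (simp add: s_sq cl mult.commute[of "s \<phi> y" "s \<phi> x"])
  also have "\<dots> = (s \<phi> x + s \<phi> y)\<^sup>2" by (simp add: power2_eq_square algebra_simps)
  finally show ?thesis by (rule power2_le_imp_le) (intro add_nonneg_nonneg s_nonneg x y)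
qed

lemma s_mult: "a \<in> I \<Longrightarrow> x \<in> I \<Longrightarrow> s \<phi> (a * x) \<le> norm a * s \<phi> x"
  using real_sqrt_le_mono[OF functional_bounded[OF G(1,2) gstateD(1)[OF \<phi>], of a x]]
  by (simp add: s_def real_sqrt_mult)

lemma s_gamma: "x \<in> I \<Longrightarrow> s \<phi> (\<gamma> x) = s \<phi> x"
  using gstateD(3)[OF \<phi>, of "adj x * x"] by (simp add: s_def hom cl)

lemma cform_eq: "P \<in> I \<times> I \<Longrightarrow> cform \<gamma> \<phi> P = complex_of_real ((q \<phi> P)\<^sup>2)"
proof -
  assume P: "P \<in> I \<times> I"
  obtain x y where [simp]: "P = (x, y)" and xy: "x \<in> I" "y \<in> I" using P by auto
  have "cform \<gamma> \<phi> P = \<phi> (adj x * x) + \<phi> (\<gamma> (adj y * y))"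
    using xy by (simp add: cform_def cmul_def cadj_def hom cl F(1) G(4))
  then show ?thesis using xy F(3)[OF xy(1)] F(3)[OF xy(2)]
    by (simp add: gstateD(3)[OF \<phi>] cl q_def s_sq F(4))
qed

lemma q_add:
  assumes "P \<in> I \<times> I" "Q \<in> I \<times> I" shows "q \<phi> (P + Q) \<le> q \<phi> P + q \<phi> Q"
proof -
  have PQ: "fst P \<in> I" "snd P \<in> I" "fst Q \<in> I" "snd Q \<in> I" using assms by auto
  have "q \<phi> (P + Q) \<le> sqrt ((s \<phi> (fst P) + s \<phi> (fst Q))\<^sup>2 + (s \<phi> (snd P) + s \<phi> (snd Q))\<^sup>2)"
    unfolding q_def using PQ
    by (intro real_sqrt_le_mono add_mono power_mono) (simp_all add: s_add s_nonneg cl)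
  also have "\<dots> \<le> q \<phi> P + q \<phi> Q" unfolding q_def by (rule real_sqrt_sum_squares_triangle_ineq)
  finally show ?thesis .
qed

lemma q_cs:
  assumes "P \<in> I \<times> I" "Q \<in> I \<times> I"
  shows "Re (\<phi> (fst (cmul \<gamma> (cadj \<gamma> P) Q))) \<le> q \<phi> P * q \<phi> Q"
proof -
  obtain x y u v where [simp]: "P = (x, y)" "Q = (u, v)" and I: "x \<in> I" "y \<in> I" "u \<in> I" "v \<in> I"
    using assms by auto
  have "\<phi> (fst (cmul \<gamma> (cadj \<gamma> P) Q)) = \<phi> (adj x * u) + \<phi> (\<gamma> (adj y * v))"
    using I by (simp add: cmul_def cadj_def hom cl F(1) G(4))
  then have "Re (\<phi> (fst (cmul \<gamma> (cadj \<gamma> P) Q))) \<le> s \<phi> x * s \<phi> u + s \<phi> y * s \<phi> v"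
    using s_cs[OF I(1,3)] s_cs[OF I(2,4)] complex_Re_le_cmod[of "\<phi> (adj x * u)"]
      complex_Re_le_cmod[of "\<phi> (adj y * v)"] I by (simp add: gstateD(3)[OF \<phi>] cl)
  also have "\<dots> \<le> q \<phi> P * q \<phi> Q" unfolding q_def using plane_cauchy_schwarz by simp
  finally show ?thesis .
qed

lemma q_bound_one:
  assumes a: "a \<in> I" and xy: "x \<in> I" "y \<in> I"
  shows "q \<phi> (a * x, a * y) \<le> norm a * q \<phi> (x, y)"
proof -
  have "q \<phi> (a * x, a * y) \<le> sqrt ((norm a * s \<phi> x)\<^sup>2 + (norm a * s \<phi> y)\<^sup>2)"
    unfolding q_def using a xy
    by (intro real_sqrt_le_mono add_mono power_mono) (simp_all add: s_mult s_nonneg cl)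
  also have "(norm a * s \<phi> x)\<^sup>2 + (norm a * s \<phi> y)\<^sup>2 = (norm a)\<^sup>2 * ((s \<phi> x)\<^sup>2 + (s \<phi> y)\<^sup>2)"
    by (simp add: power_mult_distrib distrib_left)
  finally show ?thesis by (simp add: q_def real_sqrt_mult)
qed

text \<open>Left multiplication by a + b e is a plus b after e. Since \<phi> is invariant, e acts
  isometrically, sending (x, y) to (\<gamma> y, \<gamma> x).\<close>

lemma q_bound:
  assumes "P \<in> I \<times> I" "Q \<in> I \<times> I"
  shows "q \<phi> (cmul \<gamma> P Q) \<le> (norm (fst P) + norm (snd P)) * q \<phi> Q"
proof -
  obtain a b x y where [simp]: "P = (a, b)" "Q = (x, y)" and I: "a \<in> I" "b \<in> I" "x \<in> I" "y \<in> I"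
    using assms by auto
  have "cmul \<gamma> P Q = (a * x, a * y) + (b * \<gamma> y, b * \<gamma> x)" by (simp add: cmul_def)
  then have "q \<phi> (cmul \<gamma> P Q) \<le> q \<phi> (a * x, a * y) + q \<phi> (b * \<gamma> y, b * \<gamma> x)"
    using I q_add[of "(a * x, a * y)" "(b * \<gamma> y, b * \<gamma> x)"] by (simp add: cl G(4))
  also have "\<dots> \<le> norm a * q \<phi> (x, y) + norm b * q \<phi> (\<gamma> y, \<gamma> x)"
    using I by (intro add_mono q_bound_one G(4))
  also have "q \<phi> (\<gamma> y, \<gamma> x) = q \<phi> (x, y)" using I by (simp add: q_def s_gamma add.commute)
  finally show ?thesis by (simp add: distrib_right)
qed

end

lemma cform_Re: "gstate I \<gamma> \<phi> \<Longrightarrow> P \<in> I \<times> I \<Longrightarrow> Re (cform \<gamma> \<phi> P) = (q \<phi> P)\<^sup>2"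
  by (simp add: cform_eq)

lemma cform_zero_iff: "gstate I \<gamma> \<phi> \<Longrightarrow> P \<in> I \<times> I \<Longrightarrow> cform \<gamma> \<phi> P = 0 \<longleftrightarrow> q \<phi> P = 0"
  by (simp add: cform_eq)

abbreviation (input) "ratios P \<equiv> {Re (cform \<gamma> \<phi> (cmul \<gamma> P Q)) / Re (cform \<gamma> \<phi> Q) | \<phi> Q.
     gstate I \<gamma> \<phi> \<and> Q \<in> I \<times> I \<and> cform \<gamma> \<phi> Q \<noteq> 0}"

lemma ratios_le:
  assumes P: "P \<in> I \<times> I" and K: "K \<ge> 0"
    and bound: "\<And>\<phi> Q. gstate I \<gamma> \<phi> \<Longrightarrow> Q \<in> I \<times> I \<Longrightarrow> q \<phi> (cmul \<gamma> P Q) \<le> K * q \<phi> Q"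
    and x: "x \<in> insert 0 (ratios P)"
  shows "x \<le> K\<^sup>2"
proof (cases "x = 0")
  case False
  then obtain \<phi> Q where \<phi>: "gstate I \<gamma> \<phi>" and Q: "Q \<in> I \<times> I" "cform \<gamma> \<phi> Q \<noteq> 0"
    and x: "x = Re (cform \<gamma> \<phi> (cmul \<gamma> P Q)) / Re (cform \<gamma> \<phi> Q)" using x by blast
  have "q \<phi> Q \<noteq> 0" using Q \<phi> by (simp add: cform_zero_iff)
  moreover have "(q \<phi> (cmul \<gamma> P Q))\<^sup>2 \<le> (K * q \<phi> Q)\<^sup>2"
    using bound[OF \<phi> Q(1)] by (intro power_mono q_nonneg)
  ultimately show ?thesis
    using \<phi> Q P by (simp add: x cform_Re cmul_in power_mult_distrib divide_le_eq)
qed simp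

text \<open>Together with \<open>cnorm_ge\<close> this describes \<open>cnorm I \<gamma> P\<close>
  as the least common bound for left multiplication by P in all GNS seminorms, which is how the norm
  axioms are proved.\<close>

lemma cnorm_le:
  assumes "P \<in> I \<times> I" "K \<ge> 0"
    "\<And>\<phi> Q. gstate I \<gamma> \<phi> \<Longrightarrow> Q \<in> I \<times> I \<Longrightarrow> q \<phi> (cmul \<gamma> P Q) \<le> K * q \<phi> Q"
  shows "cnorm I \<gamma> P \<le> K"
proof -
  have "Sup (insert 0 (ratios P)) \<le> K\<^sup>2"
    by (rule cSup_least) (auto intro!: ratios_le[OF assms])
  then have "cnorm I \<gamma> P \<le> sqrt (K\<^sup>2)" unfolding cnorm_def by (rule real_sqrt_le_mono)
  then show ?thesis using assms(2) by simp
qed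

lemma
  assumes P: "P \<in> I \<times> I"
  shows cnorm_nonneg: "cnorm I \<gamma> P \<ge> 0"
    and cnorm_ge: "gstate I \<gamma> \<phi> \<Longrightarrow> Q \<in> I \<times> I \<Longrightarrow> q \<phi> (cmul \<gamma> P Q) \<le> cnorm I \<gamma> P * q \<phi> Q"
proof -
  have bdd: "bdd_above (insert 0 (ratios P))"
    by (rule bdd_aboveI, rule ratios_le[OF P, of "norm (fst P) + norm (snd P)"])
      (auto intro: q_bound[OF _ P])
  have pos: "0 \<le> Sup (insert 0 (ratios P))" by (rule cSup_upper[OF _ bdd]) simp
  then show "cnorm I \<gamma> P \<ge> 0" by (simp add: cnorm_def)
  assume \<phi>: "gstate I \<gamma> \<phi>" and Q: "Q \<in> I \<times> I"
  show "q \<phi> (cmul \<gamma> P Q) \<le> cnorm I \<gamma> P * q \<phi> Q"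
  proof (cases "q \<phi> Q = 0")
    case True
    \<comment> \<open>Vectors of seminorm 0 do not enter the supremum; \<open>q_bound\<close> shows
      that P maps them to such vectors.\<close>
    then show ?thesis using q_bound[OF \<phi> P Q] by simp
  next
    case False
    then have "cform \<gamma> \<phi> Q \<noteq> 0" using \<phi> Q by (simp add: cform_zero_iff)
    then have "Re (cform \<gamma> \<phi> (cmul \<gamma> P Q)) / Re (cform \<gamma> \<phi> Q) \<le> Sup (insert 0 (ratios P))"
      using \<phi> Q by (intro cSup_upper[OF _ bdd]) blast
    then have "(q \<phi> (cmul \<gamma> P Q))\<^sup>2 / (q \<phi> Q)\<^sup>2 \<le> (cnorm I \<gamma> P)\<^sup>2"
      using \<phi> Q P pos by (simp add: cform_Re cmul_in cnorm_def)
    then have "(q \<phi> (cmul \<gamma> P Q))\<^sup>2 \<le> (cnorm I \<gamma> P * q \<phi> Q)\<^sup>2"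
      using False by (simp add: divide_le_eq power_mult_distrib)
    moreover have "0 \<le> cnorm I \<gamma> P * q \<phi> Q" using pos by (simp add: cnorm_def q_nonneg)
    ultimately show ?thesis by (rule power2_le_imp_le)
  qed
qed

lemma cnorm_upper: "P \<in> I \<times> I \<Longrightarrow> cnorm I \<gamma> P \<le> norm (fst P) + norm (snd P)"
  by (rule cnorm_le) (auto intro: q_bound)

text \<open>Multiplying (a, b) by (x, 0) gives (a x, b \<gamma> x), so \<open>cnorm\<close> bounds
  multiplication by a and by b in the seminorm of every invariant state. Invariant states determine
  the norm (\<open>norm_le_of_states\<close>). With \<open>cnorm_upper\<close> this makes
  \<open>cnorm\<close> equivalent to the product norm, hence complete.\<close>

lemma cnorm_lower:
  assumes "P \<in> I \<times> I"
  shows "norm (fst P) \<le> cnorm I \<gamma> P" "norm (snd P) \<le> cnorm I \<gamma> P"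
proof -
  obtain a b where [simp]: "P = (a, b)" and I: "a \<in> I" "b \<in> I" using assms by auto
  have s0: "s \<phi> 0 = 0" if "gstate I \<gamma> \<phi>" for \<phi>
    using F(2)[OF that cl(1), of 0] by (simp add: s_def scaleC_zero_left)
  have \<gamma>0: "\<gamma> 0 = 0" using star_hom_on_zero[OF G(2,3)] .
  have *: "s \<phi> (a * x) \<le> cnorm I \<gamma> P * s \<phi> x" "s \<phi> (b * \<gamma> x) \<le> cnorm I \<gamma> P * s \<phi> x"
    if \<phi>: "gstate I \<gamma> \<phi>" and x: "x \<in> I" for \<phi> x
  proof -
    have "q \<phi> (a * x, b * \<gamma> x) \<le> cnorm I \<gamma> P * s \<phi> x"
      using cnorm_ge[OF assms \<phi>, of "(x, 0)"] x cl(1) s_nonneg[OF \<phi> x]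
      by (simp add: cmul_def \<gamma>0 q_def s0[OF \<phi>])
    moreover have "s \<phi> (a * x) \<le> q \<phi> (a * x, b * \<gamma> x)" "s \<phi> (b * \<gamma> x) \<le> q \<phi> (a * x, b * \<gamma> x)"
      by (simp_all add: q_def real_le_rsqrt)
    ultimately show "s \<phi> (a * x) \<le> cnorm I \<gamma> P * s \<phi> x" "s \<phi> (b * \<gamma> x) \<le> cnorm I \<gamma> P * s \<phi> x" by auto
  qed
  have le: "norm c \<le> cnorm I \<gamma> P"
    if c: "c \<in> I" and le: "\<And>\<phi> x. gstate I \<gamma> \<phi> \<Longrightarrow> x \<in> I \<Longrightarrow> s \<phi> (c * x) \<le> cnorm I \<gamma> P * s \<phi> x" for c
  proof (rule norm_le_of_states[OF G(1,2) grading c cnorm_nonneg[OF assms]])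
    fix \<phi> x assume \<phi>: "gstate I \<gamma> \<phi>" and x: "x \<in> I"
    have "(s \<phi> (c * x))\<^sup>2 \<le> (cnorm I \<gamma> P * s \<phi> x)\<^sup>2"
      using c x by (intro power_mono le[OF \<phi> x] s_nonneg[OF \<phi>] cl)
    then show "Re (\<phi> (adj (c * x) * (c * x))) \<le> (cnorm I \<gamma> P)\<^sup>2 * Re (\<phi> (adj x * x))"
      using c x by (simp add: power_mult_distrib s_sq[OF \<phi>] cl)
  qed
  show "norm (fst P) \<le> cnorm I \<gamma> P" using le[OF I(1)] *(1) by simp
  have "s \<phi> (b * x) \<le> cnorm I \<gamma> P * s \<phi> x" if "gstate I \<gamma> \<phi>" "x \<in> I" for \<phi> x
    using *(2)[OF that(1) G(4)[OF that(2)]] that by (simp add: G(5) s_gamma)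
  then show "norm (snd P) \<le> cnorm I \<gamma> P" using le[OF I(2)] by simp
qed

lemma q_cscale:
  assumes \<phi>: "gstate I \<gamma> \<phi>" and P: "P \<in> I \<times> I"
  shows "q \<phi> (cscale c P) = cmod c * q \<phi> P"
proof -
  have s: "s \<phi> (scaleC c x) = cmod c * s \<phi> x" if "x \<in> I" for x
  proof -
    have "\<phi> (adj (scaleC c x) * scaleC c x) = (cnj c * c) * \<phi> (adj x * x)"
      using that by (simp add: adj_scaleC scaleC_simps F(2)[OF \<phi>] cl mult.commute)
    also have "cnj c * c = of_real ((cmod c)\<^sup>2)" by (metis complex_norm_square mult.commute)
    finally have "Re (\<phi> (adj (scaleC c x) * scaleC c x)) = (cmod c)\<^sup>2 * Re (\<phi> (adj x * x))" by simp
    then show ?thesis by (simp add: s_def real_sqrt_mult)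
  qed
  have "(s \<phi> (fst (cscale c P)))\<^sup>2 + (s \<phi> (snd (cscale c P)))\<^sup>2 = (cmod c)\<^sup>2 * ((s \<phi> (fst P))\<^sup>2 + (s \<phi> (snd P))\<^sup>2)"
    using P by (auto simp: cscale_def s power_mult_distrib distrib_left)
  then show ?thesis by (simp add: q_def real_sqrt_mult)
qed

lemma cnorm_cscale:
  assumes P: "P \<in> I \<times> I"
  shows "cnorm I \<gamma> (cscale c P) = cmod c * cnorm I \<gamma> P"
proof -
  have le: "cnorm I \<gamma> (cscale c P) \<le> cmod c * cnorm I \<gamma> P" if P: "P \<in> I \<times> I" for c P
  proof (rule cnorm_le[OF cscale_in[OF P]])
    fix \<phi> Q assume \<phi>: "gstate I \<gamma> \<phi>" and Q: "Q \<in> I \<times> I"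
    show "q \<phi> (cmul \<gamma> (cscale c P) Q) \<le> cmod c * cnorm I \<gamma> P * q \<phi> Q"
      unfolding cmul_scale_left q_cscale[OF \<phi> cmul_in[OF P Q]]
      using mult_left_mono[OF cnorm_ge[OF P \<phi> Q], of "cmod c"] by (simp add: mult.assoc)
  qed (simp add: cnorm_nonneg P)
  show ?thesis
  proof (cases "c = 0")
    case True
    then show ?thesis using le[OF P, of 0] cnorm_nonneg[OF cscale_in[OF P], of 0] by simp
  next
    case False
    have "cscale (inverse c) (cscale c P) = P" using False by (simp add: cscale_def scaleC_simps)
    then have "cmod c * cnorm I \<gamma> P \<le> cmod c * (cmod (inverse c) * cnorm I \<gamma> (cscale c P))"
      using le[OF cscale_in[OF P], of "inverse c" c] by (intro mult_left_mono) auto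
    also have "\<dots> = cnorm I \<gamma> (cscale c P)" using False by (simp add: norm_inverse)
    finally show ?thesis using le[OF P, of c] by simp
  qed
qed

lemma cnorm_add:
  assumes P: "P \<in> I \<times> I" and Q: "Q \<in> I \<times> I"
  shows "cnorm I \<gamma> (P + Q) \<le> cnorm I \<gamma> P + cnorm I \<gamma> Q"
proof (rule cnorm_le[OF add_in[OF P Q]])
  fix \<phi> R assume \<phi>: "gstate I \<gamma> \<phi>" and R: "R \<in> I \<times> I"
  show "q \<phi> (cmul \<gamma> (P + Q) R) \<le> (cnorm I \<gamma> P + cnorm I \<gamma> Q) * q \<phi> R"
    unfolding cmul_add_left[OF P Q R]
    using q_add[OF \<phi> cmul_in[OF P R] cmul_in[OF Q R]] cnorm_ge[OF P \<phi> R] cnorm_ge[OF Q \<phi> R]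
    by (simp add: distrib_right)
qed (simp add: cnorm_nonneg P Q)

lemma cnorm_mult:
  assumes P: "P \<in> I \<times> I" and Q: "Q \<in> I \<times> I"
  shows "cnorm I \<gamma> (cmul \<gamma> P Q) \<le> cnorm I \<gamma> P * cnorm I \<gamma> Q"
proof (rule cnorm_le[OF cmul_in[OF P Q]])
  fix \<phi> R assume \<phi>: "gstate I \<gamma> \<phi>" and R: "R \<in> I \<times> I"
  show "q \<phi> (cmul \<gamma> (cmul \<gamma> P Q) R) \<le> cnorm I \<gamma> P * cnorm I \<gamma> Q * q \<phi> R"
    unfolding cmul_assoc[OF P Q R]
    using cnorm_ge[OF P \<phi> cmul_in[OF Q R]] mult_left_mono[OF cnorm_ge[OF Q \<phi> R] cnorm_nonneg[OF P]]
    by (simp add: mult.assoc)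
qed (simp add: cnorm_nonneg P Q)

text \<open>The proof for Hilbert space operators, with \<open>q_cs\<close> as the Cauchy-Schwarz
  inequality.\<close>

lemma cnorm_cadj_mult:
  assumes P: "P \<in> I \<times> I"
  shows "cnorm I \<gamma> (cmul \<gamma> (cadj \<gamma> P) P) = (cnorm I \<gamma> P)\<^sup>2"
proof -
  have ge: "(cnorm I \<gamma> P)\<^sup>2 \<le> cnorm I \<gamma> (cmul \<gamma> (cadj \<gamma> P) P)" if P: "P \<in> I \<times> I" for P
  proof -
    let ?N = "cnorm I \<gamma> (cmul \<gamma> (cadj \<gamma> P) P)"
    note PP = cmul_in[OF cadj_in[OF P] P]
    have "cnorm I \<gamma> P \<le> sqrt ?N"
    proof (rule cnorm_le[OF P])
      show "0 \<le> sqrt ?N" by (simp add: cnorm_nonneg[OF PP])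
      fix \<phi> Q assume \<phi>: "gstate I \<gamma> \<phi>" and Q: "Q \<in> I \<times> I"
      note PQ = cmul_in[OF P Q]
      have "cmul \<gamma> (cadj \<gamma> (cmul \<gamma> P Q)) (cmul \<gamma> P Q) = cmul \<gamma> (cadj \<gamma> Q) (cmul \<gamma> (cmul \<gamma> (cadj \<gamma> P) P) Q)"
        using P Q by (simp add: cadj_cmul cmul_assoc crossed_in)
      then have "(q \<phi> (cmul \<gamma> P Q))\<^sup>2 \<le> q \<phi> Q * q \<phi> (cmul \<gamma> (cmul \<gamma> (cadj \<gamma> P) P) Q)"
        using q_cs[OF \<phi> Q cmul_in[OF PP Q]] cform_Re[OF \<phi> PQ] by (simp add: cform_def)
      also have "\<dots> \<le> q \<phi> Q * (?N * q \<phi> Q)"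
        by (intro mult_left_mono cnorm_ge[OF PP \<phi> Q] q_nonneg)
      finally have "(q \<phi> (cmul \<gamma> P Q))\<^sup>2 \<le> ?N * (q \<phi> Q)\<^sup>2" by (simp add: power2_eq_square mult_ac)
      from real_le_rsqrt[OF this] show "q \<phi> (cmul \<gamma> P Q) \<le> sqrt ?N * q \<phi> Q"
        by (simp add: real_sqrt_mult q_nonneg)
    qed
    from power_mono[OF this cnorm_nonneg[OF P], of 2] show ?thesis by (simp add: cnorm_nonneg[OF PP])
  qed
  have le: "cnorm I \<gamma> (cmul \<gamma> (cadj \<gamma> P) P) \<le> cnorm I \<gamma> (cadj \<gamma> P) * cnorm I \<gamma> P" if "P \<in> I \<times> I" for P
    using that by (intro cnorm_mult cadj_in)
  have le': "cnorm I \<gamma> P \<le> cnorm I \<gamma> (cadj \<gamma> P)" if P: "P \<in> I \<times> I" for P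
  proof (cases "cnorm I \<gamma> P = 0")
    case False
    have "cnorm I \<gamma> P * cnorm I \<gamma> P \<le> cnorm I \<gamma> (cadj \<gamma> P) * cnorm I \<gamma> P"
      using ge[OF P] le[OF P] by (simp add: power2_eq_square)
    then show ?thesis using False cnorm_nonneg[OF P] by simp
  qed (simp add: cnorm_nonneg cadj_in P)
  have "cnorm I \<gamma> (cadj \<gamma> P) = cnorm I \<gamma> P"
    using le'[OF P] le'[OF cadj_in[OF P]] cadj_cadj[OF P] by simp
  then show ?thesis using ge[OF P] le[OF P] by (simp add: power2_eq_square)
qed

lemma crossed_simps:
  "carrier (crossed I \<gamma>) = I \<times> I" "P \<otimes>\<^bsub>crossed I \<gamma>\<^esub> Q = cmul \<gamma> P Q" "P \<oplus>\<^bsub>crossed I \<gamma>\<^esub> Q = P + Q"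
  "\<zero>\<^bsub>crossed I \<gamma>\<^esub> = 0" "c \<odot>\<^bsub>crossed I \<gamma>\<^esub> P = cscale c P" "star (crossed I \<gamma>) P = cadj \<gamma> P"
  "nrm (crossed I \<gamma>) P = cnorm I \<gamma> P"
  by (simp_all add: crossed_def)

lemma zero_in: "(0 :: 'a \<times> 'a) \<in> I \<times> I"
  by (simp add: zero_prod_def cl)

lemma abelian_group_crossed: "abelian_group (crossed I \<gamma>)"
proof (rule abelian_groupI)
  fix P assume P: "P \<in> carrier (crossed I \<gamma>)"
  show "\<exists>Q\<in>carrier (crossed I \<gamma>). Q \<oplus>\<^bsub>crossed I \<gamma>\<^esub> P = \<zero>\<^bsub>crossed I \<gamma>\<^esub>"
    using P by (intro bexI[of _ "- P"]) (auto simp: crossed_simps cl)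
qed (auto simp: crossed_simps add_in zero_in add_ac simp del: mem_Sigma_iff)

lemma crossed_minus:
  assumes "P \<in> I \<times> I" "Q \<in> I \<times> I"
  shows "P \<ominus>\<^bsub>crossed I \<gamma>\<^esub> Q = P - Q"
proof -
  interpret abelian_group "crossed I \<gamma>" by (rule abelian_group_crossed)
  have "- Q \<in> I \<times> I" using assms by (cases Q) (auto simp: cl)
  then have "\<ominus>\<^bsub>crossed I \<gamma>\<^esub> Q = - Q"
    using assms by (intro minus_equality) (simp_all add: crossed_simps)
  then show ?thesis by (simp add: a_minus_def crossed_simps)
qed

lemma cstar_crossed: "cstar_algebra (crossed I \<gamma>)"
proof (intro cstar_algebra.intro cstar_algebra_axioms.intro abelian_group_crossed; unfold crossed_simps)
  fix f assume "f \<in> cauchy_seqs (crossed I \<gamma>)"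
  then have f: "f n \<in> I \<times> I" and Cf: "\<And>e. e > 0 \<Longrightarrow> \<exists>N. \<forall>m\<ge>N. \<forall>n\<ge>N. cnorm I \<gamma> (f m - f n) < e" for n
    by (auto simp: cauchy_seqs_def crossed_simps crossed_minus simp del: mem_Sigma_iff)
  have diff: "P - Q \<in> I \<times> I" if "P \<in> I \<times> I" "Q \<in> I \<times> I" for P Q
    using that by (cases P; cases Q) (auto simp: cl)
  have C: "Cauchy (\<lambda>n. p (f n))" if p: "\<And>P Q. P \<in> I \<times> I \<Longrightarrow> Q \<in> I \<times> I \<Longrightarrow> norm (p P - p Q) \<le> cnorm I \<gamma> (P - Q)"
    for p :: "'a \<times> 'a \<Rightarrow> 'a"
  proof (rule metric_CauchyI)
    fix e :: real assume "e > 0"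
    then obtain N where N: "\<forall>m\<ge>N. \<forall>n\<ge>N. cnorm I \<gamma> (f m - f n) < e" using Cf by blast
    have "dist (p (f m)) (p (f n)) < e" if "m \<ge> N" "n \<ge> N" for m n
      using N that p[OF f f, of m n] by (force simp: dist_norm)
    then show "\<exists>M. \<forall>m\<ge>M. \<forall>n\<ge>M. dist (p (f m)) (p (f n)) < e" by blast
  qed
  have "Cauchy (\<lambda>n. fst (f n))" "Cauchy (\<lambda>n. snd (f n))"
    using cnorm_lower[OF diff] by (intro C; simp)+
  then obtain a b where a: "(\<lambda>n. fst (f n)) \<longlonglongrightarrow> a" and b: "(\<lambda>n. snd (f n)) \<longlonglongrightarrow> b"
    using Cauchy_convergent convergent_def by metis
  have "fst (f n) \<in> I" "snd (f n) \<in> I" for n using f[of n] by auto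
  then have ab: "(a, b) \<in> I \<times> I"
    using closed_sequentially[OF G(1) _ a] closed_sequentially[OF G(1) _ b] by auto
  have "(\<lambda>n. norm (fst (f n) - a) + norm (snd (f n) - b)) \<longlonglongrightarrow> 0 + 0"
    using a b by (intro tendsto_add tendsto_norm_zero) (simp_all add: LIM_zero)
  then have lim: "(\<lambda>n. norm (fst (f n) - a) + norm (snd (f n) - b)) \<longlonglongrightarrow> 0" by simp
  have "\<forall>n. norm (cnorm I \<gamma> (f n - (a, b))) \<le> norm (fst (f n) - a) + norm (snd (f n) - b)"
    using cnorm_upper[OF diff[OF f ab]] cnorm_nonneg[OF diff[OF f ab]] by simp
  from Lim_null_comparison[OF always_eventually[OF this] lim]
  show "\<exists>l\<in>I \<times> I. (\<lambda>n. cnorm I \<gamma> (f n \<ominus>\<^bsub>crossed I \<gamma>\<^esub> l)) \<longlonglongrightarrow> 0"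
    using ab by (intro bexI[of _ "(a, b)"]) (simp_all add: crossed_minus[OF f])
next
  fix P assume P: "P \<in> I \<times> I"
  show "cnorm I \<gamma> P = 0 \<longleftrightarrow> P = 0"
    using cnorm_lower[OF P] cnorm_upper[OF P] cnorm_nonneg[OF P] by (cases P) (auto simp: zero_prod_def)
qed (simp_all add: crossed_in cmul_assoc cmul_add_left cmul_add_right cmul_scale_left cmul_scale_right
   cadj_cadj cadj_add cadj_scale cadj_cmul cnorm_nonneg cnorm_add cnorm_mult cnorm_cscale cnorm_cadj_mult
   cscale_simps del: mem_Sigma_iff)

end

subsection \<open>The graded tensor product with a copy of \<open>Cliff\<^sub>1\<close>\<close>

lemma star_isoD:
  assumes "star_iso A B f"
  shows "bij_betw f (carrier A) (carrier B)" "x \<in> carrier A \<Longrightarrow> f x \<in> carrier B"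
    "x \<in> carrier A \<Longrightarrow> y \<in> carrier A \<Longrightarrow> f (x \<oplus>\<^bsub>A\<^esub> y) = f x \<oplus>\<^bsub>B\<^esub> f y"
    "x \<in> carrier A \<Longrightarrow> y \<in> carrier A \<Longrightarrow> f (x \<otimes>\<^bsub>A\<^esub> y) = f x \<otimes>\<^bsub>B\<^esub> f y"
    "x \<in> carrier A \<Longrightarrow> f (c \<odot>\<^bsub>A\<^esub> x) = c \<odot>\<^bsub>B\<^esub> f x" "x \<in> carrier A \<Longrightarrow> f (star A x) = star B (f x)"
  using assms by (auto simp: star_iso_def bij_betw_def)

lemma Cliff1_simps:
  "carrier Cliff1 = UNIV" "p \<otimes>\<^bsub>Cliff1\<^esub> r = (fst p * fst r, snd p * snd r)"
  "p \<oplus>\<^bsub>Cliff1\<^esub> r = p + r" "\<zero>\<^bsub>Cliff1\<^esub> = 0" "c \<odot>\<^bsub>Cliff1\<^esub> p = (c * fst p, c * snd p)"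
  "star Cliff1 p = (cnj (fst p), cnj (snd p))" "nrm Cliff1 p = max (cmod (fst p)) (cmod (snd p))"
  by (simp_all add: Cliff1_def case_prod_beta zero_prod_def)

lemma sum_single_keys:
  "(\<Sum>k\<in>Poly_Mapping.keys u. Poly_Mapping.single k (Poly_Mapping.lookup u k)) = u"
proof (rule poly_mapping_eqI)
  fix j
  have "Poly_Mapping.lookup (\<Sum>k\<in>W. Poly_Mapping.single k (Poly_Mapping.lookup u k)) j =
      (if j \<in> W then Poly_Mapping.lookup u j else 0)" if "finite W" for W
    using that by (induction W rule: finite_induct) (auto simp: lookup_add lookup_single when_def)
  then show "Poly_Mapping.lookup (\<Sum>k\<in>Poly_Mapping.keys u. Poly_Mapping.single k (Poly_Mapping.lookup u k)) j =
      Poly_Mapping.lookup u j" by (simp add: in_keys_iff)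
qed

lemma scale_fun_single: "scale_fun c (Poly_Mapping.single k d) = Poly_Mapping.single k (c * d)"
  by (rule poly_mapping_eqI) (simp add: lookup_scale_fun lookup_single when_def)

lemma sum_bit: "(\<Sum>i\<in>{0, 1}. f i) = f (0::bit) + f 1"
  by simp

text \<open>Covers \<open>Cliff1\<close> and the C*-algebra of the group at once. The norm is
  mentioned separately, since \<open>star_iso\<close> speaks only of the algebraic
  operations.\<close>

locale clifford =
  fixes B :: "'b star_alg" and \<beta> :: "'b \<Rightarrow> 'b" and g :: "'b \<Rightarrow> complex \<times> complex"
  assumes cstar: "cstar_algebra B"
    and iso: "star_iso B Cliff1 g"
    and beta: "y \<in> carrier B \<Longrightarrow> \<beta> y \<in> carrier B" "y \<in> carrier B \<Longrightarrow> g (\<beta> y) = prod.swap (g y)"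
    and nrm_g: "y \<in> carrier B \<Longrightarrow> nrm B y = nrm Cliff1 (g y)"
begin

sublocale B: cstar_algebra B by (rule cstar)

text \<open>The coordinates with respect to the basis consisting of \<open>(1, 1)\<close> and the odd unitary \<open>(1, -1)\<close>.\<close>

definition z :: "'b \<Rightarrow> complex" where "z y = (fst (g y) + snd (g y)) / 2"
definition w :: "'b \<Rightarrow> complex" where "w y = (fst (g y) - snd (g y)) / 2"
definition "u0 = inv_into (carrier B) g (1, 1)"
definition "e = inv_into (carrier B) g (1, -1)"

lemma surj_g: "g ` carrier B = UNIV"
  using star_isoD(1)[OF iso] by (simp add: bij_betw_def Cliff1_simps)

lemma u0: "u0 \<in> carrier B" "g u0 = (1, 1)" and e: "e \<in> carrier B" "g e = (1, -1)"
  using surj_g by (auto simp: u0_def e_def intro: inv_into_into f_inv_into_f)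

lemma eqI: "x \<in> carrier B \<Longrightarrow> y \<in> carrier B \<Longrightarrow> g x = g y \<Longrightarrow> x = y"
  using star_isoD(1)[OF iso] by (auto simp: bij_betw_def dest: inj_onD)

lemmas g_simps = star_isoD(3-)[OF iso] beta Cliff1_simps

lemma zw_ops2:
  assumes "x \<in> carrier B" "y \<in> carrier B"
  shows "z (x \<oplus>\<^bsub>B\<^esub> y) = z x + z y" "w (x \<oplus>\<^bsub>B\<^esub> y) = w x + w y"
    "z (x \<otimes>\<^bsub>B\<^esub> y) = z x * z y + w x * w y" "w (x \<otimes>\<^bsub>B\<^esub> y) = z x * w y + w x * z y"
  using assms by (simp_all add: z_def w_def g_simps field_simps)

lemma zw_ops1:
  assumes "x \<in> carrier B"
  shows "z (c \<odot>\<^bsub>B\<^esub> x) = c * z x" "w (c \<odot>\<^bsub>B\<^esub> x) = c * w x"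
    "z (star B x) = cnj (z x)" "w (star B x) = cnj (w x)" "z (\<beta> x) = z x" "w (\<beta> x) = - w x"
  using assms by (simp_all add: z_def w_def g_simps field_simps)

lemmas zw_ops = zw_ops1 zw_ops2

lemma zw_u0: "z u0 = 1" "w u0 = 0" and zw_e: "z e = 0" "w e = 1"
  by (simp_all add: z_def w_def u0 e)

lemma decompose:
  assumes "y \<in> carrier B" shows "y = z y \<odot>\<^bsub>B\<^esub> u0 \<oplus>\<^bsub>B\<^esub> w y \<odot>\<^bsub>B\<^esub> e"
  using assms
  by (intro eqI) (simp_all add: g_simps u0 e B.scale_closed z_def w_def prod_eq_iff field_simps)

lemma hcomp_in: "y \<in> carrier B \<Longrightarrow> hcomp B \<beta> i y \<in> carrier B"
  by (simp add: hcomp_def B.scale_closed beta)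

lemma zw_hcomp:
  assumes "y \<in> carrier B"
  shows "z (hcomp B \<beta> 0 y) = z y" "w (hcomp B \<beta> 0 y) = 0" "z (hcomp B \<beta> 1 y) = 0" "w (hcomp B \<beta> 1 y) = w y"
  using assms by (simp_all add: hcomp_def zw_ops B.scale_closed beta)

lemma cmod_z_le: "y \<in> carrier B \<Longrightarrow> cmod (z y) \<le> nrm B y"
  using norm_triangle_ineq[of "fst (g y)" "snd (g y)"] by (simp add: z_def nrm_g Cliff1_simps norm_divide)

lemma sup_z: "(SUP y\<in>{y \<in> carrier B. nrm B y \<le> 1}. cmod (z y)) = 1"
proof (rule cSup_eq_maximum)
  show "1 \<in> (\<lambda>y. cmod (z y)) ` {y \<in> carrier B. nrm B y \<le> 1}"
    using u0 zw_u0 by (intro image_eqI[of _ _ u0]) (auto simp: nrm_g Cliff1_simps)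
qed (auto intro: order_trans[OF cmod_z_le])

lemma graded_state_z: "graded_state B \<beta> z"
  unfolding graded_state_def state_def
proof (intro conjI ballI allI sup_z)
  fix y assume y: "y \<in> carrier B"
  show "\<exists>r\<ge>0. z (star B y \<otimes>\<^bsub>B\<^esub> y) = complex_of_real r"
  proof (intro exI conjI)
    show "z (star B y \<otimes>\<^bsub>B\<^esub> y) = complex_of_real ((cmod (z y))\<^sup>2 + (cmod (w y))\<^sup>2)"
      using y by (simp add: zw_ops B.star_closed complex_norm_square mult.commute del: of_real_power)
  qed simp
qed (auto simp: zw_ops cmod_z_le)

text \<open>An invariant functional vanishes at e because e is odd, so it is a multiple of z. The
  multiple is its value at the unit \<open>u0\<close>, and the normalization of states makes it
  1.\<close>

lemma graded_state_unique:
  assumes \<psi>: "graded_state B \<beta> \<psi>" and y: "y \<in> carrier B"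
  shows "\<psi> y = z y"
proof -
  have add: "\<psi> (x \<oplus>\<^bsub>B\<^esub> y) = \<psi> x + \<psi> y" if "x \<in> carrier B" "y \<in> carrier B" for x y
    using \<psi> that by (simp add: graded_state_def state_def)
  have sc: "\<psi> (c \<odot>\<^bsub>B\<^esub> x) = c * \<psi> x" if "x \<in> carrier B" for x c
    using \<psi> that by (simp add: graded_state_def state_def)
  have "\<beta> e = (-1) \<odot>\<^bsub>B\<^esub> e" by (rule eqI) (simp_all add: e g_simps B.scale_closed)
  then have "\<psi> e = - \<psi> e" using \<psi> sc[OF e(1), of "-1"] e(1) by (auto simp: graded_state_def)
  then have \<psi>e: "\<psi> e = 0" by simp
  have \<psi>y: "\<psi> y = z y * \<psi> u0" if "y \<in> carrier B" for y
    by (subst decompose[OF that]) (simp add: add sc u0 e B.scale_closed \<psi>e)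
  have "star B u0 \<otimes>\<^bsub>B\<^esub> u0 = u0" by (rule eqI) (simp_all add: u0 g_simps B.star_closed B.mult_closed)
  then obtain r where r: "r \<ge> 0" "\<psi> u0 = complex_of_real r"
    using \<psi> u0(1) unfolding graded_state_def state_def by metis
  have "(SUP y\<in>{y \<in> carrier B. nrm B y \<le> 1}. cmod (\<psi> y)) = r"
  proof (rule cSup_eq_maximum)
    show "r \<in> (\<lambda>y. cmod (\<psi> y)) ` {y \<in> carrier B. nrm B y \<le> 1}"
      using u0 r by (intro image_eqI[of _ _ u0]) (auto simp: nrm_g Cliff1_simps)
    fix x assume "x \<in> (\<lambda>y. cmod (\<psi> y)) ` {y \<in> carrier B. nrm B y \<le> 1}"
    then obtain y where y: "y \<in> carrier B" "nrm B y \<le> 1" "x = cmod (\<psi> y)" by auto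
    have "cmod (z y) * r \<le> 1 * r" using cmod_z_le[OF y(1)] y(2) r(1) by (intro mult_right_mono) auto
    then show "x \<le> r" using y r by (simp add: \<psi>y norm_mult)
  qed
  then have "r = 1" using \<psi> by (simp add: graded_state_def state_def)
  then show ?thesis using \<psi>y[OF y] r by simp
qed

end

context crossed_product
begin

abbreviation "D \<equiv> crossed I \<gamma>"

lemmas emb_faithful = faithful_repD[OF cstar_algebra.faithful_emb[OF cstar_crossed]]

lemma emb_simps2:
  assumes "P \<in> I \<times> I" "Q \<in> I \<times> I"
  shows "emb D (P + Q) = emb D P + emb D Q" "emb D (cmul \<gamma> P Q) = emb D P * emb D Q"
  using star_repD(4,6)[OF emb_faithful(1)] assms unfolding crossed_simps by blast+

lemma emb_simps1:
  assumes "P \<in> I \<times> I"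
  shows "emb D (cadj \<gamma> P) = adj (emb D P)" "emb D (cscale c P) = scaleC c (emb D P)"
    "cnorm I \<gamma> P = norm (emb D P)"
  using star_repD(8,10)[OF emb_faithful(1)] emb_faithful(3) assms unfolding crossed_simps by blast+

lemma emb_zero: "emb D 0 = 0"
  using star_repD(2)[OF emb_faithful(1)] by (simp only: crossed_simps)

lemmas emb_simps = emb_simps1 emb_simps2

lemma emb_eq_iff: "P \<in> I \<times> I \<Longrightarrow> Q \<in> I \<times> I \<Longrightarrow> emb D P = emb D Q \<longleftrightarrow> P = Q"
  using inj_on_eq_iff[OF emb_faithful(2), of P Q] by (simp only: crossed_simps)

lemma closed_crossed: "closed (emb D ` (I \<times> I))"
  using cstar_algebra.closed_emb[OF cstar_crossed] by (simp add: crossed_simps)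

lemma star_closed_crossed: "star_closed (emb D ` (I \<times> I))"
  using star_closed_image[OF emb_faithful(1)] by (simp add: crossed_simps)

text \<open>The grading of the crossed product for which \<open>e\<close> is odd.\<close>

definition cgrade :: "('a \<times> 'a, unit) cprod \<Rightarrow> ('a \<times> 'a, unit) cprod" where
  "cgrade y = (let P = inv_into (I \<times> I) (emb D) y in emb D (\<gamma> (fst P), - \<gamma> (snd P)))"

lemma cgrade_emb:
  assumes "P \<in> I \<times> I" shows "cgrade (emb D P) = emb D (\<gamma> (fst P), - \<gamma> (snd P))"
proof -
  have "inj_on (emb D) (I \<times> I)" using emb_faithful(2) by (simp only: crossed_simps)
  then show ?thesis using assms by (simp add: cgrade_def Let_def)
qed

lemma grading_cgrade: "grading_on (emb D ` (I \<times> I)) cgrade"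
  unfolding grading_on_def star_hom_on_def
proof (intro conjI ballI allI closed_crossed star_closed_crossed; elim imageE; clarify)
  fix x y assume x: "x \<in> I" "y \<in> I"
  note [simp] = cgrade_emb emb_simps[symmetric] G(4,5) cl hom
  have gy: "\<gamma> (- y) = - \<gamma> y" if "y \<in> I" for y
    using hom(4)[OF that, of "-1"] by (simp add: scaleC_minus1)
  show "cgrade (emb D (x, y)) \<in> emb D ` (I \<times> I)" using x by simp
  show "cgrade (cgrade (emb D (x, y))) = emb D (x, y)" using x by (simp add: gy)
  show "cgrade (adj (emb D (x, y))) = adj (cgrade (emb D (x, y)))"
    using x by (simp add: cadj_in cadj_def gy adj_minus)
  show "cgrade (scaleC c (emb D (x, y))) = scaleC c (cgrade (emb D (x, y)))" for c
    using x by (simp add: cscale_def scaleC_minus_right)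
  fix u v assume u: "u \<in> I" "v \<in> I"
  show "cgrade (emb D (x, y) + emb D (u, v)) = cgrade (emb D (x, y)) + cgrade (emb D (u, v))"
    using x u by simp
  show "cgrade (emb D (x, y) * emb D (u, v)) = cgrade (emb D (x, y)) * cgrade (emb D (u, v))"
    using x u by (simp add: cmul_def gy algebra_simps)
qed

end

section \<open>The graded tensor product as the crossed product\<close>

locale graded_tensor_setup = crossed_product I \<gamma> + clifford B \<beta> g
  for I :: "'a::cstar_type set" and \<gamma> and B :: "'b star_alg" and \<beta> and g +
  fixes A :: "'c star_alg" and \<alpha> :: "'c \<Rightarrow> 'c" and h :: "'c \<Rightarrow> 'a"
  assumes A: "realizes A \<alpha> h I \<gamma>"
begin

lemmas RA = realizesD[OF A]
lemmas DA = star_repD[OF RA(2)]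

lemma h_in: "x \<in> carrier A \<Longrightarrow> h x \<in> I"
  using RA(4) by auto

lemma hcomp_A: 
  assumes "x \<in> carrier A"
  shows "hcomp A \<alpha> i x \<in> carrier A" "h (hcomp A \<alpha> i x) = scaleC (1/2) (h x + scaleC (bit_sign i) (\<gamma> (h x)))"
  using assms by (simp_all add: hcomp_def DA RA)

text \<open>Expanding y as z y + w y e turns the elementary tensor of x and y into the pair
  (\<open>E1\<close>, \<open>E2\<close>); \<open>ev\<close> is the linear extension.\<close>

definition E1 :: "'c \<times> 'b \<Rightarrow> 'a" where "E1 p = scaleC (z (snd p)) (h (fst p))"
definition E2 :: "'c \<times> 'b \<Rightarrow> 'a" where "E2 p = scaleC (w (snd p)) (h (fst p))"
definition ev :: "('c \<times> 'b \<Rightarrow>\<^sub>0 complex) \<Rightarrow> 'a \<times> 'a" where "ev u = (lift E1 u, lift E2 u)"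

abbreviation "pre \<equiv> pre_tensor_carrier A B"
abbreviation "AB \<equiv> carrier A \<times> carrier B"

lemma preD: "u \<in> pre \<Longrightarrow> p \<in> Poly_Mapping.keys u \<Longrightarrow> p \<in> AB"
  by (auto simp: pre_tensor_carrier_def)

lemma pre_single: "p \<in> AB \<Longrightarrow> Poly_Mapping.single p c \<in> pre"
  by (auto simp: pre_tensor_carrier_def)

lemma pre_sum: "(\<And>i. i \<in> X \<Longrightarrow> f i \<in> pre) \<Longrightarrow> sum f X \<in> pre"
  unfolding pre_tensor_carrier_def mem_Collect_eq by (rule keys_sum_subset)

lemma pre_add: "u \<in> pre \<Longrightarrow> v \<in> pre \<Longrightarrow> u + v \<in> pre"
  using Poly_Mapping.keys_add[of u v] by (auto simp: pre_tensor_carrier_def)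

lemma pre_scale: "u \<in> pre \<Longrightarrow> scale_fun c u \<in> pre"
  using keys_scale_fun[of c u] by (auto simp: pre_tensor_carrier_def)

lemma E_in: "p \<in> AB \<Longrightarrow> E1 p \<in> I" "p \<in> AB \<Longrightarrow> E2 p \<in> I"
  by (auto simp: E1_def E2_def h_in cl)

lemma lift_in:
  assumes "u \<in> pre" "\<And>p. p \<in> AB \<Longrightarrow> E p \<in> I" shows "lift E u \<in> I"
  unfolding lift_def using preD[OF assms(1)] assms(2) by (intro cl) auto

lemma ev_in: "u \<in> pre \<Longrightarrow> ev u \<in> I \<times> I"
  by (simp add: ev_def lift_in E_in)

lemma gamma_lift:
  assumes u: "u \<in> pre" and E: "\<And>p. p \<in> AB \<Longrightarrow> E p \<in> I"
  shows "\<gamma> (lift E u) = lift (\<lambda>p. \<gamma> (E p)) u"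
proof -
  have in_I: "scaleC (Poly_Mapping.lookup u p) (E p) \<in> I" if "p \<in> Poly_Mapping.keys u" for p
    using preD[OF u that] E by (intro cl) auto
  have "\<gamma> (lift E u) = (\<Sum>p\<in>Poly_Mapping.keys u. \<gamma> (scaleC (Poly_Mapping.lookup u p) (E p)))"
    unfolding lift_def by (rule star_hom_on_sum[OF G(2,3) in_I])
  also have "\<dots> = lift (\<lambda>p. \<gamma> (E p)) u"
    unfolding lift_def using preD[OF u] E by (intro sum.cong refl hom(4)) auto
  finally show ?thesis .
qed

lemma lift_mult: "lift E u * lift E' v =
   (\<Sum>p\<in>Poly_Mapping.keys u. \<Sum>r\<in>Poly_Mapping.keys v.
      scaleC (Poly_Mapping.lookup u p * Poly_Mapping.lookup v r) (E p * E' r))"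
  unfolding lift_def sum_product by (simp add: scaleC_simps mult.commute)

lemma pre_tensor_mult_eq: "pre_tensor_mult A \<alpha> B \<beta> u v =
   (\<Sum>p\<in>Poly_Mapping.keys u. \<Sum>r\<in>Poly_Mapping.keys v. \<Sum>i\<in>{0, 1}. \<Sum>j\<in>{0, 1}.
      Poly_Mapping.single (fst p \<otimes>\<^bsub>A\<^esub> hcomp A \<alpha> j (fst r), hcomp B \<beta> i (snd p) \<otimes>\<^bsub>B\<^esub> snd r)
        (bit_sign (i * j) * (Poly_Mapping.lookup u p * Poly_Mapping.lookup v r)))"
  unfolding pre_tensor_mult_def by (simp only: case_prod_unfold prod.collapse)

lemma pre_tensor_star_eq: "pre_tensor_star A \<alpha> B \<beta> u =
   (\<Sum>p\<in>Poly_Mapping.keys u. \<Sum>i\<in>{0, 1}. \<Sum>j\<in>{0, 1}.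
      Poly_Mapping.single (star A (hcomp A \<alpha> i (fst p)), star B (hcomp B \<beta> j (snd p)))
        (bit_sign (i * j) * cnj (Poly_Mapping.lookup u p)))"
  unfolding pre_tensor_star_def by (simp only: case_prod_unfold prod.collapse)

lemma pre_mult: "u \<in> pre \<Longrightarrow> v \<in> pre \<Longrightarrow> pre_tensor_mult A \<alpha> B \<beta> u v \<in> pre"
  unfolding pre_tensor_mult_eq
  by (intro pre_sum pre_single) (auto dest!: preD intro!: DA(5) hcomp_A B.mult_closed hcomp_in)

lemma pre_star: "u \<in> pre \<Longrightarrow> pre_tensor_star A \<alpha> B \<beta> u \<in> pre"
  unfolding pre_tensor_star_eq
  by (intro pre_sum pre_single) (auto dest!: preD intro!: DA(7) hcomp_A B.star_closed hcomp_in)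

lemma half_sum: "scaleC (1/2) (x + y) + scaleC (1/2) (x - y) = (x :: 'a)"
  "scaleC (1/2) (x + y) - scaleC (1/2) (x - y) = (y :: 'a)"
proof -
  have "scaleC (1/2) u + scaleC (1/2) u = u" for u :: 'a
    by (simp add: scaleC_one flip: scaleC_add_left)
  then show "scaleC (1/2) (x + y) + scaleC (1/2) (x - y) = x" "scaleC (1/2) (x + y) - scaleC (1/2) (x - y) = y"
    by (simp_all add: scaleC_add_right scaleC_diff_right algebra_simps)
qed

text \<open>Only the odd part w y e of the second tensor factor is affected by signs: it picks up
  the sign of the degree of x', and summing over the homogeneous parts of x' replaces x' by \<gamma>
  x'. This is the rule by which e passes x' in the crossed product.\<close>

lemma ev_mult:
  assumes u: "u \<in> pre" and v: "v \<in> pre"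
  shows "ev (pre_tensor_mult A \<alpha> B \<beta> u v) = cmul \<gamma> (ev u) (ev v)"
proof -
  have term1: "(\<Sum>i\<in>{0, 1}. \<Sum>j\<in>{0, 1}. scaleC (bit_sign (i * j) * c)
      (E1 (x \<otimes>\<^bsub>A\<^esub> hcomp A \<alpha> j x', hcomp B \<beta> i y \<otimes>\<^bsub>B\<^esub> y'))) =
      scaleC c (E1 (x, y) * E1 (x', y')) + scaleC c (E2 (x, y) * \<gamma> (E2 (x', y')))"
    and term2: "(\<Sum>i\<in>{0, 1}. \<Sum>j\<in>{0, 1}. scaleC (bit_sign (i * j) * c)
      (E2 (x \<otimes>\<^bsub>A\<^esub> hcomp A \<alpha> j x', hcomp B \<beta> i y \<otimes>\<^bsub>B\<^esub> y'))) =
      scaleC c (E1 (x, y) * E2 (x', y')) + scaleC c (E2 (x, y) * \<gamma> (E1 (x', y')))"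
    if x: "x \<in> carrier A" "x' \<in> carrier A" and y: "y \<in> carrier B" "y' \<in> carrier B" for x x' y y' c
  proof -
    \<comment> \<open>X and Y are x times the even and the odd part of x'; with equal signs they
      combine to x x', with opposite signs to x \<gamma> x'.\<close>
    define X where "X = h x * scaleC (1/2) (h x' + \<gamma> (h x'))"
    define Y where "Y = h x * scaleC (1/2) (h x' - \<gamma> (h x'))"
    have XY: "X + Y = h x * h x'" "X - Y = h x * \<gamma> (h x')"
      by (simp_all add: X_def Y_def half_sum flip: distrib_left right_diff_distrib)
    have comp: "h (x \<otimes>\<^bsub>A\<^esub> hcomp A \<alpha> 0 x') = X" "h (x \<otimes>\<^bsub>A\<^esub> hcomp A \<alpha> 1 x') = Y"
      using x by (simp_all add: DA hcomp_A X_def Y_def scaleC_one scaleC_minus1)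
    have lin: "scaleC a X + scaleC a Y + (scaleC b X - scaleC b Y) = scaleC a (h x * h x') + scaleC b (h x * \<gamma> (h x'))"
      for a b unfolding XY[symmetric] by (simp add: scaleC_simps)
    show "(\<Sum>i\<in>{0, 1}. \<Sum>j\<in>{0, 1}. scaleC (bit_sign (i * j) * c)
      (E1 (x \<otimes>\<^bsub>A\<^esub> hcomp A \<alpha> j x', hcomp B \<beta> i y \<otimes>\<^bsub>B\<^esub> y'))) =
      scaleC c (E1 (x, y) * E1 (x', y')) + scaleC c (E2 (x, y) * \<gamma> (E2 (x', y')))"
      unfolding sum_bit E1_def E2_def fst_conv snd_conv comp
      using x y lin[of "c * (z y * z y')" "c * (w y * w y')"]
      by (simp add: zw_ops zw_hcomp hcomp_in scaleC_simps hom h_in mult_ac)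
    show "(\<Sum>i\<in>{0, 1}. \<Sum>j\<in>{0, 1}. scaleC (bit_sign (i * j) * c)
      (E2 (x \<otimes>\<^bsub>A\<^esub> hcomp A \<alpha> j x', hcomp B \<beta> i y \<otimes>\<^bsub>B\<^esub> y'))) =
      scaleC c (E1 (x, y) * E2 (x', y')) + scaleC c (E2 (x, y) * \<gamma> (E1 (x', y')))"
      unfolding sum_bit E1_def E2_def fst_conv snd_conv comp
      using x y lin[of "c * (z y * w y')" "c * (w y * z y')"]
      by (simp add: zw_ops zw_hcomp hcomp_in scaleC_simps hom h_in mult_ac)
  qed
  have gl1: "\<gamma> (lift E1 v) = lift (\<lambda>p. \<gamma> (E1 p)) v" and gl2: "\<gamma> (lift E2 v) = lift (\<lambda>p. \<gamma> (E2 p)) v"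
    using v by (simp_all add: gamma_lift E_in)
  have "lift E1 (pre_tensor_mult A \<alpha> B \<beta> u v) = lift E1 u * lift E1 v + lift E2 u * \<gamma> (lift E2 v)"
    unfolding pre_tensor_mult_eq lift_sum lift_single gl2 lift_mult sum.distrib[symmetric]
  proof (intro sum.cong refl)
    fix p r assume "p \<in> Poly_Mapping.keys u" "r \<in> Poly_Mapping.keys v"
    then have "fst p \<in> carrier A" "fst r \<in> carrier A" "snd p \<in> carrier B" "snd r \<in> carrier B"
      using preD[OF u, of p] preD[OF v, of r] by auto
    note term1[OF this, of "Poly_Mapping.lookup u p * Poly_Mapping.lookup v r", unfolded prod.collapse]
    then show "(\<Sum>i\<in>{0, 1}. \<Sum>j\<in>{0, 1}. scaleC (bit_sign (i * j) * (Poly_Mapping.lookup u p * Poly_Mapping.lookup v r))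
        (E1 (fst p \<otimes>\<^bsub>A\<^esub> hcomp A \<alpha> j (fst r), hcomp B \<beta> i (snd p) \<otimes>\<^bsub>B\<^esub> snd r))) =
      scaleC (Poly_Mapping.lookup u p * Poly_Mapping.lookup v r) (E1 p * E1 r) +
      scaleC (Poly_Mapping.lookup u p * Poly_Mapping.lookup v r) (E2 p * \<gamma> (E2 r))" .
  qed
  moreover have "lift E2 (pre_tensor_mult A \<alpha> B \<beta> u v) = lift E1 u * lift E2 v + lift E2 u * \<gamma> (lift E1 v)"
    unfolding pre_tensor_mult_eq lift_sum lift_single gl1 lift_mult sum.distrib[symmetric]
  proof (intro sum.cong refl)
    fix p r assume "p \<in> Poly_Mapping.keys u" "r \<in> Poly_Mapping.keys v"
    then have "fst p \<in> carrier A" "fst r \<in> carrier A" "snd p \<in> carrier B" "snd r \<in> carrier B"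
      using preD[OF u, of p] preD[OF v, of r] by auto
    note term2[OF this, of "Poly_Mapping.lookup u p * Poly_Mapping.lookup v r", unfolded prod.collapse]
    then show "(\<Sum>i\<in>{0, 1}. \<Sum>j\<in>{0, 1}. scaleC (bit_sign (i * j) * (Poly_Mapping.lookup u p * Poly_Mapping.lookup v r))
        (E2 (fst p \<otimes>\<^bsub>A\<^esub> hcomp A \<alpha> j (fst r), hcomp B \<beta> i (snd p) \<otimes>\<^bsub>B\<^esub> snd r))) =
      scaleC (Poly_Mapping.lookup u p * Poly_Mapping.lookup v r) (E1 p * E2 r) +
      scaleC (Poly_Mapping.lookup u p * Poly_Mapping.lookup v r) (E2 p * \<gamma> (E1 r))" .
  qed
  ultimately show ?thesis by (simp add: ev_def cmul_def)
qed

lemma ev_star: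
  assumes u: "u \<in> pre"
  shows "ev (pre_tensor_star A \<alpha> B \<beta> u) = cadj \<gamma> (ev u)"
proof -
  have t1: "(\<Sum>i\<in>{0, 1}. \<Sum>j\<in>{0, 1}. scaleC (bit_sign (i * j) * cnj c)
      (E1 (star A (hcomp A \<alpha> i x), star B (hcomp B \<beta> j y)))) = scaleC (cnj c) (adj (E1 (x, y)))"
    and t2: "(\<Sum>i\<in>{0, 1}. \<Sum>j\<in>{0, 1}. scaleC (bit_sign (i * j) * cnj c)
      (E2 (star A (hcomp A \<alpha> i x), star B (hcomp B \<beta> j y)))) = scaleC (cnj c) (\<gamma> (adj (E2 (x, y))))"
    if x: "x \<in> carrier A" and y: "y \<in> carrier B" for x y c
  proof -
    define X where "X = adj (scaleC (1/2) (h x + \<gamma> (h x)))"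
    define Y where "Y = adj (scaleC (1/2) (h x - \<gamma> (h x)))"
    have XY: "X + Y = adj (h x)" "X - Y = \<gamma> (adj (h x))"
      using x by (simp_all add: X_def Y_def half_sum hom h_in flip: adj_add adj_diff)
    have comp: "h (star A (hcomp A \<alpha> 0 x)) = X" "h (star A (hcomp A \<alpha> 1 x)) = Y"
      using x by (simp_all add: DA hcomp_A X_def Y_def scaleC_one scaleC_minus1)
    show "(\<Sum>i\<in>{0, 1}. \<Sum>j\<in>{0, 1}. scaleC (bit_sign (i * j) * cnj c)
      (E1 (star A (hcomp A \<alpha> i x), star B (hcomp B \<beta> j y)))) = scaleC (cnj c) (adj (E1 (x, y)))"
      unfolding sum_bit E1_def fst_conv snd_conv comp adj_scaleC XY(1)[symmetric]
      using x y by (simp add: zw_ops zw_hcomp hcomp_in scaleC_simps)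
    show "(\<Sum>i\<in>{0, 1}. \<Sum>j\<in>{0, 1}. scaleC (bit_sign (i * j) * cnj c)
      (E2 (star A (hcomp A \<alpha> i x), star B (hcomp B \<beta> j y)))) = scaleC (cnj c) (\<gamma> (adj (E2 (x, y))))"
      unfolding sum_bit E2_def fst_conv snd_conv comp adj_scaleC
      using x y by (simp add: zw_ops zw_hcomp hcomp_in scaleC_simps hom(4) h_in cl flip: XY(2))
  qed
  have u_in: "fst p \<in> carrier A" "snd p \<in> carrier B" if "p \<in> Poly_Mapping.keys u" for p
    using preD[OF u that] by auto
  have "lift E1 (pre_tensor_star A \<alpha> B \<beta> u) = adj (lift E1 u)"
    unfolding pre_tensor_star_eq lift_sum lift_single lift_def[of E1 u] adj_sum adj_scaleC
  proof (intro sum.cong refl)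
    fix p assume p: "p \<in> Poly_Mapping.keys u"
    show "(\<Sum>i\<in>{0, 1}. \<Sum>j\<in>{0, 1}. scaleC (bit_sign (i * j) * cnj (Poly_Mapping.lookup u p))
        (E1 (star A (hcomp A \<alpha> i (fst p)), star B (hcomp B \<beta> j (snd p))))) =
      scaleC (cnj (Poly_Mapping.lookup u p)) (adj (E1 p))"
      using t1[OF u_in[OF p], of "Poly_Mapping.lookup u p"] by (simp only: prod.collapse)
  qed
  moreover have "lift E2 (pre_tensor_star A \<alpha> B \<beta> u) = \<gamma> (adj (lift E2 u))"
  proof -
    have "\<gamma> (adj (lift E2 u)) = adj (lift (\<lambda>p. \<gamma> (E2 p)) u)"
      by (simp add: hom(3) lift_in[OF u] E_in gamma_lift[OF u])
    also have "\<dots> = (\<Sum>p\<in>Poly_Mapping.keys u. scaleC (cnj (Poly_Mapping.lookup u p)) (\<gamma> (adj (E2 p))))"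
      unfolding lift_def adj_sum adj_scaleC
      using preD[OF u] by (intro sum.cong refl) (simp add: hom(3) E_in)
    also have "\<dots> = lift E2 (pre_tensor_star A \<alpha> B \<beta> u)"
      unfolding pre_tensor_star_eq lift_sum lift_single
    proof (intro sum.cong refl)
      fix p assume p: "p \<in> Poly_Mapping.keys u"
      show "scaleC (cnj (Poly_Mapping.lookup u p)) (\<gamma> (adj (E2 p))) =
        (\<Sum>i\<in>{0, 1}. \<Sum>j\<in>{0, 1}. scaleC (bit_sign (i * j) * cnj (Poly_Mapping.lookup u p))
          (E2 (star A (hcomp A \<alpha> i (fst p)), star B (hcomp B \<beta> j (snd p)))))"
        using t2[OF u_in[OF p], of "Poly_Mapping.lookup u p"] by (simp only: prod.collapse)
    qed
    finally show ?thesis by simp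
  qed
  ultimately show ?thesis by (simp add: ev_def cadj_def)
qed

lemma ev_simps: "ev (u + v) = ev u + ev v" "ev (scale_fun c u) = cscale c (ev u)" "ev 0 = 0"
  "ev (u - v) = ev u - ev v" "ev (Poly_Mapping.single p c) = cscale c (E1 p, E2 p)"
  by (simp_all add: ev_def lift_add lift_scale lift_zero lift_diff lift_single cscale_def zero_prod_def)

lemma ev_null: "u \<in> tensor_null A B \<Longrightarrow> ev u = 0"
proof (induction rule: tensor_null.induct)
  case (add_left x x' y)
  then show ?case by (simp add: ev_simps E1_def E2_def cscale_def DA scaleC_simps zero_prod_def)
next
  case (add_right x y y')
  then show ?case by (simp add: ev_simps E1_def E2_def cscale_def zw_ops scaleC_simps zero_prod_def)
next
  case (scale_left x y c)
  then show ?case by (simp add: ev_simps E1_def E2_def cscale_def DA scaleC_simps zero_prod_def mult.commute)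
next
  case (scale_right x y c)
  then show ?case by (simp add: ev_simps E1_def E2_def cscale_def zw_ops scaleC_simps zero_prod_def)
qed (simp_all add: ev_simps cscale_def scaleC_zero_right zero_prod_def)

text \<open>The tensor x \<otimes> 1 + y \<otimes> e.\<close>

abbreviation nf :: "'c \<Rightarrow> 'c \<Rightarrow> 'c \<times> 'b \<Rightarrow>\<^sub>0 complex" where
  "nf x y \<equiv> Poly_Mapping.single (x, u0) 1 + Poly_Mapping.single (y, e) 1"

lemma ev_nf: "ev (nf x y) = (h x, h y)"
  by (simp add: ev_simps E1_def E2_def cscale_def zw_u0 zw_e scaleC_one scaleC_zero_left scaleC_zero_right)

lemma nf_in: "x \<in> carrier A \<Longrightarrow> y \<in> carrier A \<Longrightarrow> nf x y \<in> pre"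
  by (intro pre_add pre_single) (auto simp: u0 e)

lemma null_minus: "u \<in> tensor_null A B \<Longrightarrow> - u \<in> tensor_null A B"
proof -
  assume "u \<in> tensor_null A B"
  then have "scale_fun (-1) u \<in> tensor_null A B" by (rule tensor_null.scale)
  moreover have "scale_fun (-1) u = - u" by (rule poly_mapping_eqI) (simp add: lookup_scale_fun)
  ultimately show ?thesis by simp
qed

lemma null_trans: "u - v \<in> tensor_null A B \<Longrightarrow> v - t \<in> tensor_null A B \<Longrightarrow> u - t \<in> tensor_null A B"
  using tensor_null.add[of "u - v" A B "v - t"] by simp

lemma null_add2: "u - v \<in> tensor_null A B \<Longrightarrow> u' - v' \<in> tensor_null A B \<Longrightarrow> (u + u') - (v + v') \<in> tensor_null A B"
  using tensor_null.add[of "u - v" A B "u' - v'"] by (simp add: algebra_simps)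

lemma null_sym: "u - v \<in> tensor_null A B \<Longrightarrow> v - u \<in> tensor_null A B"
  using null_minus[of "u - v"] by simp

lemma single_nf:
  assumes x: "x \<in> carrier A" and y: "y \<in> carrier B"
  shows "Poly_Mapping.single (x, y) c - nf ((c * z y) \<odot>\<^bsub>A\<^esub> x) ((c * w y) \<odot>\<^bsub>A\<^esub> x) \<in> tensor_null A B"
proof -
  have B: "z y \<odot>\<^bsub>B\<^esub> u0 \<in> carrier B" "w y \<odot>\<^bsub>B\<^esub> e \<in> carrier B" using u0 e by (simp_all add: B.scale_closed)
  have "Poly_Mapping.single (x, y) 1 - (Poly_Mapping.single (x, z y \<odot>\<^bsub>B\<^esub> u0) 1 +
      Poly_Mapping.single (x, w y \<odot>\<^bsub>B\<^esub> e) 1) \<in> tensor_null A B"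
    by (subst (1) decompose[OF y]) (rule tensor_null.add_right[OF x B])
  then have "Poly_Mapping.single (x, y) 1 - (Poly_Mapping.single (x, u0) (z y) + Poly_Mapping.single (x, e) (w y)) \<in> tensor_null A B"
    by (rule null_trans) (intro null_add2 tensor_null.scale_right x u0 e)
  from tensor_null.scale[OF this, of c]
  have "Poly_Mapping.single (x, y) c - (Poly_Mapping.single (x, u0) (c * z y) + Poly_Mapping.single (x, e) (c * w y)) \<in> tensor_null A B"
  proof -
    have "scale_fun c (u - v) = scale_fun c u - scale_fun c v" "scale_fun c (u + v) = scale_fun c u + scale_fun c v"
      for u v :: "'c \<times> 'b \<Rightarrow>\<^sub>0 complex"
      by (rule poly_mapping_eqI, simp add: lookup_scale_fun lookup_minus lookup_add algebra_simps)+
    with \<open>scale_fun c _ \<in> _\<close> show ?thesis by (simp add: scale_fun_single)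
  qed
  then show ?thesis
    by (rule null_trans) (intro null_add2 null_sym[OF tensor_null.scale_left] x u0 e)
qed

lemma sum_nf:
  assumes W: "finite W" "W \<subseteq> AB"
  shows "\<exists>x\<in>carrier A. \<exists>y\<in>carrier A. (\<Sum>p\<in>W. Poly_Mapping.single p (c p)) - nf x y \<in> tensor_null A B"
  using W
proof (induction W rule: finite_induct)
  case empty
  have 0: "Poly_Mapping.single (\<zero>\<^bsub>A\<^esub>, y) 1 \<in> tensor_null A B" if "y \<in> carrier B" for y
  proof -
    have "0 \<odot>\<^bsub>A\<^esub> \<zero>\<^bsub>A\<^esub> = \<zero>\<^bsub>A\<^esub>" by (rule inj_onD[OF RA(3)]) (simp_all add: DA scaleC_zero_left)
    then show ?thesis using tensor_null.scale_left[OF DA(1) that, of 0] by simp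
  qed
  have "- nf \<zero>\<^bsub>A\<^esub> \<zero>\<^bsub>A\<^esub> \<in> tensor_null A B" by (intro null_minus tensor_null.add 0 u0 e)
  then show ?case using DA(1) by (intro bexI[of _ "\<zero>\<^bsub>A\<^esub>"]) auto
next
  case (insert p W)
  then obtain x y where xy: "x \<in> carrier A" "y \<in> carrier A"
    and s: "(\<Sum>p\<in>W. Poly_Mapping.single p (c p)) - nf x y \<in> tensor_null A B" by auto
  obtain a b where p: "p = (a, b)" and ab: "a \<in> carrier A" "b \<in> carrier B" using insert by auto
  let ?x = "(c p * z b) \<odot>\<^bsub>A\<^esub> a" and ?y = "(c p * w b) \<odot>\<^bsub>A\<^esub> a"
  have A': "?x \<in> carrier A" "?y \<in> carrier A" using ab by (simp_all add: DA)
  have "(Poly_Mapping.single p (c p) + (\<Sum>p\<in>W. Poly_Mapping.single p (c p))) - (nf ?x ?y + nf x y) \<in> tensor_null A B"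
    using single_nf[OF ab, of "c p"] s by (intro null_add2) (simp_all add: p)
  moreover have "(nf ?x ?y + nf x y) - nf (?x \<oplus>\<^bsub>A\<^esub> x) (?y \<oplus>\<^bsub>A\<^esub> y) \<in> tensor_null A B"
  proof -
    have "(Poly_Mapping.single (?x, u0) 1 + Poly_Mapping.single (x, u0) 1) + (Poly_Mapping.single (?y, e) 1 + Poly_Mapping.single (y, e) 1)
        - nf (?x \<oplus>\<^bsub>A\<^esub> x) (?y \<oplus>\<^bsub>A\<^esub> y) \<in> tensor_null A B"
      by (intro null_add2 null_sym[OF tensor_null.add_left] A' xy u0 e)
    then show ?thesis by (simp add: algebra_simps)
  qed
  ultimately have "(Poly_Mapping.single p (c p) + (\<Sum>p\<in>W. Poly_Mapping.single p (c p))) -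
      nf (?x \<oplus>\<^bsub>A\<^esub> x) (?y \<oplus>\<^bsub>A\<^esub> y) \<in> tensor_null A B" by (rule null_trans)
  then show ?case using insert A' xy by (intro bexI[of _ "?x \<oplus>\<^bsub>A\<^esub> x"] bexI[of _ "?y \<oplus>\<^bsub>A\<^esub> y"]) (simp_all add: DA)
qed

text \<open>Modulo \<open>tensor_null\<close> every element is a normal form \<open>nf x y\<close>,
  and \<open>ev\<close> reads off x and y through the injective h. So the kernel of
  \<open>ev\<close> is not larger than the space of tensor relations.\<close>

lemma null_iff:
  assumes u: "u \<in> pre" and v: "v \<in> pre"
  shows "u - v \<in> tensor_null A B \<longleftrightarrow> ev u = ev v"
proof
  assume "u - v \<in> tensor_null A B"
  then show "ev u = ev v" using ev_null[of "u - v"] by (simp add: ev_simps)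
next
  have nf: "\<exists>x\<in>carrier A. \<exists>y\<in>carrier A. u - nf x y \<in> tensor_null A B \<and> ev u = (h x, h y)" if u: "u \<in> pre" for u
  proof -
    have "\<exists>x\<in>carrier A. \<exists>y\<in>carrier A. u - nf x y \<in> tensor_null A B"
      using sum_nf[of "Poly_Mapping.keys u" "Poly_Mapping.lookup u"] u
      by (simp add: sum_single_keys pre_tensor_carrier_def)
    moreover have "ev u = (h x, h y)" if "u - nf x y \<in> tensor_null A B" for x y
      using ev_null[OF that] unfolding ev_simps(4) ev_nf by simp
    ultimately show ?thesis by blast
  qed
  assume eq: "ev u = ev v"
  obtain x y where x: "x \<in> carrier A" "y \<in> carrier A" "u - nf x y \<in> tensor_null A B" "ev u = (h x, h y)"
    using nf[OF u] by blast
  obtain x' y' where x': "x' \<in> carrier A" "y' \<in> carrier A" "v - nf x' y' \<in> tensor_null A B" "ev v = (h x', h y')"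
    using nf[OF v] by blast
  have "x = x'" "y = y'" using eq x x' inj_onD[OF RA(3)] by auto
  then show "u - v \<in> tensor_null A B" using x(3) null_sym[OF x'(3)] by (metis null_trans)
qed

lemma ev_surj: "ev ` pre = I \<times> I"
proof (intro equalityI subsetI)
  fix P assume "P \<in> I \<times> I"
  then obtain x y where "x \<in> carrier A" "y \<in> carrier A" "P = (h x, h y)"
    using RA(4) by (auto simp: image_iff)
  then have "P = ev (nf x y)" "nf x y \<in> pre" using nf_in by (simp_all add: ev_nf)
  then show "P \<in> ev ` pre" by blast
qed (use ev_in in blast)

lemma gstate_of_state:
  assumes "graded_state A \<alpha> \<phi>"
  shows "gstate I \<gamma> (\<lambda>y. \<phi> (inv_into (carrier A) h y))"
proof -
  let ?i = "inv_into (carrier A) h"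
  have hi: "?i y \<in> carrier A" "h (?i y) = y" if "y \<in> I" for y
    using that RA(4) by (auto intro: inv_into_into f_inv_into_f)
  have ih: "?i (h x) = x" if "x \<in> carrier A" for x using that RA(3) by simp
  have ops: "?i (x + y) = ?i x \<oplus>\<^bsub>A\<^esub> ?i y" "?i (scaleC c x) = c \<odot>\<^bsub>A\<^esub> ?i x"
    "?i (adj x * x) = star A (?i x) \<otimes>\<^bsub>A\<^esub> ?i x" "?i (\<gamma> x) = \<alpha> (?i x)" "norm x = nrm A (?i x)"
    if "x \<in> I" "y \<in> I" for x y c
    using that by (auto intro!: inj_onD[OF RA(3)] simp: hi DA RA cl G(4))
  have im: "{x \<in> I. norm x \<le> 1} = h ` {x \<in> carrier A. nrm A x \<le> 1}"
    using RA(4,7) by auto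
  have "(SUP y\<in>{x \<in> I. norm x \<le> 1}. cmod (\<phi> (?i y))) = (SUP x\<in>{x \<in> carrier A. nrm A x \<le> 1}. cmod (\<phi> x))"
    unfolding im image_image by (intro SUP_cong refl) (simp add: ih)
  then show ?thesis
    using assms hi unfolding gstate_def graded_state_def state_def
    by (auto simp: ops)
qed

lemma state_of_gstate:
  assumes "gstate I \<gamma> \<phi>"
  shows "graded_state A \<alpha> (\<lambda>x. \<phi> (h x))"
proof -
  have "{x \<in> I. norm x \<le> 1} = h ` {x \<in> carrier A. nrm A x \<le> 1}"
    using RA(4,7) by auto
  then have "(SUP x\<in>{x \<in> carrier A. nrm A x \<le> 1}. cmod (\<phi> (h x))) = (SUP y\<in>{x \<in> I. norm x \<le> 1}. cmod (\<phi> y))"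
    by (simp add: image_image)
  then show ?thesis
    using assms unfolding gstate_def graded_state_def state_def
    by (auto simp: DA RA h_in)
qed

lemma tensor_functional_eq:
  assumes \<phi>: "gstate I \<gamma> \<phi>" and \<phi>': "\<And>x. x \<in> carrier A \<Longrightarrow> \<phi>' x = \<phi> (h x)"
    and \<psi>: "\<And>y. y \<in> carrier B \<Longrightarrow> \<psi> y = z y" and u: "u \<in> pre"
  shows "tensor_functional \<phi>' \<psi> u = \<phi> (fst (ev u))"
proof -
  note P = pos_functionalD[OF gstateD(1)[OF \<phi>]]
  have sum: "f ` X \<subseteq> I \<Longrightarrow> \<phi> (sum f X) = (\<Sum>i\<in>X. \<phi> (f i))" for f :: "'c \<times> 'b \<Rightarrow> 'a" and X
  proof (induction X rule: infinite_finite_induct)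
    case (insert p X)
    then have "f p \<in> I" "sum f X \<in> I" by (auto intro!: cl)
    then show ?case using insert by (simp add: P(1))
  qed (use P(2)[OF cl(1), of 0] in \<open>simp_all add: scaleC_zero_left\<close>)
  have "\<phi> (lift E1 u) = (\<Sum>p\<in>Poly_Mapping.keys u. \<phi> (scaleC (Poly_Mapping.lookup u p) (E1 p)))"
    unfolding lift_def by (rule sum) (auto dest!: preD[OF u] intro!: cl E_in)
  also have "\<dots> = tensor_functional \<phi>' \<psi> u"
    unfolding tensor_functional_def
    by (intro sum.cong refl) (auto dest!: preD[OF u] simp: P(2) E1_def h_in cl \<phi>' \<psi> mult_ac scaleC_simps)
  finally show ?thesis by (simp add: ev_def)
qed

text \<open>Invariant states of A correspond to those of its model I, the only invariant state of B
  is z, and \<open>ev\<close> is onto. Both suprema are therefore over the same set of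
  quotients.\<close>

lemma minimal_norm_eq:
  assumes u: "u \<in> pre"
  shows "minimal_norm A \<alpha> B \<beta> u = cnorm I \<gamma> (ev u)"
proof -
  define sq where "sq v = pre_tensor_mult A \<alpha> B \<beta> (pre_tensor_star A \<alpha> B \<beta> v) v" for v
  have sq_in: "sq v \<in> pre" if "v \<in> pre" for v using that by (simp add: sq_def pre_mult pre_star)
  have tf: "tensor_functional \<phi>' \<psi> (sq v) = cform \<gamma> \<phi> (ev v)"
    if "gstate I \<gamma> \<phi>" "\<And>x. x \<in> carrier A \<Longrightarrow> \<phi>' x = \<phi> (h x)" "\<And>y. y \<in> carrier B \<Longrightarrow> \<psi> y = z y" "v \<in> pre"
    for \<phi> \<phi>' \<psi> v
    using tensor_functional_eq[OF that(1-3) sq_in[OF that(4)]] that(4)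
    by (simp add: sq_def ev_mult ev_star pre_star cform_def)
  have ih: "inv_into (carrier A) h (h x) = x" if "x \<in> carrier A" for x using that RA(3) by simp
  have "{Re (tensor_functional \<phi> \<psi> (sq (pre_tensor_mult A \<alpha> B \<beta> u v))) / Re (tensor_functional \<phi> \<psi> (sq v)) | \<phi> \<psi> v.
        graded_state A \<alpha> \<phi> \<and> graded_state B \<beta> \<psi> \<and> v \<in> pre \<and> tensor_functional \<phi> \<psi> (sq v) \<noteq> 0} =
      {Re (cform \<gamma> \<phi> (cmul \<gamma> (ev u) Q)) / Re (cform \<gamma> \<phi> Q) | \<phi> Q.
        gstate I \<gamma> \<phi> \<and> Q \<in> I \<times> I \<and> cform \<gamma> \<phi> Q \<noteq> 0}" (is "?S = ?T")
  proof (intro equalityI subsetI)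
    fix r assume "r \<in> ?S"
    then obtain \<phi> \<psi> v where r: "r = Re (tensor_functional \<phi> \<psi> (sq (pre_tensor_mult A \<alpha> B \<beta> u v))) / Re (tensor_functional \<phi> \<psi> (sq v))"
      and st: "graded_state A \<alpha> \<phi>" "graded_state B \<beta> \<psi>" and v: "v \<in> pre" and ne: "tensor_functional \<phi> \<psi> (sq v) \<noteq> 0"
      by blast
    define \<phi>' where "\<phi>' y = \<phi> (inv_into (carrier A) h y)" for y
    have g: "gstate I \<gamma> \<phi>'" using gstate_of_state[OF st(1)] by (simp add: \<phi>'_def[abs_def])
    have tf': "tensor_functional \<phi> \<psi> (sq v) = cform \<gamma> \<phi>' (ev v)" if "v \<in> pre" for v
      using that by (intro tf g) (simp_all add: \<phi>'_def ih graded_state_unique[OF st(2)])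
    show "r \<in> ?T"
      unfolding mem_Collect_eq using g v ne u ev_in[OF v]
      by (intro exI[of _ \<phi>'] exI[of _ "ev v"] conjI) (simp_all add: r tf' pre_mult ev_mult del: mem_Sigma_iff)
  next
    fix r assume "r \<in> ?T"
    then obtain \<phi> Q where r: "r = Re (cform \<gamma> \<phi> (cmul \<gamma> (ev u) Q)) / Re (cform \<gamma> \<phi> Q)"
      and g: "gstate I \<gamma> \<phi>" and Q: "Q \<in> I \<times> I" and ne: "cform \<gamma> \<phi> Q \<noteq> 0" by blast
    obtain v where v: "v \<in> pre" "Q = ev v" using Q ev_surj by blast
    have tf': "tensor_functional (\<lambda>x. \<phi> (h x)) z (sq v) = cform \<gamma> \<phi> (ev v)" if "v \<in> pre" for v
      using that by (intro tf g) simp_all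
    have "r = Re (tensor_functional (\<lambda>x. \<phi> (h x)) z (sq (pre_tensor_mult A \<alpha> B \<beta> u v))) /
        Re (tensor_functional (\<lambda>x. \<phi> (h x)) z (sq v))"
      using u v by (simp add: r tf' pre_mult ev_mult)
    moreover have "tensor_functional (\<lambda>x. \<phi> (h x)) z (sq v) \<noteq> 0" using v ne by (simp add: tf')
    ultimately show "r \<in> ?S"
      using state_of_gstate[OF g] graded_state_z v(1) by blast
  qed
  then show ?thesis unfolding minimal_norm_def cnorm_def Let_def sq_def by simp
qed

definition pre_tensor :: "('c \<times> 'b \<Rightarrow>\<^sub>0 complex) star_alg" where
  "pre_tensor = \<lparr>carrier = pre, mult = pre_tensor_mult A \<alpha> B \<beta>, one = undefined,
     zero = 0, add = (+), smult = scale_fun, star = pre_tensor_star A \<alpha> B \<beta>, nrm = minimal_norm A \<alpha> B \<beta>\<rparr>"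

lemma isometric_pre_tensor: "isometric_rep pre_tensor (\<lambda>u. emb D (ev u))"
  unfolding isometric_rep_def star_rep_def
  by (auto simp: pre_tensor_def pre_add pre_mult pre_star pre_scale ev_in ev_simps ev_mult ev_star
      minimal_norm_eq emb_simps emb_zero zero_in simp del: mem_Sigma_iff)
    (simp add: pre_tensor_carrier_def)

lemma tensor_rel_eq: "tensor_rel A B = fiber_rel pre_tensor (\<lambda>u. emb D (ev u))"
  by (auto simp: tensor_rel_def fiber_rel_def pre_tensor_def null_iff emb_eq_iff ev_in simp del: mem_Sigma_iff)

lemma pre_tensor_grading_eq: "pre_tensor_grading \<alpha> \<beta> u =
   (\<Sum>p\<in>Poly_Mapping.keys u. Poly_Mapping.single (\<alpha> (fst p), \<beta> (snd p)) (Poly_Mapping.lookup u p))"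
  unfolding pre_tensor_grading_def by (simp only: case_prod_unfold prod.collapse)

lemma ev_grading:
  assumes u: "u \<in> pre"
  shows "pre_tensor_grading \<alpha> \<beta> u \<in> pre" "ev (pre_tensor_grading \<alpha> \<beta> u) = (\<gamma> (fst (ev u)), - \<gamma> (snd (ev u)))"
proof -
  have u_in: "fst p \<in> carrier A" "snd p \<in> carrier B" if "p \<in> Poly_Mapping.keys u" for p
    using preD[OF u that] by auto
  show "pre_tensor_grading \<alpha> \<beta> u \<in> pre"
    unfolding pre_tensor_grading_eq using u_in by (intro pre_sum pre_single) (simp add: RA beta)
  have "lift E1 (pre_tensor_grading \<alpha> \<beta> u) = lift (\<lambda>p. \<gamma> (E1 p)) u"
    unfolding pre_tensor_grading_eq lift_sum lift_single lift_def[of _ u]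
    using u_in by (intro sum.cong refl) (simp add: E1_def zw_ops RA hom h_in)
  moreover have "lift E2 (pre_tensor_grading \<alpha> \<beta> u) = - lift (\<lambda>p. \<gamma> (E2 p)) u"
    unfolding pre_tensor_grading_eq lift_sum lift_single lift_def[of _ u] sum_negf[symmetric]
    using u_in by (intro sum.cong refl) (simp add: E2_def zw_ops RA hom h_in scaleC_minus_left scaleC_minus_right)
  ultimately show "ev (pre_tensor_grading \<alpha> \<beta> u) = (\<gamma> (fst (ev u)), - \<gamma> (snd (ev u)))"
    using gamma_lift[OF u, of E1, OF E_in(1)] gamma_lift[OF u, of E2, OF E_in(2)] by (simp add: ev_def)
qed

text \<open>The algebraic tensor product maps onto the whole crossed product, whose image in the
  type class is already closed, so the completion adds nothing.\<close>

lemma graded_tensor_realized: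
  "\<exists>k. realizes (graded_tensor A \<alpha> B \<beta>) (tensor_grading A \<alpha> B \<beta>) k (emb D ` (I \<times> I)) cgrade"
proof -
  let ?L = "\<lambda>u. emb D (ev u)"
  let ?R = "fiber_rel pre_tensor ?L"
  let ?S = "quotient_alg pre_tensor ?R"
  note Q = quotient_rep[OF isometric_pre_tensor]
  have carr: "carrier pre_tensor = pre" by (simp add: pre_tensor_def)
  have im: "fiber_val ?L ` carrier ?S = emb D ` (I \<times> I)"
    unfolding Q(2) carr by (simp add: ev_surj[symmetric] image_image)
  have S: "algebraic_tensor A \<alpha> B \<beta> = ?S"
    by (simp only: algebraic_tensor_def tensor_rel_eq pre_tensor_def)
  have cgrade: "continuous_on (closure (fiber_val ?L ` carrier ?S)) cgrade"
    using continuous_on_grading[OF grading_cgrade] grading_onD(1)[OF grading_cgrade] by (simp add: im)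
  have g: "pre_tensor_grading \<alpha> \<beta> u \<in> carrier pre_tensor" "?L (pre_tensor_grading \<alpha> \<beta> u) = cgrade (?L u)"
    if "u \<in> carrier pre_tensor" for u
    using that by (simp_all add: carr ev_grading cgrade_emb ev_in del: mem_Sigma_iff)
  have "\<exists>k. realizes (completion ?S) (completion_map ?S (quotient_map ?R (pre_tensor_grading \<alpha> \<beta>))) k
      (closure (fiber_val ?L ` carrier ?S)) cgrade"
  proof (rule completion_realizes[OF _ _ _ _ cgrade])
    show "abelian_group ?S" "isometric_rep ?S (fiber_val ?L)"
      using Q(1) abelian_group_of_rep by (auto simp: faithful_rep_def isometric_rep_def)
    fix X assume X: "X \<in> carrier ?S"
    show "quotient_map ?R (pre_tensor_grading \<alpha> \<beta>) X \<in> carrier ?S"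
      by (rule quotient_map_fiber(1)[OF X, where \<gamma>=cgrade]) (simp_all add: g)
    show "fiber_val ?L (quotient_map ?R (pre_tensor_grading \<alpha> \<beta>) X) = cgrade (fiber_val ?L X)"
      by (rule quotient_map_fiber(2)[OF X, where \<gamma>=cgrade]) (simp_all add: g)
  qed
  then show ?thesis
    using grading_onD(1)[OF grading_cgrade]
    by (simp add: graded_tensor_def tensor_grading_def S tensor_rel_eq im)
qed

end

subsection \<open>\<open>Cliff\<^sub>1\<close> and the \<open>C\<^sup>*\<close>-algebra of \<open>\<int>\<^sub>2\<close>\<close>

lemma cstar_Cliff1: "cstar_algebra Cliff1"
proof -
  have grp: "abelian_group Cliff1"
  proof (rule abelian_groupI)
    fix p assume "p \<in> carrier Cliff1"
    show "\<exists>r\<in>carrier Cliff1. r \<oplus>\<^bsub>Cliff1\<^esub> p = \<zero>\<^bsub>Cliff1\<^esub>"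
      by (rule bexI[of _ "- p"]) (simp_all add: Cliff1_simps)
  qed (simp_all add: Cliff1_simps add_ac)
  interpret abelian_group Cliff1 by (rule grp)
  have minus: "p \<ominus>\<^bsub>Cliff1\<^esub> r = p - r" for p r
  proof -
    have "\<ominus>\<^bsub>Cliff1\<^esub> r = - r" by (rule minus_equality) (simp_all add: Cliff1_simps)
    then show ?thesis by (simp add: a_minus_def Cliff1_simps)
  qed
  show ?thesis
  proof (intro cstar_algebra.intro cstar_algebra_axioms.intro grp; unfold Cliff1_simps)
    fix f assume "f \<in> cauchy_seqs Cliff1"
    then have C: "\<exists>N. \<forall>m\<ge>N. \<forall>n\<ge>N. max (cmod (fst (f m) - fst (f n))) (cmod (snd (f m) - snd (f n))) < e"
      if "e > 0" for e using that by (simp add: cauchy_seqs_def Cliff1_simps minus)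
    have "Cauchy (\<lambda>n. fst (f n))" "Cauchy (\<lambda>n. snd (f n))"
      using C by (auto simp: Cauchy_def dist_norm) fast+
    then obtain a b where "(\<lambda>n. fst (f n)) \<longlonglongrightarrow> a" "(\<lambda>n. snd (f n)) \<longlonglongrightarrow> b"
      using Cauchy_convergent convergent_def by metis
    then have "(\<lambda>n. max (cmod (fst (f n) - a)) (cmod (snd (f n) - b))) \<longlonglongrightarrow> max 0 0"
      by (intro tendsto_max tendsto_norm_zero) (simp_all add: LIM_zero)
    then show "\<exists>l\<in>UNIV. (\<lambda>n. max (cmod (fst (f n \<ominus>\<^bsub>Cliff1\<^esub> l))) (cmod (snd (f n \<ominus>\<^bsub>Cliff1\<^esub> l)))) \<longlonglongrightarrow> 0"
      by (intro bexI[of _ "(a, b)"]) (simp_all add: minus)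
  next
    fix x y :: "complex \<times> complex"
    show "max (cmod (fst (x + y))) (cmod (snd (x + y))) \<le>
        max (cmod (fst x)) (cmod (snd x)) + max (cmod (fst y)) (cmod (snd y))"
      using norm_triangle_ineq[of "fst x" "fst y"] norm_triangle_ineq[of "snd x" "snd y"] by auto
    show "max (cmod (fst (fst x * fst y, snd x * snd y))) (cmod (snd (fst x * fst y, snd x * snd y))) \<le>
        max (cmod (fst x)) (cmod (snd x)) * max (cmod (fst y)) (cmod (snd y))"
      by (auto simp: norm_mult le_max_iff_disj intro!: mult_mono)
    show "max (cmod (fst (fst (cnj (fst x), cnj (snd x)) * fst x, snd (cnj (fst x), cnj (snd x)) * snd x)))
        (cmod (snd (fst (cnj (fst x), cnj (snd x)) * fst x, snd (cnj (fst x), cnj (snd x)) * snd x))) =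
        (max (cmod (fst x)) (cmod (snd x)))\<^sup>2"
      by (cases "cmod (fst x) \<le> cmod (snd x)")
        (simp_all add: norm_mult power2_eq_square max_absorb1 max_absorb2 mult_mono)
  qed (auto simp: prod_eq_iff norm_mult algebra_simps max_def le_max_iff_disj mult_le_cancel_left_pos mult_le_cancel_left mult_le_cancel_right)
qed

lemma clifford_Cliff1: "clifford Cliff1 Cliff1_grading (\<lambda>p. p)"
  by (intro clifford.intro cstar_Cliff1)
    (auto simp: star_iso_def Cliff1_simps Cliff1_grading_def bij_betw_def)

abbreviation embC :: "complex \<times> complex \<Rightarrow> (complex \<times> complex, unit) cprod" where
  "embC \<equiv> emb Cliff1"

lemmas embC_faithful = faithful_repD[OF cstar_algebra.faithful_emb[OF cstar_Cliff1]]
lemma embC_simps: "embC 0 = 0" "embC (p + r) = embC p + embC r"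
  "embC (fst p * fst r, snd p * snd r) = embC p * embC r"
  "embC (cnj (fst p), cnj (snd p)) = adj (embC p)" "embC (c * fst p, c * snd p) = scaleC c (embC p)"
  using star_repD[OF embC_faithful(1)] by (simp_all add: Cliff1_simps)

lemma inv_embC: "inv_into UNIV embC (embC p) = p"
  using embC_faithful(2) by (simp add: Cliff1_simps)

lemma closed_embC: "closed (range embC)" and star_closed_embC: "star_closed (range embC)"
  using cstar_algebra.closed_emb[OF cstar_Cliff1] star_closed_image[OF embC_faithful(1)]
  by (simp_all add: Cliff1_simps)

lemma UNIV_bit: "UNIV = {0, 1 :: bit}"
proof -
  have "i = 0 \<or> i = 1" for i :: bit by (cases i) simp_all
  then show ?thesis by auto
qed

lemma Z2_simps: "mor Z2_graph = UNIV" "rng Z2_graph i = 0" "src Z2_graph i = 0" "cmp Z2_graph i j = i + j"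
  "pdeg Z2_graph i = (\<lambda>_. 0, (\<lambda>_. 0)(0 := i))"
  by (simp_all add: Z2_graph_def)

lemma objs_Z2: "objs Z2_graph = {0}"
  by (auto simp: objs_def Z2_simps)

lemma small_category_Z2: "small_category Z2_graph"
  by unfold_locales (auto simp: objs_Z2 Z2_simps add_ac)

lemma paths_to_Z2: "(m, n) \<in> Pmon 0 1 \<Longrightarrow> paths_to Z2_graph 0 (m, n) = {n 0}"
  by (auto simp: paths_to_def Z2_simps Pmon_def fun_eq_iff)

lemma parity_Z2: "graph_parity 0 1 Z2_graph i = i"
  by (simp add: graph_parity_def parity_def reduce2_def Z2_simps)

text \<open>The values at i of the two characters of the group.\<close>

definition tau :: "bit \<Rightarrow> complex \<times> complex" where
  "tau i = (1, bit_sign i)"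

lemma tau_family: "tfam 0 1 Z2_graph (\<lambda>_ _. 1) (\<lambda>i. embC (tau i))"
  unfolding tfam_def objs_Z2 Z2_simps
proof (intro conjI ballI allI impI)
  fix p assume p: "p \<in> Pmon 0 1"
  fix v :: bit assume v: "v \<in> {0}"
  have "paths_to Z2_graph 0 p = {snd p 0}" using paths_to_Z2[of "fst p" "snd p"] p by simp
  then show "embC (tau v) = (\<Sum>i\<in>paths_to Z2_graph v p. embC (tau i) * adj (embC (tau i)))"
    using v by (simp add: tau_def flip: embC_simps)
qed (auto simp: tau_def scaleC_one simp flip: embC_simps)

text \<open>Such a family is a unit together with a self-adjoint unitary of order 2;
  self-adjointness of t 1 follows from t 1 t 1 = t 0 and
  \<open>adj (t 1) * t 1 = t 0\<close>.\<close>

lemma Z2_family: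
  fixes t :: "bit \<Rightarrow> 'a::cstar_type"
  assumes mult: "\<And>i j. t i * t j = t (i + j)" and sq: "\<And>i. adj (t i) * t i = t 0" and 0: "adj (t 0) = t 0"
  shows "t 0 * t 0 = t 0" "t 0 * t 1 = t 1" "t 1 * t 0 = t 1" "t 1 * t 1 = t 0" "adj (t 0) = t 0" "adj (t 1) = t 1"
proof -
  show "t 0 * t 0 = t 0" "t 0 * t 1 = t 1" "t 1 * t 0 = t 1" "t 1 * t 1 = t 0" "adj (t 0) = t 0"
    by (simp_all add: mult 0)
  have "adj (t 1) = adj (t 0 * t 1)" by (simp add: mult)
  also have "\<dots> = adj (t 1) * t 0" by (simp only: adj_mult 0)
  also have "\<dots> = adj (t 1) * (t 1 * t 1)" by (simp add: mult)
  also have "\<dots> = (adj (t 1) * t 1) * t 1" by (simp only: mult.assoc)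
  also have "\<dots> = t 1" by (simp only: sq mult) simp
  finally show "adj (t 1) = t 1" .
qed

text \<open>\<open>tau\<close> is one family, and any other is the image of it under a
  *-homomorphism of \<open>Cliff1\<close>, which is contractive.\<close>

lemma Z2_universal_norm:
  assumes x: "x \<in> carrier (free_star_alg 0 1 Z2_graph (\<lambda>_ _. 1))"
  shows "universal_norm 0 1 Z2_graph (\<lambda>_ _. 1) x = norm (fv (\<lambda>i. embC (tau i)) x)"
proof (rule antisym)
  interpret Z: small_category Z2_graph by (rule small_category_Z2)
  show "norm (fv (\<lambda>i. embC (tau i)) x) \<le> universal_norm 0 1 Z2_graph (\<lambda>_ _. 1) x"
    by (intro Z.tfam_universal tau_family x) (simp add: Z2_simps UNIV_bit)
  show "universal_norm 0 1 Z2_graph (\<lambda>_ _. 1) x \<le> norm (fv (\<lambda>i. embC (tau i)) x)"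
  proof (rule Z.universal_least)
    fix E :: "real star_alg" and t assume E: "cstar_algebra E" and t: "graph_family 0 1 Z2_graph (\<lambda>_ _. 1) E t"
    interpret E: cstar_algebra E by (rule E)
    note tc = Z.family_carrier[OF t]
    define s where "s i = emb E (t i)" for i
    have "tfam 0 1 Z2_graph (\<lambda>_ _. 1) s"
      using Z.family_tfam[OF E tc] t by (simp add: s_def[abs_def])
    then have "s i * s j = s (i + j)" "adj (s i) * s i = s 0" "adj (s 0) = s 0" for i j
      by (auto simp: tfam_def objs_Z2 Z2_simps scaleC_one)
    note S = Z2_family[OF this]
    \<comment> \<open>Inverse Fourier transform: (z, w) is (z + w) / 2 times \<open>tau 0\<close>
      plus (z - w) / 2 times \<open>tau 1\<close>.\<close>
    define \<psi> where "\<psi> y = (let p = inv_into UNIV embC y in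
      scaleC ((fst p + snd p) / 2) (s 0) + scaleC ((fst p - snd p) / 2) (s 1))" for y
    have \<psi>: "\<psi> (embC p) = scaleC ((fst p + snd p) / 2) (s 0) + scaleC ((fst p - snd p) / 2) (s 1)" for p
      by (simp add: \<psi>_def inv_embC)
    have comb: "scaleC a x + scaleC b y + (scaleC c x + scaleC d y) = scaleC (a + c) x + scaleC (b + d) y"
      for a b c d and x y :: "(real, unit) cprod" by (simp add: scaleC_simps)
    have prod: "(scaleC a (s 0) + scaleC b (s 1)) * (scaleC c (s 0) + scaleC d (s 1)) =
        scaleC (a * c + b * d) (s 0) + scaleC (a * d + b * c) (s 1)" for a b c d
      by (simp add: distrib_left distrib_right scaleC_mult_left scaleC_mult_right scaleC_scaleC
          scaleC_add_left scaleC_add_right S add_ac mult_ac)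
    have hom: "star_hom_on (range embC) \<psi>"
      unfolding star_hom_on_def
    proof (intro conjI ballI allI; clarify)
      fix p r :: "complex \<times> complex" and c
      obtain a b a' b' where [simp]: "p = (a, b)" "r = (a', b')" by (cases p; cases r)
      have "\<psi> (embC p) + \<psi> (embC r) =
          scaleC ((a + b) / 2 + (a' + b') / 2) (s 0) + scaleC ((a - b) / 2 + (a' - b') / 2) (s 1)"
        by (simp add: \<psi> comb)
      also have "\<dots> = \<psi> (embC p + embC r)"
        by (simp add: \<psi> flip: embC_simps)
          (intro arg_cong2[of _ _ _ _ "(+)"] arg_cong2[of _ _ _ _ scaleC]; simp add: field_simps)
      finally show "\<psi> (embC p + embC r) = \<psi> (embC p) + \<psi> (embC r)" by simp
      show "\<psi> (scaleC c (embC p)) = scaleC c (\<psi> (embC p))"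
        by (simp add: \<psi> scaleC_add_right scaleC_scaleC field_simps flip: embC_simps)
      show "\<psi> (adj (embC p)) = adj (\<psi> (embC p))"
        by (simp add: \<psi> adj_add adj_scaleC S flip: embC_simps)
      have "\<psi> (embC p) * \<psi> (embC r) =
          scaleC ((a + b) / 2 * ((a' + b') / 2) + (a - b) / 2 * ((a' - b') / 2)) (s 0) +
          scaleC ((a + b) / 2 * ((a' - b') / 2) + (a - b) / 2 * ((a' + b') / 2)) (s 1)"
        by (simp only: \<psi> prod comb fst_conv snd_conv \<open>p = (a, b)\<close> \<open>r = (a', b')\<close>)
      also have "\<dots> = \<psi> (embC p * embC r)"
        by (simp add: \<psi> flip: embC_simps)
          (intro arg_cong2[of _ _ _ _ "(+)"] arg_cong2[of _ _ _ _ scaleC]; simp add: field_simps)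
      finally show "\<psi> (embC p * embC r) = \<psi> (embC p) * \<psi> (embC r)" by simp
    qed
    have \<psi>t: "\<psi> (embC (tau i)) = s i" for i
      by (cases i) (simp_all add: \<psi> tau_def scaleC_one scaleC_zero_left)
    note R = free_value_rep[OF E.abelian_group_axioms faithful_repD(1)[OF E.faithful_emb] tc x]
    have "nrm E (free_value E t x) = norm (fv s x)"
      using R by (simp add: faithful_repD(3)[OF E.faithful_emb] s_def[abs_def])
    also have "fv s x = \<psi> (fv (\<lambda>i. embC (tau i)) x)"
      using fv_hom(2)[OF star_closed_embC hom _ x, of "\<lambda>i. embC (tau i)"] by (simp add: \<psi>t)
    also have "norm \<dots> \<le> norm (fv (\<lambda>i. embC (tau i)) x)"
      using fv_in[OF star_closed_embC _ x, of "\<lambda>i. embC (tau i)"]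
      by (intro star_hom_contractive[OF closed_embC star_closed_embC hom]) simp
    finally show "nrm E (free_value E t x) \<le> norm (fv (\<lambda>i. embC (tau i)) x)" .
  qed
qed

lemma clifford_Z2:
  "\<exists>g. clifford (graph_cstar 0 1 Z2_graph (\<lambda>_ _. 1)) (graph_grading 0 1 Z2_graph (\<lambda>_ _. 1)) g"
proof -
  let ?F = "free_star_alg 0 1 Z2_graph (\<lambda>_ _. 1)" and ?t = "\<lambda>i. embC (tau i)"
  define \<gamma> where "\<gamma> y = embC (prod.swap (inv_into UNIV embC y))" for y
  have \<gamma>: "\<gamma> (embC p) = embC (prod.swap p)" for p by (simp add: \<gamma>_def inv_embC)
  have hom: "star_hom_on (range embC) \<gamma>"
    unfolding star_hom_on_def by (auto simp: \<gamma> simp flip: embC_simps)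
  have closure: "closure (fv ?t ` carrier ?F) = range embC"
  proof (rule antisym)
    have "fv ?t x \<in> range embC" if "x \<in> carrier ?F" for x
      using fv_in[OF star_closed_embC _ that, of ?t] by simp
    then show "closure (fv ?t ` carrier ?F) \<subseteq> range embC" by (intro closure_minimal closed_embC) auto
    have "embC p \<in> fv ?t ` carrier ?F" for p
    proof -
      let ?x = "Poly_Mapping.single [(0, False)] ((fst p + snd p) / 2) + Poly_Mapping.single [(1, False)] ((fst p - snd p) / 2)"
      have "fv ?t ?x = embC p"
        by (simp add: lift_add lift_single lv_def tau_def flip: embC_simps) (simp add: field_simps prod_eq_iff)
      moreover have "?x \<in> carrier ?F"
        using Poly_Mapping.keys_add[of "Poly_Mapping.single [(0, False)] ((fst p + snd p) / 2)"
            "Poly_Mapping.single [(1, False)] ((fst p - snd p) / 2)"]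
        by (auto simp: carrier_free Z2_simps split: if_splits)
      ultimately show ?thesis by (rule image_eqI[OF sym])
    qed
    then have "range embC \<subseteq> fv ?t ` carrier ?F" by auto
    then show "range embC \<subseteq> closure (fv ?t ` carrier ?F)" by (rule order_trans[OF _ closure_subset])
  qed
  have "\<exists>h. realizes (graph_cstar 0 1 Z2_graph (\<lambda>_ _. 1)) (graph_grading 0 1 Z2_graph (\<lambda>_ _. 1)) h
      (closure (fv ?t ` carrier ?F)) \<gamma>"
    unfolding graph_cstar_def graph_grading_def
  proof (rule completion_realizes)
    show "abelian_group ?F" by (rule abelian_group_free)
    show "isometric_rep ?F (fv ?t)"
      using star_rep_free Z2_universal_norm by (auto simp: isometric_rep_def free_star_alg_def)
    show "continuous_on (closure (fv ?t ` carrier ?F)) \<gamma>"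
      unfolding closure by (rule continuous_on_star_hom[OF closed_embC star_closed_embC hom])
    fix x assume x: "x \<in> carrier ?F"
    show "free_grading 0 1 Z2_graph x \<in> carrier ?F" by (rule free_grading(1)[OF x])
    have "scaleC (bit_sign i) (?t i) = \<gamma> (?t i)" for i
      by (cases i) (simp_all add: \<gamma> tau_def flip: embC_simps)
    then show "fv ?t (free_grading 0 1 Z2_graph x) = \<gamma> (fv ?t x)"
      using fv_hom(2)[OF star_closed_embC hom _ x, of ?t] by (simp add: free_grading(2)[OF x] parity_Z2 del: One_nat_def)
  qed
  then obtain h where h: "realizes (graph_cstar 0 1 Z2_graph (\<lambda>_ _. 1)) (graph_grading 0 1 Z2_graph (\<lambda>_ _. 1)) h (range embC) \<gamma>"
    unfolding closure ..
  note R = realizesD[OF h]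
  define g where "g y = inv_into UNIV embC (h y)" for y
  have hg: "embC (g y) = h y" if "y \<in> carrier (graph_cstar 0 1 Z2_graph (\<lambda>_ _. 1))" for y
    using R(8)[OF that] by (simp add: g_def f_inv_into_f)
  have "clifford (graph_cstar 0 1 Z2_graph (\<lambda>_ _. 1)) (graph_grading 0 1 Z2_graph (\<lambda>_ _. 1)) g"
  proof (rule clifford.intro)
    show "cstar_algebra (graph_cstar 0 1 Z2_graph (\<lambda>_ _. 1))" by (rule realizes_cstar[OF h closed_embC])
    have "inj_on (inv_into UNIV embC) (range embC)" by (rule inj_on_inv_into) simp
    then have "bij_betw g (carrier (graph_cstar 0 1 Z2_graph (\<lambda>_ _. 1))) (carrier Cliff1)"
      unfolding g_def bij_betw_def Cliff1_simps
      using comp_inj_on[OF R(3)] R(4) inv_embC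
      by (auto simp: o_def image_image[symmetric, of "inv_into UNIV embC" h] image_comp)
    then show "star_iso (graph_cstar 0 1 Z2_graph (\<lambda>_ _. 1)) Cliff1 g"
      using hg by (intro star_iso_via[where \<psi>="\<lambda>x. x", OF R(1) cstar_algebra.faithful_emb[OF cstar_Cliff1]])
        (auto simp: star_hom_on_def)
    fix y assume y: "y \<in> carrier (graph_cstar 0 1 Z2_graph (\<lambda>_ _. 1))"
    show "graph_grading 0 1 Z2_graph (\<lambda>_ _. 1) y \<in> carrier (graph_cstar 0 1 Z2_graph (\<lambda>_ _. 1))"
      by (rule R(5)[OF y])
    show "g (graph_grading 0 1 Z2_graph (\<lambda>_ _. 1) y) = prod.swap (g y)"
      unfolding g_def[of "graph_grading 0 1 Z2_graph (\<lambda>_ _. 1) y"] R(6)[OF y] hg[OF y, symmetric] \<gamma> by (rule inv_embC)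
    show "nrm (graph_cstar 0 1 Z2_graph (\<lambda>_ _. 1)) y = nrm Cliff1 (g y)"
      using embC_faithful(3)[of "g y"] R(7)[OF y] hg[OF y] by (simp only: Cliff1_simps UNIV_I)
  qed
  then show ?thesis by blast
qed

subsection \<open>The graph \<open>\<Lambda> \<times> Z\<^sub>2\<close>\<close>

lemma bit_sign_square_mult [simp]: "bit_sign b * (bit_sign b * z) = z"
  by (simp flip: mult.assoc)

text \<open>In the free algebra the involution sits on single letters, so adjoints are considered
  for generators only. This allows induction for properties that are not visibly stable under
  adjoints.\<close>

lemma fv_induct [consumes 1, case_names zero add mult scale generator adj]:
  fixes t :: "'l \<Rightarrow> 'a::cstar_type"
  assumes x: "x \<in> carrier (free_star_alg k a L c)"
    and zero: "P 0" and add: "\<And>y z. P y \<Longrightarrow> P z \<Longrightarrow> P (y + z)"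
    and mult: "\<And>y z. P y \<Longrightarrow> P z \<Longrightarrow> P (y * z)" and scale: "\<And>r y. P y \<Longrightarrow> P (scaleC r y)"
    and gen: "\<And>y. y \<in> mor L \<Longrightarrow> P (t y)" and adj: "\<And>y. y \<in> mor L \<Longrightarrow> P (adj (t y))"
  shows "P (fv t x)"
proof -
  have letter: "P (lv t p)" if "fst p \<in> mor L" for p
    using that gen adj by (cases p) (auto simp: lv_def)
  have word: "w \<noteq> [] \<Longrightarrow> fst ` set w \<subseteq> mor L \<Longrightarrow> P (wv t w)" for w
  proof (induction w)
    case (Cons y w)
    then show ?case using letter[of y] by (cases "w = []") (auto simp: wv_Cons intro: mult)
  qed simp
  have "P (\<Sum>w\<in>W. scaleC (Poly_Mapping.lookup x w) (wv t w))" if "W \<subseteq> words L" for W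
    using that by (induction W rule: infinite_finite_induct) (auto intro: zero add scale word)
  then show ?thesis using x by (simp add: lift_def carrier_free)
qed

lemma generator_in_closure:
  assumes "x \<in> mor L" shows "t x \<in> closure (fv t ` carrier (free_star_alg k a L c))"
proof -
  have "Poly_Mapping.single [(x, False)] 1 \<in> carrier (free_star_alg k a L c)"
    using assms by (auto simp: carrier_free)
  then have "fv t (Poly_Mapping.single [(x, False)] 1) \<in> closure (fv t ` carrier (free_star_alg k a L c))"
    by (intro subsetD[OF closure_subset] imageI)
  then show ?thesis by (simp add: lift_single lv_def scaleC_one)
qed

context P_graph
begin

abbreviation "Z \<equiv> times_Z2 a L"
abbreviation (input) "cZ \<equiv> graph_cocycle k (Suc a) Z"
abbreviation (input) "cL \<equiv> graph_cocycle k a L"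

lemma times_Z2_simps:
  "mor Z = mor L \<times> UNIV" "rng Z (x, i) = (rng L x, 0)" "src Z (x, i) = (src L x, 0)"
  "cmp Z (x, i) (y, j) = (cmp L x y, i + j)"
  "pdeg Z (x, i) = (fst (pdeg L x), (snd (pdeg L x))(a := i))"
  by (simp_all add: times_Z2_def Z2_simps)

lemma objs_times_Z2: "objs Z = objs L \<times> {0}"
  by (auto simp: objs_def times_Z2_simps)

lemma small_category_times_Z2: "small_category Z"
  by unfold_locales
    (auto simp: times_Z2_simps objs_times_Z2 rng_obj src_obj cmp_closed rng_cmp src_cmp cmp_assoc cmp_rng cmp_src add_ac)

lemma countable_times_Z2: "countable (mor Z)"
  by (simp add: times_Z2_simps countable_mor UNIV_bit)

lemma reduce2_times_Z2:
  "reduce2 k (pdeg Z (x, i)) j = (if j = k + a then i else reduce2 k (pdeg L x) j)"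
  by (auto simp: reduce2_def times_Z2_simps)

lemma parity_times_Z2: "graph_parity k (Suc a) Z (x, i) = graph_parity k a L x + i"
  by (simp add: graph_parity_def parity_def reduce2_times_Z2)

text \<open>The new coordinate is the last one, so in \<open>kappa\<close> it occurs only in the
  first argument. There i is paired with the sum of all old coordinates of y, which is the parity of
  y.\<close>

lemma cocycle_times_Z2:
  "cZ (x, i) (y, j) = cL x y * bit_sign (i * graph_parity k a L y)"
proof -
  let ?m = "reduce2 k (pdeg L x)" and ?n = "reduce2 k (pdeg L y)"
  have "kappa (k + Suc a) (reduce2 k (pdeg Z (x, i))) (reduce2 k (pdeg Z (y, j))) =
      (\<Sum>l<k + a. \<Sum>l'<l. ?m l * ?n l') + (\<Sum>l'<k + a. i * ?n l')"
    unfolding kappa_def reduce2_times_Z2 add_Suc_right sum.lessThan_Suc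
    by (intro arg_cong2[of _ _ _ _ "(+)"] sum.cong refl arg_cong2[of _ _ _ _ "(*)"]) auto
  then show ?thesis
    unfolding graph_cocycle_def kappa_def graph_parity_def parity_def sum_distrib_left[symmetric]
    by (simp only: bit_sign_simps)
qed

lemma cocycle_obj: "v \<in> objs L \<Longrightarrow> cL x v = 1" "v \<in> objs L \<Longrightarrow> cL v x = 1"
  by (simp_all add: graph_cocycle_def pdeg_obj reduce2_zero kappa_def)

text \<open>The last coordinate of the degree prescribes the second component of the path.\<close>

lemma paths_to_times_Z2:
  assumes "p \<in> Pmon k (Suc a)"
  shows "paths_to Z (v, 0) p = (\<lambda>x. (x, snd p a)) ` paths_to L v (fst p, (snd p)(a := 0))"
proof -
  have eq: "pdeg L x = (fst p, (snd p)(a := 0)) \<longleftrightarrow> pdeg Z (x, snd p a) = p" if "x \<in> mor L" for x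
    using pdeg_in[OF that] by (auto simp: times_Z2_simps Pmon_def prod_eq_iff fun_eq_iff split: prod.splits)
  have idx: "pdeg Z (x, i) = p \<Longrightarrow> i = snd p a" for x i
    by (auto simp: times_Z2_simps)
  have "(x, i) \<in> paths_to Z (v, 0) p \<longleftrightarrow> i = snd p a \<and> x \<in> paths_to L v (fst p, (snd p)(a := 0))" for x i
    using eq[of x] idx[of x i] unfolding paths_to_def times_Z2_simps(1,2) mem_Collect_eq mem_Times_iff prod.inject fst_conv snd_conv
    by (metis UNIV_I)
  then show ?thesis by (auto simp del: split_paired_All)
qed

lemma Pmon_drop: "p \<in> Pmon k (Suc a) \<Longrightarrow> (fst p, (snd p)(a := 0)) \<in> Pmon k a"
  by (auto simp: Pmon_def le_less_Suc_eq Suc_le_eq dest: le_neq_implies_less)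

abbreviation (input) "gn \<equiv> gen k a L cL"
abbreviation (input) "II \<equiv> closure (fv (gen k a L cL) ` carrier (free_star_alg k a L cL))"
abbreviation (input) "gr \<equiv> regrade (graph_parity k a L)"

lemma crossed_graph: "crossed_product II gr"
  by unfold_locales (rule graph_algebra_realized)

interpretation C: crossed_product II gr
  by (rule crossed_graph)

text \<open>\<open>i0 x\<close> and \<open>i1 x\<close> are x and x e. Without a unit in the algebra
  e itself is not an element of the crossed product, only such products are.\<close>

definition i0 :: "(real, 'l \<Rightarrow> real) cprod \<Rightarrow> ((real, 'l \<Rightarrow> real) cprod \<times> (real, 'l \<Rightarrow> real) cprod, unit) cprod" where
  "i0 x = emb C.D (x, 0)"
definition i1 :: "(real, 'l \<Rightarrow> real) cprod \<Rightarrow> ((real, 'l \<Rightarrow> real) cprod \<times> (real, 'l \<Rightarrow> real) cprod, unit) cprod" where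
  "i1 x = emb C.D (0, x)"

lemma gr_0: "gr 0 = 0"
  using star_hom_on_zero[OF star_closed_UNIV regrade_hom] .

lemma i01:
  assumes "x \<in> II" "y \<in> II"
  shows "emb C.D (x, y) = i0 x + i1 y" "i0 (x + y) = i0 x + i0 y" "i1 (x + y) = i1 x + i1 y"
    "i0 x * i0 y = i0 (x * y)" "i0 x * i1 y = i1 (x * y)"
    "i1 x * i0 y = i1 (x * gr y)" "i1 x * i1 y = i0 (x * gr y)"
  using assms C.emb_simps2[of "(x, 0)" "(0, y)"] C.emb_simps2[of "(x, 0)" "(y, 0)"]
    C.emb_simps2[of "(0, x)" "(0, y)"] C.emb_simps2[of "(0, x)" "(y, 0)"] C.cl(1)
  by (simp_all add: i0_def i1_def cmul_def gr_0)

lemma i01':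
  assumes "x \<in> II"
  shows "adj (i0 x) = i0 (adj x)" "adj (i1 x) = i1 (gr (adj x))"
    "scaleC r (i0 x) = i0 (scaleC r x)" "scaleC r (i1 x) = i1 (scaleC r x)"
    "C.cgrade (i0 x) = i0 (gr x)" "C.cgrade (i1 x) = - i1 (gr x)"
    "norm (i0 x) \<le> norm x" "norm (i1 x) \<le> norm x"
proof -
  show "adj (i0 x) = i0 (adj x)" "adj (i1 x) = i1 (gr (adj x))"
    and s: "scaleC r (i0 x) = i0 (scaleC r x)" "scaleC r (i1 x) = i1 (scaleC r x)" for r
    using assms C.emb_simps1(1,2)[of "(x, 0)"] C.emb_simps1(1,2)[of "(0, x)"] C.cl(1)
    by (simp_all add: i0_def i1_def cadj_def cscale_def gr_0 adj_zero scaleC_zero_right)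
  have m: "- i1 y = i1 (- y)" if "y \<in> II" for y
    using that C.emb_simps1(2)[of "(0, y)" "-1"] C.cl(1)
    by (simp add: i1_def cscale_def scaleC_minus1)
  show "C.cgrade (i0 x) = i0 (gr x)" "C.cgrade (i1 x) = - i1 (gr x)"
    using assms C.cl(1) C.G(4) by (simp_all add: m) (simp_all add: i0_def i1_def C.cgrade_emb gr_0)
  show "norm (i0 x) \<le> norm x" "norm (i1 x) \<le> norm x"
    using assms C.cl(1) C.cnorm_upper[of "(x, 0)"] C.cnorm_upper[of "(0, x)"]
      C.emb_simps1(3)[of "(x, 0)"] C.emb_simps1(3)[of "(0, x)"]
    by (simp_all add: i0_def i1_def)
qed

lemma i01_zero: "i0 0 = 0" "i1 0 = 0"
  using C.emb_zero by (simp_all add: i0_def i1_def zero_prod_def)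

lemma gen_in: "x \<in> mor L \<Longrightarrow> gn x \<in> II"
  by (rule generator_in_closure)

text \<open>The elements s_x e^i.\<close>

definition twist :: "'l \<times> bit \<Rightarrow> ((real, 'l \<Rightarrow> real) cprod \<times> (real, 'l \<Rightarrow> real) cprod, unit) cprod" where
  "twist = (\<lambda>(x, i). if i = 0 then i0 (gn x) else i1 (gn x))"

lemma twist_simps: "twist (x, 0) = i0 (gn x)" "twist (x, 1) = i1 (gn x)"
  by (simp_all add: twist_def)

lemma gr_gen: "x \<in> mor L \<Longrightarrow> gr (gn x) = scaleC (psign x) (gn x)"
  by (rule regrade_gen)

lemma gr_adj_gen: "x \<in> mor L \<Longrightarrow> gr (adj (gn x)) = scaleC (psign x) (adj (gn x))"
  using C.hom(3)[OF gen_in] by (simp add: gr_gen adj_scaleC)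

text \<open>Moving e past the generator of y produces the sign of the parity of y, which is the
  extra factor in \<open>cocycle_times_Z2\<close>. In products of an element with its adjoint e
  cancels, so the other relations are those of the original graph.\<close>

lemma tfam_twist: "tfam k (Suc a) Z cZ twist"
  unfolding tfam_def objs_times_Z2
proof (intro conjI ballI impI)
  note gen = tfam_gen[of k a cL, unfolded tfam_def] and [simp] = i01 i01' gen_in C.cl objs_mor i01_zero
  show "twist v * twist v = twist v" "adj (twist v) = twist v" if "v \<in> objs L \<times> {0}" for v
    using that gen by (auto simp: twist_simps)
  show "twist v * twist w = 0" if vw: "v \<in> objs L \<times> {0}" "w \<in> objs L \<times> {0}" "v \<noteq> w" for v w
  proof -
    obtain u u' where "v = (u, 0)" "w = (u', 0)" "u \<in> objs L" "u' \<in> objs L" "u \<noteq> u'" using vw by auto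
    moreover from this have "gn u * gn u' = 0" using gen by blast
    ultimately show ?thesis by (simp add: twist_simps)
  qed
  have prod: "gn x * gn y = scaleC (cL x y) (gn (cmp L x y))" and sq: "adj (gn x) * gn x = gn (src L x)"
    if "x \<in> mor L" "y \<in> mor L" "src L x = rng L y" for x y
    using that gen by auto
  show "twist p * twist q = scaleC (cZ p q) (twist (cmp Z p q))"
    if pq: "p \<in> mor Z" "q \<in> mor Z" "src Z p = rng Z q" for p q
  proof -
    obtain x i y j where [simp]: "p = (x, i)" "q = (y, j)" and xy: "x \<in> mor L" "y \<in> mor L" "src L x = rng L y"
      using pq by (cases p; cases q) (auto simp: times_Z2_simps)
    show ?thesis using xy
      by (cases i; cases j) (simp_all add: twist_simps times_Z2_simps cocycle_times_Z2 prod gr_gen cmp_closed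
          scaleC_mult_right scaleC_scaleC mult.commute)
  qed
  show "adj (twist p) * twist p = twist (src Z p)" if p: "p \<in> mor Z" for p
  proof -
    obtain x i where [simp]: "p = (x, i)" and x: "x \<in> mor L" using p by (cases p) (auto simp: times_Z2_simps)
    have "adj (gn x) * gn x = gn (src L x)" using x gen by auto
    then show ?thesis using x
      by (cases i) (simp_all add: twist_simps times_Z2_simps gr_gen gr_adj_gen
          scaleC_mult_right scaleC_mult_left scaleC_scaleC scaleC_one)
  qed
  show "twist v = (\<Sum>p\<in>paths_to Z v p. twist p * adj (twist p))"
    if vp: "v \<in> objs L \<times> {0}" "p \<in> Pmon k (Suc a)" for v p
  proof -
    obtain u where [simp]: "v = (u, 0)" and u: "u \<in> objs L" using vp by auto
    let ?P = "paths_to L u (fst p, (snd p)(a := 0))"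
    have P: "x \<in> mor L" if "x \<in> ?P" for x using that by (simp add: paths_to_def)
    have hom: "star_hom_on II i0" by (simp add: star_hom_on_def)
    have "twist (x, i) * adj (twist (x, i)) = i0 (gn x * adj (gn x))" if "x \<in> mor L" for x i
      using that by (cases i) (simp_all add: twist_simps C.G)
    then have "(\<Sum>p\<in>paths_to Z v p. twist p * adj (twist p)) = (\<Sum>x\<in>?P. i0 (gn x * adj (gn x)))"
      unfolding \<open>v = (u, 0)\<close> paths_to_times_Z2[OF vp(2)]
      by (subst sum.reindex) (auto simp: inj_on_def P)
    also have "\<dots> = i0 (\<Sum>x\<in>?P. gn x * adj (gn x))"
      by (rule star_hom_on_sum[OF C.G(2) hom, symmetric]) (simp add: P)
    also have "(\<Sum>x\<in>?P. gn x * adj (gn x)) = gn u"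
      using gen u Pmon_drop[OF vp(2)] by (elim conjE) (metis (no_types, lifting))
    finally show ?thesis by (simp add: twist_simps)
  qed
qed

text \<open>The closed algebra generated by the elements s_x e^i contains x and x e for all x in the
  dense subalgebra, and by continuity for all x in the algebra.\<close>

lemma closure_twist:
  "closure (fv twist ` carrier (free_star_alg k (Suc a) Z cZ)) = emb C.D ` (II \<times> II)"
proof (rule antisym)
  let ?F = "free_star_alg k (Suc a) Z cZ" and ?J = "emb C.D ` (II \<times> II)"
  have "twist p \<in> ?J" if "p \<in> mor Z" for p
    using that gen_in C.cl(1) by (cases p) (auto simp: times_Z2_simps twist_def i0_def i1_def)
  then have "fv twist x \<in> ?J" if "x \<in> carrier ?F" for x
    by (rule fv_in[OF C.star_closed_crossed _ that])
  then show "closure (fv twist ` carrier ?F) \<subseteq> ?J"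
    by (intro closure_minimal C.closed_crossed) auto
  define R where "R = closure (fv twist ` carrier ?F)"
  have R: "star_closed R"
    unfolding R_def by (rule star_closed_closure[OF star_closed_image[OF star_rep_free]])
  note Rc = star_closedD[OF R]
  have tw: "twist p \<in> R" if "p \<in> mor Z" for p
    using that unfolding R_def by (rule generator_in_closure)
  have gens: "i0 (gn x) \<in> R" "i1 (gn x) \<in> R" if "x \<in> mor L" for x
    using that tw[of "(x, 0)"] tw[of "(x, 1)"] by (simp_all add: twist_simps times_Z2_simps)
  have adjs: "i0 (adj (gn x)) \<in> R" "i1 (adj (gn x)) \<in> R" if x: "x \<in> mor L" for x
  proof -
    show "i0 (adj (gn x)) \<in> R" using Rc(4)[OF gens(1)[OF x]] gen_in[OF x] by (simp add: i01')
    have "i1 (adj (gn x)) = scaleC (psign x) (adj (i1 (gn x)))"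
      using gen_in[OF x] by (simp add: i01' gr_adj_gen x C.cl C.G scaleC_scaleC scaleC_one)
    then show "i1 (adj (gn x)) \<in> R" using Rc(4,5) gens(2)[OF x] by simp
  qed
  \<comment> \<open>Both memberships are proved together, since (x y) e is the product of x and y
    e.\<close>
  have fvR: "fv gn x \<in> II \<and> i0 (fv gn x) \<in> R \<and> i1 (fv gn x) \<in> R" if "x \<in> carrier (free_star_alg k a L cL)" for x
    using that
  proof (induction rule: fv_induct)
    case (mult y z)
    then show ?case using Rc(3)[of "i0 y" "i0 z"] Rc(3)[of "i0 y" "i1 z"] by (simp add: i01 C.cl)
  next
    case (scale r y)
    then show ?case using Rc(5)[of "i0 y" r] Rc(5)[of "i1 y" r] by (simp add: i01' C.cl)
  qed (simp_all add: i01 i01' i01_zero C.cl Rc gen_in gens adjs)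
  have lip: "continuous_on II f" if "\<And>x y. x \<in> II \<Longrightarrow> y \<in> II \<Longrightarrow> f (x + y) = f x + f y"
    "\<And>x. x \<in> II \<Longrightarrow> norm (f x) \<le> norm x" for f :: "_ \<Rightarrow> ((real, 'l \<Rightarrow> real) cprod \<times> (real, 'l \<Rightarrow> real) cprod, unit) cprod"
    unfolding continuous_on_iff
  proof (intro ballI allI impI)
    fix x e assume x: "x \<in> II" and e: "(0::real) < e"
    have "dist (f y) (f x) \<le> dist y x" if y: "y \<in> II" for y
      using \<open>\<And>x y. x \<in> II \<Longrightarrow> y \<in> II \<Longrightarrow> f (x + y) = f x + f y\<close>[of "y - x" x]
        \<open>\<And>x. x \<in> II \<Longrightarrow> norm (f x) \<le> norm x\<close>[of "y - x"] x y C.cl(8)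
      by (simp add: dist_norm)
    then show "\<exists>d>0. \<forall>y\<in>II. dist y x < d \<longrightarrow> dist (f y) (f x) < e" using e by (meson le_less_trans)
  qed
  have "i0 ` II \<subseteq> R" "i1 ` II \<subseteq> R"
    using fvR by (intro image_closure_subset lip image_subsetI; auto simp: R_def i01 i01')+
  then show "?J \<subseteq> closure (fv twist ` carrier ?F)"
    unfolding R_def[symmetric] by (auto simp: i01(1) image_subset_iff intro!: Rc(2))
qed

end

section \<open>Recovering the odd unitary from a family for the product graph\<close>

text \<open>A common Lipschitz constant lets pointwise convergence pass to limit points. This and
  \<open>closed_convergent\<close> extend limits from generated algebras to their closures.\<close>

lemma closed_tendsto_zero:
  fixes F :: "nat \<Rightarrow> 'a::real_normed_vector \<Rightarrow> 'b::real_normed_vector"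
  assumes lip: "\<And>n x y. norm (F n x - F n y) \<le> K * norm (x - y)"
  shows "closed {x. (\<lambda>n. F n x) \<longlonglongrightarrow> 0}"
  unfolding closed_sequential_limits
proof (intro allI impI, elim conjE, unfold mem_Collect_eq)
  fix f x assume f: "\<forall>m. (\<lambda>n. F n (f m)) \<longlonglongrightarrow> 0" "f \<longlonglongrightarrow> x"
  show "(\<lambda>n. F n x) \<longlonglongrightarrow> 0"
  proof (rule tendstoI)
    fix e :: real assume e: "e > 0"
    have "(\<lambda>m. K * norm (x - f m)) \<longlonglongrightarrow> K * norm (x - x)" by (intro tendsto_intros f)
    then have "eventually (\<lambda>m. K * norm (x - f m) < e / 2) sequentially"
      by (rule order_tendstoD(2)) (use e in simp)
    then obtain m where m: "K * norm (x - f m) < e / 2" by (auto simp: eventually_sequentially)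
    have "eventually (\<lambda>n. dist (F n (f m)) 0 < e / 2) sequentially"
      by (rule tendstoD) (use f e in auto)
    then show "eventually (\<lambda>n. dist (F n x) 0 < e) sequentially"
    proof eventually_elim
      case (elim n)
      have "norm (F n x) \<le> norm (F n (f m)) + norm (F n x - F n (f m))"
        using norm_triangle_ineq[of "F n (f m)" "F n x - F n (f m)"] by simp
      then show ?case using elim m lip[of n x "f m"] by simp
    qed
  qed
qed

lemma closed_convergent:
  fixes F :: "nat \<Rightarrow> 'a::real_normed_vector \<Rightarrow> 'b::banach"
  assumes lip: "\<And>n x y. norm (F n x - F n y) \<le> K * norm (x - y)"
  shows "closed {x. convergent (\<lambda>n. F n x)}"
  unfolding closed_sequential_limits Cauchy_convergent_iff[symmetric]
proof (intro allI impI, elim conjE, unfold mem_Collect_eq)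
  fix f x assume f: "\<forall>m. Cauchy (\<lambda>n. F n (f m))" "f \<longlonglongrightarrow> x"
  show "Cauchy (\<lambda>n. F n x)"
  proof (rule metric_CauchyI)
    fix e :: real assume e: "e > 0"
    have "(\<lambda>m. K * norm (x - f m)) \<longlonglongrightarrow> K * norm (x - x)" by (intro tendsto_intros f)
    then have "eventually (\<lambda>m. K * norm (x - f m) < e / 3) sequentially"
      by (rule order_tendstoD(2)) (use e in simp)
    then obtain m where m: "K * norm (x - f m) < e / 3" by (auto simp: eventually_sequentially)
    have near: "dist (F n x) (F n (f m)) < e / 3" for n
      using m lip[of n x "f m"] by (simp add: dist_norm)
    obtain N where N: "\<And>i j. i \<ge> N \<Longrightarrow> j \<ge> N \<Longrightarrow> dist (F i (f m)) (F j (f m)) < e / 3"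
      using f(1) e metric_CauchyD[of "\<lambda>n. F n (f m)" "e / 3"] by auto
    have "dist (F i x) (F j x) < e" if "i \<ge> N" "j \<ge> N" for i j
      using near[of i] near[of j] N[OF that] dist_triangle[of "F i x" "F j x" "F i (f m)"]
        dist_triangle[of "F i (f m)" "F j x" "F j (f m)"] by (simp add: dist_commute)
    then show "\<exists>N. \<forall>i\<ge>N. \<forall>j\<ge>N. dist (F i x) (F j x) < e" by blast
  qed
qed

context P_graph
begin

interpretation C: crossed_product II gr
  by (rule crossed_graph)

context
  fixes s :: "'l \<times> bit \<Rightarrow> 'b::cstar_type" and \<phi> :: "(real, 'l \<Rightarrow> real) cprod \<Rightarrow> 'b"
  assumes s: "tfam k (Suc a) Z cZ s" and \<phi>: "star_hom_on UNIV \<phi>"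
    and \<phi>_gen: "\<And>x. x \<in> mor L \<Longrightarrow> \<phi> (gn x) = s (x, 0)"
begin

lemma s_mult:
  assumes "x \<in> mor L" "y \<in> mor L" "src L x = rng L y"
  shows "s (x, i) * s (y, j) = scaleC (cL x y * bit_sign (i * graph_parity k a L y)) (s (cmp L x y, i + j))"
proof -
  have "s (x, i) * s (y, j) = scaleC (cZ (x, i) (y, j)) (s (cmp Z (x, i) (y, j)))"
    using s assms unfolding tfam_def by (simp add: times_Z2_simps(1-3))
  then show ?thesis by (simp only: cocycle_times_Z2 times_Z2_simps)
qed

lemma s_sq: "x \<in> mor L \<Longrightarrow> adj (s (x, i)) * s (x, i) = s (src L x, 0)"
  using s unfolding tfam_def by (simp add: times_Z2_simps(1-3))

lemma s_src: "x \<in> mor L \<Longrightarrow> s (x, i) * s (src L x, j) = s (x, i + j)"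
  using s_mult[of x "src L x" i j] src_obj[of x]
  by (simp add: cocycle_obj parity_obj cmp_src objs_def scaleC_one)

lemma s_rng: "x \<in> mor L \<Longrightarrow> s (rng L x, i) * s (x, j) = scaleC (bit_sign (i * graph_parity k a L x)) (s (x, i + j))"
  using s_mult[of "rng L x" x i j] rng_obj[of x]
  by (simp add: cocycle_obj cmp_rng objs_def)

lemma s_units:
  "\<forall>v\<in>objs L \<times> {0}. adj (s v) = s v" "\<forall>v\<in>objs L \<times> {0}. \<forall>w\<in>objs L \<times> {0}. v \<noteq> w \<longrightarrow> s v * s w = 0"
  by (rule s[unfolded tfam_def objs_times_Z2 ball_conj_distrib, THEN conjunct1, THEN conjunct2])
    (rule s[unfolded tfam_def objs_times_Z2, THEN conjunct2, THEN conjunct1])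

lemma s_obj:
  assumes v: "v \<in> objs L"
  shows "s (v, i) * s (v, j) = s (v, i + j)" "adj (s (v, i)) = s (v, i)"
proof -
  have L: "v \<in> mor L" "src L v = v" using v by (auto simp: objs_def)
  show m: "s (v, i) * s (v, j) = s (v, i + j)" for i j using s_src[of v] L by simp
  have 0: "adj (s (v, 0)) = s (v, 0)" using s_units(1) v by simp
  have "adj (s (v, i)) * s (v, i) = s (v, 0)" for i using s_sq[of v] L by simp
  note Z2_family[of "\<lambda>i. s (v, i)", OF m this 0]
  then show "adj (s (v, i)) = s (v, i)" by (cases i) simp_all
qed

lemma s_orth:
  assumes v: "v \<in> objs L" "w \<in> objs L" "v \<noteq> w"
  shows "s (v, i) * s (w, j) = 0"
proof -
  have "s (v, 0) * s (w, 0) = 0" using s_units(2) v by simp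
  then have "(s (v, i) * s (v, 0)) * (s (w, 0) * s (w, j)) = 0"
    by (simp only: mult.assoc mult.assoc[of "s (v, 0)" "s (w, 0)", symmetric]) simp
  then show ?thesis by (simp only: s_obj(1)[OF v(1)] s_obj(1)[OF v(2)] add_0_right add_0_left)
qed

definition V :: "nat \<Rightarrow> 'l set" where
  "V n = {v \<in> objs L. to_nat_on (objs L) v < n}"

text \<open>Partial sums, along an enumeration of the objects, of the unit (i = 0) and of the
  unitary e (i = 1). They converge only when multiplied by elements of the algebra.\<close>

definition W :: "bit \<Rightarrow> nat \<Rightarrow> 'b" where
  "W i n = (\<Sum>v\<in>V n. s (v, i))"

lemma finite_V: "finite (V n)"
proof (rule inj_on_finite)
  have "countable (objs L)" using countable_mor by (rule countable_subset[rotated]) (auto simp: objs_def)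
  then show "inj_on (to_nat_on (objs L)) (V n)" by (intro inj_on_subset[OF inj_on_to_nat_on]) (auto simp: V_def)
  show "to_nat_on (objs L) ` V n \<subseteq> {..<n}" by (auto simp: V_def)
qed simp

lemma eventually_V: "v \<in> objs L \<Longrightarrow> eventually (\<lambda>n. v \<in> V n) sequentially"
  using eventually_gt_at_top[of "to_nat_on (objs L) v"] by (simp add: V_def)

lemma s_W: "v \<in> V n \<Longrightarrow> s (v, i) * W j n = s (v, i + j)"
proof -
  assume v: "v \<in> V n"
  have "s (v, i) * W j n = (\<Sum>w\<in>V n. if w = v then s (v, i + j) else 0)"
    unfolding W_def sum_distrib_left
    using v by (intro sum.cong refl) (auto simp: V_def s_orth s_obj)
  then show ?thesis using v finite_V by (simp add: sum.delta)
qed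

lemma W_mult: "W i n * W j n = W (i + j) n"
  by (simp only: W_def[of i] W_def[of "i + j"] sum_distrib_right) (intro sum.cong refl s_W)

lemma adj_W: "adj (W i n) = W i n"
  by (simp add: W_def adj_sum V_def s_obj)

lemma W_s: "v \<in> V n \<Longrightarrow> W j n * s (v, i) = s (v, i + j)"
  using arg_cong[where f=adj, OF s_W[of v n i j]] by (simp add: adj_mult adj_W s_obj V_def)

lemma norm_W: "norm (W i n) \<le> 1"
proof -
  have "norm (W 0 n) \<le> 1" by (rule norm_proj_le_1) (simp_all add: W_mult adj_W)
  then have "(norm (W i n))\<^sup>2 \<le> 1"
    using norm_adj_mult[of "W i n"] by (cases i) (simp_all add: W_mult adj_W)
  then show ?thesis by (simp add: power2_le_iff_abs_le abs_square_le_1)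
qed

text \<open>The sequence is constant once the source of x has been enumerated.\<close>

lemma x_W: "x \<in> mor L \<Longrightarrow> (\<lambda>n. s (x, i) * W j n) \<longlonglongrightarrow> s (x, i + j)"
proof (rule tendsto_eventually, rule eventually_mono[OF eventually_V[OF src_obj]])
  fix n assume x: "x \<in> mor L" and "src L x \<in> V n"
  then have "s (x, i) * s (src L x, 0) * W j n = s (x, i) * s (src L x, j)"
    by (simp add: mult.assoc s_W)
  then show "s (x, i) * W j n = s (x, i + j)" by (simp only: s_src[OF x] add_0_right)
qed

lemma W_x: "x \<in> mor L \<Longrightarrow>
  (\<lambda>n. W i n * s (x, j)) \<longlonglongrightarrow> scaleC (bit_sign (i * graph_parity k a L x)) (s (x, i + j))"
proof (rule tendsto_eventually, rule eventually_mono[OF eventually_V[OF rng_obj]])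
  fix n assume x: "x \<in> mor L" and "rng L x \<in> V n"
  then have "W i n * (s (rng L x, 0) * s (x, j)) = s (rng L x, i) * s (x, j)"
    by (simp add: W_s flip: mult.assoc)
  then show "W i n * s (x, j) = scaleC (bit_sign (i * graph_parity k a L x)) (s (x, i + j))"
    by (simp only: s_rng[OF x] mult_zero_left bit_sign_simps scaleC_one add_0_left)
qed

lemmas \<phi>_simps = star_hom_onD[OF \<phi>, simplified]

lemma norm_phi: "norm (\<phi> x) \<le> norm x"
  by (rule star_hom_contractive[OF closed_UNIV star_closed_UNIV \<phi>]) simp

lemma phi_zero: "\<phi> 0 = 0" and phi_diff: "\<phi> (x - y) = \<phi> x - \<phi> y"
  using star_hom_on_zero[OF star_closed_UNIV \<phi>] star_hom_on_diff[OF star_closed_UNIV \<phi>] by simp_all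

lemmas gr_simps = star_hom_onD[OF regrade_hom[of "graph_parity k a L"], simplified]

text \<open>For generators the relevant sequences are eventually constant; for general elements only
  these limits survive. The property is inherited by sums, products, multiples and limits. Adjoints
  of generators are checked directly, because the first and third clauses concern multiplication
  from the right only.\<close>

definition approximable :: "(real, 'l \<Rightarrow> real) cprod \<Rightarrow> bool" where
  "approximable x \<longleftrightarrow> (\<lambda>n. \<phi> x * W 0 n - \<phi> x) \<longlonglongrightarrow> 0 \<and>
     (\<lambda>n. W 1 n * \<phi> x - \<phi> (gr x) * W 1 n) \<longlonglongrightarrow> 0 \<and> convergent (\<lambda>n. \<phi> x * W 1 n)"

lemma approximable_mult:
  assumes x: "approximable x" and y: "approximable y" shows "approximable (x * y)"
  unfolding approximable_def
proof (intro conjI)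
  note X = x[unfolded approximable_def] and Y = y[unfolded approximable_def]
  have "(\<lambda>n. \<phi> x * (\<phi> y * W 0 n - \<phi> y)) \<longlonglongrightarrow> \<phi> x * 0" using Y by (intro tendsto_mult tendsto_const) auto
  then show "(\<lambda>n. \<phi> (x * y) * W 0 n - \<phi> (x * y)) \<longlonglongrightarrow> 0" by (simp add: \<phi>_simps right_diff_distrib mult.assoc)
  \<comment> \<open>\<open>W 1 n\<close> is moved first past x and then past y.\<close>
  have "(\<lambda>n. (W 1 n * \<phi> x - \<phi> (gr x) * W 1 n) * \<phi> y + \<phi> (gr x) * (W 1 n * \<phi> y - \<phi> (gr y) * W 1 n))
      \<longlonglongrightarrow> 0 * \<phi> y + \<phi> (gr x) * 0"
    using X Y by (intro tendsto_add tendsto_mult tendsto_const) auto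
  then show "(\<lambda>n. W 1 n * \<phi> (x * y) - \<phi> (gr (x * y)) * W 1 n) \<longlonglongrightarrow> 0"
    by (simp add: \<phi>_simps gr_simps algebra_simps)
  obtain l where "(\<lambda>n. \<phi> y * W 1 n) \<longlonglongrightarrow> l" using Y by (auto simp: convergent_def)
  then have "(\<lambda>n. \<phi> x * (\<phi> y * W 1 n)) \<longlonglongrightarrow> \<phi> x * l" by (intro tendsto_mult tendsto_const)
  then show "convergent (\<lambda>n. \<phi> (x * y) * W 1 n)" by (auto simp: convergent_def \<phi>_simps mult.assoc)
qed

lemma approximable_add:
  assumes x: "approximable x" and y: "approximable y" shows "approximable (x + y)"
  unfolding approximable_def
proof (intro conjI)
  note X = x[unfolded approximable_def] and Y = y[unfolded approximable_def]
  have "(\<lambda>n. (\<phi> x * W 0 n - \<phi> x) + (\<phi> y * W 0 n - \<phi> y)) \<longlonglongrightarrow> 0 + 0"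
    using X Y by (intro tendsto_add) auto
  then show "(\<lambda>n. \<phi> (x + y) * W 0 n - \<phi> (x + y)) \<longlonglongrightarrow> 0" by (simp add: \<phi>_simps algebra_simps)
  have "(\<lambda>n. (W 1 n * \<phi> x - \<phi> (gr x) * W 1 n) + (W 1 n * \<phi> y - \<phi> (gr y) * W 1 n)) \<longlonglongrightarrow> 0 + 0"
    using X Y by (intro tendsto_add) auto
  then show "(\<lambda>n. W 1 n * \<phi> (x + y) - \<phi> (gr (x + y)) * W 1 n) \<longlonglongrightarrow> 0"
    by (simp add: \<phi>_simps gr_simps algebra_simps)
  show "convergent (\<lambda>n. \<phi> (x + y) * W 1 n)"
    using X Y unfolding \<phi>_simps distrib_right by (intro convergent_add) simp_all
qed

lemma approximable_scale:
  assumes x: "approximable x" shows "approximable (scaleC r x)"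
  unfolding approximable_def
proof (intro conjI)
  note X = x[unfolded approximable_def]
  have "(\<lambda>n. scaleC r (\<phi> x * W 0 n - \<phi> x)) \<longlonglongrightarrow> scaleC r 0" using X by (intro tendsto_scaleC) auto
  then show "(\<lambda>n. \<phi> (scaleC r x) * W 0 n - \<phi> (scaleC r x)) \<longlonglongrightarrow> 0"
    by (simp add: \<phi>_simps scaleC_diff_right scaleC_mult_left scaleC_zero_right)
  have "(\<lambda>n. scaleC r (W 1 n * \<phi> x - \<phi> (gr x) * W 1 n)) \<longlonglongrightarrow> scaleC r 0" using X by (intro tendsto_scaleC) auto
  then show "(\<lambda>n. W 1 n * \<phi> (scaleC r x) - \<phi> (gr (scaleC r x)) * W 1 n) \<longlonglongrightarrow> 0"
    by (simp add: \<phi>_simps gr_simps scaleC_diff_right scaleC_mult_left scaleC_mult_right scaleC_zero_right)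
  obtain l where "(\<lambda>n. \<phi> x * W 1 n) \<longlonglongrightarrow> l" using X by (auto simp: convergent_def)
  then have "(\<lambda>n. scaleC r (\<phi> x * W 1 n)) \<longlonglongrightarrow> scaleC r l" by (rule tendsto_scaleC)
  then show "convergent (\<lambda>n. \<phi> (scaleC r x) * W 1 n)" by (auto simp: convergent_def \<phi>_simps scaleC_mult_left)
qed

lemma approximable_gen:
  assumes x: "x \<in> mor L" shows "approximable (gn x)"
  unfolding approximable_def
proof (intro conjI)
  note gx = \<phi>_gen[OF x]
  show "(\<lambda>n. \<phi> (gn x) * W 0 n - \<phi> (gn x)) \<longlonglongrightarrow> 0"
    using x_W[OF x, of 0 0] by (simp add: gx LIM_zero)
  have "(\<lambda>n. W 1 n * s (x, 0)) \<longlonglongrightarrow> scaleC (psign x) (s (x, 1))"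
    "(\<lambda>n. s (x, 0) * W 1 n) \<longlonglongrightarrow> s (x, 1)"
    using W_x[OF x, of 1 0] x_W[OF x, of 0 1] by (simp_all only: mult_1_left add_0_left add_0_right)
  then have "(\<lambda>n. W 1 n * s (x, 0) - scaleC (psign x) (s (x, 0) * W 1 n)) \<longlonglongrightarrow>
      scaleC (psign x) (s (x, 1)) - scaleC (psign x) (s (x, 1))"
    by (intro tendsto_diff tendsto_scaleC)
  then show "(\<lambda>n. W 1 n * \<phi> (gn x) - \<phi> (gr (gn x)) * W 1 n) \<longlonglongrightarrow> 0"
    by (simp add: gx gr_gen[OF x] \<phi>_simps scaleC_mult_left)
  show "convergent (\<lambda>n. \<phi> (gn x) * W 1 n)" using x_W[OF x, of 0 1] by (auto simp: gx convergent_def)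
qed

lemma approximable_adj_gen:
  assumes x: "x \<in> mor L" shows "approximable (adj (gn x))"
  unfolding approximable_def
proof (intro conjI)
  note gx = \<phi>_gen[OF x]
  have W: "(\<lambda>n. adj (s (x, 0)) * W i n) \<longlonglongrightarrow> scaleC (bit_sign (i * graph_parity k a L x)) (adj (s (x, i)))" for i
    using tendsto_adj[OF W_x[OF x, of i 0]] by (simp only: adj_mult adj_W adj_scaleC bit_sign_simps add_0_right)
  have W': "(\<lambda>n. W 1 n * adj (s (x, 0))) \<longlonglongrightarrow> adj (s (x, 1))"
    using tendsto_adj[OF x_W[OF x, of 0 1]] by (simp add: adj_mult adj_W)
  show "(\<lambda>n. \<phi> (adj (gn x)) * W 0 n - \<phi> (adj (gn x))) \<longlonglongrightarrow> 0"
    using W[of 0] by (simp add: gx \<phi>_simps LIM_zero scaleC_one)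
  have "(\<lambda>n. W 1 n * adj (s (x, 0)) - scaleC (psign x) (adj (s (x, 0)) * W 1 n)) \<longlonglongrightarrow>
      adj (s (x, 1)) - scaleC (psign x) (scaleC (psign x) (adj (s (x, 1))))"
    using W[of 1] W' unfolding mult_1_left by (intro tendsto_diff tendsto_scaleC)
  then show "(\<lambda>n. W 1 n * \<phi> (adj (gn x)) - \<phi> (gr (adj (gn x))) * W 1 n) \<longlonglongrightarrow> 0"
    by (simp add: gx gr_adj_gen[OF x] \<phi>_simps scaleC_mult_left scaleC_scaleC scaleC_one)
  show "convergent (\<lambda>n. \<phi> (adj (gn x)) * W 1 n)" using W[of 1] by (auto simp: gx \<phi>_simps convergent_def)
qed

lemma approximable_closed: "closed {x. approximable x}"
proof -
  have b: "norm (y * W i n) \<le> norm y" "norm (W i n * y) \<le> norm y" for y i n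
    using norm_mult_ineq[of y "W i n"] norm_mult_ineq[of "W i n" y] mult_left_mono[OF norm_W, of "norm y" i n]
    by (simp_all add: mult.commute)
  have "norm (\<phi> x * W 0 n - \<phi> x - (\<phi> y * W 0 n - \<phi> y)) \<le> 2 * norm (x - y)" for n x y
    using norm_triangle_ineq4[of "\<phi> (x - y) * W 0 n" "\<phi> (x - y)"] b(1)[of "\<phi> (x - y)" 0 n] norm_phi[of "x - y"]
    by (simp add: phi_diff algebra_simps)
  note 1 = closed_tendsto_zero[where K=2, OF this]
  have "norm (W 1 n * \<phi> x - \<phi> (gr x) * W 1 n - (W 1 n * \<phi> y - \<phi> (gr y) * W 1 n)) \<le> 2 * norm (x - y)" for n x y
  proof -
    have gd: "gr (x - y) = gr x - gr y" by (rule star_hom_on_diff[OF star_closed_UNIV regrade_hom]) simp_all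
    have "norm (\<phi> (gr (x - y))) \<le> norm (x - y)"
      using norm_phi[of "gr (x - y)"] star_hom_contractive[OF closed_UNIV star_closed_UNIV regrade_hom, of "x - y"]
      by (meson UNIV_I order_trans)
    then show ?thesis
      using norm_triangle_ineq4[of "W 1 n * \<phi> (x - y)" "\<phi> (gr (x - y)) * W 1 n"] b(2)[of 1 n "\<phi> (x - y)"]
        b(1)[of "\<phi> (gr (x - y))" 1 n] norm_phi[of "x - y"]
      by (simp add: phi_diff gd algebra_simps)
  qed
  note 2 = closed_tendsto_zero[where K=2, OF this]
  have "norm (\<phi> x * W 1 n - \<phi> y * W 1 n) \<le> 1 * norm (x - y)" for n x y
    using b(1)[of "\<phi> (x - y)" 1 n] norm_phi[of "x - y"] by (simp add: phi_diff algebra_simps)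
  note 3 = closed_convergent[OF this]
  show ?thesis
    using closed_Int[OF 1 closed_Int[OF 2 3]] by (simp add: approximable_def Collect_conj_eq)
qed

lemma approximable_algebra:
  assumes "x \<in> II" shows "approximable x"
proof -
  have "approximable (fv gn y)" if "y \<in> carrier (free_star_alg k a L cL)" for y
    using that
  proof (induction rule: fv_induct)
    case zero
    then show ?case by (simp add: approximable_def phi_zero gr_0 convergent_const)
  qed (simp_all add: approximable_add approximable_mult approximable_scale approximable_gen approximable_adj_gen)
  then have "II \<subseteq> {x. approximable x}" by (intro closure_minimal approximable_closed) auto
  then show ?thesis using assms by auto
qed

text \<open>The image of x e.\<close>

definition \<psi> :: "(real, 'l \<Rightarrow> real) cprod \<Rightarrow> 'b" where
  "\<psi> x = lim (\<lambda>n. \<phi> x * W 1 n)"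

lemma lims:
  assumes "x \<in> II"
  shows "(\<lambda>n. \<phi> x * W 0 n) \<longlonglongrightarrow> \<phi> x" "(\<lambda>n. \<phi> x * W 1 n) \<longlonglongrightarrow> \<psi> x" "(\<lambda>n. W 1 n * \<phi> x) \<longlonglongrightarrow> \<psi> (gr x)"
    "(\<lambda>n. W 1 n * \<phi> x - \<phi> (gr x) * W 1 n) \<longlonglongrightarrow> 0"
proof -
  note X = approximable_algebra[OF assms, unfolded approximable_def]
  show "(\<lambda>n. \<phi> x * W 0 n) \<longlonglongrightarrow> \<phi> x" "(\<lambda>n. W 1 n * \<phi> x - \<phi> (gr x) * W 1 n) \<longlonglongrightarrow> 0"
    using X by (auto simp: LIM_zero_iff)
  have 1: "(\<lambda>n. \<phi> x * W 1 n) \<longlonglongrightarrow> \<psi> x" if "x \<in> II" for x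
    using approximable_algebra[OF that] unfolding approximable_def \<psi>_def by (simp add: convergent_LIMSEQ_iff)
  show "(\<lambda>n. \<phi> x * W 1 n) \<longlonglongrightarrow> \<psi> x" by (rule 1[OF assms])
  have "(\<lambda>n. W 1 n * \<phi> x - \<phi> (gr x) * W 1 n + \<phi> (gr x) * W 1 n) \<longlonglongrightarrow> 0 + \<psi> (gr x)"
    using X by (intro tendsto_add 1 C.G(4) assms) auto
  then show "(\<lambda>n. W 1 n * \<phi> x) \<longlonglongrightarrow> \<psi> (gr x)" by simp
qed

lemma chi_add: "x \<in> II \<Longrightarrow> y \<in> II \<Longrightarrow> \<psi> (x + y) = \<psi> x + \<psi> y"
  using tendsto_add[OF lims(2) lims(2), of x y] lims(2)[OF C.cl(2), of x y]
  by (simp add: \<phi>_simps distrib_right LIMSEQ_unique)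

lemma chi_scale: "x \<in> II \<Longrightarrow> \<psi> (scaleC r x) = scaleC r (\<psi> x)"
  using tendsto_scaleC[OF lims(2), of x r] lims(2)[OF C.cl(5), of x r]
  by (simp add: \<phi>_simps scaleC_mult_left LIMSEQ_unique)

lemma phi_chi: "x \<in> II \<Longrightarrow> y \<in> II \<Longrightarrow> \<phi> x * \<psi> y = \<psi> (x * y)"
  using tendsto_mult[OF tendsto_const lims(2), of y "\<phi> x"] lims(2)[OF C.cl(3), of x y]
  by (simp add: \<phi>_simps mult.assoc LIMSEQ_unique)

lemma chi_phi: "x \<in> II \<Longrightarrow> y \<in> II \<Longrightarrow> \<psi> x * \<phi> y = \<psi> (x * gr y)"
  using tendsto_mult[OF lims(2) tendsto_const, of x "\<phi> y"] tendsto_mult[OF tendsto_const lims(3), of y "\<phi> x"]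
    phi_chi[of x "gr y"] C.G(4)[of y]
  by (simp add: mult.assoc LIMSEQ_unique)

text \<open>This is x e y e = x \<gamma>(y): the inner \<open>W 1 n\<close> is moved past y with an
  error tending to 0, and the two copies then multiply to \<open>W 0 n\<close>, an approximate
  unit.\<close>

lemma chi_chi: 
  assumes x: "x \<in> II" and y: "y \<in> II" shows "\<psi> x * \<psi> y = \<phi> (x * gr y)"
proof -
  have "(\<lambda>n. (W 1 n * \<phi> y - \<phi> (gr y) * W 1 n) * W 1 n) \<longlonglongrightarrow> 0"
    by (rule Lim_null_comparison[OF _ tendsto_norm_zero[OF lims(4)[OF y]]])
      (intro always_eventually allI order_trans[OF norm_mult_ineq] mult_left_le norm_W norm_ge_zero)
  then have "(\<lambda>n. \<phi> x * ((W 1 n * \<phi> y - \<phi> (gr y) * W 1 n) * W 1 n + \<phi> (gr y) * W 0 n)) \<longlonglongrightarrow> \<phi> x * (0 + \<phi> (gr y))"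
    by (intro tendsto_mult tendsto_add tendsto_const lims(1) C.G(4) y)
  moreover have "\<phi> x * ((W 1 n * \<phi> y - \<phi> (gr y) * W 1 n) * W 1 n + \<phi> (gr y) * W 0 n) =
      (\<phi> x * W 1 n) * (\<phi> y * W 1 n)" for n
    using W_mult[of 1 n 1] by (simp add: left_diff_distrib mult.assoc)
  ultimately have "(\<lambda>n. (\<phi> x * W 1 n) * (\<phi> y * W 1 n)) \<longlonglongrightarrow> \<phi> (x * gr y)" by (simp add: \<phi>_simps)
  then show ?thesis using tendsto_mult[OF lims(2)[OF x] lims(2)[OF y]] by (rule LIMSEQ_unique[symmetric])
qed

lemma chi_adj: "x \<in> II \<Longrightarrow> adj (\<psi> x) = \<psi> (gr (adj x))"
  using tendsto_adj[OF lims(2), of x] lims(3)[OF C.cl(4), of x]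
  by (simp add: \<phi>_simps adj_mult adj_W LIMSEQ_unique)

lemma chi_gen: "x \<in> mor L \<Longrightarrow> \<psi> (gn x) = s (x, 1)"
  using lims(2)[OF gen_in, of x] x_W[of x 0 1] by (simp add: \<phi>_gen LIMSEQ_unique)

text \<open>The map x + y e -> \<phi> x + \<psi> y is a *-homomorphism of the crossed product that
  takes \<open>twist\<close> to s, and *-homomorphisms are contractive.\<close>

lemma norm_fv_le_twist:
  assumes z: "z \<in> carrier (free_star_alg k (Suc a) Z cZ)"
  shows "norm (fv s z) \<le> norm (fv twist z)"
proof -
  let ?J = "emb C.D ` (II \<times> II)"
  define \<Psi> where "\<Psi> y = (let P = inv_into (II \<times> II) (emb C.D) y in \<phi> (fst P) + \<psi> (snd P))" for y
  have \<Psi>: "\<Psi> (emb C.D P) = \<phi> (fst P) + \<psi> (snd P)" if "P \<in> II \<times> II" for P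
  proof -
    have "inj_on (emb C.D) (II \<times> II)" using C.emb_faithful(2) by (simp only: C.crossed_simps)
    then show ?thesis using that by (simp add: \<Psi>_def Let_def)
  qed
  have hom: "star_hom_on ?J \<Psi>"
    unfolding star_hom_on_def
  proof (intro conjI ballI allI; elim imageE; clarify)
    fix x y u v r assume I: "x \<in> II" "y \<in> II"
    note [simp] = \<Psi> C.emb_simps[symmetric] C.G(4,5) C.cl \<phi>_simps chi_add chi_scale
    show "\<Psi> (adj (emb C.D (x, y))) = adj (\<Psi> (emb C.D (x, y)))"
      using I by (simp add: C.cadj_in cadj_def adj_add chi_adj)
    show "\<Psi> (scaleC r (emb C.D (x, y))) = scaleC r (\<Psi> (emb C.D (x, y)))"
      using I by (simp add: cscale_def scaleC_add_right)
    assume J: "u \<in> II" "v \<in> II"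
    show "\<Psi> (emb C.D (x, y) + emb C.D (u, v)) = \<Psi> (emb C.D (x, y)) + \<Psi> (emb C.D (u, v))"
      using I J by (simp add: add_ac)
    show "\<Psi> (emb C.D (x, y) * emb C.D (u, v)) = \<Psi> (emb C.D (x, y)) * \<Psi> (emb C.D (u, v))"
      using I J by (simp add: C.cmul_in cmul_def phi_chi chi_phi chi_chi algebra_simps)
  qed
  have tw: "twist p \<in> ?J" "\<Psi> (twist p) = s p" if "p \<in> mor Z" for p
  proof -
    have "\<psi> 0 = 0" by (simp add: \<psi>_def phi_zero)
    then show "twist p \<in> ?J" "\<Psi> (twist p) = s p"
      using that gen_in C.cl(1)
      by (cases p; cases "snd p"; auto simp: times_Z2_simps twist_def i0_def i1_def \<Psi> phi_zero \<phi>_gen chi_gen)+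
  qed
  have "fv s z = fv (\<lambda>p. \<Psi> (twist p)) z" by (rule fv_cong[OF _ z]) (simp add: tw)
  also have "\<dots> = \<Psi> (fv twist z)" by (rule fv_hom(2)[OF C.star_closed_crossed hom _ z, symmetric]) (rule tw)
  also have "norm \<dots> \<le> norm (fv twist z)"
    by (rule star_hom_contractive[OF C.closed_crossed C.star_closed_crossed hom fv_in[OF C.star_closed_crossed _ z]])
      (rule tw)
  finally show ?thesis .
qed

end

text \<open>The cocycles agree on pairs with second components 0, and a degree with last coordinate
  0 has only paths of this kind.\<close>

lemma tfam_restrict:
  assumes s: "tfam k (Suc a) Z cZ s" shows "tfam k a L cL (\<lambda>x. s (x, 0))"
proof -
  have c: "cZ (x, 0) (y, 0) = cL x y" for x y by (simp add: cocycle_times_Z2)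
  have P: "p \<in> Pmon k (Suc a)" "(\<Sum>q\<in>paths_to Z (v, 0) p. s q * adj (s q)) = (\<Sum>x\<in>paths_to L v p. s (x, 0) * adj (s (x, 0)))"
    if p: "p \<in> Pmon k a" for v p
  proof -
    show P: "p \<in> Pmon k (Suc a)" using p by (auto simp: Pmon_def)
    have "(fst p, (snd p)(a := 0)) = p" "snd p a = 0" using p by (auto simp: Pmon_def prod_eq_iff fun_eq_iff)
    then show "(\<Sum>q\<in>paths_to Z (v, 0) p. s q * adj (s q)) = (\<Sum>x\<in>paths_to L v p. s (x, 0) * adj (s (x, 0)))"
      by (simp only: paths_to_times_Z2[OF P]) (simp add: sum.reindex inj_on_def)
  qed
  note S = s[unfolded tfam_def objs_times_Z2 times_Z2_simps(1)]
  show ?thesis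
    unfolding tfam_def
  proof (intro conjI ballI impI)
    fix x y assume "x \<in> mor L" "y \<in> mor L" "src L x = rng L y"
    then show "s (x, 0) * s (y, 0) = scaleC (cL x y) (s (cmp L x y, 0))"
      using S c[of x y] by (simp add: times_Z2_simps(2-4))
  next
    fix x assume "x \<in> mor L"
    then show "adj (s (x, 0)) * s (x, 0) = s (src L x, 0)" using S by (simp add: times_Z2_simps(2-4))
  next
    fix v p assume v: "v \<in> objs L" and p: "p \<in> Pmon k a"
    have "\<forall>v\<in>objs L. \<forall>p\<in>Pmon k (Suc a). s (v, 0) = (\<Sum>q\<in>paths_to Z (v, 0) p. s q * adj (s q))"
      using S by auto
    from bspec[OF bspec[OF this v] P(1)[OF p]]
    show "s (v, 0) = (\<Sum>x\<in>paths_to L v p. s (x, 0) * adj (s (x, 0)))" unfolding P(2)[OF p] .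
  qed (use S in auto)
qed

lemma norm_fv_twist:
  assumes z: "z \<in> carrier (free_star_alg k (Suc a) Z cZ)"
  shows "universal_norm k (Suc a) Z cZ z = norm (fv twist z)"
proof (rule antisym)
  interpret Z: small_category Z by (rule small_category_times_Z2)
  show "norm (fv twist z) \<le> universal_norm k (Suc a) Z cZ z"
    by (rule Z.tfam_universal[OF countable_times_Z2 tfam_twist z])
  show "universal_norm k (Suc a) Z cZ z \<le> norm (fv twist z)"
  proof (rule Z.universal_least)
    fix E :: "real star_alg" and t assume E: "cstar_algebra E" and t: "graph_family k (Suc a) Z cZ E t"
    interpret E: cstar_algebra E by (rule E)
    note tc = Z.family_carrier[OF t]
    define s where "s p = emb E (t p)" for p
    have s: "tfam k (Suc a) Z cZ s"
      using Z.family_tfam[OF E tc] t by (simp add: s_def[abs_def])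
    have tc0: "t (x, 0) \<in> carrier E" if "x \<in> mor L" for x using that tc by (simp add: times_Z2_simps)
    have "graph_family k a L cL E (\<lambda>x. t (x, 0))"
      using family_tfam[OF E tc0] tfam_restrict[OF s] by (simp add: s_def)
    \<comment> \<open>The coordinate at the restricted family serves as the homomorphism \<phi> of
      the graph algebra.\<close>
    then have "pr E (\<lambda>x. t (x, 0)) (gn x) = s (x, 0)" if "x \<in> mor L" for x
      using that by (simp add: pr_gen[OF E] s_def)
    note le = norm_fv_le_twist[OF s pr_hom[OF E] this z]
    note R = free_value_rep[OF E.abelian_group_axioms faithful_repD(1)[OF E.faithful_emb] tc z]
    show "nrm E (free_value E t z) \<le> norm (fv twist z)"
      using R le by (simp add: faithful_repD(3)[OF E.faithful_emb] s_def[abs_def])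
  qed
qed

section \<open>Comparison of the three graded algebras\<close>

lemma times_Z2_realized:
  "\<exists>h. realizes (graph_cstar k (Suc a) Z cZ) (graph_grading k (Suc a) Z cZ) h (emb C.D ` (II \<times> II)) C.cgrade"
proof -
  let ?F = "free_star_alg k (Suc a) Z cZ"
  have "\<exists>h. realizes (graph_cstar k (Suc a) Z cZ) (graph_grading k (Suc a) Z cZ) h (closure (fv twist ` carrier ?F)) C.cgrade"
    unfolding graph_cstar_def graph_grading_def
  proof (rule completion_realizes)
    show "abelian_group ?F" by (rule abelian_group_free)
    show "isometric_rep ?F (fv twist)"
      using star_rep_free norm_fv_twist by (auto simp: isometric_rep_def free_star_alg_def)
    show "continuous_on (closure (fv twist ` carrier ?F)) C.cgrade"
      unfolding closure_twist by (rule continuous_on_grading[OF C.grading_cgrade])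
    fix z assume z: "z \<in> carrier ?F"
    show "free_grading k (Suc a) Z z \<in> carrier ?F" by (rule free_grading(1)[OF z])
    have tw: "C.cgrade (twist p) = scaleC (bit_sign (graph_parity k (Suc a) Z p)) (twist p)" if "p \<in> mor Z" for p
      using that by (cases p; cases "snd p")
        (auto simp: times_Z2_simps(1) parity_times_Z2 twist_simps i01'(5,6) i01'(3,4)[symmetric] gen_in gr_gen
          scaleC_one scaleC_minus1)
    have "fv twist (free_grading k (Suc a) Z z) = fv (\<lambda>p. C.cgrade (twist p)) z"
      unfolding free_grading(2)[OF z] by (rule fv_cong[OF _ z]) (rule tw[symmetric])
    also have "\<dots> = C.cgrade (fv twist z)"
      by (rule fv_hom(2)[OF C.star_closed_crossed grading_onD(3)[OF C.grading_cgrade] _ z, symmetric])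
        (rule generator_in_closure[of _ Z twist k "Suc a" cZ, unfolded closure_twist])
    finally show "fv twist (free_grading k (Suc a) Z z) = C.cgrade (fv twist z)" .
  qed
  then show ?thesis by (simp only: closure_twist)
qed

lemma graded_isomorphic_times_Z2:
  assumes "clifford B \<beta> g"
  shows "graded_isomorphic (graph_cstar k (Suc a) Z cZ) (graph_grading k (Suc a) Z cZ)
    (graded_tensor (graph_cstar k a L cL) (graph_grading k a L cL) B \<beta>)
    (tensor_grading (graph_cstar k a L cL) (graph_grading k a L cL) B \<beta>)"
proof -
  obtain h where h: "realizes (graph_cstar k a L cL) (graph_grading k a L cL) h II gr"
    using graph_algebra_realized(2) by blast
  interpret clifford B \<beta> g by (rule assms)
  interpret T: graded_tensor_setup II gr B \<beta> g "graph_cstar k a L cL" "graph_grading k a L cL" h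
    by unfold_locales (rule h)
  show ?thesis
    using times_Z2_realized T.graded_tensor_realized realizes_graded_isomorphic C.grading_cgrade by blast
qed

lemma graded_tensor_clifford_isomorphic:
  assumes "clifford B \<beta> g" "clifford B' \<beta>' g'"
  shows "graded_isomorphic (graded_tensor (graph_cstar k a L cL) (graph_grading k a L cL) B \<beta>)
    (tensor_grading (graph_cstar k a L cL) (graph_grading k a L cL) B \<beta>)
    (graded_tensor (graph_cstar k a L cL) (graph_grading k a L cL) B' \<beta>')
    (tensor_grading (graph_cstar k a L cL) (graph_grading k a L cL) B' \<beta>')"
proof -
  obtain h where h: "realizes (graph_cstar k a L cL) (graph_grading k a L cL) h II gr"
    using graph_algebra_realized(2) by blast
  interpret T: clifford B \<beta> g by (rule assms)
  interpret T': clifford B' \<beta>' g' by (rule assms)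
  interpret T: graded_tensor_setup II gr B \<beta> g "graph_cstar k a L cL" "graph_grading k a L cL" h
    by unfold_locales (rule h)
  interpret T': graded_tensor_setup II gr B' \<beta>' g' "graph_cstar k a L cL" "graph_grading k a L cL" h
    by unfold_locales (rule h)
  show ?thesis
    using T.graded_tensor_realized T'.graded_tensor_realized realizes_graded_isomorphic C.grading_cgrade by blast
qed

end

theorem corollary7p2:
  fixes k a :: nat and \<Lambda> :: "'l pgraph"
  assumes "P_graph k a \<Lambda>" and "row_finite k a \<Lambda>" and "no_sources k a \<Lambda>"
  defines "\<Lambda>Z \<equiv> times_Z2 a \<Lambda>"
  defines "c \<equiv> graph_cocycle k a \<Lambda>"
    and "c' \<equiv> graph_cocycle k (Suc a) \<Lambda>Z"
    and "c\<^sub>1 \<equiv> (\<lambda>_ _. 1)"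
  defines "A \<equiv> graph_cstar k a \<Lambda> c"
    and "\<alpha> \<equiv> graph_grading k a \<Lambda> c"
    and "B \<equiv> graph_cstar 0 1 Z2_graph c\<^sub>1"
    and "\<beta> \<equiv> graph_grading 0 1 Z2_graph c\<^sub>1"
  shows "graded_isomorphic
           (graph_cstar k (Suc a) \<Lambda>Z c') (graph_grading k (Suc a) \<Lambda>Z c')
           (graded_tensor A \<alpha> B \<beta>) (tensor_grading A \<alpha> B \<beta>)
       \<and> graded_isomorphic
           (graded_tensor A \<alpha> B \<beta>) (tensor_grading A \<alpha> B \<beta>)
           (graded_tensor A \<alpha> Cliff1 Cliff1_grading) (tensor_grading A \<alpha> Cliff1 Cliff1_grading)"
proof -
  interpret P_graph k a \<Lambda> by fact
  obtain g where g: "clifford B \<beta> g" unfolding B_def \<beta>_def c\<^sub>1_def using clifford_Z2 by blast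
  show ?thesis
    unfolding A_def \<alpha>_def c_def c'_def \<Lambda>Z_def
    by (intro conjI graded_isomorphic_times_Z2[OF g] graded_tensor_clifford_isomorphic[OF g clifford_Cliff1])
qed

end
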